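(* Let $\mathscr K$ be a tt-category and let $A$ be a tt-ring in $\mathscr K$ with unit $\eta:\mathbb 1\to A$. Suppose that $A$ has finite degree and that $A$ detects $\otimes$-nilpotence of morphisms, i.e. for every morphism $f$ in $\mathscr K$ with $A\otimes f=0$ there is $n\ge 1$ with $f^{\otimes n}=0$. Let $\varphi_A:\operatorname{Spc}(A\text{-}\mathrm{Mod}_{\mathscr K})\to\operatorname{Spc}(\mathscr K)$ be the map induced by extension-of-scalars $F_A$, and for $i=1,2$ let $\varphi_i:\operatorname{Spc}(A^{\otimes 2}\text{-}\mathrm{Mod}_{\mathscr K})\to\operatorname{Spc}(A\text{-}\mathrm{Mod}_{\mathscr K})$ be the map induced by extension-of-scalars along the homomorphism $f_i:A\to A\otimes A$, where $f_1=1\otimes\eta$ and $f_2=\eta\otimes 1$. Then $$\operatorname{Spc}(A^{\otimes 2}\text{-}\mathrm{Mod}_{\mathscr K})\ \underset{\varphi_2}{\overset{\varphi_1}{\rightrightarrows}}\ \operatorname{Spc}(A\text{-}\mathrm{Mod}_{\mathscr K})\ \xrightarrow{\ \varphi_A\ }\ \operatorname{Spc}(\mathscr K)$$ is a coequalizer of topological spaces.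
   Context: Triangulated categories are understood in the mildly strengthened sense of Künzer and Maltsiniotis: besides Verdier's axioms, there are distinguished octahedra satisfying the analogue of the morphism axiom (every composable pair of morphisms is the base of a distinguished octahedron and every morphism between bases extends to a morphism of distinguished octahedra). A tt-category is an essentially small, idempotent-complete triangulated category $\mathscr K$ with a symmetric monoidal structure $\otimes$, unit $\mathbb 1$, such that $x\otimes-$ is exact for every object $x$. A tt-functor is an exact (symmetric, strong) monoidal functor $F$ such that the two natural isomorphisms $F(x\otimes\Sigma y)\cong\Sigma F(x\otimes y)$ (obtained by using the compatibilities of $F$, $\otimes$, $\Sigma$ in different orders) agree, and similarly on the left. Spectrum: a thick $\otimes$-ideal of $\mathscr K$ is a triangulated subcategory $\mathscr J$ closed under direct summands with $\mathscr K\otimes\mathscr J\subseteq\mathscr J$; a proper one $\mathscr P\subsetneq\mathscr K$ is prime if $x\otimes y\in\mathscr P$ implies $x\in\mathscr P$ or $y\in\mathscr P$. $\operatorname{Spc}(\mathscr K)$ is the set of primes, with open basis the sets $\{\mathscr P: x\in\mathscr P\}$, $x\in\mathscr K$. The support of $x$ is the closed set $\operatorname{supp}(x)=\{\mathscr P: x\notin\mathscr P\}$. A tt-functor $F:\mathscr K\to\mathscr L$ induces a continuous map $\operatorname{Spc}(F):\operatorname{Spc}(\mathscr L)\to\operatorname{Spc}(\mathscr K)$, $\mathscr P\mapsto F^{-1}(\mathscr P)$. tt-rings: a ring object $(A,\mu:A\otimes A\to A,\eta:\mathbb 1\to A)$ in $\mathscr K$ is an associative unital monoid; it is separable if there is $\sigma:A\to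 A\otimes A$ with $\mu\sigma=\mathrm{id}_A$ and $(1\otimes\mu)(\sigma\otimes1)=\sigma\mu=(\mu\otimes1)(1\otimes\sigma)$; a tt-ring is a commutative separable ring object. $A\otimes A$ is then again a tt-ring. $A\text{-}\mathrm{Mod}_{\mathscr K}$ is the category of $A$-modules $(x,\rho:A\otimes x\to x)$ in $\mathscr K$, with forgetful functor $U_A$ to $\mathscr K$ and extension-of-scalars $F_A:\mathscr K\to A\text{-}\mathrm{Mod}_{\mathscr K}$, $F_A(y)=(A\otimes y,\mu\otimes1)$. By known results, $A\text{-}\mathrm{Mod}_{\mathscr K}$ is a tt-category (a triangle is distinguished iff its image under $U_A$ is), with tensor $\otimes_A$ (the coequalizer of the two actions $x\otimes A\otimes y\rightrightarrows x\otimes y$) and unit $A$; $F_A$ is a tt-functor. A homomorphism $f:A\to B$ of tt-rings likewise induces the tt-functor $B\otimes_A-:A\text{-}\mathrm{Mod}_{\mathscr K}\to B\text{-}\mathrm{Mod}_{\mathscr K}$ (extension-of-scalars along $f$). Degree: for a tt-ring $A$ define a tower of tt-rings $A^{[0]}=\mathbb 1\to A^{[1]}=A\to A^{[2]}\to\cdots$ as follows: for $n\ge1$, $A^{[n+1]}$ is the (unique up to isomorphism) tt-ring for which there is a ring isomorphism $A^{[n]}\otimes_{A^{[n-1]}}A^{[n]}\cong A^{[n]}\times A^{[n+1]}$ whose first component is the multiplication, and $A^{[n]}\to A^{[n+1]}$ is the second component precomposed with $1\otimes\eta$. The tt-ring $A$ has finite degree $d$ if $A^{[d]}\neq0$ and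 $A^{[d+1]}=0$. *)

theory Defs
  imports "HOL-Analysis.Function_Topology"
begin

section \<open>Categories\<close>

text \<open>
  Objects and arrows are elements of HOL types, so every category below is small; an essentially
  small category is represented by a small skeleton of it (or by any equivalent small category).
\<close>

record ('o, 'm) cat =
  obj :: "'o set"
  arr :: "'m set"
  src :: "'m \<Rightarrow> 'o"
  tgt :: "'m \<Rightarrow> 'o"
  idn :: "'o \<Rightarrow> 'm"
  cmp :: "'m \<Rightarrow> 'm \<Rightarrow> 'm" (infixl "\<cdot>\<index>" 70)

definition hom :: "('o, 'm, 'z) cat_scheme \<Rightarrow> 'o \<Rightarrow> 'o \<Rightarrow> 'm set" where
  "hom K x y = {f \<in> arr K. src K f = x \<and> tgt K f = y}"

locale category =
  fixes K :: "('o, 'm, 'z) cat_scheme" (structure)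
  assumes src_obj: "f \<in> arr K \<Longrightarrow> src K f \<in> obj K"
    and tgt_obj: "f \<in> arr K \<Longrightarrow> tgt K f \<in> obj K"
    and idn_hom: "x \<in> obj K \<Longrightarrow> idn K x \<in> hom K x x"
    and cmp_hom: "\<lbrakk>f \<in> hom K x y; g \<in> hom K y z\<rbrakk> \<Longrightarrow> g \<cdot> f \<in> hom K x z"
    and cmp_idn: "f \<in> hom K x y \<Longrightarrow> f \<cdot> idn K x = f"
    and idn_cmp: "f \<in> hom K x y \<Longrightarrow> idn K y \<cdot> f = f"
    and cmp_assoc: "\<lbrakk>f \<in> hom K w x; g \<in> hom K x y; h \<in> hom K y z\<rbrakk>
      \<Longrightarrow> (h \<cdot> g) \<cdot> f = h \<cdot> (g \<cdot> f)"

context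
  fixes K :: "('o, 'm, 'z) cat_scheme" (structure)
begin

definition isos :: "'o \<Rightarrow> 'o \<Rightarrow> 'm set" where
  "isos x y = {f \<in> hom K x y. \<exists>g \<in> hom K y x. g \<cdot> f = idn K x \<and> f \<cdot> g = idn K y}"

definition inverse_arr :: "'m \<Rightarrow> 'm" where
  "inverse_arr f = (THE g. g \<in> hom K (tgt K f) (src K f) \<and>
     g \<cdot> f = idn K (src K f) \<and> f \<cdot> g = idn K (tgt K f))"

definition zero_object :: "'o \<Rightarrow> bool" where
  "zero_object z \<longleftrightarrow> z \<in> obj K \<and>
     (\<forall>x \<in> obj K. (\<exists>!f. f \<in> hom K x z) \<and> (\<exists>!f. f \<in> hom K z x))"

definition is_product :: "'o \<Rightarrow> 'o \<Rightarrow> 'o \<Rightarrow> 'm \<Rightarrow> 'm \<Rightarrow> bool" where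
  "is_product s x y p q \<longleftrightarrow> s \<in> obj K \<and> p \<in> hom K s x \<and> q \<in> hom K s y \<and>
     (\<forall>w \<in> obj K. \<forall>f \<in> hom K w x. \<forall>g \<in> hom K w y.
        \<exists>!h. h \<in> hom K w s \<and> p \<cdot> h = f \<and> q \<cdot> h = g)"

definition is_coequalizer :: "'m \<Rightarrow> 'm \<Rightarrow> 'm \<Rightarrow> bool" where
  "is_coequalizer f g q \<longleftrightarrow> f \<in> arr K \<and> g \<in> hom K (src K f) (tgt K f) \<and>
     q \<in> arr K \<and> src K q = tgt K f \<and> q \<cdot> f = q \<cdot> g \<and>
     (\<forall>h \<in> arr K. src K h = tgt K f \<longrightarrow> h \<cdot> f = h \<cdot> g \<longrightarrow>
        (\<exists>!k. k \<in> hom K (tgt K q) (tgt K h) \<and> k \<cdot> q = h))"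

text \<open>The arrow \<open>h\<close> with \<open>h \<cdot> e = f\<close>; it is only used where \<open>e\<close> is an epimorphism.\<close>

definition factor_through :: "'m \<Rightarrow> 'm \<Rightarrow> 'm" where
  "factor_through e f = (THE h. h \<in> hom K (tgt K e) (tgt K f) \<and> h \<cdot> e = f)"

definition idempotent_complete :: bool where
  "idempotent_complete \<longleftrightarrow> (\<forall>x \<in> obj K. \<forall>e \<in> hom K x x. e \<cdot> e = e \<longrightarrow>
     (\<exists>y \<in> obj K. \<exists>i \<in> hom K y x. \<exists>r \<in> hom K x y. r \<cdot> i = idn K y \<and> i \<cdot> r = e))"

end

section \<open>Triangulated categories with distinguished octahedra\<close>

text \<open>
  An octahedron on \<open>x \<rightarrow>f y \<rightarrow>g z\<close> consists of the cones \<open>y \<rightarrow>f1 F \<rightarrow>f2 \<Sigma>x\<close> of \<open>f\<close>,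
  \<open>z \<rightarrow>g1 G \<rightarrow>g2 \<Sigma>y\<close> of \<open>g\<close>, \<open>z \<rightarrow>h1 H \<rightarrow>h2 \<Sigma>x\<close> of \<open>g f\<close>, and the fourth triangle
  \<open>F \<rightarrow>u H \<rightarrow>v G \<rightarrow>w \<Sigma>F\<close>.
\<close>

datatype 'm octahedron =
  Octahedron (oct_f: 'm) (oct_g: 'm) (oct_f1: 'm) (oct_f2: 'm) (oct_g1: 'm) (oct_g2: 'm)
    (oct_h1: 'm) (oct_h2: 'm) (oct_u: 'm) (oct_v: 'm) (oct_w: 'm)

text \<open>
  A triangle \<open>x \<rightarrow>f y \<rightarrow>g z \<rightarrow>h \<Sigma>x\<close> is the triple \<open>(f, g, h)\<close>. The fields \<open>sus\<close> and \<open>susa\<close> are the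
  suspension on objects and arrows, \<open>dist\<close> and \<open>octa\<close> the distinguished triangles and octahedra.
\<close>

record ('o, 'm) tricat = "('o, 'm) cat" +
  plus_arr :: "'m \<Rightarrow> 'm \<Rightarrow> 'm" (infixl "\<oplus>\<index>" 65)
  zero_arr :: "'o \<Rightarrow> 'o \<Rightarrow> 'm"
  sus :: "'o \<Rightarrow> 'o"
  susa :: "'m \<Rightarrow> 'm"
  dist :: "('m \<times> 'm \<times> 'm) set"
  octa :: "'m octahedron set"

context
  fixes K :: "('o, 'm, 'z) tricat_scheme" (structure)
begin

definition neg_arr :: "'m \<Rightarrow> 'm" where
  "neg_arr f = (THE g. g \<in> hom K (src K f) (tgt K f) \<and> f \<oplus> g = zero_arr K (src K f) (tgt K f))"

definition is_biproduct :: "'o \<Rightarrow> 'o \<Rightarrow> 'o \<Rightarrow> bool" where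
  "is_biproduct s x y \<longleftrightarrow> s \<in> obj K \<and> x \<in> obj K \<and> y \<in> obj K \<and>
     (\<exists>i \<in> hom K x s. \<exists>j \<in> hom K y s. \<exists>p \<in> hom K s x. \<exists>q \<in> hom K s y.
        p \<cdot> i = idn K x \<and> q \<cdot> j = idn K y \<and> q \<cdot> i = zero_arr K x y \<and> p \<cdot> j = zero_arr K y x \<and>
        (i \<cdot> p) \<oplus> (j \<cdot> q) = idn K s)"

definition is_triangle :: "'m \<Rightarrow> 'm \<Rightarrow> 'm \<Rightarrow> bool" where
  "is_triangle f g h \<longleftrightarrow> f \<in> arr K \<and> g \<in> arr K \<and> h \<in> arr K \<and>
     src K g = tgt K f \<and> src K h = tgt K g \<and> tgt K h = sus K (src K f)"

definition triangle_morphism ::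
    "'m \<times> 'm \<times> 'm \<Rightarrow> 'm \<times> 'm \<times> 'm \<Rightarrow> 'm \<Rightarrow> 'm \<Rightarrow> 'm \<Rightarrow> bool" where
  "triangle_morphism T T' a b c = (case (T, T') of ((f, g, h), (f', g', h')) \<Rightarrow>
     a \<in> hom K (src K f) (src K f') \<and> b \<in> hom K (tgt K f) (tgt K f') \<and>
     c \<in> hom K (tgt K g) (tgt K g') \<and>
     b \<cdot> f = f' \<cdot> a \<and> c \<cdot> g = g' \<cdot> b \<and> susa K a \<cdot> h = h' \<cdot> c)"

definition is_octahedron :: "'m octahedron \<Rightarrow> bool" where
  "is_octahedron Q = (case Q of Octahedron f g f1 f2 g1 g2 h1 h2 u v w \<Rightarrow>
     f \<in> arr K \<and> g \<in> arr K \<and> src K g = tgt K f \<and>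
     (f, f1, f2) \<in> dist K \<and> (g, g1, g2) \<in> dist K \<and> (g \<cdot> f, h1, h2) \<in> dist K \<and> (u, v, w) \<in> dist K \<and>
     u \<cdot> f1 = h1 \<cdot> g \<and> h2 \<cdot> u = f2 \<and> v \<cdot> h1 = g1 \<and> g2 \<cdot> v = susa K f \<cdot> h2 \<and>
     w = susa K f1 \<cdot> g2)"

definition octahedron_morphism ::
    "'m octahedron \<Rightarrow> 'm octahedron \<Rightarrow> 'm \<Rightarrow> 'm \<Rightarrow> 'm \<Rightarrow> 'm \<Rightarrow> 'm \<Rightarrow> 'm \<Rightarrow> bool" where
  "octahedron_morphism Q Q' a b c p r s = (case (Q, Q') of
     (Octahedron f g f1 f2 g1 g2 h1 h2 u v w, Octahedron f' g' f1' f2' g1' g2' h1' h2' u' v' w') \<Rightarrow>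
     triangle_morphism (f, f1, f2) (f', f1', f2') a b p \<and>
     triangle_morphism (g, g1, g2) (g', g1', g2') b c s \<and>
     triangle_morphism (g \<cdot> f, h1, h2) (g' \<cdot> f', h1', h2') a c r \<and>
     triangle_morphism (u, v, w) (u', v', w') p r s)"

end

locale additive_category = category K
  for K :: "('o, 'm, 'z) tricat_scheme" (structure) +
  assumes plus_hom: "\<lbrakk>f \<in> hom K x y; g \<in> hom K x y\<rbrakk> \<Longrightarrow> f \<oplus> g \<in> hom K x y"
    and plus_assoc: "\<lbrakk>f \<in> hom K x y; g \<in> hom K x y; h \<in> hom K x y\<rbrakk> \<Longrightarrow> (f \<oplus> g) \<oplus> h = f \<oplus> (g \<oplus> h)"
    and plus_comm: "\<lbrakk>f \<in> hom K x y; g \<in> hom K x y\<rbrakk> \<Longrightarrow> f \<oplus> g = g \<oplus> f"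
    and zero_hom: "\<lbrakk>x \<in> obj K; y \<in> obj K\<rbrakk> \<Longrightarrow> zero_arr K x y \<in> hom K x y"
    and zero_plus: "f \<in> hom K x y \<Longrightarrow> zero_arr K x y \<oplus> f = f"
    and neg_ex: "f \<in> hom K x y \<Longrightarrow> \<exists>g \<in> hom K x y. f \<oplus> g = zero_arr K x y"
    and cmp_plus: "\<lbrakk>f \<in> hom K x y; g \<in> hom K x y; h \<in> hom K y z\<rbrakk>
      \<Longrightarrow> h \<cdot> (f \<oplus> g) = (h \<cdot> f) \<oplus> (h \<cdot> g)"
    and plus_cmp: "\<lbrakk>f \<in> hom K x y; g \<in> hom K y z; h \<in> hom K y z\<rbrakk>
      \<Longrightarrow> (g \<oplus> h) \<cdot> f = (g \<cdot> f) \<oplus> (h \<cdot> f)"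
    and zero_object_ex: "\<exists>z. zero_object K z"
    and biproduct_ex: "\<lbrakk>x \<in> obj K; y \<in> obj K\<rbrakk> \<Longrightarrow> \<exists>s. is_biproduct K s x y"

locale triangulated_category = additive_category K
  for K :: "('o, 'm, 'z) tricat_scheme" (structure) +
  assumes sus_obj: "x \<in> obj K \<Longrightarrow> sus K x \<in> obj K"
    and susa_idn: "x \<in> obj K \<Longrightarrow> susa K (idn K x) = idn K (sus K x)"
    and susa_cmp: "\<lbrakk>f \<in> hom K x y; g \<in> hom K y z\<rbrakk> \<Longrightarrow> susa K (g \<cdot> f) = susa K g \<cdot> susa K f"
    and susa_plus: "\<lbrakk>f \<in> hom K x y; g \<in> hom K x y\<rbrakk> \<Longrightarrow> susa K (f \<oplus> g) = susa K f \<oplus> susa K g"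
    and susa_bij: "\<lbrakk>x \<in> obj K; y \<in> obj K\<rbrakk>
      \<Longrightarrow> bij_betw (susa K) (hom K x y) (hom K (sus K x) (sus K y))"
    and sus_ess_surj: "y \<in> obj K \<Longrightarrow> \<exists>x \<in> obj K. isos K (sus K x) y \<noteq> {}"
    and dist_triangle: "(f, g, h) \<in> dist K \<Longrightarrow> is_triangle K f g h"
    and dist_iso: "\<lbrakk>(f, g, h) \<in> dist K; is_triangle K f' g' h';
        triangle_morphism K (f, g, h) (f', g', h') a b c;
        a \<in> isos K (src K f) (src K f'); b \<in> isos K (tgt K f) (tgt K f');
        c \<in> isos K (tgt K g) (tgt K g')\<rbrakk> \<Longrightarrow> (f', g', h') \<in> dist K"
    and dist_idn: "\<lbrakk>x \<in> obj K; zero_object K z\<rbrakk>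
      \<Longrightarrow> (idn K x, zero_arr K x z, zero_arr K z (sus K x)) \<in> dist K"
    and dist_cone: "f \<in> arr K \<Longrightarrow> \<exists>g h. (f, g, h) \<in> dist K"
    and dist_rotate: "is_triangle K f g h \<Longrightarrow>
        (f, g, h) \<in> dist K \<longleftrightarrow> (g, h, neg_arr K (susa K f)) \<in> dist K"
    and dist_morphism: "\<lbrakk>(f, g, h) \<in> dist K; (f', g', h') \<in> dist K;
        a \<in> hom K (src K f) (src K f'); b \<in> hom K (tgt K f) (tgt K f'); b \<cdot> f = f' \<cdot> a\<rbrakk>
      \<Longrightarrow> \<exists>c. triangle_morphism K (f, g, h) (f', g', h') a b c"
    and dist_octahedral: "\<lbrakk>(f, f1, f2) \<in> dist K; (g, g1, g2) \<in> dist K; src K g = tgt K f;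
        (g \<cdot> f, h1, h2) \<in> dist K\<rbrakk>
      \<Longrightarrow> \<exists>u v. is_octahedron K (Octahedron f g f1 f2 g1 g2 h1 h2 u v (susa K f1 \<cdot> g2))"
    and octa_octahedron: "Q \<in> octa K \<Longrightarrow> is_octahedron K Q"
    and octa_base: "\<lbrakk>f \<in> hom K x y; g \<in> hom K y z\<rbrakk>
      \<Longrightarrow> \<exists>Q \<in> octa K. oct_f Q = f \<and> oct_g Q = g"
    and octa_morphism: "\<lbrakk>Q \<in> octa K; Q' \<in> octa K;
        a \<in> hom K (src K (oct_f Q)) (src K (oct_f Q'));
        b \<in> hom K (tgt K (oct_f Q)) (tgt K (oct_f Q'));
        c \<in> hom K (tgt K (oct_g Q)) (tgt K (oct_g Q'));
        b \<cdot> oct_f Q = oct_f Q' \<cdot> a; c \<cdot> oct_g Q = oct_g Q' \<cdot> b\<rbrakk>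
      \<Longrightarrow> \<exists>p r s. octahedron_morphism K Q Q' a b c p r s"

section \<open>Tensor-triangulated categories\<close>

text \<open>
  The field \<open>tsus K x y\<close> is the isomorphism from \<open>x \<odot> \<Sigma>y\<close> to \<open>\<Sigma>(x \<odot> y)\<close> that is part of the
  exact functor \<open>x \<odot> -\<close>. The one from \<open>\<Sigma>x \<odot> y\<close> to \<open>\<Sigma>(x \<odot> y)\<close> is obtained from it by the symmetry.
\<close>

record ('o, 'm) ttcat = "('o, 'm) tricat" +
  tens :: "'o \<Rightarrow> 'o \<Rightarrow> 'o" (infixl "\<odot>\<index>" 75)
  tensa :: "'m \<Rightarrow> 'm \<Rightarrow> 'm" (infixl "\<otimes>\<index>" 75)
  unit :: "'o" ("\<one>\<index>")
  assoc :: "'o \<Rightarrow> 'o \<Rightarrow> 'o \<Rightarrow> 'm"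
  lunit :: "'o \<Rightarrow> 'm"
  runit :: "'o \<Rightarrow> 'm"
  braid :: "'o \<Rightarrow> 'o \<Rightarrow> 'm"
  tsus :: "'o \<Rightarrow> 'o \<Rightarrow> 'm"

locale symmetric_monoidal_category = category K
  for K :: "('o, 'm, 'z) ttcat_scheme" (structure) +
  assumes unit_obj: "\<one> \<in> obj K"
    and tens_obj: "\<lbrakk>x \<in> obj K; y \<in> obj K\<rbrakk> \<Longrightarrow> x \<odot> y \<in> obj K"
    and tensa_hom: "\<lbrakk>f \<in> hom K x x'; g \<in> hom K y y'\<rbrakk> \<Longrightarrow> f \<otimes> g \<in> hom K (x \<odot> y) (x' \<odot> y')"
    and tensa_idn: "\<lbrakk>x \<in> obj K; y \<in> obj K\<rbrakk> \<Longrightarrow> idn K x \<otimes> idn K y = idn K (x \<odot> y)"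
    and tensa_cmp: "\<lbrakk>f \<in> hom K x x'; f' \<in> hom K x' x''; g \<in> hom K y y'; g' \<in> hom K y' y''\<rbrakk>
      \<Longrightarrow> (f' \<cdot> f) \<otimes> (g' \<cdot> g) = (f' \<otimes> g') \<cdot> (f \<otimes> g)"
    and assoc_iso: "\<lbrakk>x \<in> obj K; y \<in> obj K; z \<in> obj K\<rbrakk>
      \<Longrightarrow> assoc K x y z \<in> isos K ((x \<odot> y) \<odot> z) (x \<odot> (y \<odot> z))"
    and lunit_iso: "x \<in> obj K \<Longrightarrow> lunit K x \<in> isos K (\<one> \<odot> x) x"
    and runit_iso: "x \<in> obj K \<Longrightarrow> runit K x \<in> isos K (x \<odot> \<one>) x"
    and braid_iso: "\<lbrakk>x \<in> obj K; y \<in> obj K\<rbrakk> \<Longrightarrow> braid K x y \<in> isos K (x \<odot> y) (y \<odot> x)"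
    and assoc_natural: "\<lbrakk>f \<in> hom K x x'; g \<in> hom K y y'; h \<in> hom K z z'\<rbrakk>
      \<Longrightarrow> assoc K x' y' z' \<cdot> ((f \<otimes> g) \<otimes> h) = (f \<otimes> (g \<otimes> h)) \<cdot> assoc K x y z"
    and lunit_natural: "f \<in> hom K x x' \<Longrightarrow> lunit K x' \<cdot> (idn K \<one> \<otimes> f) = f \<cdot> lunit K x"
    and runit_natural: "f \<in> hom K x x' \<Longrightarrow> runit K x' \<cdot> (f \<otimes> idn K \<one>) = f \<cdot> runit K x"
    and braid_natural: "\<lbrakk>f \<in> hom K x x'; g \<in> hom K y y'\<rbrakk>
      \<Longrightarrow> braid K x' y' \<cdot> (f \<otimes> g) = (g \<otimes> f) \<cdot> braid K x y"
    and pentagon: "\<lbrakk>w \<in> obj K; x \<in> obj K; y \<in> obj K; z \<in> obj K\<rbrakk>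
      \<Longrightarrow> assoc K w x (y \<odot> z) \<cdot> assoc K (w \<odot> x) y z
        = (idn K w \<otimes> assoc K x y z) \<cdot> assoc K w (x \<odot> y) z \<cdot> (assoc K w x y \<otimes> idn K z)"
    and unit_triangle: "\<lbrakk>x \<in> obj K; y \<in> obj K\<rbrakk>
      \<Longrightarrow> (idn K x \<otimes> lunit K y) \<cdot> assoc K x \<one> y = runit K x \<otimes> idn K y"
    and hexagon: "\<lbrakk>x \<in> obj K; y \<in> obj K; z \<in> obj K\<rbrakk>
      \<Longrightarrow> assoc K y z x \<cdot> braid K x (y \<odot> z) \<cdot> assoc K x y z
        = (idn K y \<otimes> braid K x z) \<cdot> assoc K y x z \<cdot> (braid K x y \<otimes> idn K z)"
    and braid_symmetric: "\<lbrakk>x \<in> obj K; y \<in> obj K\<rbrakk>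
      \<Longrightarrow> braid K y x \<cdot> braid K x y = idn K (x \<odot> y)"

text \<open>
  The axioms \<open>tsus_natural\<close>, \<open>tsus_unit\<close> and \<open>tsus_assoc\<close> say that the exact structures of the
  functors \<open>x \<odot> -\<close> are compatible with the monoidal structure; this is what makes \<open>A \<odot> -\<close> an exact
  monad for a ring object \<open>A\<close>, and hence gives modules a suspension.
\<close>

locale tt_category = triangulated_category K + symmetric_monoidal_category K
  for K :: "('o, 'm, 'z) ttcat_scheme" (structure) +
  assumes idempotents_split: "idempotent_complete K"
    and tens_plus: "\<lbrakk>x \<in> obj K; f \<in> hom K y y'; g \<in> hom K y y'\<rbrakk>
      \<Longrightarrow> idn K x \<otimes> (f \<oplus> g) = (idn K x \<otimes> f) \<oplus> (idn K x \<otimes> g)"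
    and tsus_iso: "\<lbrakk>x \<in> obj K; y \<in> obj K\<rbrakk> \<Longrightarrow> tsus K x y \<in> isos K (x \<odot> sus K y) (sus K (x \<odot> y))"
    and tsus_natural: "\<lbrakk>f \<in> hom K x x'; g \<in> hom K y y'\<rbrakk>
      \<Longrightarrow> tsus K x' y' \<cdot> (f \<otimes> susa K g) = susa K (f \<otimes> g) \<cdot> tsus K x y"
    and tsus_unit: "x \<in> obj K \<Longrightarrow> susa K (lunit K x) \<cdot> tsus K \<one> x = lunit K (sus K x)"
    and tsus_assoc: "\<lbrakk>x \<in> obj K; y \<in> obj K; z \<in> obj K\<rbrakk>
      \<Longrightarrow> tsus K x (y \<odot> z) \<cdot> (idn K x \<otimes> tsus K y z) \<cdot> assoc K x y (sus K z)
        = susa K (assoc K x y z) \<cdot> tsus K (x \<odot> y) z"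
    and tens_exact: "\<lbrakk>x \<in> obj K; (f, g, h) \<in> dist K\<rbrakk>
      \<Longrightarrow> (idn K x \<otimes> f, idn K x \<otimes> g, tsus K x (src K f) \<cdot> (idn K x \<otimes> h)) \<in> dist K"

section \<open>The spectrum\<close>

context
  fixes K :: "('o, 'm, 'z) ttcat_scheme" (structure)
begin

text \<open>Full subcategories are identified with their sets of objects.\<close>

definition thick_ideal :: "'o set \<Rightarrow> bool" where
  "thick_ideal J \<longleftrightarrow> J \<subseteq> obj K \<and>
     (\<forall>z. zero_object K z \<longrightarrow> z \<in> J) \<and>
     (\<forall>x \<in> obj K. x \<in> J \<longleftrightarrow> sus K x \<in> J) \<and>
     (\<forall>f g h. (f, g, h) \<in> dist K \<longrightarrow> src K f \<in> J \<longrightarrow> tgt K f \<in> J \<longrightarrow> tgt K g \<in> J) \<and>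
     (\<forall>s x y. is_biproduct K s x y \<longrightarrow> s \<in> J \<longrightarrow> x \<in> J) \<and>
     (\<forall>x \<in> obj K. \<forall>y \<in> J. x \<odot> y \<in> J)"

definition prime_ideal :: "'o set \<Rightarrow> bool" where
  "prime_ideal P \<longleftrightarrow> thick_ideal P \<and> P \<noteq> obj K \<and>
     (\<forall>x \<in> obj K. \<forall>y \<in> obj K. x \<odot> y \<in> P \<longrightarrow> x \<in> P \<or> y \<in> P)"

text \<open>
  The generating family is closed under finite intersections (take a biproduct of the objects,
  or a zero object), so it is a basis of the topology generated by it.
\<close>

definition Spc :: "'o set topology" where
  "Spc = topology_generated_by {{P. prime_ideal P \<and> x \<in> P} | x. x \<in> obj K}"

text \<open>The map induced by a functor out of \<open>K\<close> with object map \<open>F\<close>.\<close>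

definition Spc_map :: "('o \<Rightarrow> 'p) \<Rightarrow> 'p set \<Rightarrow> 'o set" where
  "Spc_map F P = {x \<in> obj K. F x \<in> P}"

end

section \<open>Ring objects\<close>

record ('o, 'm) ring_ob =
  car :: 'o
  mul :: 'm
  uni :: 'm

context
  fixes K :: "('o, 'm, 'z) ttcat_scheme" (structure)
begin

definition ring_object :: "('o, 'm) ring_ob \<Rightarrow> bool" where
  "ring_object A \<longleftrightarrow> car A \<in> obj K \<and> mul A \<in> hom K (car A \<odot> car A) (car A) \<and>
     uni A \<in> hom K \<one> (car A) \<and>
     mul A \<cdot> (mul A \<otimes> idn K (car A))
       = mul A \<cdot> (idn K (car A) \<otimes> mul A) \<cdot> assoc K (car A) (car A) (car A) \<and>
     mul A \<cdot> (uni A \<otimes> idn K (car A)) = lunit K (car A) \<and>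
     mul A \<cdot> (idn K (car A) \<otimes> uni A) = runit K (car A)"

definition commutative_ring :: "('o, 'm) ring_ob \<Rightarrow> bool" where
  "commutative_ring A \<longleftrightarrow> mul A \<cdot> braid K (car A) (car A) = mul A"

definition separable_ring :: "('o, 'm) ring_ob \<Rightarrow> bool" where
  "separable_ring A \<longleftrightarrow> (\<exists>\<sigma> \<in> hom K (car A) (car A \<odot> car A).
     mul A \<cdot> \<sigma> = idn K (car A) \<and>
     (idn K (car A) \<otimes> mul A) \<cdot> assoc K (car A) (car A) (car A) \<cdot> (\<sigma> \<otimes> idn K (car A)) = \<sigma> \<cdot> mul A \<and>
     (mul A \<otimes> idn K (car A)) \<cdot> inverse_arr K (assoc K (car A) (car A) (car A))
        \<cdot> (idn K (car A) \<otimes> \<sigma>) = \<sigma> \<cdot> mul A)"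

definition tt_ring :: "('o, 'm) ring_ob \<Rightarrow> bool" where
  "tt_ring A \<longleftrightarrow> ring_object A \<and> commutative_ring A \<and> separable_ring A"

definition ring_homs :: "('o, 'm) ring_ob \<Rightarrow> ('o, 'm) ring_ob \<Rightarrow> 'm set" where
  "ring_homs A B = {f \<in> hom K (car A) (car B).
     f \<cdot> mul A = mul B \<cdot> (f \<otimes> f) \<and> f \<cdot> uni A = uni B}"

definition ring_isos :: "('o, 'm) ring_ob \<Rightarrow> ('o, 'm) ring_ob \<Rightarrow> 'm set" where
  "ring_isos A B = ring_homs A B \<inter> isos K (car A) (car B)"

definition unit_ring :: "('o, 'm) ring_ob" where
  "unit_ring = \<lparr>car = \<one>, mul = lunit K \<one>, uni = idn K \<one>\<rparr>"

text \<open>The product ring structure is the only one for which both projections are homomorphisms.\<close>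

definition ring_product :: "('o, 'm) ring_ob \<Rightarrow> ('o, 'm) ring_ob \<Rightarrow> ('o, 'm) ring_ob
    \<Rightarrow> 'm \<Rightarrow> 'm \<Rightarrow> bool" where
  "ring_product A B P p q \<longleftrightarrow> ring_object P \<and> is_product K (car P) (car A) (car B) p q \<and>
     p \<in> ring_homs P A \<and> q \<in> ring_homs P B"

text \<open>The middle interchange from \<open>(w \<odot> x) \<odot> (y \<odot> z)\<close> to \<open>(w \<odot> y) \<odot> (x \<odot> z)\<close>.\<close>

definition interchange :: "'o \<Rightarrow> 'o \<Rightarrow> 'o \<Rightarrow> 'o \<Rightarrow> 'm" where
  "interchange w x y z = inverse_arr K (assoc K w y (x \<odot> z))
     \<cdot> (idn K w \<otimes> (assoc K y x z \<cdot> (braid K x y \<otimes> idn K z) \<cdot> inverse_arr K (assoc K x y z)))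
     \<cdot> assoc K w x (y \<odot> z)"

definition ring_tensor :: "('o, 'm) ring_ob \<Rightarrow> ('o, 'm) ring_ob \<Rightarrow> ('o, 'm) ring_ob" where
  "ring_tensor A B = \<lparr>car = car A \<odot> car B,
     mul = (mul A \<otimes> mul B) \<cdot> interchange (car A) (car B) (car A) (car B),
     uni = (uni A \<otimes> uni B) \<cdot> inverse_arr K (lunit K \<one>)\<rparr>"

text \<open>The homomorphisms \<open>1 \<otimes> \<eta>\<close> and \<open>\<eta> \<otimes> 1\<close> from a ring \<open>A\<close> to \<open>A \<otimes> A\<close>.\<close>

definition left_incl :: "('o, 'm) ring_ob \<Rightarrow> 'm" where
  "left_incl A = (idn K (car A) \<otimes> uni A) \<cdot> inverse_arr K (runit K (car A))"

definition right_incl :: "('o, 'm) ring_ob \<Rightarrow> 'm" where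
  "right_incl A = (uni A \<otimes> idn K (car A)) \<cdot> inverse_arr K (lunit K (car A))"

end

section \<open>Modules and their tensor product\<close>

text \<open>
  A module is a pair of an object and an action; an arrow of modules carries its source and target,
  since the same arrow of \<open>K\<close> can be linear for several actions.
\<close>

type_synonym ('o, 'm) module = "'o \<times> 'm"
type_synonym ('o, 'm) module_arr = "('o, 'm) module \<times> 'm \<times> ('o, 'm) module"

context
  fixes K :: "('o, 'm, 'z) ttcat_scheme" (structure)
begin

definition modules :: "('o, 'm) ring_ob \<Rightarrow> ('o, 'm) module set" where
  "modules A = {(x, \<rho>). x \<in> obj K \<and> \<rho> \<in> hom K (car A \<odot> x) x \<and>
     \<rho> \<cdot> (mul A \<otimes> idn K x) = \<rho> \<cdot> (idn K (car A) \<otimes> \<rho>) \<cdot> assoc K (car A) (car A) x \<and>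
     \<rho> \<cdot> (uni A \<otimes> idn K x) = lunit K x}"

definition module_homs ::
    "('o, 'm) ring_ob \<Rightarrow> ('o, 'm) module \<Rightarrow> ('o, 'm) module \<Rightarrow> 'm set" where
  "module_homs A M N = {f \<in> hom K (fst M) (fst N). f \<cdot> snd M = snd N \<cdot> (idn K (car A) \<otimes> f)}"

definition free_module :: "('o, 'm) ring_ob \<Rightarrow> 'o \<Rightarrow> ('o, 'm) module" where
  "free_module A y = (car A \<odot> y,
     (mul A \<otimes> idn K y) \<cdot> inverse_arr K (assoc K (car A) (car A) y))"

definition module_sus :: "('o, 'm) ring_ob \<Rightarrow> ('o, 'm) module \<Rightarrow> ('o, 'm) module" where
  "module_sus A M = (sus K (fst M), susa K (snd M) \<cdot> tsus K (car A) (fst M))"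

text \<open>
  A chosen quotient \<open>x \<odot> y \<rightarrow> x \<otimes>\<^sub>A y\<close>: the coequalizer of the two actions of \<open>A\<close> on
  \<open>(x \<odot> A) \<odot> y\<close>, where \<open>A\<close> acts on \<open>x\<close> from the right via the symmetry.
\<close>

definition tensor_quot ::
    "('o, 'm) ring_ob \<Rightarrow> ('o, 'm) module \<Rightarrow> ('o, 'm) module \<Rightarrow> 'm" where
  "tensor_quot A M N = (SOME q. is_coequalizer K
     ((snd M \<cdot> braid K (fst M) (car A)) \<otimes> idn K (fst N))
     ((idn K (fst M) \<otimes> snd N) \<cdot> assoc K (fst M) (car A) (fst N)) q)"

definition module_tensor ::
    "('o, 'm) ring_ob \<Rightarrow> ('o, 'm) module \<Rightarrow> ('o, 'm) module \<Rightarrow> ('o, 'm) module" where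
  "module_tensor A M N = (tgt K (tensor_quot A M N),
     factor_through K (idn K (car A) \<otimes> tensor_quot A M N)
       (tensor_quot A M N \<cdot> (snd M \<otimes> idn K (fst N))
          \<cdot> inverse_arr K (assoc K (car A) (fst M) (fst N))))"

text \<open>
  Every structure arrow of the module category is induced by the corresponding one of \<open>K\<close> along
  the quotients \<open>x \<odot> y \<rightarrow> x \<otimes>\<^sub>A y\<close>.
\<close>

definition Mod_without_octahedra ::
    "('o, 'm) ring_ob \<Rightarrow> (('o, 'm) module, ('o, 'm) module_arr) ttcat" where
  "Mod_without_octahedra A = (let
      Arr = {(M, f, N). M \<in> modules A \<and> N \<in> modules A \<and> f \<in> module_homs A M N};
      S = module_sus A; T = module_tensor A; q = tensor_quot A
    in \<lparr>
      obj = modules A,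
      arr = Arr,
      src = (\<lambda>(M, f, N). M),
      tgt = (\<lambda>(M, f, N). N),
      idn = (\<lambda>M. (M, idn K (fst M), M)),
      cmp = (\<lambda>(_, g, P) (M, f, _). (M, g \<cdot> f, P)),
      plus_arr = (\<lambda>(M, f, N) (_, g, _). (M, f \<oplus> g, N)),
      zero_arr = (\<lambda>M N. (M, zero_arr K (fst M) (fst N), N)),
      sus = S,
      susa = (\<lambda>(M, f, N). (S M, susa K f, S N)),
      dist = {((M, f, N), (N, g, P), (P, h, S M)) | M f N g P h.
        (M, f, N) \<in> Arr \<and> (N, g, P) \<in> Arr \<and> (P, h, S M) \<in> Arr \<and> (f, g, h) \<in> dist K},
      octa = {},
      tens = T,
      tensa = (\<lambda>(M, f, M') (N, g, N').
        (T M N, factor_through K (q M N) (q M' N' \<cdot> (f \<otimes> g)), T M' N')),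
      unit = (car A, mul A),
      assoc = (\<lambda>M N P. (T (T M N) P,
        factor_through K (q (T M N) P \<cdot> (q M N \<otimes> idn K (fst P)))
          (q M (T N P) \<cdot> (idn K (fst M) \<otimes> q N P) \<cdot> assoc K (fst M) (fst N) (fst P)),
        T M (T N P))),
      lunit = (\<lambda>M. (T (car A, mul A) M, factor_through K (q (car A, mul A) M) (snd M), M)),
      runit = (\<lambda>M. (T M (car A, mul A),
        factor_through K (q M (car A, mul A)) (snd M \<cdot> braid K (fst M) (car A)), M)),
      braid = (\<lambda>M N. (T M N, factor_through K (q M N) (q N M \<cdot> braid K (fst M) (fst N)), T N M)),
      tsus = (\<lambda>M N. (T M (S N),
        factor_through K (q M (S N)) (susa K (q M N) \<cdot> tsus K (fst M) (fst N)), S (T M N)))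
    \<rparr>)"

text \<open>As for triangles, an octahedron is distinguished iff the forgetful functor makes it so.\<close>

definition Mod ::
    "('o, 'm) ring_ob \<Rightarrow> (('o, 'm) module, ('o, 'm) module_arr) ttcat" where
  "Mod A = (Mod_without_octahedra A)\<lparr>octa :=
     {Q. is_octahedron (Mod_without_octahedra A) Q \<and> map_octahedron (\<lambda>(M, f, N). f) Q \<in> octa K}\<rparr>"

text \<open>A ring \<open>B\<close> as a module over \<open>A\<close> along a homomorphism \<open>f\<close> from \<open>A\<close> to \<open>B\<close>.\<close>

definition restricted_module :: "('o, 'm) ring_ob \<Rightarrow> 'm \<Rightarrow> ('o, 'm) module" where
  "restricted_module B f = (car B, mul B \<cdot> (f \<otimes> idn K (car B)))"

text \<open>The \<open>B\<close>-module \<open>B \<otimes>\<^sub>A M\<close>, for \<open>f\<close> from \<open>A\<close> to \<open>B\<close>.\<close>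

definition extend_scalars ::
    "('o, 'm) ring_ob \<Rightarrow> ('o, 'm) ring_ob \<Rightarrow> 'm \<Rightarrow> ('o, 'm) module \<Rightarrow> ('o, 'm) module" where
  "extend_scalars A B f M = (let q = tensor_quot A (restricted_module B f) M in
     (tgt K q, factor_through K (idn K (car B) \<otimes> q)
       (q \<cdot> (mul B \<otimes> idn K (fst M)) \<cdot> inverse_arr K (assoc K (car B) (car B) (fst M)))))"

section \<open>Degree and detection of nilpotence\<close>

definition algebra_quot :: "('o, 'm) ring_ob \<Rightarrow> ('o, 'm) ring_ob \<Rightarrow> 'm \<Rightarrow> 'm" where
  "algebra_quot R B f = tensor_quot R (restricted_module B f) (restricted_module B f)"

text \<open>The ring \<open>B \<otimes>\<^sub>R B\<close> for a homomorphism \<open>f\<close> from \<open>R\<close> to \<open>B\<close>, a quotient of \<open>B \<otimes> B\<close>.\<close>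

definition algebra_square ::
    "('o, 'm) ring_ob \<Rightarrow> ('o, 'm) ring_ob \<Rightarrow> 'm \<Rightarrow> ('o, 'm) ring_ob" where
  "algebra_square R B f = (let q = algebra_quot R B f in
     \<lparr>car = tgt K q,
      mul = factor_through K (q \<otimes> q) (q \<cdot> mul (ring_tensor K B B)),
      uni = q \<cdot> uni (ring_tensor K B B)\<rparr>)"

text \<open>
  Here \<open>B n\<close> is the \<open>n\<close>-th ring of the tower and \<open>t n\<close> the homomorphism from \<open>B n\<close> to
  \<open>B (n + 1)\<close>. Both conditions on the components of the ring isomorphism \<open>h\<close> are stated after
  composition with the quotient map from \<open>B (n + 1) \<otimes> B (n + 1)\<close>.
\<close>

definition splitting_tower ::
    "('o, 'm) ring_ob \<Rightarrow> (nat \<Rightarrow> ('o, 'm) ring_ob) \<Rightarrow> (nat \<Rightarrow> 'm) \<Rightarrow> bool" where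
  "splitting_tower A B t \<longleftrightarrow>
     B 0 = unit_ring K \<and> B 1 = A \<and> t 0 = uni A \<and>
     (\<forall>n. tt_ring K (B n) \<and> t n \<in> ring_homs K (B n) (B (n + 1))) \<and>
     (\<forall>n. let q = algebra_quot (B n) (B (n + 1)) (t n) in
        \<exists>P p p' h. ring_product K (B (n + 1)) (B (n + 2)) P p p' \<and>
          h \<in> ring_isos K (algebra_square (B n) (B (n + 1)) (t n)) P \<and>
          p \<cdot> h \<cdot> q = mul (B (n + 1)) \<and>
          t (n + 1) = p' \<cdot> h \<cdot> q \<cdot> left_incl K (B (n + 1)))"

definition has_degree :: "('o, 'm) ring_ob \<Rightarrow> nat \<Rightarrow> bool" where
  "has_degree A d \<longleftrightarrow> (\<exists>B t. splitting_tower A B t \<and>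
     \<not> zero_object K (car (B d)) \<and> zero_object K (car (B (d + 1))))"

definition finite_degree :: "('o, 'm) ring_ob \<Rightarrow> bool" where
  "finite_degree A \<longleftrightarrow> (\<exists>d. has_degree A d)"

fun tensor_power :: "'m \<Rightarrow> nat \<Rightarrow> 'm" where
  "tensor_power f 0 = idn K \<one>"
| "tensor_power f (Suc 0) = f"
| "tensor_power f (Suc (Suc n)) = tensor_power f (Suc n) \<otimes> f"

definition is_zero_arr :: "'m \<Rightarrow> bool" where
  "is_zero_arr f \<longleftrightarrow> f = zero_arr K (src K f) (tgt K f)"

definition detects_nilpotence :: "('o, 'm) ring_ob \<Rightarrow> bool" where
  "detects_nilpotence A \<longleftrightarrow> (\<forall>f \<in> arr K. is_zero_arr (idn K (car A) \<otimes> f) \<longrightarrow>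
     (\<exists>n \<ge> 1. is_zero_arr (tensor_power f n)))"

end

section \<open>Coequalizers of topological spaces\<close>

text \<open>
  HOL cannot quantify over types, so the type of the points of the test space is a parameter;
  a theorem with a free type variable in its place asserts the universal property for all spaces.
  Maps are compared on the topological space only, hence the use of \<open>extensional\<close>.
\<close>

definition top_coequalizer :: "'w itself \<Rightarrow> 'a topology \<Rightarrow> 'b topology \<Rightarrow> 'c topology
    \<Rightarrow> ('a \<Rightarrow> 'b) \<Rightarrow> ('a \<Rightarrow> 'b) \<Rightarrow> ('b \<Rightarrow> 'c) \<Rightarrow> bool" where
  "top_coequalizer _ X Y Z f g q \<longleftrightarrow>
     continuous_map X Y f \<and> continuous_map X Y g \<and> continuous_map Y Z q \<and>
     (\<forall>x \<in> topspace X. q (f x) = q (g x)) \<and>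
     (\<forall>(W :: 'w topology) h. continuous_map Y W h \<longrightarrow> (\<forall>x \<in> topspace X. h (f x) = h (g x)) \<longrightarrow>
        (\<exists>!k. k \<in> extensional (topspace Z) \<and> continuous_map Z W k \<and>
           (\<forall>y \<in> topspace Y. k (q y) = h y)))"

end

theory Submission
  imports Defs
begin

text \<open>
  Write \<open>\<phi>\<close> for \<open>\<phi>\<^sub>A\<close> and \<open>U\<close> for the right adjoint of \<open>F\<^sub>A\<close>. By the projection formula, and because the
  counits split (separability), a prime \<open>P\<close> of \<open>K\<close> lifts to a prime of \<open>A\<close>-modules avoiding a given
  multiplicative set \<open>M\<close> as soon as no \<open>U(m)\<close> with \<open>m \<in> M\<close> lies in \<open>P\<close>. For the set \<open>M\<close> of modules that lie in
  no prime of a closed set \<open>Z\<close> this shows that \<open>\<phi>(Z)\<close> is closed. For \<open>M = {A}\<close> it shows that \<open>\<phi>\<close> is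
  surjective, because no prime contains \<open>A\<close>: the fibre \<open>\<xi>\<close> of \<open>\<eta>\<close> satisfies \<open>A \<otimes> \<xi> = 0\<close>, so it is
  \<open>\<otimes>\<close>-nilpotent, but if \<open>A \<in> P\<close> then all its tensor powers are invertible modulo \<open>P\<close>. So \<open>\<phi>\<close> is a quotient map.

  Two primes with the same image come from a prime of \<open>A \<otimes> A\<close>-modules: lifting gives this up to inclusions
  between primes of a fibre of \<open>\<phi>\<close>, and distinct primes of a fibre are incomparable. The latter is where finite
  degree enters, by descending induction along the tower: \<open>B \<otimes>\<^sub>R B \<cong> B \<times> E\<close> reduces incomparability for
  \<open>R \<rightarrow> B\<close> to that for \<open>B \<rightarrow> E\<close>, and it is vacuous when \<open>E = 0\<close>.
\<close>

section \<open>Inverses, unit coherence and symmetries in a symmetric monoidal category\<close>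

section \<open>Symmetric monoidal coherence\<close>

text \<open>The tensor product over \<open>A\<close> is a chosen coequalizer, so its associativity,
  symmetry and unit laws hold only up to isomorphism. The argument about primes is therefore made
  for abstract systems of thick ideals, where tensor identities are used only up to membership in an
  ideal; for modules one has to supply retracts, isomorphisms and triangles, but no coherence
  between them. Separability gives these by explicit formulas: M \<otimes>_R N is the image of an
  idempotent on M \<otimes> N, so maps out of it are plain composites and its exactness is inherited
  by a retract.

  The tower starts at the unit ring, hence \<open>K\<close> is identified with the modules over it.
  Then \<eta>, the steps of the tower and the two maps A -> A \<otimes> A are all extensions along
  homomorphisms of tt-rings.

  In B \<otimes>_R B = B x E the factor B is the obstacle of the inductive step: it accounts for the
  diagonal pairs of primes, which carry no information. For primes Q' < Q of one fibre the test
  elements are multiplied by some c in Q outside Q'; modulo Q this removes the contribution of B,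
  and E then has a prime over the pair (Q', Q), to which going down and the induction hypothesis
  apply.\<close>

lemma homI: "\<lbrakk>f \<in> arr K; src K f = x; tgt K f = y\<rbrakk> \<Longrightarrow> f \<in> hom K x y"
  by (simp add: hom_def)

lemma hom_arr: "f \<in> hom K x y \<Longrightarrow> f \<in> arr K"
  and hom_src: "f \<in> hom K x y \<Longrightarrow> src K f = x"
  and hom_tgt: "f \<in> hom K x y \<Longrightarrow> tgt K f = y"
  by (simp_all add: hom_def)

lemmas homD = hom_arr hom_src hom_tgt

lemma isos_hom: "f \<in> isos K x y \<Longrightarrow> f \<in> hom K x y"
  by (simp add: isos_def)

context category
begin

lemma src_in [simp]: "f \<in> arr K \<Longrightarrow> src K f \<in> obj K"
  by (rule src_obj)

lemma tgt_in [simp]: "f \<in> arr K \<Longrightarrow> tgt K f \<in> obj K"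
  by (rule tgt_obj)

lemma hom_obj: "f \<in> hom K x y \<Longrightarrow> x \<in> obj K" "f \<in> hom K x y \<Longrightarrow> y \<in> obj K"
  by (auto simp: hom_def)

lemma arr_cmp [simp]: "\<lbrakk>f \<in> arr K; g \<in> arr K; src K g = tgt K f\<rbrakk> \<Longrightarrow> g \<cdot> f \<in> arr K"
  and src_cmp [simp]: "\<lbrakk>f \<in> arr K; g \<in> arr K; src K g = tgt K f\<rbrakk> \<Longrightarrow> src K (g \<cdot> f) = src K f"
  and tgt_cmp [simp]: "\<lbrakk>f \<in> arr K; g \<in> arr K; src K g = tgt K f\<rbrakk> \<Longrightarrow> tgt K (g \<cdot> f) = tgt K g"
  using cmp_hom[of f "src K f" "tgt K f" g "tgt K g"] by (auto simp: hom_def)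

lemma arr_idn [simp]: "x \<in> obj K \<Longrightarrow> idn K x \<in> arr K"
  and src_idn [simp]: "x \<in> obj K \<Longrightarrow> src K (idn K x) = x"
  and tgt_idn [simp]: "x \<in> obj K \<Longrightarrow> tgt K (idn K x) = x"
  using idn_hom[of x] by (auto simp: hom_def)

lemma cmp_idn_r [simp]: "\<lbrakk>f \<in> arr K; src K f = x\<rbrakk> \<Longrightarrow> f \<cdot> idn K x = f"
  using cmp_idn[of f x "tgt K f"] by (simp add: hom_def)

lemma cmp_idn_l [simp]: "\<lbrakk>f \<in> arr K; tgt K f = x\<rbrakk> \<Longrightarrow> idn K x \<cdot> f = f"
  using idn_cmp[of f "src K f" x] by (simp add: hom_def)

lemma cmp_ass: "\<lbrakk>f \<in> arr K; g \<in> arr K; h \<in> arr K; src K g = tgt K f; src K h = tgt K g\<rbrakk>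
   \<Longrightarrow> (h \<cdot> g) \<cdot> f = h \<cdot> (g \<cdot> f)"
  using cmp_assoc[of f "src K f" "tgt K f" g "tgt K g" h "tgt K h"] by (simp add: hom_def)

lemma inverse_unique:
  assumes "f \<in> hom K x y" "g \<in> hom K y x" "g \<cdot> f = idn K x" "f \<cdot> g = idn K y"
  shows "inverse_arr K f = g"
  unfolding inverse_arr_def
proof (rule the_equality)
  have s: "src K f = x" "tgt K f = y" using assms by (auto simp: hom_def)
  show "g \<in> hom K (tgt K f) (src K f) \<and> g \<cdot> f = idn K (src K f) \<and> f \<cdot> g = idn K (tgt K f)"
    using assms s by simp
  fix k assume "k \<in> hom K (tgt K f) (src K f) \<and> k \<cdot> f = idn K (src K f) \<and> f \<cdot> k = idn K (tgt K f)"
  then have k: "k \<in> hom K y x" "k \<cdot> f = idn K x" "f \<cdot> k = idn K y" using s by auto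
  have "k = k \<cdot> (f \<cdot> g)" using k assms by (simp add: hom_def)
  also have "\<dots> = (k \<cdot> f) \<cdot> g" using k(1) assms(1,2) by (simp add: hom_def cmp_ass)
  also have "\<dots> = g" using k assms by (simp add: hom_def)
  finally show "k = g" .
qed

lemma isos_inverse:
  assumes "f \<in> isos K x y"
  shows "inverse_arr K f \<in> hom K y x" "inverse_arr K f \<cdot> f = idn K x" "f \<cdot> inverse_arr K f = idn K y"
proof -
  obtain g where g: "f \<in> hom K x y" "g \<in> hom K y x" "g \<cdot> f = idn K x" "f \<cdot> g = idn K y"
    using assms by (auto simp: isos_def)
  then have "inverse_arr K f = g" by (rule inverse_unique)
  with g show "inverse_arr K f \<in> hom K y x" "inverse_arr K f \<cdot> f = idn K x"
    "f \<cdot> inverse_arr K f = idn K y" by auto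
qed

lemma isosI:
  "\<lbrakk>f \<in> hom K x y; g \<in> hom K y x; g \<cdot> f = idn K x; f \<cdot> g = idn K y\<rbrakk> \<Longrightarrow> f \<in> isos K x y"
  unfolding isos_def by blast

lemma isos_inverse_isos: "f \<in> isos K x y \<Longrightarrow> inverse_arr K f \<in> isos K y x"
  by (rule isosI[of _ _ _ f]) (simp_all add: isos_inverse isos_hom)

text \<open>The ends are read off from \<open>f\<close>, so that invertibility of a composite is
  decided by rewriting, with no objects to guess.\<close>

definition iso :: "'m \<Rightarrow> bool" where
  "iso f \<longleftrightarrow> f \<in> arr K \<and> f \<in> isos K (src K f) (tgt K f)"

lemma isos_iso: "f \<in> isos K x y \<Longrightarrow> iso f"
  by (auto simp: iso_def isos_def hom_def)

lemma iso_arr [simp]: "iso f \<Longrightarrow> f \<in> arr K"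
  by (simp add: iso_def)

lemma arr_inverse [simp]: "iso f \<Longrightarrow> inverse_arr K f \<in> arr K"
  and src_inverse [simp]: "iso f \<Longrightarrow> src K (inverse_arr K f) = tgt K f"
  and tgt_inverse [simp]: "iso f \<Longrightarrow> tgt K (inverse_arr K f) = src K f"
  and inverse_cmp [simp]: "iso f \<Longrightarrow> inverse_arr K f \<cdot> f = idn K (src K f)"
  and cmp_inverse [simp]: "iso f \<Longrightarrow> f \<cdot> inverse_arr K f = idn K (tgt K f)"
  using isos_inverse[of f "src K f" "tgt K f"] by (auto simp: iso_def hom_def)

lemma iso_inverse [simp]: "iso f \<Longrightarrow> iso (inverse_arr K f)"
  using isos_inverse_isos[of f "src K f" "tgt K f"] by (auto simp: iso_def isos_iso)

lemma inverse_cmp' [simp]: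
  "\<lbrakk>iso f; g \<in> arr K; tgt K g = src K f\<rbrakk> \<Longrightarrow> inverse_arr K f \<cdot> (f \<cdot> g) = g"
  using cmp_ass[of g f "inverse_arr K f"] by simp

lemma cmp_inverse' [simp]:
  "\<lbrakk>iso f; g \<in> arr K; tgt K g = tgt K f\<rbrakk> \<Longrightarrow> f \<cdot> (inverse_arr K f \<cdot> g) = g"
  using cmp_ass[of g "inverse_arr K f" f] by simp

lemma iso_cancel_l:
  assumes "iso f" "g \<in> arr K" "h \<in> arr K" "tgt K g = src K f" "tgt K h = src K f" "f \<cdot> g = f \<cdot> h"
  shows "g = h"
proof -
  have "g = inverse_arr K f \<cdot> (f \<cdot> g)" using assms(1-5) by simp
  also have "\<dots> = inverse_arr K f \<cdot> (f \<cdot> h)" by (simp only: assms(6))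
  also have "\<dots> = h" using assms(1-5) by simp
  finally show ?thesis .
qed

lemma iso_cancel_r:
  assumes "iso f" "g \<in> arr K" "h \<in> arr K" "src K g = tgt K f" "src K h = tgt K f" "g \<cdot> f = h \<cdot> f"
  shows "g = h"
proof -
  have "g = (g \<cdot> f) \<cdot> inverse_arr K f" using assms(1-5) by (simp add: cmp_ass)
  also have "\<dots> = (h \<cdot> f) \<cdot> inverse_arr K f" by (simp only: assms(6))
  also have "\<dots> = h" using assms(1-5) by (simp add: cmp_ass)
  finally show ?thesis .
qed

lemma isoI: "\<lbrakk>f \<in> arr K; g \<in> arr K; src K g = tgt K f; tgt K g = src K f;
    g \<cdot> f = idn K (src K f); f \<cdot> g = idn K (tgt K f)\<rbrakk> \<Longrightarrow> iso f"
  unfolding iso_def by (auto intro!: isosI[of _ _ _ g] simp: hom_def)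

lemma inverse_eqI: "\<lbrakk>f \<in> arr K; g \<in> arr K; src K g = tgt K f; tgt K g = src K f;
    g \<cdot> f = idn K (src K f); f \<cdot> g = idn K (tgt K f)\<rbrakk> \<Longrightarrow> inverse_arr K f = g"
  by (rule inverse_unique[of _ "src K f" "tgt K f"]) (auto simp: hom_def)

lemma iso_cmp [simp]: "\<lbrakk>iso f; iso g; src K g = tgt K f\<rbrakk> \<Longrightarrow> iso (g \<cdot> f)"
  by (rule isoI[of _ "inverse_arr K f \<cdot> inverse_arr K g"]) (simp_all add: cmp_ass)

lemma inverse_of_cmp:
  "\<lbrakk>iso f; iso g; src K g = tgt K f\<rbrakk> \<Longrightarrow> inverse_arr K (g \<cdot> f) = inverse_arr K f \<cdot> inverse_arr K g"
  by (rule inverse_eqI) (simp_all add: cmp_ass)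

lemma iso_idn [simp]: "x \<in> obj K \<Longrightarrow> iso (idn K x)"
  by (rule isoI[of _ "idn K x"]) simp_all

lemma inverse_idn [simp]: "x \<in> obj K \<Longrightarrow> inverse_arr K (idn K x) = idn K x"
  by (rule inverse_eqI) simp_all

end

context symmetric_monoidal_category
begin

abbreviation inv :: "'m \<Rightarrow> 'm" where "inv \<equiv> inverse_arr K"
abbreviation one :: "'o \<Rightarrow> 'm" where "one \<equiv> idn K"
abbreviation \<alpha> :: "'o \<Rightarrow> 'o \<Rightarrow> 'o \<Rightarrow> 'm" where "\<alpha> \<equiv> assoc K"
abbreviation lu :: "'o \<Rightarrow> 'm" where "lu \<equiv> lunit K"
abbreviation ru :: "'o \<Rightarrow> 'm" where "ru \<equiv> runit K"
abbreviation \<beta> :: "'o \<Rightarrow> 'o \<Rightarrow> 'm" where "\<beta> \<equiv> braid K"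

declare unit_obj [simp] tens_obj [simp] tensa_idn [simp]

lemma arr_tensa [simp]: "\<lbrakk>f \<in> arr K; g \<in> arr K\<rbrakk> \<Longrightarrow> f \<otimes> g \<in> arr K"
  and src_tensa [simp]: "\<lbrakk>f \<in> arr K; g \<in> arr K\<rbrakk> \<Longrightarrow> src K (f \<otimes> g) = src K f \<odot> src K g"
  and tgt_tensa [simp]: "\<lbrakk>f \<in> arr K; g \<in> arr K\<rbrakk> \<Longrightarrow> tgt K (f \<otimes> g) = tgt K f \<odot> tgt K g"
  using tensa_hom[of f "src K f" "tgt K f" g "src K g" "tgt K g"] by (auto simp: hom_def)

lemma tens_cmp: "\<lbrakk>f \<in> arr K; f' \<in> arr K; g \<in> arr K; g' \<in> arr K; src K f' = tgt K f; src K g' = tgt K g\<rbrakk>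
  \<Longrightarrow> (f' \<otimes> g') \<cdot> (f \<otimes> g) = (f' \<cdot> f) \<otimes> (g' \<cdot> g)"
  using tensa_cmp[of f "src K f" "tgt K f" f' "tgt K f'" g "src K g" "tgt K g" g' "tgt K g'"]
  by (simp add: hom_def)

lemma tens_cmp': "\<lbrakk>f \<in> arr K; f' \<in> arr K; g \<in> arr K; g' \<in> arr K; src K f' = tgt K f; src K g' = tgt K g;
    k \<in> arr K; tgt K k = src K f \<odot> src K g\<rbrakk>
  \<Longrightarrow> (f' \<otimes> g') \<cdot> ((f \<otimes> g) \<cdot> k) = ((f' \<cdot> f) \<otimes> (g' \<cdot> g)) \<cdot> k"
  by (simp add: cmp_ass[symmetric] tens_cmp)

lemma iso_tensa [simp]: "\<lbrakk>iso f; iso g\<rbrakk> \<Longrightarrow> iso (f \<otimes> g)"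
  by (rule isoI[of _ "inv f \<otimes> inv g"]) (simp_all add: tens_cmp)

lemma inv_tensa [simp]: "\<lbrakk>iso f; iso g\<rbrakk> \<Longrightarrow> inv (f \<otimes> g) = inv f \<otimes> inv g"
  by (rule inverse_eqI) (simp_all add: tens_cmp)

lemma \<alpha>_simps [simp]:
  assumes "x \<in> obj K" "y \<in> obj K" "z \<in> obj K"
  shows "iso (\<alpha> x y z)" "\<alpha> x y z \<in> arr K"
    "src K (\<alpha> x y z) = (x \<odot> y) \<odot> z" "tgt K (\<alpha> x y z) = x \<odot> (y \<odot> z)"
  using isos_iso[OF assoc_iso[OF assms]] homD[OF isos_hom[OF assoc_iso[OF assms]]] by simp_all

lemma lu_simps [simp]:
  assumes "x \<in> obj K"
  shows "iso (lu x)" "lu x \<in> arr K" "src K (lu x) = \<one> \<odot> x" "tgt K (lu x) = x"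
  using isos_iso[OF lunit_iso[OF assms]] homD[OF isos_hom[OF lunit_iso[OF assms]]] by simp_all

lemma ru_simps [simp]:
  assumes "x \<in> obj K"
  shows "iso (ru x)" "ru x \<in> arr K" "src K (ru x) = x \<odot> \<one>" "tgt K (ru x) = x"
  using isos_iso[OF runit_iso[OF assms]] homD[OF isos_hom[OF runit_iso[OF assms]]] by simp_all

lemma \<beta>_simps [simp]:
  assumes "x \<in> obj K" "y \<in> obj K"
  shows "iso (\<beta> x y)" "\<beta> x y \<in> arr K" "src K (\<beta> x y) = x \<odot> y" "tgt K (\<beta> x y) = y \<odot> x"
  using isos_iso[OF braid_iso[OF assms]] homD[OF isos_hom[OF braid_iso[OF assms]]] by simp_all

lemma \<alpha>_nat: "\<lbrakk>f \<in> arr K; g \<in> arr K; h \<in> arr K; tgt K f = x; tgt K g = y; tgt K h = z\<rbrakk> \<Longrightarrow>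
   \<alpha> x y z \<cdot> ((f \<otimes> g) \<otimes> h) = (f \<otimes> (g \<otimes> h)) \<cdot> \<alpha> (src K f) (src K g) (src K h)"
  using assoc_natural[of f "src K f" x g "src K g" y h "src K h" z] by (simp add: hom_def)

lemma \<beta>_nat: "\<lbrakk>f \<in> arr K; g \<in> arr K; tgt K f = x; tgt K g = y\<rbrakk> \<Longrightarrow>
   \<beta> x y \<cdot> (f \<otimes> g) = (g \<otimes> f) \<cdot> \<beta> (src K f) (src K g)"
  using braid_natural[of f "src K f" x g "src K g" y] by (simp add: hom_def)

lemma lu_nat: "\<lbrakk>f \<in> arr K; tgt K f = x\<rbrakk> \<Longrightarrow> lu x \<cdot> (one \<one> \<otimes> f) = f \<cdot> lu (src K f)"
  using lunit_natural[of f "src K f" x] by (simp add: hom_def)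

lemma ru_nat: "\<lbrakk>f \<in> arr K; tgt K f = x\<rbrakk> \<Longrightarrow> ru x \<cdot> (f \<otimes> one \<one>) = f \<cdot> ru (src K f)"
  using runit_natural[of f "src K f" x] by (simp add: hom_def)

lemma \<beta>_sym [simp]: "\<lbrakk>x \<in> obj K; y \<in> obj K\<rbrakk> \<Longrightarrow> inv (\<beta> x y) = \<beta> y x"
  by (rule inverse_eqI) (simp_all add: braid_symmetric)

lemma \<beta>_\<beta>: "\<lbrakk>x \<in> obj K; y \<in> obj K\<rbrakk> \<Longrightarrow> \<beta> y x \<cdot> \<beta> x y = one (x \<odot> y)"
  by (rule braid_symmetric)

text \<open>Tensoring with the unit is naturally isomorphic to the identity through
  \<open>lu\<close>. The unit laws below are checked after such a tensoring, where the pentagon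
  becomes applicable.\<close>

lemma one_tens_faithful:
  assumes "f \<in> arr K" "g \<in> arr K" "src K f = src K g" "tgt K f = tgt K g" "one \<one> \<otimes> f = one \<one> \<otimes> g"
  shows "f = g"
proof (rule iso_cancel_r[of "lu (src K f)"])
  have "f \<cdot> lu (src K f) = lu (tgt K f) \<cdot> (one \<one> \<otimes> f)" using assms lu_nat[of f] by simp
  also have "\<dots> = lu (tgt K f) \<cdot> (one \<one> \<otimes> g)" using assms by simp
  also have "\<dots> = g \<cdot> lu (src K f)" using assms lu_nat[of g] by simp
  finally show "f \<cdot> lu (src K f) = g \<cdot> lu (src K f)" .
qed (use assms in simp_all)

lemma tens_one_faithful:
  assumes "f \<in> arr K" "g \<in> arr K" "src K f = src K g" "tgt K f = tgt K g" "f \<otimes> one \<one> = g \<otimes> one \<one>"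
  shows "f = g"
proof (rule iso_cancel_r[of "ru (src K f)"])
  have "f \<cdot> ru (src K f) = ru (tgt K f) \<cdot> (f \<otimes> one \<one>)" using assms ru_nat[of f] by simp
  also have "\<dots> = ru (tgt K f) \<cdot> (g \<otimes> one \<one>)" using assms by simp
  also have "\<dots> = g \<cdot> ru (src K f)" using assms ru_nat[of g] by simp
  finally show "f \<cdot> ru (src K f) = g \<cdot> ru (src K f)" .
qed (use assms in simp_all)

text \<open>Kelly's argument: after tensoring with the unit on the left, the pentagon for \<one>,
  \<one>, x, y is pasted with two unit triangles.\<close>

lemma lu_\<alpha>:
  assumes x: "x \<in> obj K" and y: "y \<in> obj K"
  shows "lu (x \<odot> y) \<cdot> \<alpha> \<one> x y = lu x \<otimes> one y"
proof (rule one_tens_faithful)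
  let ?c = "\<alpha> \<one> (\<one> \<odot> x) y \<cdot> (\<alpha> \<one> \<one> x \<otimes> one y)"
  show "one \<one> \<otimes> (lu (x \<odot> y) \<cdot> \<alpha> \<one> x y) = one \<one> \<otimes> (lu x \<otimes> one y)"
  proof (rule iso_cancel_r[of ?c])
    have "(one \<one> \<otimes> (lu (x \<odot> y) \<cdot> \<alpha> \<one> x y)) \<cdot> ?c
        = (one \<one> \<otimes> lu (x \<odot> y)) \<cdot> ((one \<one> \<otimes> \<alpha> \<one> x y) \<cdot> \<alpha> \<one> (\<one> \<odot> x) y \<cdot> (\<alpha> \<one> \<one> x \<otimes> one y))"
      using x y by (simp add: cmp_ass tens_cmp')
    also have "\<dots> = (one \<one> \<otimes> lu (x \<odot> y)) \<cdot> (\<alpha> \<one> \<one> (x \<odot> y) \<cdot> \<alpha> (\<one> \<odot> \<one>) x y)"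
      using x y pentagon[of \<one> \<one> x y] by simp
    also have "\<dots> = (ru \<one> \<otimes> one (x \<odot> y)) \<cdot> \<alpha> (\<one> \<odot> \<one>) x y"
      using x y unit_triangle[of \<one> "x \<odot> y"] by (simp add: cmp_ass[symmetric])
    also have "\<dots> = \<alpha> \<one> x y \<cdot> ((ru \<one> \<otimes> one x) \<otimes> one y)"
      using x y by (simp add: \<alpha>_nat)
    also have "\<dots> = \<alpha> \<one> x y \<cdot> (((one \<one> \<otimes> lu x) \<cdot> \<alpha> \<one> \<one> x) \<otimes> one y)"
      using x y unit_triangle[of \<one> x] by simp
    also have "\<dots> = \<alpha> \<one> x y \<cdot> (((one \<one> \<otimes> lu x) \<otimes> one y) \<cdot> (\<alpha> \<one> \<one> x \<otimes> one y))"
      using x y by (simp add: tens_cmp)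
    also have "\<dots> = (one \<one> \<otimes> (lu x \<otimes> one y)) \<cdot> ?c"
      using x y by (simp add: cmp_ass[symmetric] \<alpha>_nat)
    finally show "(one \<one> \<otimes> (lu (x \<odot> y) \<cdot> \<alpha> \<one> x y)) \<cdot> ?c = (one \<one> \<otimes> (lu x \<otimes> one y)) \<cdot> ?c" .
  qed (use x y in simp_all)
qed (use x y in simp_all)

text \<open>The mirror image of \<open>lu_\<alpha>\<close>: tensoring with the unit on the right,
  and the pentagon for x, y, \<one>, \<one>.\<close>

lemma ru_\<alpha>:
  assumes x: "x \<in> obj K" and y: "y \<in> obj K"
  shows "(one x \<otimes> ru y) \<cdot> \<alpha> x y \<one> = ru (x \<odot> y)"
proof (rule tens_one_faithful)
  let ?c = "\<alpha> x y \<one>"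
  show "((one x \<otimes> ru y) \<cdot> \<alpha> x y \<one>) \<otimes> one \<one> = ru (x \<odot> y) \<otimes> one \<one>"
  proof (rule iso_cancel_l[of ?c])
    have "?c \<cdot> (((one x \<otimes> ru y) \<cdot> \<alpha> x y \<one>) \<otimes> one \<one>)
        = ?c \<cdot> (((one x \<otimes> ru y) \<otimes> one \<one>) \<cdot> (\<alpha> x y \<one> \<otimes> one \<one>))"
      using x y by (simp add: tens_cmp)
    also have "\<dots> = (one x \<otimes> (ru y \<otimes> one \<one>)) \<cdot> (\<alpha> x (y \<odot> \<one>) \<one> \<cdot> (\<alpha> x y \<one> \<otimes> one \<one>))"
      using x y by (simp add: cmp_ass[symmetric] \<alpha>_nat)
    also have "\<dots> = (one x \<otimes> ((one y \<otimes> lu \<one>) \<cdot> \<alpha> y \<one> \<one>)) \<cdot> (\<alpha> x (y \<odot> \<one>) \<one> \<cdot> (\<alpha> x y \<one> \<otimes> one \<one>))"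
      using x y by (simp add: unit_triangle)
    also have "\<dots> = (one x \<otimes> (one y \<otimes> lu \<one>)) \<cdot> ((one x \<otimes> \<alpha> y \<one> \<one>) \<cdot> \<alpha> x (y \<odot> \<one>) \<one> \<cdot> (\<alpha> x y \<one> \<otimes> one \<one>))"
      using x y by (simp add: cmp_ass tens_cmp')
    also have "\<dots> = (one x \<otimes> (one y \<otimes> lu \<one>)) \<cdot> (\<alpha> x y (\<one> \<odot> \<one>) \<cdot> \<alpha> (x \<odot> y) \<one> \<one>)"
      using x y pentagon[of x y \<one> \<one>] by simp
    also have "\<dots> = \<alpha> x y \<one> \<cdot> ((one (x \<odot> y) \<otimes> lu \<one>) \<cdot> \<alpha> (x \<odot> y) \<one> \<one>)"
      using x y \<alpha>_nat[of "one x" "one y" "lu \<one>" x y \<one>] by (simp add: cmp_ass[symmetric])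
    also have "\<dots> = ?c \<cdot> (ru (x \<odot> y) \<otimes> one \<one>)"
      using x y by (simp add: unit_triangle)
    finally show "?c \<cdot> (((one x \<otimes> ru y) \<cdot> \<alpha> x y \<one>) \<otimes> one \<one>) = ?c \<cdot> (ru (x \<odot> y) \<otimes> one \<one>)" .
  qed (use x y in simp_all)
qed (use x y in simp_all)

lemma lu_one: "lu \<one> = ru \<one>"
proof (rule tens_one_faithful)
  \<comment> \<open>Naturality of \<open>lu\<close> at the arrow \<open>lu \<one>\<close> itself,
    with the outer \<open>lu \<one>\<close> cancelled.\<close>
  have e: "lu (\<one> \<odot> \<one>) = one \<one> \<otimes> lu \<one>"
    by (rule iso_cancel_l[of "lu \<one>"]) (simp_all add: lu_nat)
  show "lu \<one> \<otimes> one \<one> = ru \<one> \<otimes> one \<one>"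
    using lu_\<alpha>[of \<one> \<one>] unit_triangle[of \<one> \<one>] e by simp
qed simp_all

text \<open>The hexagon with two unit arguments yields \<open>?t \<cdot> (ru x \<otimes> one \<one>)
  = ?t \<cdot> (?t \<otimes> one \<one>)\<close>. The isomorphism \<open>?t\<close> cancels, and
  tensoring with the unit is faithful.\<close>

lemma lu_\<beta>:
  assumes x: "x \<in> obj K"
  shows "lu x \<cdot> \<beta> x \<one> = ru x"
proof -
  let ?t = "lu x \<cdot> \<beta> x \<one>"
  have it: "iso ?t" using x by simp
  have t: "lu \<one> \<otimes> one x = (one \<one> \<otimes> lu x) \<cdot> \<alpha> \<one> \<one> x"
    using x by (simp add: lu_one unit_triangle)
  have "\<beta> x \<one> \<cdot> (ru x \<otimes> one \<one>) = \<beta> x \<one> \<cdot> ((one x \<otimes> lu \<one>) \<cdot> \<alpha> x \<one> \<one>)"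
    using x by (simp add: unit_triangle)
  also have "\<dots> = (lu \<one> \<otimes> one x) \<cdot> (\<beta> x (\<one> \<odot> \<one>) \<cdot> \<alpha> x \<one> \<one>)"
    using x by (simp add: cmp_ass[symmetric] \<beta>_nat)
  also have "\<dots> = (one \<one> \<otimes> lu x) \<cdot> (\<alpha> \<one> \<one> x \<cdot> \<beta> x (\<one> \<odot> \<one>) \<cdot> \<alpha> x \<one> \<one>)"
    using x by (simp add: t cmp_ass)
  also have "\<dots> = (one \<one> \<otimes> lu x) \<cdot> ((one \<one> \<otimes> \<beta> x \<one>) \<cdot> \<alpha> \<one> x \<one> \<cdot> (\<beta> x \<one> \<otimes> one \<one>))"
    using x hexagon[of x \<one> \<one>] by simp
  also have "\<dots> = (one \<one> \<otimes> ?t) \<cdot> (\<alpha> \<one> x \<one> \<cdot> (\<beta> x \<one> \<otimes> one \<one>))"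
    using x by (simp add: cmp_ass tens_cmp')
  finally have "lu x \<cdot> (\<beta> x \<one> \<cdot> (ru x \<otimes> one \<one>)) = lu x \<cdot> ((one \<one> \<otimes> ?t) \<cdot> (\<alpha> \<one> x \<one> \<cdot> (\<beta> x \<one> \<otimes> one \<one>)))"
    by simp
  also have "\<dots> = ?t \<cdot> ((lu (x \<odot> \<one>) \<cdot> \<alpha> \<one> x \<one>) \<cdot> (\<beta> x \<one> \<otimes> one \<one>))"
    using x by (simp add: cmp_ass[symmetric] lu_nat)
  also have "\<dots> = ?t \<cdot> (?t \<otimes> one \<one>)"
    using x by (simp add: lu_\<alpha> tens_cmp)
  finally have "?t \<cdot> (ru x \<otimes> one \<one>) = ?t \<cdot> (?t \<otimes> one \<one>)" using x by (simp add: cmp_ass)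
  then have "ru x \<otimes> one \<one> = ?t \<otimes> one \<one>" by (rule iso_cancel_l[OF it, rotated -1]) (use x in simp_all)
  then show ?thesis by (rule tens_one_faithful[symmetric, rotated -1]) (use x in simp_all)
qed

lemma ru_\<beta>:
  assumes x: "x \<in> obj K"
  shows "ru x \<cdot> \<beta> \<one> x = lu x"
proof -
  have "(lu x \<cdot> \<beta> x \<one>) \<cdot> \<beta> \<one> x = lu x" using x by (simp add: cmp_ass \<beta>_\<beta>)
  then show ?thesis by (simp only: lu_\<beta>[OF x])
qed

text \<open>The symmetry carrying the middle factor to the front.\<close>

definition sw :: "'o \<Rightarrow> 'o \<Rightarrow> 'o \<Rightarrow> 'm" where
  "sw l y m = \<alpha> y l m \<cdot> ((\<beta> l y \<otimes> one m) \<cdot> inv (\<alpha> l y m))"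

lemma sw_simps [simp]:
  assumes "l \<in> obj K" "y \<in> obj K" "m \<in> obj K"
  shows "iso (sw l y m)" "sw l y m \<in> arr K" "src K (sw l y m) = l \<odot> (y \<odot> m)"
    "tgt K (sw l y m) = y \<odot> (l \<odot> m)"
  using assms by (simp_all add: sw_def)

lemma inv_\<alpha>_nat:
  assumes "f \<in> arr K" "g \<in> arr K" "h \<in> arr K" "tgt K f = x" "tgt K g = y" "tgt K h = z"
  shows "inv (\<alpha> x y z) \<cdot> (f \<otimes> (g \<otimes> h)) = ((f \<otimes> g) \<otimes> h) \<cdot> inv (\<alpha> (src K f) (src K g) (src K h))"
proof (rule iso_cancel_l[of "\<alpha> x y z"])
  let ?b = "\<alpha> (src K f) (src K g) (src K h)"
  have o: "x \<in> obj K" "y \<in> obj K" "z \<in> obj K" using assms by auto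
  have "\<alpha> x y z \<cdot> (((f \<otimes> g) \<otimes> h) \<cdot> inv ?b) = (\<alpha> x y z \<cdot> ((f \<otimes> g) \<otimes> h)) \<cdot> inv ?b"
    using assms o by (simp add: cmp_ass)
  also have "\<dots> = ((f \<otimes> (g \<otimes> h)) \<cdot> ?b) \<cdot> inv ?b" using assms by (simp only: \<alpha>_nat)
  also have "\<dots> = f \<otimes> (g \<otimes> h)" using assms by (simp add: cmp_ass)
  finally show "\<alpha> x y z \<cdot> (inv (\<alpha> x y z) \<cdot> (f \<otimes> (g \<otimes> h))) = \<alpha> x y z \<cdot> (((f \<otimes> g) \<otimes> h) \<cdot> inv ?b)"
    using assms o by simp
qed (use assms in auto)

lemma sw_nat:
  assumes "f \<in> arr K" "g \<in> arr K" "h \<in> arr K" "tgt K f = x" "tgt K g = y" "tgt K h = z"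
  shows "sw x y z \<cdot> (f \<otimes> (g \<otimes> h)) = (g \<otimes> (f \<otimes> h)) \<cdot> sw (src K f) (src K g) (src K h)"
proof -
  have o: "x \<in> obj K" "y \<in> obj K" "z \<in> obj K" using assms by auto
  let ?x = "src K f" let ?y = "src K g" let ?z = "src K h"
  have "sw x y z \<cdot> (f \<otimes> (g \<otimes> h)) = \<alpha> y x z \<cdot> ((\<beta> x y \<otimes> one z) \<cdot> (inv (\<alpha> x y z) \<cdot> (f \<otimes> (g \<otimes> h))))"
    using assms o unfolding sw_def by (simp add: cmp_ass)
  also have "\<dots> = \<alpha> y x z \<cdot> (((\<beta> x y \<cdot> (f \<otimes> g)) \<otimes> h) \<cdot> inv (\<alpha> ?x ?y ?z))"
    using assms o by (simp add: inv_\<alpha>_nat tens_cmp')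
  also have "\<dots> = (\<alpha> y x z \<cdot> ((g \<otimes> f) \<otimes> h)) \<cdot> ((\<beta> ?x ?y \<otimes> one ?z) \<cdot> inv (\<alpha> ?x ?y ?z))"
    using assms o by (simp add: \<beta>_nat cmp_ass tens_cmp')
  also have "\<dots> = (g \<otimes> (f \<otimes> h)) \<cdot> sw ?x ?y ?z"
    using assms o by (simp add: \<alpha>_nat cmp_ass sw_def)
  finally show ?thesis .
qed

text \<open>The hexagon solved for the symmetry past a tensor product. It is the inductive step of
  \<open>mg_sym\<close>, in which one of the two lists loses its head.\<close>

lemma sw_\<beta>:
  assumes o: "x \<in> obj K" "l \<in> obj K" "b \<in> obj K"
  shows "sw b x l \<cdot> \<beta> (x \<odot> l) b = (one x \<otimes> \<beta> l b) \<cdot> \<alpha> x l b"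
proof (rule iso_cancel_l[of "one x \<otimes> \<beta> b l"])
  have h: "\<alpha> x l b \<cdot> (\<beta> b (x \<odot> l) \<cdot> \<alpha> b x l) = (one x \<otimes> \<beta> b l) \<cdot> (\<alpha> x b l \<cdot> (\<beta> b x \<otimes> one l))"
    using hexagon[of b x l] o by (simp add: cmp_ass)
  have "(one x \<otimes> \<beta> b l) \<cdot> (sw b x l \<cdot> \<beta> (x \<odot> l) b)
      = ((one x \<otimes> \<beta> b l) \<cdot> (\<alpha> x b l \<cdot> (\<beta> b x \<otimes> one l))) \<cdot> (inv (\<alpha> b x l) \<cdot> \<beta> (x \<odot> l) b)"
    using o by (simp add: sw_def cmp_ass)
  also have "\<dots> = (\<alpha> x l b \<cdot> (\<beta> b (x \<odot> l) \<cdot> \<alpha> b x l)) \<cdot> (inv (\<alpha> b x l) \<cdot> \<beta> (x \<odot> l) b)"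
    by (simp only: h)
  also have "\<dots> = \<alpha> x l b"
    using o by (simp add: cmp_ass \<beta>_\<beta>)
  also have "\<dots> = (one x \<otimes> \<beta> b l) \<cdot> ((one x \<otimes> \<beta> l b) \<cdot> \<alpha> x l b)"
    using o by (simp add: tens_cmp' \<beta>_\<beta>)
  finally show "(one x \<otimes> \<beta> b l) \<cdot> (sw b x l \<cdot> \<beta> (x \<odot> l) b) = (one x \<otimes> \<beta> b l) \<cdot> ((one x \<otimes> \<beta> l b) \<cdot> \<alpha> x l b)" .
qed (use o in simp_all)

text \<open>Two pentagons, one before and one after the exchange of \<open>l\<close> and
  \<open>y\<close>, joined by naturality of the associator. It serves the case of
  \<open>mg_assoc\<close> in which the head comes from the middle list.\<close>

lemma sw_tens:
  assumes o: "l \<in> obj K" "y \<in> obj K" "m \<in> obj K" "n \<in> obj K"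
  shows "(one y \<otimes> \<alpha> l m n) \<cdot> (\<alpha> y (l \<odot> m) n \<cdot> (sw l y m \<otimes> one n))
    = sw l y (m \<odot> n) \<cdot> ((one l \<otimes> \<alpha> y m n) \<cdot> \<alpha> l (y \<odot> m) n)"
proof -
  have p: "(one y \<otimes> \<alpha> l m n) \<cdot> (\<alpha> y (l \<odot> m) n \<cdot> (\<alpha> y l m \<otimes> one n)) = \<alpha> y l (m \<odot> n) \<cdot> \<alpha> (y \<odot> l) m n"
    using pentagon[of y l m n] o by (simp add: cmp_ass)
  have q: "(one l \<otimes> \<alpha> y m n) \<cdot> (\<alpha> l (y \<odot> m) n \<cdot> (\<alpha> l y m \<otimes> one n)) = \<alpha> l y (m \<odot> n) \<cdot> \<alpha> (l \<odot> y) m n"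
    using pentagon[of l y m n] o by (simp add: cmp_ass)
  let ?B = "(\<beta> l y \<otimes> one m) \<otimes> one n" and ?i = "inv (\<alpha> l y m) \<otimes> one n"
  have "(one y \<otimes> \<alpha> l m n) \<cdot> (\<alpha> y (l \<odot> m) n \<cdot> (sw l y m \<otimes> one n))
      = ((one y \<otimes> \<alpha> l m n) \<cdot> (\<alpha> y (l \<odot> m) n \<cdot> (\<alpha> y l m \<otimes> one n))) \<cdot> (?B \<cdot> ?i)"
    using o by (simp add: sw_def cmp_ass tens_cmp)
  also have "\<dots> = \<alpha> y l (m \<odot> n) \<cdot> ((\<alpha> (y \<odot> l) m n \<cdot> ?B) \<cdot> ?i)"
    using o by (simp only: p) (simp add: cmp_ass)
  also have "\<dots> = \<alpha> y l (m \<odot> n) \<cdot> ((\<beta> l y \<otimes> one (m \<odot> n)) \<cdot> (\<alpha> (l \<odot> y) m n \<cdot> ?i))"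
    using o by (simp add: \<alpha>_nat cmp_ass)
  also have "\<dots> = sw l y (m \<odot> n) \<cdot> ((\<alpha> l y (m \<odot> n) \<cdot> \<alpha> (l \<odot> y) m n) \<cdot> ?i)"
    using o by (simp add: sw_def cmp_ass)
  also have "\<dots> = sw l y (m \<odot> n) \<cdot> ((one l \<otimes> \<alpha> y m n) \<cdot> (\<alpha> l (y \<odot> m) n \<cdot> ((\<alpha> l y m \<otimes> one n) \<cdot> ?i)))"
    using o by (simp only: q[symmetric]) (simp add: cmp_ass)
  also have "\<dots> = sw l y (m \<odot> n) \<cdot> ((one l \<otimes> \<alpha> y m n) \<cdot> \<alpha> l (y \<odot> m) n)"
    using o by (simp add: tens_cmp)
  finally show ?thesis .
qed

text \<open>Carrying \<open>z\<close> past \<open>l \<odot> m\<close> means carrying it past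
  \<open>m\<close> and then past \<open>l\<close>, by \<open>sw_\<beta>\<close>; the rest is
  \<open>sw_tens\<close>. It serves the case of \<open>mg_assoc\<close> in which the head comes from
  the last list.\<close>

lemma sw_sw:
  assumes o: "l \<in> obj K" "m \<in> obj K" "z \<in> obj K" "n \<in> obj K"
  shows "(one z \<otimes> \<alpha> l m n) \<cdot> sw (l \<odot> m) z n
    = sw l z (m \<odot> n) \<cdot> ((one l \<otimes> sw m z n) \<cdot> \<alpha> l m (z \<odot> n))"
proof -
  have b: "\<beta> (l \<odot> m) z = sw l z m \<cdot> ((one l \<otimes> \<beta> m z) \<cdot> \<alpha> l m z)"
  proof (rule iso_cancel_l[of "sw z l m"])
    show "sw z l m \<cdot> \<beta> (l \<odot> m) z = sw z l m \<cdot> (sw l z m \<cdot> ((one l \<otimes> \<beta> m z) \<cdot> \<alpha> l m z))"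
      using o sw_\<beta>[of l m z] by (simp add: sw_def cmp_ass tens_cmp' \<beta>_\<beta>)
  qed (use o in simp_all)
  have q: "(one l \<otimes> \<alpha> m z n) \<cdot> (\<alpha> l (m \<odot> z) n \<cdot> (\<alpha> l m z \<otimes> one n)) = \<alpha> l m (z \<odot> n) \<cdot> \<alpha> (l \<odot> m) z n"
    using pentagon[of l m z n] o by (simp add: cmp_ass)
  let ?v = "inv (\<alpha> (l \<odot> m) z n)"
  have "(one z \<otimes> \<alpha> l m n) \<cdot> sw (l \<odot> m) z n
      = ((one z \<otimes> \<alpha> l m n) \<cdot> (\<alpha> z (l \<odot> m) n \<cdot> (sw l z m \<otimes> one n))) \<cdot>
          ((((one l \<otimes> \<beta> m z) \<cdot> \<alpha> l m z) \<otimes> one n) \<cdot> ?v)"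
    using o by (simp add: sw_def[of "l \<odot> m"] b cmp_ass tens_cmp tens_cmp')
  also have "\<dots> = sw l z (m \<odot> n) \<cdot> ((one l \<otimes> \<alpha> z m n) \<cdot> ((\<alpha> l (z \<odot> m) n \<cdot>
          ((one l \<otimes> \<beta> m z) \<otimes> one n)) \<cdot> ((\<alpha> l m z \<otimes> one n) \<cdot> ?v)))"
    using o by (simp only: sw_tens) (simp add: cmp_ass tens_cmp tens_cmp')
  also have "\<dots> = sw l z (m \<odot> n) \<cdot> ((one l \<otimes> (\<alpha> z m n \<cdot> (\<beta> m z \<otimes> one n))) \<cdot> (\<alpha> l (m \<odot> z) n \<cdot>
          ((\<alpha> l m z \<otimes> one n) \<cdot> ?v)))"
    using o by (simp add: \<alpha>_nat cmp_ass tens_cmp')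
  also have "\<dots> = sw l z (m \<odot> n) \<cdot> ((one l \<otimes> sw m z n) \<cdot> (((one l \<otimes> \<alpha> m z n) \<cdot> (\<alpha> l (m \<odot> z) n \<cdot>
          (\<alpha> l m z \<otimes> one n))) \<cdot> ?v))"
    using o by (simp add: sw_def cmp_ass tens_cmp')
  also have "\<dots> = sw l z (m \<odot> n) \<cdot> ((one l \<otimes> sw m z n) \<cdot> \<alpha> l m (z \<odot> n))"
    using o by (simp only: q) (simp add: cmp_ass)
  finally show ?thesis .
qed

end

section \<open>Generalized elements over labelled stages, replacing diagrams in coherence
  computations\<close>

section \<open>Calculus of labelled elements\<close>

text \<open>The common stage of two elements. Concatenation would not be symmetric; comparing labels
  makes the result independent of the order when labels are disjoint, and it remains
  associative.\<close>

fun merge :: "(nat \<times> 'a) list \<Rightarrow> (nat \<times> 'a) list \<Rightarrow> (nat \<times> 'a) list" where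
  "merge [] ys = ys"
| "merge (x # xs) [] = x # xs"
| "merge (x # xs) (y # ys) =
     (if fst x \<le> fst y then x # merge xs (y # ys) else y # merge (x # xs) ys)"

lemma merge_Nil [simp]: "merge xs [] = xs"
  by (cases xs) auto

lemma set_merge [simp]: "set (merge xs ys) = set xs \<union> set ys"
  by (induction xs ys rule: merge.induct) auto

lemma merge_commute: "fst ` set xs \<inter> fst ` set ys = {} \<Longrightarrow> merge xs ys = merge ys xs"
  by (induction xs ys rule: merge.induct) auto

lemma merge_assoc: "merge (merge xs ys) zs = merge xs (merge ys zs)"
proof (induction "length xs + length ys + length zs" arbitrary: xs ys zs rule: less_induct)
  case less
  show ?case
  proof (cases "xs = [] \<or> ys = [] \<or> zs = []")
    case False
    then obtain x xs' y ys' z zs' where e: "xs = x # xs'" "ys = y # ys'" "zs = z # zs'"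
      by (metis neq_Nil_conv)
    have IH: "merge (merge xs' ys) zs = merge xs' (merge ys zs)"
      "merge (merge xs ys') zs = merge xs (merge ys' zs)"
      "merge (merge xs ys) zs' = merge xs (merge ys zs')"
      by (rule less; simp add: e)+
    show ?thesis
      using IH by (auto simp: e)
  qed auto
qed

context symmetric_monoidal_category
begin

fun tl_obj :: "(nat \<times> 'o) list \<Rightarrow> 'o" where
  "tl_obj [] = \<one>"
| "tl_obj (p # l) = snd p \<odot> tl_obj l"

definition objs :: "(nat \<times> 'o) list \<Rightarrow> bool" where
  "objs l \<longleftrightarrow> snd ` set l \<subseteq> obj K"

lemma objs_simps [simp]: "objs []" "objs (p # l) \<longleftrightarrow> snd p \<in> obj K \<and> objs l"
  "objs (merge l l') \<longleftrightarrow> objs l \<and> objs l'"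
  by (auto simp: objs_def)

lemma tl_obj_in [simp]: "objs l \<Longrightarrow> tl_obj l \<in> obj K"
  by (induction l) auto

text \<open>The canonical shuffle from \<open>tl_obj l \<odot> tl_obj l'\<close> to
  \<open>tl_obj (merge l l')\<close>. Its recursion copies that of \<open>merge\<close>, so that
  both unfold together.\<close>

fun mg :: "(nat \<times> 'o) list \<Rightarrow> (nat \<times> 'o) list \<Rightarrow> 'm" where
  "mg [] l' = lu (tl_obj l')"
| "mg (p # l) [] = ru (snd p \<odot> tl_obj l)"
| "mg (p # l) (q # l') = (if fst p \<le> fst q
     then (one (snd p) \<otimes> mg l (q # l')) \<cdot> \<alpha> (snd p) (tl_obj l) (snd q \<odot> tl_obj l')
     else (one (snd q) \<otimes> mg (p # l) l') \<cdot> sw (snd p \<odot> tl_obj l) (snd q) (tl_obj l'))"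

lemma mg_simps: "objs l \<Longrightarrow> objs l' \<Longrightarrow> iso (mg l l') \<and> src K (mg l l') = tl_obj l \<odot> tl_obj l' \<and>
    tgt K (mg l l') = tl_obj (merge l l')"
  by (induction l l' rule: mg.induct) auto

lemma mg_iso [simp]: "objs l \<Longrightarrow> objs l' \<Longrightarrow> iso (mg l l')"
  and mg_arr [simp]: "objs l \<Longrightarrow> objs l' \<Longrightarrow> mg l l' \<in> arr K"
  and src_mg [simp]: "objs l \<Longrightarrow> objs l' \<Longrightarrow> src K (mg l l') = tl_obj l \<odot> tl_obj l'"
  and tgt_mg [simp]: "objs l \<Longrightarrow> objs l' \<Longrightarrow> tgt K (mg l l') = tl_obj (merge l l')"
  using mg_simps[of l l'] by auto

lemma mg_Nil [simp]: "objs l \<Longrightarrow> mg l [] = ru (tl_obj l)"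
  by (cases l) (auto simp: lu_one)

text \<open>With disjoint labels both merges pick the same head, and each step is an instance of
  \<open>sw_\<beta>\<close>. For two copies of one labelled object the equation would force a
  symmetry to be trivial, hence the disjointness.\<close>

lemma mg_sym:
  "\<lbrakk>objs l; objs l'; fst ` set l \<inter> fst ` set l' = {}\<rbrakk> \<Longrightarrow> mg l' l \<cdot> \<beta> (tl_obj l) (tl_obj l') = mg l l'"
proof (induction l l' rule: mg.induct)
  case (1 l')
  then show ?case by (simp add: ru_\<beta>)
next
  case (2 p l)
  then show ?case by (simp add: lu_\<beta>)
next
  case (3 p l q l')
  obtain i x j y where pq: "p = (i, x)" "q = (j, y)" by fastforce
  have ne: "i \<noteq> j" using 3 by (auto simp: pq)
  have o: "x \<in> obj K" "y \<in> obj K" "objs l" "objs l'" using 3 by (auto simp: pq)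
  let ?P = "x \<odot> tl_obj l" and ?Q = "y \<odot> tl_obj l'"
  show ?case
  proof (cases "i \<le> j")
    case True
    then have ij: "\<not> j \<le> i" "i \<le> j" using ne by auto
    have ih: "mg (q # l') l \<cdot> \<beta> (tl_obj l) ?Q = mg l (q # l')"
      using 3 True by (simp add: pq)
    have "mg (q # l') (p # l) \<cdot> \<beta> ?P ?Q = (one x \<otimes> mg (q # l') l) \<cdot> (sw ?Q x (tl_obj l) \<cdot> \<beta> ?P ?Q)"
      using ij o by (simp add: pq cmp_ass)
    also have "\<dots> = ((one x \<otimes> (mg (q # l') l \<cdot> \<beta> (tl_obj l) ?Q)) \<cdot> \<alpha> x (tl_obj l) ?Q)"
      using o by (simp add: pq sw_\<beta> tens_cmp')
    also have "\<dots> = mg (p # l) (q # l')"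
      unfolding ih using ij by (simp add: pq)
    finally show ?thesis by (simp add: pq)
  next
    case False
    have ih: "mg l' (p # l) \<cdot> \<beta> ?P (tl_obj l') = mg (p # l) l'"
      using 3 False by (simp add: pq)
    have s: "\<alpha> y (tl_obj l') ?P \<cdot> \<beta> ?P ?Q = (one y \<otimes> \<beta> ?P (tl_obj l')) \<cdot> sw ?P y (tl_obj l')"
    proof (rule iso_cancel_l[of "one y \<otimes> \<beta> (tl_obj l') ?P"])
      have "(one y \<otimes> \<beta> (tl_obj l') ?P) \<cdot> (\<alpha> y (tl_obj l') ?P \<cdot> \<beta> ?P ?Q) = (sw ?P y (tl_obj l') \<cdot> \<beta> ?Q ?P) \<cdot> \<beta> ?P ?Q"
        using o by (simp add: sw_\<beta> cmp_ass)
      also have "\<dots> = (one y \<otimes> \<beta> (tl_obj l') ?P) \<cdot> ((one y \<otimes> \<beta> ?P (tl_obj l')) \<cdot> sw ?P y (tl_obj l'))"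
        using o by (simp add: cmp_ass tens_cmp' \<beta>_\<beta>)
      finally show "(one y \<otimes> \<beta> (tl_obj l') ?P) \<cdot> (\<alpha> y (tl_obj l') ?P \<cdot> \<beta> ?P ?Q)
        = (one y \<otimes> \<beta> (tl_obj l') ?P) \<cdot> ((one y \<otimes> \<beta> ?P (tl_obj l')) \<cdot> sw ?P y (tl_obj l'))" .
    qed (use o in simp_all)
    have "mg (q # l') (p # l) \<cdot> \<beta> ?P ?Q = (one y \<otimes> mg l' (p # l)) \<cdot> (\<alpha> y (tl_obj l') ?P \<cdot> \<beta> ?P ?Q)"
      using False o by (simp add: pq cmp_ass)
    also have "\<dots> = (one y \<otimes> (mg l' (p # l) \<cdot> \<beta> ?P (tl_obj l'))) \<cdot> sw ?P y (tl_obj l')"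
      unfolding s using o by (simp add: pq tens_cmp')
    also have "\<dots> = mg (p # l) (q # l')"
      unfolding ih using False by (simp add: pq)
    finally show ?thesis by (simp add: pq)
  qed
qed

text \<open>Induction on the total length, by the list that supplies the first entry of the merged
  list: the pentagon for the first list, \<open>sw_tens\<close> for the second, \<open>sw_sw\<close>
  for the third. Together with \<open>mg_sym\<close> this replaces a coherence theorem.\<close>

lemma mg_assoc:
  "\<lbrakk>objs a; objs b; objs c\<rbrakk> \<Longrightarrow> mg (merge a b) c \<cdot> (mg a b \<otimes> one (tl_obj c))
     = mg a (merge b c) \<cdot> ((one (tl_obj a) \<otimes> mg b c) \<cdot> \<alpha> (tl_obj a) (tl_obj b) (tl_obj c))"
proof (induction "length a + length b + length c" arbitrary: a b c rule: less_induct)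
  case less
  note o = less.prems
  consider "a = []" | "b = []" | "c = []" | "a \<noteq> []" "b \<noteq> []" "c \<noteq> []" by blast
  then show ?case
  proof cases
    case 1
    have "mg b c \<cdot> (lu (tl_obj b) \<otimes> one (tl_obj c)) = (mg b c \<cdot> lu (tl_obj b \<odot> tl_obj c)) \<cdot> \<alpha> \<one> (tl_obj b) (tl_obj c)"
      using o by (simp add: cmp_ass lu_\<alpha>)
    also have "\<dots> = lu (tl_obj (merge b c)) \<cdot> ((one \<one> \<otimes> mg b c) \<cdot> \<alpha> \<one> (tl_obj b) (tl_obj c))"
      using o lu_nat[of "mg b c"] by (simp add: cmp_ass[symmetric])
    finally show ?thesis using 1 by simp
  next
    case 2
    then show ?thesis using o by (simp add: unit_triangle)
  next
    case 3
    have "ru (tl_obj (merge a b)) \<cdot> (mg a b \<otimes> one \<one>) = mg a b \<cdot> ru (tl_obj a \<odot> tl_obj b)"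
      using o ru_nat[of "mg a b"] by simp
    then show ?thesis using o 3 by (simp add: ru_\<alpha>)
  next
    case 4
    then obtain p l q m r n where e: "a = p # l" "b = q # m" "c = r # n"
      by (metis neq_Nil_conv)
    obtain i x j y k z where pqr: "p = (i, x)" "q = (j, y)" "r = (k, z)" by fastforce
    have oo: "x \<in> obj K" "y \<in> obj K" "z \<in> obj K" "objs l" "objs m" "objs n"
      using o by (auto simp: e pqr)
    let ?A = "tl_obj a" and ?B = "tl_obj b" and ?C = "tl_obj c"
    let ?L = "tl_obj l" and ?M = "tl_obj m" and ?N = "tl_obj n"
    have IH1: "mg (merge l b) c \<cdot> (mg l b \<otimes> one ?C) = mg l (merge b c) \<cdot> ((one ?L \<otimes> mg b c) \<cdot> \<alpha> ?L ?B ?C)"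
      by (rule less.hyps) (use o e in auto)
    have IH2: "mg (merge a m) c \<cdot> (mg a m \<otimes> one ?C) = mg a (merge m c) \<cdot> ((one ?A \<otimes> mg m c) \<cdot> \<alpha> ?A ?M ?C)"
      by (rule less.hyps) (use o e in auto)
    have IH3: "mg (merge a b) n \<cdot> (mg a b \<otimes> one ?N) = mg a (merge b n) \<cdot> ((one ?A \<otimes> mg b n) \<cdot> \<alpha> ?A ?B ?N)"
      by (rule less.hyps) (use o e in auto)
    consider "i \<le> j" "i \<le> k" | "j < i" "j \<le> k" | "k < i" "k < j" by linarith
    then show ?thesis
    proof cases
      case 1
      have c1: "mg a b = (one x \<otimes> mg l b) \<cdot> \<alpha> x ?L ?B" "merge a b = p # merge l b"
        using 1 by (simp_all add: e pqr)
      have c2: "mg (merge a b) c = (one x \<otimes> mg (merge l b) c) \<cdot> \<alpha> x (tl_obj (merge l b)) ?C"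
        using 1 by (simp add: c1(2)) (simp add: e pqr)
      have c3: "mg a (merge b c) = (one x \<otimes> mg l (merge b c)) \<cdot> \<alpha> x ?L (tl_obj (merge b c))"
        using 1 by (simp add: e pqr)
      have "mg (merge a b) c \<cdot> (mg a b \<otimes> one ?C)
          = (one x \<otimes> mg (merge l b) c) \<cdot> ((\<alpha> x (tl_obj (merge l b)) ?C \<cdot> ((one x \<otimes> mg l b) \<otimes> one ?C)) \<cdot> (\<alpha> x ?L ?B \<otimes> one ?C))"
        unfolding c2 unfolding c1(1) using o oo by (simp add: cmp_ass tens_cmp tens_cmp')
      also have "\<dots> = (one x \<otimes> (mg (merge l b) c \<cdot> (mg l b \<otimes> one ?C))) \<cdot> (\<alpha> x (?L \<odot> ?B) ?C \<cdot> (\<alpha> x ?L ?B \<otimes> one ?C))"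
        using o oo by (simp add: \<alpha>_nat cmp_ass tens_cmp')
      also have "\<dots> = (one x \<otimes> mg l (merge b c)) \<cdot> ((one x \<otimes> (one ?L \<otimes> mg b c)) \<cdot> ((one x \<otimes> \<alpha> ?L ?B ?C) \<cdot> \<alpha> x (?L \<odot> ?B) ?C \<cdot> (\<alpha> x ?L ?B \<otimes> one ?C)))"
        unfolding IH1 using o oo by (simp add: cmp_ass tens_cmp')
      also have "\<dots> = (one x \<otimes> mg l (merge b c)) \<cdot> ((one x \<otimes> (one ?L \<otimes> mg b c)) \<cdot> (\<alpha> x ?L (?B \<odot> ?C) \<cdot> \<alpha> (x \<odot> ?L) ?B ?C))"
        using pentagon[of x ?L ?B ?C] o oo by simp
      also have "\<dots> = (one x \<otimes> mg l (merge b c)) \<cdot> ((\<alpha> x ?L (tl_obj (merge b c)) \<cdot> ((one x \<otimes> one ?L) \<otimes> mg b c)) \<cdot> \<alpha> (x \<odot> ?L) ?B ?C)"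
        using o oo by (simp add: \<alpha>_nat cmp_ass del: tensa_idn)
      also have "\<dots> = mg a (merge b c) \<cdot> ((one ?A \<otimes> mg b c) \<cdot> \<alpha> ?A ?B ?C)"
      proof -
        have A: "?A = x \<odot> ?L" by (simp add: e pqr)
        show ?thesis unfolding c3 A using o oo by (simp add: cmp_ass)
      qed
      finally show ?thesis .
    next
      case 2
      have c1: "mg a b = (one y \<otimes> mg a m) \<cdot> sw ?A y ?M" "merge a b = q # merge a m"
        using 2 by (simp_all add: e pqr)
      have c2: "mg (merge a b) c = (one y \<otimes> mg (merge a m) c) \<cdot> \<alpha> y (tl_obj (merge a m)) ?C"
        using 2 by (simp add: c1(2)) (simp add: e pqr)
      have c4: "mg b c = (one y \<otimes> mg m c) \<cdot> \<alpha> y ?M ?C" "merge b c = q # merge m c"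
        using 2 by (simp_all add: e pqr)
      have c3: "mg a (merge b c) = (one y \<otimes> mg a (merge m c)) \<cdot> sw ?A y (tl_obj (merge m c))"
        using 2 by (simp add: c4(2)) (simp add: e pqr)
      have "mg (merge a b) c \<cdot> (mg a b \<otimes> one ?C)
          = (one y \<otimes> mg (merge a m) c) \<cdot> ((\<alpha> y (tl_obj (merge a m)) ?C \<cdot> ((one y \<otimes> mg a m) \<otimes> one ?C)) \<cdot> (sw ?A y ?M \<otimes> one ?C))"
        unfolding c2 unfolding c1(1) using o oo by (simp add: cmp_ass tens_cmp tens_cmp' del: tl_obj.simps)
      also have "\<dots> = (one y \<otimes> (mg (merge a m) c \<cdot> (mg a m \<otimes> one ?C))) \<cdot> (\<alpha> y (?A \<odot> ?M) ?C \<cdot> (sw ?A y ?M \<otimes> one ?C))"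
        using o oo by (simp add: \<alpha>_nat cmp_ass tens_cmp')
      also have "\<dots> = (one y \<otimes> mg a (merge m c)) \<cdot> ((one y \<otimes> (one ?A \<otimes> mg m c)) \<cdot> ((one y \<otimes> \<alpha> ?A ?M ?C) \<cdot> (\<alpha> y (?A \<odot> ?M) ?C \<cdot> (sw ?A y ?M \<otimes> one ?C))))"
        unfolding IH2 using o oo by (simp add: cmp_ass tens_cmp')
      also have "\<dots> = (one y \<otimes> mg a (merge m c)) \<cdot> (((one y \<otimes> (one ?A \<otimes> mg m c)) \<cdot> sw ?A y (?M \<odot> ?C)) \<cdot> ((one ?A \<otimes> \<alpha> y ?M ?C) \<cdot> \<alpha> ?A (y \<odot> ?M) ?C))"
        using o oo by (simp add: sw_tens cmp_ass)
      also have "(one y \<otimes> (one ?A \<otimes> mg m c)) \<cdot> sw ?A y (?M \<odot> ?C) = sw ?A y (tl_obj (merge m c)) \<cdot> (one ?A \<otimes> (one y \<otimes> mg m c))"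
        using o oo by (simp add: sw_nat)
      also have "(one y \<otimes> mg a (merge m c)) \<cdot> ((sw ?A y (tl_obj (merge m c)) \<cdot> (one ?A \<otimes> (one y \<otimes> mg m c))) \<cdot> ((one ?A \<otimes> \<alpha> y ?M ?C) \<cdot> \<alpha> ?A (y \<odot> ?M) ?C))
         = mg a (merge b c) \<cdot> ((one ?A \<otimes> mg b c) \<cdot> \<alpha> ?A (y \<odot> ?M) ?C)"
        unfolding c3 unfolding c4(1) using o oo by (simp add: cmp_ass tens_cmp')
      finally show ?thesis by (simp add: e pqr)
    next
      case 3
      have c1: "mg b c = (one z \<otimes> mg b n) \<cdot> sw ?B z ?N" "merge b c = r # merge b n"
        using 3 by (simp_all add: e pqr)
      have c2: "mg a (merge b c) = (one z \<otimes> mg a (merge b n)) \<cdot> sw ?A z (tl_obj (merge b n))"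
        using 3 by (simp add: c1(2)) (simp add: e pqr)
      have c3: "mg (merge a b) c = (one z \<otimes> mg (merge a b) n) \<cdot> sw (tl_obj (merge a b)) z ?N"
        using 3 by (simp add: e pqr)
      have "mg (merge a b) c \<cdot> (mg a b \<otimes> one ?C)
         = (one z \<otimes> mg (merge a b) n) \<cdot> (sw (tl_obj (merge a b)) z ?N \<cdot> (mg a b \<otimes> (one z \<otimes> one ?N)))"
        unfolding c3 using o oo by (simp add: cmp_ass e pqr)
      also have "\<dots> = (one z \<otimes> (mg (merge a b) n \<cdot> (mg a b \<otimes> one ?N))) \<cdot> sw (?A \<odot> ?B) z ?N"
        using o oo by (simp add: sw_nat tens_cmp' del: tensa_idn)
      also have "\<dots> = (one z \<otimes> mg a (merge b n)) \<cdot> ((one z \<otimes> (one ?A \<otimes> mg b n)) \<cdot> ((one z \<otimes> \<alpha> ?A ?B ?N) \<cdot> sw (?A \<odot> ?B) z ?N))"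
        unfolding IH3 using o oo by (simp add: cmp_ass tens_cmp')
      also have "\<dots> = (one z \<otimes> mg a (merge b n)) \<cdot> (((one z \<otimes> (one ?A \<otimes> mg b n)) \<cdot> sw ?A z (?B \<odot> ?N)) \<cdot> ((one ?A \<otimes> sw ?B z ?N) \<cdot> \<alpha> ?A ?B (z \<odot> ?N)))"
        using o oo by (simp add: sw_sw cmp_ass)
      also have "(one z \<otimes> (one ?A \<otimes> mg b n)) \<cdot> sw ?A z (?B \<odot> ?N) = sw ?A z (tl_obj (merge b n)) \<cdot> (one ?A \<otimes> (one z \<otimes> mg b n))"
        using o oo by (simp add: sw_nat)
      also have "(one z \<otimes> mg a (merge b n)) \<cdot> ((sw ?A z (tl_obj (merge b n)) \<cdot> (one ?A \<otimes> (one z \<otimes> mg b n))) \<cdot> ((one ?A \<otimes> sw ?B z ?N) \<cdot> \<alpha> ?A ?B (z \<odot> ?N)))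
        = mg a (merge b c) \<cdot> ((one ?A \<otimes> mg b c) \<cdot> \<alpha> ?A ?B (z \<odot> ?N))"
        unfolding c2 unfolding c1(1) using o oo by (simp add: cmp_ass tens_cmp')
      finally show ?thesis by (simp add: e pqr)
    qed
  qed
qed

text \<open>
  A generalized element of an object, whose stage is a tensor product of labelled objects. On
  elements with disjoint labels the structure isomorphisms act as on pure tensors of modules, and
  arrows out of a tensor product are determined by their values on pure tensors of variables.
\<close>

definition el :: "(nat \<times> 'o) list \<times> 'm \<Rightarrow> bool" where
  "el t \<longleftrightarrow> objs (fst t) \<and> snd t \<in> arr K \<and> src K (snd t) = tl_obj (fst t)"

definition ty :: "(nat \<times> 'o) list \<times> 'm \<Rightarrow> 'o" where
  "ty t = tgt K (snd t)"

definition lab :: "(nat \<times> 'o) list \<times> 'm \<Rightarrow> nat set" where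
  "lab t = fst ` set (fst t)"

definition ap :: "'m \<Rightarrow> (nat \<times> 'o) list \<times> 'm \<Rightarrow> (nat \<times> 'o) list \<times> 'm" (infixr "\<star>" 72) where
  "f \<star> t = (fst t, f \<cdot> snd t)"

definition tn :: "(nat \<times> 'o) list \<times> 'm \<Rightarrow> (nat \<times> 'o) list \<times> 'm \<Rightarrow> (nat \<times> 'o) list \<times> 'm"
    (infixr "\<bowtie>" 73) where
  "s \<bowtie> t = (merge (fst s) (fst t), (snd s \<otimes> snd t) \<cdot> inv (mg (fst s) (fst t)))"

text \<open>Besides isomorphisms, the quotient maps onto relative tensor products have to be
  cancelled. These are split, and splitting, unlike being epi, visibly survives tensoring.\<close>

definition split_epi :: "'m \<Rightarrow> bool" where
  "split_epi f \<longleftrightarrow> f \<in> arr K \<and> (\<exists>s \<in> hom K (tgt K f) (src K f). f \<cdot> s = one (tgt K f))"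

lemma split_epiI: "\<lbrakk>f \<in> arr K; s \<in> arr K; src K s = tgt K f; tgt K s = src K f; f \<cdot> s = one (tgt K f)\<rbrakk>
    \<Longrightarrow> split_epi f"
  unfolding split_epi_def by (auto intro: homI)

lemma split_epi_iso [simp]: "iso f \<Longrightarrow> split_epi f"
  by (rule split_epiI[of _ "inv f"]) auto

lemma split_epi_cmp [simp]:
  assumes "split_epi f" "split_epi g" "src K g = tgt K f"
  shows "split_epi (g \<cdot> f)"
proof -
  obtain s t where s: "s \<in> hom K (tgt K f) (src K f)" "f \<cdot> s = one (tgt K f)"
    and t: "t \<in> hom K (tgt K g) (src K g)" "g \<cdot> t = one (tgt K g)" and "f \<in> arr K" "g \<in> arr K"
    using assms by (auto simp: split_epi_def)
  moreover note homD[OF s(1)] homD[OF t(1)]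
  moreover have "f \<cdot> (s \<cdot> t) = t" using calculation assms by (simp add: cmp_ass[symmetric])
  ultimately show ?thesis
    using assms by (intro split_epiI[of _ "s \<cdot> t"]) (simp_all add: cmp_ass)
qed

lemma split_epi_tensa [simp]:
  assumes "split_epi f" "split_epi g"
  shows "split_epi (f \<otimes> g)"
proof -
  obtain s t where s: "s \<in> hom K (tgt K f) (src K f)" "f \<cdot> s = one (tgt K f)"
    and t: "t \<in> hom K (tgt K g) (src K g)" "g \<cdot> t = one (tgt K g)" and "f \<in> arr K" "g \<in> arr K"
    using assms by (auto simp: split_epi_def)
  moreover note homD[OF s(1)] homD[OF t(1)]
  ultimately show ?thesis
    using assms by (intro split_epiI[of _ "s \<otimes> t"]) (simp_all add: tens_cmp)
qed

lemma split_epi_cancel: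
  assumes "split_epi f" "g \<in> arr K" "h \<in> arr K" "src K g = tgt K f" "src K h = tgt K f" "g \<cdot> f = h \<cdot> f"
  shows "g = h"
proof -
  obtain s where s: "s \<in> hom K (tgt K f) (src K f)" "f \<cdot> s = one (tgt K f)" and f: "f \<in> arr K"
    using assms by (auto simp: split_epi_def)
  note d = homD[OF s(1)]
  have "g = (g \<cdot> f) \<cdot> s" using assms(1-5) s d f by (simp add: cmp_ass)
  also have "\<dots> = (h \<cdot> f) \<cdot> s" by (simp only: assms(6))
  also have "\<dots> = h" using assms(1-5) s d f by (simp add: cmp_ass)
  finally show ?thesis .
qed

text \<open>Generic elements: arrows out of \<open>ty t\<close> are separated by their values at
  \<open>t\<close>, see \<open>gen_eqI\<close>.\<close>

definition gen :: "(nat \<times> 'o) list \<times> 'm \<Rightarrow> bool" where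
  "gen t \<longleftrightarrow> el t \<and> split_epi (snd t)"

text \<open>A variable. Its stage is a list with one entry, whose object is
  \<open>x \<odot> \<one>\<close>; hence \<open>ru x\<close> in place of the identity.\<close>

definition V :: "nat \<Rightarrow> 'o \<Rightarrow> (nat \<times> 'o) list \<times> 'm" where
  "V i x = ([(i, x)], ru x)"

definition u1 :: "(nat \<times> 'o) list \<times> 'm" where
  "u1 = ([], one \<one>)"

lemma el_ap [simp]: "\<lbrakk>f \<in> arr K; el t; src K f = ty t\<rbrakk> \<Longrightarrow> el (f \<star> t)"
  and ty_ap [simp]: "\<lbrakk>f \<in> arr K; el t; src K f = ty t\<rbrakk> \<Longrightarrow> ty (f \<star> t) = tgt K f"
  and lab_ap [simp]: "lab (f \<star> t) = lab t"
  by (simp_all add: el_def ty_def ap_def lab_def)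

lemma el_tn [simp]: "\<lbrakk>el s; el t\<rbrakk> \<Longrightarrow> el (s \<bowtie> t)"
  and ty_tn [simp]: "\<lbrakk>el s; el t\<rbrakk> \<Longrightarrow> ty (s \<bowtie> t) = ty s \<odot> ty t"
  and lab_tn [simp]: "lab (s \<bowtie> t) = lab s \<union> lab t"
  by (simp_all add: el_def ty_def tn_def lab_def image_Un)

lemma ty_obj [simp]: "el t \<Longrightarrow> ty t \<in> obj K"
  by (simp add: el_def ty_def)

lemma V_simps [simp]: "x \<in> obj K \<Longrightarrow> el (V i x)" "x \<in> obj K \<Longrightarrow> ty (V i x) = x" "lab (V i x) = {i}"
  "x \<in> obj K \<Longrightarrow> gen (V i x)"
  by (simp_all add: V_def el_def ty_def lab_def gen_def)

lemma u1_simps [simp]: "el u1" "ty u1 = \<one>" "lab u1 = {}" "gen u1"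
  by (simp_all add: u1_def el_def ty_def lab_def gen_def)

lemma gen_tn [simp]: "\<lbrakk>gen s; gen t\<rbrakk> \<Longrightarrow> gen (s \<bowtie> t)"
  by (simp add: gen_def) (simp add: tn_def el_def)

lemma gen_el: "gen t \<Longrightarrow> el t"
  by (simp add: gen_def)

lemma gen_eqI:
  assumes "gen t" "f \<in> arr K" "g \<in> arr K" "src K f = ty t" "src K g = ty t" "f \<star> t = g \<star> t"
  shows "f = g"
  using assms by (intro split_epi_cancel[of "snd t" f g]) (auto simp: gen_def ap_def ty_def)

lemma gen_ap [simp]: "\<lbrakk>gen t; split_epi f; src K f = ty t\<rbrakk> \<Longrightarrow> gen (f \<star> t)"
  by (auto simp: gen_def split_epi_def[of f]) (auto simp: ap_def ty_def split_epi_def[of f] intro!: split_epi_cmp)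

lemma ap_cmp [simp]:
  "\<lbrakk>f \<in> arr K; g \<in> arr K; src K g = tgt K f; src K f = ty t; el t\<rbrakk> \<Longrightarrow> (g \<cdot> f) \<star> t = g \<star> f \<star> t"
  by (simp add: ap_def el_def ty_def cmp_ass)

lemma ap_one [simp]: "\<lbrakk>el t; ty t = x\<rbrakk> \<Longrightarrow> one x \<star> t = t"
  by (auto simp add: ap_def el_def ty_def)

lemma ap_tens [simp]:
  "\<lbrakk>f \<in> arr K; g \<in> arr K; el s; el t; src K f = ty s; src K g = ty t\<rbrakk>
     \<Longrightarrow> (f \<otimes> g) \<star> (s \<bowtie> t) = (f \<star> s) \<bowtie> (g \<star> t)"
  by (simp add: ap_def el_def ty_def tn_def tens_cmp')

lemma ap_\<beta>:
  assumes "el s" "el t" "ty s = x" "ty t = y" "lab s \<inter> lab t = {}"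
  shows "\<beta> x y \<star> (s \<bowtie> t) = t \<bowtie> s"
proof -
  obtain a f b g where e: "s = (a, f)" "t = (b, g)" by fastforce
  have o: "objs a" "objs b" "f \<in> arr K" "g \<in> arr K" "src K f = tl_obj a" "src K g = tl_obj b"
    "tgt K f = x" "tgt K g = y" and d: "fst ` set a \<inter> fst ` set b = {}"
    using assms by (auto simp: e el_def ty_def lab_def)
  have xy: "x \<in> obj K" "y \<in> obj K" using o by auto
  have m: "mg a b = mg b a \<cdot> \<beta> (tl_obj a) (tl_obj b)" using mg_sym[of a b] o d by simp
  have "\<beta> x y \<cdot> ((f \<otimes> g) \<cdot> inv (mg a b)) = (\<beta> x y \<cdot> (f \<otimes> g)) \<cdot> inv (mg a b)"
    using o xy by (simp add: cmp_ass merge_commute[OF d])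
  also have "\<dots> = (g \<otimes> f) \<cdot> (\<beta> (tl_obj a) (tl_obj b) \<cdot> inv (mg a b))"
    using o xy by (simp add: \<beta>_nat cmp_ass)
  also have "\<beta> (tl_obj a) (tl_obj b) \<cdot> inv (mg a b) = inv (mg b a)"
    unfolding m using o d by (simp add: inverse_of_cmp \<beta>_\<beta> cmp_ass[symmetric])
  finally show ?thesis by (simp add: e ap_def tn_def merge_commute[OF d])
qed

lemma ap_\<alpha>:
  assumes "el s" "el t" "el u" "ty s = x" "ty t = y" "ty u = z"
  shows "\<alpha> x y z \<star> ((s \<bowtie> t) \<bowtie> u) = s \<bowtie> (t \<bowtie> u)"
proof -
  obtain a f b g c h where e: "s = (a, f)" "t = (b, g)" "u = (c, h)" by (metis surj_pair)
  have o: "objs a" "objs b" "objs c" "f \<in> arr K" "g \<in> arr K" "h \<in> arr K" "src K f = tl_obj a"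
    "src K g = tl_obj b" "src K h = tl_obj c" "tgt K f = x" "tgt K g = y" "tgt K h = z"
    using assms by (auto simp: e el_def ty_def lab_def)
  have xyz: "x \<in> obj K" "y \<in> obj K" "z \<in> obj K" using o by auto
  let ?a = "tl_obj a" and ?b = "tl_obj b" and ?c = "tl_obj c"
  let ?w = "\<alpha> ?a ?b ?c"
  have "((f \<otimes> g) \<cdot> inv (mg a b)) \<otimes> h = ((f \<otimes> g) \<otimes> h) \<cdot> (inv (mg a b) \<otimes> one ?c)"
    using o by (simp add: tens_cmp)
  then have "\<alpha> x y z \<cdot> ((((f \<otimes> g) \<cdot> inv (mg a b)) \<otimes> h) \<cdot> inv (mg (merge a b) c))
    = \<alpha> x y z \<cdot> ((((f \<otimes> g) \<otimes> h) \<cdot> (inv (mg a b) \<otimes> one ?c)) \<cdot> inv (mg (merge a b) c))"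
    using o by simp
  also have "\<dots> = (\<alpha> x y z \<cdot> ((f \<otimes> g) \<otimes> h)) \<cdot> ((inv (mg a b) \<otimes> one ?c) \<cdot> inv (mg (merge a b) c))"
    using o xyz by (simp add: cmp_ass)
  also have "\<dots> = (f \<otimes> (g \<otimes> h)) \<cdot> (?w \<cdot> inv (mg (merge a b) c \<cdot> (mg a b \<otimes> one ?c)))"
    using o xyz by (simp add: \<alpha>_nat cmp_ass inverse_of_cmp)
  also have "?w \<cdot> inv (mg (merge a b) c \<cdot> (mg a b \<otimes> one ?c))
      = (one ?a \<otimes> inv (mg b c)) \<cdot> inv (mg a (merge b c))"
    unfolding mg_assoc[OF o(1-3)] using o by (simp add: inverse_of_cmp cmp_ass)
  also have "(f \<otimes> (g \<otimes> h)) \<cdot> ((one ?a \<otimes> inv (mg b c)) \<cdot> inv (mg a (merge b c)))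
      = (f \<otimes> ((g \<otimes> h) \<cdot> inv (mg b c))) \<cdot> inv (mg a (merge b c))"
    using o by (simp add: tens_cmp')
  finally show ?thesis by (simp add: e ap_def tn_def merge_assoc)
qed

lemma ap_inv:
  "\<lbrakk>iso f; el t; ty t = src K f\<rbrakk> \<Longrightarrow> inv f \<star> f \<star> t = t"
  by (simp add: ap_def el_def ty_def)

lemma ap_inv_\<alpha>:
  assumes "el s" "el t" "el u" "ty s = x" "ty t = y" "ty u = z"
  shows "inv (\<alpha> x y z) \<star> (s \<bowtie> (t \<bowtie> u)) = (s \<bowtie> t) \<bowtie> u"
  using ap_inv[of "\<alpha> x y z" "(s \<bowtie> t) \<bowtie> u"] assms by (auto simp: ap_\<alpha>)

lemma ap_lu:
  assumes "el t" "ty t = x"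
  shows "lu x \<star> (u1 \<bowtie> t) = t"
proof -
  obtain a f where e: "t = (a, f)" by fastforce
  have o: "objs a" "f \<in> arr K" "src K f = tl_obj a" "tgt K f = x" "x \<in> obj K"
    using assms by (auto simp: e el_def ty_def)
  have "lu x \<cdot> ((one \<one> \<otimes> f) \<cdot> inv (lu (tl_obj a))) = (lu x \<cdot> (one \<one> \<otimes> f)) \<cdot> inv (lu (tl_obj a))"
    using o by (simp add: cmp_ass)
  also have "\<dots> = f" using o by (simp add: lu_nat cmp_ass)
  finally show ?thesis by (simp add: e ap_def tn_def u1_def)
qed

lemma ap_ru:
  assumes "el t" "ty t = x"
  shows "ru x \<star> (t \<bowtie> u1) = t"
proof -
  obtain a f where e: "t = (a, f)" by fastforce
  have o: "objs a" "f \<in> arr K" "src K f = tl_obj a" "tgt K f = x" "x \<in> obj K"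
    using assms by (auto simp: e el_def ty_def)
  have "ru x \<cdot> ((f \<otimes> one \<one>) \<cdot> inv (ru (tl_obj a))) = (ru x \<cdot> (f \<otimes> one \<one>)) \<cdot> inv (ru (tl_obj a))"
    using o by (simp add: cmp_ass)
  also have "\<dots> = f" using o by (simp add: ru_nat cmp_ass)
  finally show ?thesis using o by (simp add: e ap_def tn_def u1_def)
qed

lemma ap_inv_lu: "\<lbrakk>el t; ty t = x\<rbrakk> \<Longrightarrow> inv (lu x) \<star> t = u1 \<bowtie> t"
  using ap_inv[of "lu x" "u1 \<bowtie> t"] by (auto simp: ap_lu)

lemma ap_inv_ru: "\<lbrakk>el t; ty t = x\<rbrakk> \<Longrightarrow> inv (ru x) \<star> t = t \<bowtie> u1"
  using ap_inv[of "ru x" "t \<bowtie> u1"] by (auto simp: ap_ru)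

lemmas ap_simps = ap_\<alpha> ap_inv_\<alpha> ap_lu ap_ru ap_inv_lu ap_inv_ru ap_\<beta>

lemma interchange_simps [simp]:
  assumes "w \<in> obj K" "x \<in> obj K" "y \<in> obj K" "z \<in> obj K"
  shows "interchange K w x y z \<in> arr K" "src K (interchange K w x y z) = (w \<odot> x) \<odot> (y \<odot> z)"
    "tgt K (interchange K w x y z) = (w \<odot> y) \<odot> (x \<odot> z)"
  using assms by (simp_all add: interchange_def)

lemma ap_interchange:
  assumes "el s" "el t" "el u" "el v" "ty s = w" "ty t = x" "ty u = y" "ty v = z" "lab t \<inter> lab u = {}"
  shows "interchange K w x y z \<star> ((s \<bowtie> t) \<bowtie> (u \<bowtie> v)) = (s \<bowtie> u) \<bowtie> (t \<bowtie> v)"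
proof -
  have "w \<in> obj K" "x \<in> obj K" "y \<in> obj K" "z \<in> obj K" using assms by auto
  then show ?thesis using assms by (simp add: interchange_def ap_simps)
qed

end

section \<open>Rings, modules, restriction of scalars and the section of an action given by
  separability\<close>

section \<open>Rings and modules\<close>

context symmetric_monoidal_category
begin

lemma ring_simps [simp]:
  assumes "ring_object K A"
  shows "car A \<in> obj K" "mul A \<in> arr K" "src K (mul A) = car A \<odot> car A" "tgt K (mul A) = car A"
    "uni A \<in> arr K" "src K (uni A) = \<one>" "tgt K (uni A) = car A"
  using assms by (auto simp: ring_object_def hom_def)

lemma tt_ringD: "tt_ring K A \<Longrightarrow> ring_object K A" "tt_ring K A \<Longrightarrow> commutative_ring K A"
  "tt_ring K A \<Longrightarrow> separable_ring K A"
  by (simp_all add: tt_ring_def)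

lemma mul_assoc:
  assumes "ring_object K A" "el a" "el b" "el c" "ty a = car A" "ty b = car A" "ty c = car A"
  shows "mul A \<star> ((mul A \<star> (a \<bowtie> b)) \<bowtie> c) = mul A \<star> (a \<bowtie> (mul A \<star> (b \<bowtie> c)))"
proof -
  have "mul A \<cdot> (mul A \<otimes> one (car A)) = mul A \<cdot> (one (car A) \<otimes> mul A) \<cdot> \<alpha> (car A) (car A) (car A)"
    using assms by (simp add: ring_object_def)
  from arg_cong[OF this, of "\<lambda>f. f \<star> ((a \<bowtie> b) \<bowtie> c)"] show ?thesis
    using assms by (simp add: ap_simps)
qed

lemma mul_uni_l: "\<lbrakk>ring_object K A; el a; ty a = car A\<rbrakk> \<Longrightarrow> mul A \<star> ((uni A \<star> u1) \<bowtie> a) = a"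
  and mul_uni_r: "\<lbrakk>ring_object K A; el a; ty a = car A\<rbrakk> \<Longrightarrow> mul A \<star> (a \<bowtie> (uni A \<star> u1)) = a"
proof -
  assume a: "ring_object K A" "el a" "ty a = car A"
  have "mul A \<cdot> (uni A \<otimes> one (car A)) = lu (car A)" using a by (simp add: ring_object_def)
  from arg_cong[OF this, of "\<lambda>f. f \<star> (u1 \<bowtie> a)"] show "mul A \<star> ((uni A \<star> u1) \<bowtie> a) = a"
    using a by (simp add: ap_simps)
  have "mul A \<cdot> (one (car A) \<otimes> uni A) = ru (car A)" using a by (simp add: ring_object_def)
  from arg_cong[OF this, of "\<lambda>f. f \<star> (a \<bowtie> u1)"] show "mul A \<star> (a \<bowtie> (uni A \<star> u1)) = a"
    using a by (simp add: ap_simps)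
qed

lemma mul_comm:
  assumes "ring_object K A" "commutative_ring K A" "el a" "el b" "ty a = car A" "ty b = car A"
    "lab a \<inter> lab b = {}"
  shows "mul A \<star> (a \<bowtie> b) = mul A \<star> (b \<bowtie> a)"
proof -
  have "mul A \<cdot> \<beta> (car A) (car A) = mul A" using assms by (simp add: commutative_ring_def)
  from arg_cong[OF this, of "\<lambda>f. f \<star> (b \<bowtie> a)"] show ?thesis
    using assms by (simp add: ap_simps Int_commute)
qed

lemma mul_lcomm:
  assumes "ring_object K A" "commutative_ring K A" "el a" "el b" "el c" "ty a = car A" "ty b = car A"
    "ty c = car A" "lab a \<inter> lab b = {}"
  shows "mul A \<star> (a \<bowtie> (mul A \<star> (b \<bowtie> c))) = mul A \<star> (b \<bowtie> (mul A \<star> (a \<bowtie> c)))"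
  using assms mul_comm[of A a b] by (simp add: mul_assoc[symmetric])

lemma modules_simps:
  assumes "M \<in> modules K A"
  shows "fst M \<in> obj K" "snd M \<in> arr K" "src K (snd M) = car A \<odot> fst M" "tgt K (snd M) = fst M"
  using assms by (auto simp: modules_def hom_def)

lemma act_act:
  assumes "M \<in> modules K A" "ring_object K A" "el a" "el b" "el m" "ty a = car A" "ty b = car A" "ty m = fst M"
  shows "snd M \<star> (a \<bowtie> (snd M \<star> (b \<bowtie> m))) = snd M \<star> ((mul A \<star> (a \<bowtie> b)) \<bowtie> m)"
proof -
  have "snd M \<cdot> (mul A \<otimes> one (fst M)) = snd M \<cdot> (one (car A) \<otimes> snd M) \<cdot> \<alpha> (car A) (car A) (fst M)"
    using assms(1) by (auto simp: modules_def)
  from arg_cong[OF this, of "\<lambda>f. f \<star> ((a \<bowtie> b) \<bowtie> m)"] show ?thesis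
    using assms modules_simps[OF assms(1)] by (simp add: ap_simps)
qed

lemma act_uni:
  assumes "M \<in> modules K A" "ring_object K A" "el m" "ty m = fst M"
  shows "snd M \<star> ((uni A \<star> u1) \<bowtie> m) = m"
proof -
  have "snd M \<cdot> (uni A \<otimes> one (fst M)) = lu (fst M)"
    using assms(1) by (auto simp: modules_def)
  from arg_cong[OF this, of "\<lambda>f. f \<star> (u1 \<bowtie> m)"] show ?thesis
    using assms modules_simps[OF assms(1)] by (simp add: ap_simps)
qed

text \<open>Labels 0 and 1 are reserved for the scalars. The generic \<open>m\<close> may be the
  image of a pure tensor under a quotient map, which is how relative tensor products are recognized
  as modules.\<close>

lemma modulesI:
  assumes A: "ring_object K A" and o: "x \<in> obj K" "\<rho> \<in> arr K" "src K \<rho> = car A \<odot> x" "tgt K \<rho> = x"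
    and m: "gen m" "ty m = x" "lab m \<inter> {0, 1} = {}"
    and a: "\<And>a b. \<lbrakk>gen a; gen b; el a; el b; ty a = car A; ty b = car A; lab a = {0}; lab b = {1}\<rbrakk> \<Longrightarrow>
      \<rho> \<star> (a \<bowtie> (\<rho> \<star> (b \<bowtie> m))) = \<rho> \<star> ((mul A \<star> (a \<bowtie> b)) \<bowtie> m)"
    and u: "\<rho> \<star> ((uni A \<star> u1) \<bowtie> m) = m"
  shows "(x, \<rho>) \<in> modules K A"
proof -
  let ?a = "V 0 (car A)" and ?b = "V 1 (car A)"
  have "\<rho> \<cdot> (mul A \<otimes> one x) = \<rho> \<cdot> (one (car A) \<otimes> \<rho>) \<cdot> \<alpha> (car A) (car A) x"
    by (rule gen_eqI[of "(?a \<bowtie> ?b) \<bowtie> m"]) (use A o m gen_el a[of ?a ?b] in \<open>simp_all add: ap_simps\<close>)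
  moreover have "\<rho> \<cdot> (uni A \<otimes> one x) = lu x"
    by (rule gen_eqI[of "u1 \<bowtie> m"]) (use A o m gen_el u in \<open>simp_all add: ap_simps\<close>)
  ultimately show ?thesis using o by (simp add: modules_def hom_def)
qed

lemma linear_el:
  assumes "f \<in> module_homs K A M N" "M \<in> modules K A" "N \<in> modules K A" "ring_object K A"
    "el a" "el m" "ty a = car A" "ty m = fst M"
  shows "f \<star> snd M \<star> (a \<bowtie> m) = snd N \<star> (a \<bowtie> (f \<star> m))"
proof -
  have e: "f \<cdot> snd M = snd N \<cdot> (one (car A) \<otimes> f)" "f \<in> hom K (fst M) (fst N)"
    using assms(1) by (auto simp: module_homs_def)
  from arg_cong[OF e(1), of "\<lambda>f. f \<star> (a \<bowtie> m)"] e(2) show ?thesis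
    using assms(4-) modules_simps[OF assms(2)] modules_simps[OF assms(3)] by (simp add: ap_simps hom_def)
qed

lemma module_homsI:
  assumes "M \<in> modules K A" "N \<in> modules K A" "ring_object K A"
    "f \<in> arr K" "src K f = fst M" "tgt K f = fst N" "gen m" "ty m = fst M" "0 \<notin> lab m"
    "\<And>a. \<lbrakk>gen a; el a; ty a = car A; lab a = {0}\<rbrakk> \<Longrightarrow> f \<star> snd M \<star> (a \<bowtie> m) = snd N \<star> (a \<bowtie> (f \<star> m))"
  shows "f \<in> module_homs K A M N"
proof -
  have "f \<cdot> snd M = snd N \<cdot> (one (car A) \<otimes> f)"
    by (rule gen_eqI[of "V 0 (car A) \<bowtie> m"])
      (use assms(3-9) assms(10)[of "V 0 (car A)"] modules_simps[OF assms(1)] modules_simps[OF assms(2)] gen_el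
        in \<open>simp_all add: ap_simps\<close>)
  then show ?thesis using assms by (simp add: module_homs_def hom_def)
qed

lemma module_homs_simps:
  "f \<in> module_homs K A M N \<Longrightarrow> f \<in> arr K" "f \<in> module_homs K A M N \<Longrightarrow> src K f = fst M"
  "f \<in> module_homs K A M N \<Longrightarrow> tgt K f = fst N"
  by (auto simp: module_homs_def hom_def)

lemma ring_homs_simps:
  assumes "f \<in> ring_homs K A B"
  shows "f \<in> arr K" "src K f = car A" "tgt K f = car B"
  using assms by (auto simp: ring_homs_def hom_def)

lemma ring_hom_mul:
  assumes "f \<in> ring_homs K A B" "ring_object K A" "ring_object K B" "el a" "el b" "ty a = car A" "ty b = car A"
  shows "f \<star> mul A \<star> (a \<bowtie> b) = mul B \<star> ((f \<star> a) \<bowtie> (f \<star> b))"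
proof -
  have "f \<cdot> mul A = mul B \<cdot> (f \<otimes> f)"
    using assms(1) by (simp add: ring_homs_def)
  from arg_cong[OF this, of "\<lambda>f. f \<star> (a \<bowtie> b)"] show ?thesis
    using assms ring_homs_simps[OF assms(1)] by (simp add: ap_simps)
qed

lemma ring_hom_uni:
  assumes "f \<in> ring_homs K A B" "ring_object K A" "ring_object K B"
  shows "f \<star> uni A \<star> u1 = uni B \<star> u1"
proof -
  have "f \<cdot> uni A = uni B"
    using assms(1) by (simp add: ring_homs_def)
  from arg_cong[OF this, of "\<lambda>f. f \<star> u1"] show ?thesis
    using assms ring_homs_simps[OF assms(1)] by (simp add: ap_simps)
qed

lemma ring_homsI:
  assumes "ring_object K A" "ring_object K B" "f \<in> arr K" "src K f = car A" "tgt K f = car B"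
    and m: "\<And>a b. \<lbrakk>el a; el b; ty a = car A; ty b = car A; lab a = {0}; lab b = {1}\<rbrakk> \<Longrightarrow>
      f \<star> mul A \<star> (a \<bowtie> b) = mul B \<star> ((f \<star> a) \<bowtie> (f \<star> b))"
    and u: "f \<star> uni A \<star> u1 = uni B \<star> u1"
  shows "f \<in> ring_homs K A B"
proof -
  have "f \<cdot> mul A = mul B \<cdot> (f \<otimes> f)"
    by (rule gen_eqI[of "V 0 (car A) \<bowtie> V 1 (car A)"]) (use assms(1-5) m in \<open>simp_all add: ap_simps\<close>)
  moreover have "f \<cdot> uni A = uni B"
    by (rule gen_eqI[of u1]) (use assms(1-5) u in \<open>simp_all add: ap_simps\<close>)
  ultimately show ?thesis using assms by (simp add: ring_homs_def hom_def)
qed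

lemma ring_homs_cmp:
  assumes "f \<in> ring_homs K A B" "g \<in> ring_homs K B C" "ring_object K A" "ring_object K B" "ring_object K C"
  shows "g \<cdot> f \<in> ring_homs K A C"
  by (rule ring_homsI) (use assms ring_homs_simps[OF assms(1)] ring_homs_simps[OF assms(2)]
     in \<open>simp_all add: ring_hom_mul[OF assms(1)] ring_hom_mul[OF assms(2)] ring_hom_uni[OF assms(1)] ring_hom_uni[OF assms(2)]\<close>)

lemma ring_homs_idn: "ring_object K A \<Longrightarrow> one (car A) \<in> ring_homs K A A"
  by (rule ring_homsI) simp_all

lemma self_module: "ring_object K A \<Longrightarrow> (car A, mul A) \<in> modules K A"
  by (rule modulesI[of _ _ _ "V 2 (car A)"]) (simp_all add: mul_assoc mul_uni_l)

definition restr :: "'m \<Rightarrow> 'o \<times> 'm \<Rightarrow> 'o \<times> 'm" where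
  "restr f M = (fst M, snd M \<cdot> (f \<otimes> one (fst M)))"

lemma fst_restr [simp]: "fst (restr f M) = fst M"
  by (simp add: restr_def)

lemma restr_act:
  assumes "f \<in> ring_homs K R B" "M \<in> modules K B" "ring_object K R" "ring_object K B"
    "el a" "el m" "ty a = car R" "ty m = fst M"
  shows "snd (restr f M) \<star> (a \<bowtie> m) = snd M \<star> ((f \<star> a) \<bowtie> m)"
  using assms ring_homs_simps[OF assms(1)] modules_simps[OF assms(2)]
  by (simp add: restr_def)

lemma restr_module:
  assumes "f \<in> ring_homs K R B" "M \<in> modules K B" "ring_object K R" "ring_object K B"
  shows "restr f M \<in> modules K R"
proof -
  note s = ring_homs_simps[OF assms(1)] modules_simps[OF assms(2)]
  have "(fst M, snd (restr f M)) \<in> modules K R"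
  proof (rule modulesI[of _ _ _ "V 2 (fst M)"])
    show "snd (restr f M) \<in> arr K" "src K (snd (restr f M)) = car R \<odot> fst M" "tgt K (snd (restr f M)) = fst M"
      using assms s by (simp_all add: restr_def)
  qed (use assms s in \<open>simp_all add: restr_act[OF assms] act_act ring_hom_mul ring_hom_uni act_uni\<close>)
  then show ?thesis by (simp add: restr_def)
qed

lemma restr_idn: "M \<in> modules K A \<Longrightarrow> ring_object K A \<Longrightarrow> restr (one (car A)) M = M"
  using modules_simps[of M A] by (simp add: restr_def)

lemma restr_restr:
  assumes "f \<in> ring_homs K R B" "g \<in> ring_homs K B C" "M \<in> modules K C"
  shows "restr f (restr g M) = restr (g \<cdot> f) M"
  using ring_homs_simps[OF assms(1)] ring_homs_simps[OF assms(2)] modules_simps[OF assms(3)]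
  by (simp add: restr_def cmp_ass tens_cmp)

lemma restr_homs:
  assumes "f \<in> ring_homs K R B" "M \<in> modules K B" "N \<in> modules K B" "g \<in> module_homs K B M N"
    and "ring_object K R" "ring_object K B"
  shows "g \<in> module_homs K R (restr f M) (restr f N)"
  by (rule module_homsI[of _ _ _ _ "V 1 (fst M)"])
    (use assms restr_module[OF assms(1,2)] restr_module[OF assms(1,3)] module_homs_simps[OF assms(4)]
      modules_simps[OF assms(2)] ring_homs_simps[OF assms(1)] in
      \<open>simp_all add: restr_act linear_el[OF assms(4)]\<close>)

lemma restricted_module_restr: "restricted_module K B f = restr f (car B, mul B)"
  by (simp add: restricted_module_def restr_def)

text \<open>A section of the action, \<open>m \<mapsto> \<Sigma>\<^sub>i e\<^sub>i \<otimes> e'\<^sub>i m\<close> for a separability idempotent \<open>\<Sigma>\<^sub>i e\<^sub>i \<otimes> e'\<^sub>i\<close>.\<close>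

definition sep :: "('o, 'm) ring_ob \<Rightarrow> 'm" where
  "sep A = (SOME \<sigma>. \<sigma> \<in> hom K (car A) (car A \<odot> car A) \<and> mul A \<cdot> \<sigma> = one (car A) \<and>
     (one (car A) \<otimes> mul A) \<cdot> \<alpha> (car A) (car A) (car A) \<cdot> (\<sigma> \<otimes> one (car A)) = \<sigma> \<cdot> mul A \<and>
     (mul A \<otimes> one (car A)) \<cdot> inv (\<alpha> (car A) (car A) (car A)) \<cdot> (one (car A) \<otimes> \<sigma>) = \<sigma> \<cdot> mul A)"

lemma sep_simps:
  assumes "separable_ring K A"
  shows "sep A \<in> arr K" "src K (sep A) = car A" "tgt K (sep A) = car A \<odot> car A"
    and sep_mul: "mul A \<cdot> sep A = one (car A)"
    "(one (car A) \<otimes> mul A) \<cdot> \<alpha> (car A) (car A) (car A) \<cdot> (sep A \<otimes> one (car A)) = sep A \<cdot> mul A"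
    "(mul A \<otimes> one (car A)) \<cdot> inv (\<alpha> (car A) (car A) (car A)) \<cdot> (one (car A) \<otimes> sep A) = sep A \<cdot> mul A"
proof -
  have "\<exists>\<sigma>. \<sigma> \<in> hom K (car A) (car A \<odot> car A) \<and> mul A \<cdot> \<sigma> = one (car A) \<and>
     (one (car A) \<otimes> mul A) \<cdot> \<alpha> (car A) (car A) (car A) \<cdot> (\<sigma> \<otimes> one (car A)) = \<sigma> \<cdot> mul A \<and>
     (mul A \<otimes> one (car A)) \<cdot> inv (\<alpha> (car A) (car A) (car A)) \<cdot> (one (car A) \<otimes> \<sigma>) = \<sigma> \<cdot> mul A"
    using assms unfolding separable_ring_def by blast
  from someI_ex[OF this, folded sep_def]
  show "sep A \<in> arr K" "src K (sep A) = car A" "tgt K (sep A) = car A \<odot> car A"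
    "mul A \<cdot> sep A = one (car A)"
    "(one (car A) \<otimes> mul A) \<cdot> \<alpha> (car A) (car A) (car A) \<cdot> (sep A \<otimes> one (car A)) = sep A \<cdot> mul A"
    "(mul A \<otimes> one (car A)) \<cdot> inv (\<alpha> (car A) (car A) (car A)) \<cdot> (one (car A) \<otimes> sep A) = sep A \<cdot> mul A"
    by (auto simp: hom_def)
qed

lemma sep_el_r:
  assumes "tt_ring K A" "el a" "el b" "ty a = car A" "ty b = car A"
  shows "(one (car A) \<otimes> mul A) \<star> \<alpha> (car A) (car A) (car A) \<star> ((sep A \<star> a) \<bowtie> b) = sep A \<star> mul A \<star> (a \<bowtie> b)"
proof -
  note A = tt_ringD[OF assms(1)] sep_simps[OF tt_ringD(3)[OF assms(1)]]
  from arg_cong[OF A(8), of "\<lambda>f. f \<star> (a \<bowtie> b)"] show ?thesis using assms A(1-6) by simp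
qed

lemma sep_el_l:
  assumes "tt_ring K A" "el a" "el b" "ty a = car A" "ty b = car A"
  shows "(mul A \<otimes> one (car A)) \<star> inv (\<alpha> (car A) (car A) (car A)) \<star> (a \<bowtie> (sep A \<star> b)) = sep A \<star> mul A \<star> (a \<bowtie> b)"
proof -
  note A = tt_ringD[OF assms(1)] sep_simps[OF tt_ringD(3)[OF assms(1)]]
  from arg_cong[OF A(9), of "\<lambda>f. f \<star> (a \<bowtie> b)"] show ?thesis using assms A(1-6) by simp
qed

definition coact :: "('o, 'm) ring_ob \<Rightarrow> 'o \<times> 'm \<Rightarrow> 'm" where
  "coact A M = (one (car A) \<otimes> snd M) \<cdot> (\<alpha> (car A) (car A) (fst M) \<cdot>
      (((sep A \<cdot> uni A) \<otimes> one (fst M)) \<cdot> inv (lu (fst M))))"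

lemma coact_simps:
  assumes "tt_ring K A" "M \<in> modules K A"
  shows "coact A M \<in> arr K" "src K (coact A M) = fst M" "tgt K (coact A M) = car A \<odot> fst M"
  using tt_ringD[OF assms(1)] modules_simps[OF assms(2)] sep_simps[OF tt_ringD(3)[OF assms(1)]]
  by (simp_all add: coact_def)

lemma coact_el:
  assumes "tt_ring K A" "M \<in> modules K A" "el m" "ty m = fst M"
  shows "coact A M \<star> m = (one (car A) \<otimes> snd M) \<star> \<alpha> (car A) (car A) (fst M) \<star> ((sep A \<star> uni A \<star> u1) \<bowtie> m)"
  using assms(3-) tt_ringD[OF assms(1)] modules_simps[OF assms(2)] sep_simps[OF tt_ringD(3)[OF assms(1)]]
  by (simp add: coact_def ap_simps)

text \<open>Contracting the sum of e_i \<otimes> e'_i m to the sum of e_i e'_i m leaves m, because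
  \<open>mul A \<cdot> sep A\<close> is the identity.\<close>

lemma act_coact:
  assumes A: "tt_ring K A" and M: "M \<in> modules K A"
  shows "snd M \<cdot> coact A M = one (fst M)"
proof (rule gen_eqI[of "V 0 (fst M)"])
  note s = tt_ringD[OF A] modules_simps[OF M] sep_simps[OF tt_ringD(3)[OF A]] coact_simps[OF A M]
  let ?e = "sep A \<star> uni A \<star> u1" and ?m = "V 0 (fst M)"
  have "snd M \<cdot> ((one (car A) \<otimes> snd M) \<cdot> \<alpha> (car A) (car A) (fst M)) = snd M \<cdot> (mul A \<otimes> one (fst M))"
    using M s by (auto simp: modules_def cmp_ass)
  from arg_cong[OF this, of "\<lambda>f. f \<star> (?e \<bowtie> ?m)"]
  have "snd M \<star> (one (car A) \<otimes> snd M) \<star> \<alpha> (car A) (car A) (fst M) \<star> (?e \<bowtie> ?m) = snd M \<star> ((mul A \<star> ?e) \<bowtie> ?m)"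
    using s by simp
  also have "mul A \<star> ?e = (mul A \<cdot> sep A) \<star> uni A \<star> u1"
    using s(1-3,8-10) by simp
  also have "\<dots> = uni A \<star> u1" unfolding s(11) using s(1) by simp
  finally have "snd M \<star> coact A M \<star> ?m = ?m"
    using s by (simp add: coact_el[OF A M] act_uni[OF M])
  then show "(snd M \<cdot> coact A M) \<star> ?m = one (fst M) \<star> ?m" using s by simp
qed (use tt_ringD[OF A] modules_simps[OF M] coact_simps[OF A M] in simp_all)

text \<open>For e, the value of \<open>sep A\<close> at the unit, the two bilinearity laws of
  \<open>sep A\<close> give e a = a e, both being the value of \<open>sep A\<close> at a. So a
  scalar next to m, at the far right of e, may be moved to its far left.\<close>

lemma coact_act:
  assumes A: "tt_ring K A" and M: "M \<in> modules K A" and e: "el a" "el m" "ty a = car A" "ty m = fst M"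
  shows "coact A M \<star> snd M \<star> (a \<bowtie> m) =
    (mul A \<otimes> one (fst M)) \<star> inv (\<alpha> (car A) (car A) (fst M)) \<star> (a \<bowtie> (coact A M \<star> m))"
proof -
  note s = tt_ringD[OF A] modules_simps[OF M] sep_simps(1-3)[OF tt_ringD(3)[OF A]] coact_simps[OF A M]
  let ?A = "car A" and ?x = "fst M"
  let ?e = "sep A \<star> uni A \<star> u1"
  define h where "h = (one ?A \<otimes> snd M) \<cdot> \<alpha> ?A ?A ?x"
  have h: "h \<in> arr K" "src K h = (?A \<odot> ?A) \<odot> ?x" "tgt K h = ?A \<odot> ?x"
    using s by (simp_all add: h_def)
  have he: "h \<star> ((u \<bowtie> w) \<bowtie> v) = u \<bowtie> (snd M \<star> (w \<bowtie> v))" if "el v" "ty v = ?x" "el u" "el w" "ty u = ?A" "ty w = ?A" for u v w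
    using s that by (simp add: h_def ap_simps)
  have 1: "h \<cdot> (one (?A \<odot> ?A) \<otimes> snd M) = h \<cdot> ((((one ?A \<otimes> mul A) \<cdot> \<alpha> ?A ?A ?A) \<otimes> one ?x) \<cdot> inv (\<alpha> (?A \<odot> ?A) ?A ?x))"
    by (rule gen_eqI[of "(V 0 ?A \<bowtie> V 1 ?A) \<bowtie> (V 2 ?A \<bowtie> V 3 ?x)"])
      (use s h in \<open>simp_all add: ap_simps he act_act[OF M]\<close>)
  from arg_cong[OF 1, of "\<lambda>f. f \<star> (?e \<bowtie> (a \<bowtie> m))"]
  have "h \<star> (?e \<bowtie> (snd M \<star> (a \<bowtie> m))) = h \<star> (((one ?A \<otimes> mul A) \<star> \<alpha> ?A ?A ?A \<star> (?e \<bowtie> a)) \<bowtie> m)"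
    using s h e by (simp add: ap_simps)
  also have "\<dots> = h \<star> ((sep A \<star> a) \<bowtie> m)"
    using s e by (simp add: sep_el_r[OF A] mul_uni_l)
  also have "\<dots> = h \<star> (((mul A \<otimes> one ?A) \<star> inv (\<alpha> ?A ?A ?A) \<star> (a \<bowtie> ?e)) \<bowtie> m)"
    using s e by (simp add: sep_el_l[OF A] mul_uni_r)
  also have "\<dots> = (mul A \<otimes> one ?x) \<star> inv (\<alpha> ?A ?A ?x) \<star> (a \<bowtie> (h \<star> (?e \<bowtie> m)))"
  proof -
    have 2: "h \<cdot> ((((mul A \<otimes> one ?A) \<cdot> inv (\<alpha> ?A ?A ?A)) \<otimes> one ?x) \<cdot> inv (\<alpha> ?A (?A \<odot> ?A) ?x)) =
      (mul A \<otimes> one ?x) \<cdot> (inv (\<alpha> ?A ?A ?x) \<cdot> (one ?A \<otimes> h))"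
      by (rule gen_eqI[of "V 0 ?A \<bowtie> ((V 1 ?A \<bowtie> V 2 ?A) \<bowtie> V 3 ?x)"])
        (use s h in \<open>simp_all add: ap_simps he\<close>)
    from arg_cong[OF 2, of "\<lambda>f. f \<star> (a \<bowtie> (?e \<bowtie> m))"] show ?thesis
      using s h e by (simp add: ap_simps)
  qed
  finally show ?thesis
    using s h e by (simp add: coact_el[OF A M]) (simp add: h_def)
qed

text \<open>The coaction inserts a fixed element and acts, so linear maps commute with it.
  Naturality of \<open>tpi\<close>, and hence exactness of the relative tensor product, rests on
  this.\<close>

lemma coact_natural:
  assumes A: "tt_ring K A" and M: "M \<in> modules K A" and N: "N \<in> modules K A" and f: "f \<in> module_homs K A M N"
  shows "coact A N \<cdot> f = (one (car A) \<otimes> f) \<cdot> coact A M"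
proof (rule gen_eqI[of "V 0 (fst M)"])
  note s = tt_ringD[OF A] modules_simps[OF M] modules_simps[OF N] sep_simps(1-3)[OF tt_ringD(3)[OF A]]
    coact_simps[OF A M] coact_simps[OF A N] module_homs_simps[OF f]
  let ?A = "car A" and ?x = "fst M" and ?e = "sep A \<star> uni A \<star> u1" and ?m = "V 0 (fst M)"
  have "((one ?A \<otimes> snd N) \<cdot> \<alpha> ?A ?A (fst N)) \<cdot> (one (?A \<odot> ?A) \<otimes> f) = (one ?A \<otimes> f) \<cdot> ((one ?A \<otimes> snd M) \<cdot> \<alpha> ?A ?A ?x)"
    by (rule gen_eqI[of "(V 0 ?A \<bowtie> V 1 ?A) \<bowtie> V 2 ?x"])
      (use s in \<open>simp_all add: ap_simps linear_el[OF f M N]\<close>)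
  from arg_cong[OF this, of "\<lambda>f. f \<star> (?e \<bowtie> ?m)"]
  show "(coact A N \<cdot> f) \<star> ?m = ((one (car A) \<otimes> f) \<cdot> coact A M) \<star> ?m"
    using s by (simp add: coact_el[OF A M] coact_el[OF A N])
qed (use tt_ringD[OF A] modules_simps[OF M] modules_simps[OF N] coact_simps[OF A M] coact_simps[OF A N] module_homs_simps[OF f] in simp_all)

end

section \<open>The relative tensor product as the image of an idempotent\<close>

context tt_category
begin

text \<open>The map m \<otimes> (a \<otimes> n) -> a m \<otimes> n. It is kept apart from
  \<open>tpi\<close> because the separability element is not a pure tensor: identities are proved
  for a variable a and then evaluated at the coaction.\<close>

definition pre_pi :: "('o, 'm) ring_ob \<Rightarrow> 'o \<times> 'm \<Rightarrow> 'o \<times> 'm \<Rightarrow> 'm" where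
  "pre_pi R M N = ((snd M \<cdot> \<beta> (fst M) (car R)) \<otimes> one (fst N)) \<cdot> inv (\<alpha> (fst M) (car R) (fst N))"

text \<open>\<open>m \<otimes> n \<mapsto> \<Sigma>\<^sub>i e\<^sub>i m \<otimes> e'\<^sub>i n\<close>, an idempotent with image \<open>M \<otimes>\<^sub>R N\<close>.\<close>

definition tpi :: "('o, 'm) ring_ob \<Rightarrow> 'o \<times> 'm \<Rightarrow> 'o \<times> 'm \<Rightarrow> 'm" where
  "tpi R M N = pre_pi R M N \<cdot> (one (fst M) \<otimes> coact R N)"

context
  fixes R M N
  assumes R: "tt_ring K R" and M: "M \<in> modules K R" and N: "N \<in> modules K R"
begin

lemmas RMN_simps = tt_ringD[OF R] modules_simps[OF M] modules_simps[OF N] coact_simps[OF R N]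

lemma pre_pi_simps: "pre_pi R M N \<in> arr K" "src K (pre_pi R M N) = fst M \<odot> (car R \<odot> fst N)"
   "tgt K (pre_pi R M N) = fst M \<odot> fst N"
  using RMN_simps by (simp_all add: pre_pi_def)

lemma tpi_simps: "tpi R M N \<in> arr K" "src K (tpi R M N) = fst M \<odot> fst N"
   "tgt K (tpi R M N) = fst M \<odot> fst N"
  using RMN_simps pre_pi_simps by (simp_all add: tpi_def)

lemma pre_pi_el: "\<lbrakk>el m; el a; el n; ty m = fst M; ty a = car R; ty n = fst N; lab a \<inter> lab m = {}\<rbrakk> \<Longrightarrow>
   pre_pi R M N \<star> (m \<bowtie> (a \<bowtie> n)) = (snd M \<star> (a \<bowtie> m)) \<bowtie> n"
  using RMN_simps by (simp add: pre_pi_def ap_simps Int_commute)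

lemma tpi_el: "\<lbrakk>el m; el n; ty m = fst M; ty n = fst N\<rbrakk> \<Longrightarrow>
   tpi R M N \<star> (m \<bowtie> n) = pre_pi R M N \<star> (m \<bowtie> (coact R N \<star> n))"
  using RMN_simps pre_pi_simps by (simp add: tpi_def)

text \<open>By linearity of the coaction the scalar a reaches the left of e_i, and commutativity
  turns (a e_i) m into e_i (a m).\<close>

lemma tpi_balanced:
  assumes e: "el a" "el m" "el n" "ty a = car R" "ty m = fst M" "ty n = fst N" "lab a \<inter> lab m = {}"
  shows "tpi R M N \<star> (m \<bowtie> (snd N \<star> (a \<bowtie> n))) = tpi R M N \<star> ((snd M \<star> (a \<bowtie> m)) \<bowtie> n)"
proof -
  note s = RMN_simps pre_pi_simps tpi_simps
  let ?R = "car R" and ?m = "fst M" and ?n = "fst N"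
  have 1: "pre_pi R M N \<cdot> (one ?m \<otimes> ((mul R \<otimes> one ?n) \<cdot> inv (\<alpha> ?R ?R ?n))) =
    pre_pi R M N \<cdot> (((snd M \<cdot> \<beta> ?m ?R) \<otimes> one (?R \<odot> ?n)) \<cdot> inv (\<alpha> ?m ?R (?R \<odot> ?n)))"
    by (rule gen_eqI[of "V 1 ?m \<bowtie> (V 0 ?R \<bowtie> (V 2 ?R \<bowtie> V 3 ?n))"])
      (use s in \<open>simp_all add: ap_simps pre_pi_el act_act[OF M] mul_comm\<close>)
  from arg_cong[OF this, of "\<lambda>f. f \<star> (m \<bowtie> (a \<bowtie> (coact R N \<star> n)))"]
  show ?thesis using s e
    by (simp add: ap_simps tpi_el coact_act[OF R N] Int_commute)
qed

text \<open>A balanced \<open>g\<close> carries each e_i across to the second factor, where the sum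
  of e_i e'_i is 1. The spare factor \<open>w\<close> is there because such maps also occur inside
  larger tensor products, namely for actions and for associativity.\<close>

lemma tpi_lift_l:
  assumes w: "w \<in> obj K" and g: "g \<in> arr K" "src K g = w \<odot> (fst M \<odot> fst N)"
    and e: "gen u" "gen m" "gen n" "ty u = w" "ty m = fst M" "ty n = fst N" "0 \<notin> lab m"
    and b: "g \<star> (u \<bowtie> ((snd M \<star> (V 0 (car R) \<bowtie> m)) \<bowtie> n)) = g \<star> (u \<bowtie> (m \<bowtie> (snd N \<star> (V 0 (car R) \<bowtie> n))))"
  shows "g \<cdot> (one w \<otimes> tpi R M N) = g"
proof -
  note s = RMN_simps pre_pi_simps tpi_simps
  have 1: "g \<cdot> (one w \<otimes> pre_pi R M N) = g \<cdot> (one w \<otimes> (one (fst M) \<otimes> snd N))"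
    by (rule gen_eqI[of "u \<bowtie> (m \<bowtie> (V 0 (car R) \<bowtie> n))"])
      (use s w g e b gen_el in \<open>simp_all add: ap_simps pre_pi_el\<close>)
  have "g \<cdot> (one w \<otimes> tpi R M N) = (g \<cdot> (one w \<otimes> pre_pi R M N)) \<cdot> (one w \<otimes> (one (fst M) \<otimes> coact R N))"
    using s w g by (simp add: tpi_def cmp_ass tens_cmp)
  also have "\<dots> = g"
    unfolding 1 using s w g by (simp add: cmp_ass tens_cmp act_coact[OF R N])
  finally show ?thesis .
qed

lemma tpi_lift:
  assumes g: "g \<in> arr K" "src K g = fst M \<odot> fst N"
    and e: "gen m" "gen n" "ty m = fst M" "ty n = fst N" "0 \<notin> lab m"
    and b: "g \<star> ((snd M \<star> (V 0 (car R) \<bowtie> m)) \<bowtie> n) = g \<star> (m \<bowtie> (snd N \<star> (V 0 (car R) \<bowtie> n)))"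
  shows "g \<cdot> tpi R M N = g"
proof -
  note s = RMN_simps pre_pi_simps tpi_simps
  have 1: "g \<cdot> pre_pi R M N = g \<cdot> (one (fst M) \<otimes> snd N)"
    by (rule gen_eqI[of "m \<bowtie> (V 0 (car R) \<bowtie> n)"])
      (use s g e b gen_el in \<open>simp_all add: ap_simps pre_pi_el\<close>)
  have "g \<cdot> tpi R M N = (g \<cdot> pre_pi R M N) \<cdot> (one (fst M) \<otimes> coact R N)"
    using s g by (simp add: tpi_def cmp_ass)
  also have "\<dots> = g"
    unfolding 1 using s g by (simp add: cmp_ass tens_cmp act_coact[OF R N])
  finally show ?thesis .
qed

lemma tpi_lift_r:
  assumes w: "w \<in> obj K" and g: "g \<in> arr K" "src K g = (fst M \<odot> fst N) \<odot> w"
    and e: "gen u" "gen m" "gen n" "ty u = w" "ty m = fst M" "ty n = fst N" "0 \<notin> lab m"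
    and b: "g \<star> (((snd M \<star> (V 0 (car R) \<bowtie> m)) \<bowtie> n) \<bowtie> u) = g \<star> ((m \<bowtie> (snd N \<star> (V 0 (car R) \<bowtie> n))) \<bowtie> u)"
  shows "g \<cdot> (tpi R M N \<otimes> one w) = g"
proof -
  note s = RMN_simps pre_pi_simps tpi_simps
  have 1: "g \<cdot> (pre_pi R M N \<otimes> one w) = g \<cdot> ((one (fst M) \<otimes> snd N) \<otimes> one w)"
    by (rule gen_eqI[of "(m \<bowtie> (V 0 (car R) \<bowtie> n)) \<bowtie> u"])
      (use s w g e b gen_el in \<open>simp_all add: ap_simps pre_pi_el\<close>)
  have "g \<cdot> (tpi R M N \<otimes> one w) = (g \<cdot> (pre_pi R M N \<otimes> one w)) \<cdot> ((one (fst M) \<otimes> coact R N) \<otimes> one w)"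
    using s w g by (simp add: tpi_def cmp_ass tens_cmp)
  also have "\<dots> = g"
    unfolding 1 using s w g by (simp add: cmp_ass tens_cmp act_coact[OF R N])
  finally show ?thesis .
qed

lemma tpi_tpi: "tpi R M N \<cdot> tpi R M N = tpi R M N"
  by (rule tpi_lift[of _ "V 1 (fst M)" "V 2 (fst N)"]) (use RMN_simps tpi_simps in \<open>simp_all add: tpi_balanced\<close>)

text \<open>The quotient is picked by \<open>SOME\<close>, so everything about it has to come from
  its universal property. The balanced map \<open>tpi\<close> factors as \<open>k \<cdot> q\<close>,
  and \<open>q\<close> is invariant under \<open>tpi\<close>; uniqueness of factorizations then
  makes \<open>k\<close> a section.\<close>

lemma coequalizer_props:
  assumes "is_coequalizer K ((snd M \<cdot> \<beta> (fst M) (car R)) \<otimes> one (fst N))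
     ((one (fst M) \<otimes> snd N) \<cdot> \<alpha> (fst M) (car R) (fst N)) q"
  shows "q \<in> arr K" "src K q = fst M \<odot> fst N"
    "\<exists>s. s \<in> hom K (tgt K q) (src K q) \<and> q \<cdot> s = one (tgt K q) \<and> s \<cdot> q = tpi R M N"
    "\<lbrakk>el a; el m; el n; ty a = car R; ty m = fst M; ty n = fst N; lab a \<inter> lab m = {}\<rbrakk> \<Longrightarrow>
        q \<star> (m \<bowtie> (snd N \<star> (a \<bowtie> n))) = q \<star> ((snd M \<star> (a \<bowtie> m)) \<bowtie> n)"
proof -
  note s = RMN_simps pre_pi_simps tpi_simps
  let ?f = "(snd M \<cdot> \<beta> (fst M) (car R)) \<otimes> one (fst N)"
  let ?g = "(one (fst M) \<otimes> snd N) \<cdot> \<alpha> (fst M) (car R) (fst N)"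
  have tf: "tgt K ?f = fst M \<odot> fst N" using s by simp
  show q: "q \<in> arr K" "src K q = fst M \<odot> fst N"
    using assms tf by (auto simp: is_coequalizer_def)
  have fg: "q \<cdot> ?f = q \<cdot> ?g" using assms by (simp add: is_coequalizer_def)
  show el: "q \<star> (m \<bowtie> (snd N \<star> (a \<bowtie> n))) = q \<star> ((snd M \<star> (a \<bowtie> m)) \<bowtie> n)"
    if "el a" "el m" "el n" "ty a = car R" "ty m = fst M" "ty n = fst N" "lab a \<inter> lab m = {}" for a m n
    using arg_cong[OF fg, of "\<lambda>f. f \<star> ((m \<bowtie> a) \<bowtie> n)"] that s q by (simp add: ap_simps Int_commute)
  have uni': "\<forall>h \<in> arr K. src K h = tgt K ?f \<longrightarrow> h \<cdot> ?f = h \<cdot> ?g \<longrightarrow>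
        (\<exists>!k. k \<in> hom K (tgt K q) (tgt K h) \<and> k \<cdot> q = h)"
    using assms unfolding is_coequalizer_def by (elim conjE)
  have uni: "\<exists>!k. k \<in> hom K (tgt K q) (tgt K h) \<and> k \<cdot> q = h"
    if "h \<in> arr K" "src K h = fst M \<odot> fst N" "h \<cdot> ?f = h \<cdot> ?g" for h
    by (rule uni'[rule_format]) (use that tf in \<open>simp_all only:\<close>)
  have "tpi R M N \<cdot> ?f = tpi R M N \<cdot> ?g"
    by (rule gen_eqI[of "(V 0 (fst M) \<bowtie> V 1 (car R)) \<bowtie> V 2 (fst N)"])
      (use s in \<open>simp_all add: ap_simps tpi_balanced\<close>)
  with uni[of "tpi R M N"] s obtain k where k: "k \<in> hom K (tgt K q) (fst M \<odot> fst N)" "k \<cdot> q = tpi R M N"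
    by auto
  have "q \<cdot> tpi R M N = q"
    by (rule tpi_lift[of _ "V 1 (fst M)" "V 2 (fst N)"]) (use s q in \<open>simp_all add: el\<close>)
  then have "(q \<cdot> k) \<cdot> q = q" using k q by (simp add: cmp_ass hom_def)
  moreover have "one (tgt K q) \<cdot> q = q" "one (tgt K q) \<in> hom K (tgt K q) (tgt K q)"
     "q \<cdot> k \<in> hom K (tgt K q) (tgt K q)" using q k by (simp_all add: hom_def)
  ultimately have "q \<cdot> k = one (tgt K q)"
    using uni[of q] q fg by blast
  with k q show "\<exists>s. s \<in> hom K (tgt K q) (src K q) \<and> q \<cdot> s = one (tgt K q) \<and> s \<cdot> q = tpi R M N"
    by auto
qed

text \<open>Idempotent completeness splits \<open>tpi\<close>, and the retraction onto its image is
  a coequalizer: a map equalizing the two actions is invariant under \<open>tpi\<close>.\<close>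

lemma coequalizer_ex:
  "\<exists>q. is_coequalizer K ((snd M \<cdot> \<beta> (fst M) (car R)) \<otimes> one (fst N))
     ((one (fst M) \<otimes> snd N) \<cdot> \<alpha> (fst M) (car R) (fst N)) q"
proof -
  note s = RMN_simps pre_pi_simps tpi_simps
  let ?f = "(snd M \<cdot> \<beta> (fst M) (car R)) \<otimes> one (fst N)"
  let ?g = "(one (fst M) \<otimes> snd N) \<cdot> \<alpha> (fst M) (car R) (fst N)"
  have "tpi R M N \<in> hom K (fst M \<odot> fst N) (fst M \<odot> fst N)" using s by (simp add: hom_def)
  then obtain y i r where y: "y \<in> obj K" "i \<in> hom K y (fst M \<odot> fst N)" "r \<in> hom K (fst M \<odot> fst N) y"
    and ri: "r \<cdot> i = one y" "i \<cdot> r = tpi R M N"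
    using idempotents_split tpi_tpi s unfolding idempotent_complete_def by (metis tens_obj)
  note y' = y(1) homD[OF y(2)] homD[OF y(3)]
  have tf: "tgt K ?f = fst M \<odot> fst N" using s by simp
  have r: "r = r \<cdot> tpi R M N"
    using y' ri by (simp add: ri(2)[symmetric] cmp_ass[symmetric])
  have pf: "tpi R M N \<cdot> ?f = tpi R M N \<cdot> ?g"
    by (rule gen_eqI[of "(V 0 (fst M) \<bowtie> V 1 (car R)) \<bowtie> V 2 (fst N)"])
      (use s in \<open>simp_all add: ap_simps tpi_balanced\<close>)
  have "r \<cdot> ?f = r \<cdot> (tpi R M N \<cdot> ?f)" using s y' by (subst r) (simp add: cmp_ass)
  also have "\<dots> = r \<cdot> (tpi R M N \<cdot> ?g)" by (simp only: pf)
  also have "\<dots> = r \<cdot> ?g" using s y' by (subst (2) r) (simp add: cmp_ass)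
  finally have rf: "r \<cdot> ?f = r \<cdot> ?g" .
  have "is_coequalizer K ?f ?g r"
    unfolding is_coequalizer_def
  proof (intro conjI ballI impI)
    fix h assume h: "h \<in> arr K" "src K h = tgt K ?f" "h \<cdot> ?f = h \<cdot> ?g"
    have src: "src K h = fst M \<odot> fst N" using h(2) tf by simp
    have b: "h \<star> (m \<bowtie> (snd N \<star> (a \<bowtie> n))) = h \<star> ((snd M \<star> (a \<bowtie> m)) \<bowtie> n)"
      if "el a" "el m" "el n" "ty a = car R" "ty m = fst M" "ty n = fst N" "lab a \<inter> lab m = {}" for a m n
      using arg_cong[OF h(3), of "\<lambda>f. f \<star> ((m \<bowtie> a) \<bowtie> n)"] that s h(1) src by (simp add: ap_simps Int_commute)
    have hp: "h \<cdot> tpi R M N = h"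
      by (rule tpi_lift[of _ "V 1 (fst M)" "V 2 (fst N)"]) (use s h(1) src in \<open>simp_all add: b\<close>)
    show "\<exists>!k. k \<in> hom K (tgt K r) (tgt K h) \<and> k \<cdot> r = h"
    proof (rule ex1I[of _ "h \<cdot> i"])
      show "h \<cdot> i \<in> hom K (tgt K r) (tgt K h) \<and> h \<cdot> i \<cdot> r = h"
        using y' h(1) src hp by (simp add: hom_def cmp_ass ri)
      fix k assume k: "k \<in> hom K (tgt K r) (tgt K h) \<and> k \<cdot> r = h"
      then have "h \<cdot> i = (k \<cdot> r) \<cdot> i" by simp
      also have "\<dots> = k" using conjunct1[OF k] y' ri(1) by (simp add: cmp_ass hom_def)
      finally show "k = h \<cdot> i" by simp
    qed
  qed (use s y' rf in \<open>simp_all add: hom_def\<close>)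
  then show ?thesis by blast
qed

text \<open>The section inducing exactly the idempotent \<open>tpi\<close>; it is therefore
  compatible with every map that commutes with \<open>tpi\<close>.\<close>

definition tsec :: "'m" where
  "tsec = (SOME s. s \<in> hom K (tgt K (tensor_quot K R M N)) (src K (tensor_quot K R M N)) \<and>
     tensor_quot K R M N \<cdot> s = one (tgt K (tensor_quot K R M N)) \<and> s \<cdot> tensor_quot K R M N = tpi R M N)"

lemma tensor_quot_simps:
  "tensor_quot K R M N \<in> arr K" "src K (tensor_quot K R M N) = fst M \<odot> fst N"
  "tsec \<in> arr K" "src K tsec = tgt K (tensor_quot K R M N)" "tgt K tsec = fst M \<odot> fst N"
  "tensor_quot K R M N \<cdot> tsec = one (tgt K (tensor_quot K R M N))"
  "split_epi (tensor_quot K R M N)"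
  and tsec_quot: "tsec \<cdot> tensor_quot K R M N = tpi R M N"
  and tensor_quot_balanced:
    "\<lbrakk>el a; el m; el n; ty a = car R; ty m = fst M; ty n = fst N; lab a \<inter> lab m = {}\<rbrakk> \<Longrightarrow>
        tensor_quot K R M N \<star> (m \<bowtie> (snd N \<star> (a \<bowtie> n))) = tensor_quot K R M N \<star> ((snd M \<star> (a \<bowtie> m)) \<bowtie> n)"
proof -
  note c = coequalizer_props[OF someI_ex[OF coequalizer_ex, folded tensor_quot_def]]
  show q: "tensor_quot K R M N \<in> arr K" "src K (tensor_quot K R M N) = fst M \<odot> fst N"
    by (rule c)+
  note t = someI_ex[OF c(3), folded tsec_def]
  show "tsec \<cdot> tensor_quot K R M N = tpi R M N" using t by simp
  show t': "tsec \<in> arr K" "src K tsec = tgt K (tensor_quot K R M N)" "tgt K tsec = fst M \<odot> fst N"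
     "tensor_quot K R M N \<cdot> tsec = one (tgt K (tensor_quot K R M N))"
    using t q by (auto simp: hom_def)
  show "split_epi (tensor_quot K R M N)"
    by (rule split_epiI[of _ tsec]) (use q t' in simp_all)
  show "\<lbrakk>el a; el m; el n; ty a = car R; ty m = fst M; ty n = fst N; lab a \<inter> lab m = {}\<rbrakk> \<Longrightarrow>
        tensor_quot K R M N \<star> (m \<bowtie> (snd N \<star> (a \<bowtie> n))) = tensor_quot K R M N \<star> ((snd M \<star> (a \<bowtie> m)) \<bowtie> n)"
    by (rule c(4))
qed

text \<open>The factorization of a balanced \<open>g\<close> is the explicit composite
  \<open>g \<cdot> tsec\<close>. All maps out of relative tensor products below are built in this
  form and computed on pure tensors by this rule.\<close>

lemma lift_el:
  assumes g: "g \<in> arr K" "src K g = fst M \<odot> fst N"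
    and e: "gen m" "gen n" "ty m = fst M" "ty n = fst N" "0 \<notin> lab m"
    and b: "g \<star> ((snd M \<star> (V 0 (car R) \<bowtie> m)) \<bowtie> n) = g \<star> (m \<bowtie> (snd N \<star> (V 0 (car R) \<bowtie> n)))"
    and t: "el t" "ty t = fst M \<odot> fst N"
  shows "(g \<cdot> tsec) \<star> tensor_quot K R M N \<star> t = g \<star> t"
proof -
  note s = RMN_simps tpi_simps tensor_quot_simps
  have "(g \<cdot> tsec) \<star> tensor_quot K R M N \<star> t = (g \<cdot> (tsec \<cdot> tensor_quot K R M N)) \<star> t"
    using s g t by simp
  also have "\<dots> = g \<star> t"
    unfolding tsec_quot using tpi_lift[OF g e b] by simp
  finally show ?thesis .
qed

lemma lift_el_l:
  assumes w: "w \<in> obj K" and g: "g \<in> arr K" "src K g = w \<odot> (fst M \<odot> fst N)"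
    and e: "gen u" "gen m" "gen n" "ty u = w" "ty m = fst M" "ty n = fst N" "0 \<notin> lab m"
    and b: "g \<star> (u \<bowtie> ((snd M \<star> (V 0 (car R) \<bowtie> m)) \<bowtie> n)) = g \<star> (u \<bowtie> (m \<bowtie> (snd N \<star> (V 0 (car R) \<bowtie> n))))"
    and t: "el v" "ty v = w" "el t" "ty t = fst M \<odot> fst N"
  shows "(g \<cdot> (one w \<otimes> tsec)) \<star> (v \<bowtie> (tensor_quot K R M N \<star> t)) = g \<star> (v \<bowtie> t)"
proof -
  have o: "fst M \<in> obj K" "fst N \<in> obj K" using RMN_simps by simp_all
  note s = o tpi_simps tensor_quot_simps(1-5)
  have 1: "tsec \<star> tensor_quot K R M N \<star> t = tpi R M N \<star> t"
    using arg_cong[OF tsec_quot, of "\<lambda>f. f \<star> t"] s t(3,4) by simp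
  have "(g \<cdot> (one w \<otimes> tsec)) \<star> (v \<bowtie> (tensor_quot K R M N \<star> t)) = g \<star> (v \<bowtie> (tsec \<star> tensor_quot K R M N \<star> t))"
    using s g t w by simp
  also have "\<dots> = (g \<cdot> (one w \<otimes> tpi R M N)) \<star> (v \<bowtie> t)"
    unfolding 1 using s g t w by simp
  also have "\<dots> = g \<star> (v \<bowtie> t)"
    unfolding tpi_lift_l[OF w g e b] ..
  finally show ?thesis .
qed

lemma lift_el_r:
  assumes w: "w \<in> obj K" and g: "g \<in> arr K" "src K g = (fst M \<odot> fst N) \<odot> w"
    and e: "gen u" "gen m" "gen n" "ty u = w" "ty m = fst M" "ty n = fst N" "0 \<notin> lab m"
    and b: "g \<star> (((snd M \<star> (V 0 (car R) \<bowtie> m)) \<bowtie> n) \<bowtie> u) = g \<star> ((m \<bowtie> (snd N \<star> (V 0 (car R) \<bowtie> n))) \<bowtie> u)"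
    and t: "el v" "ty v = w" "el t" "ty t = fst M \<odot> fst N"
  shows "(g \<cdot> (tsec \<otimes> one w)) \<star> ((tensor_quot K R M N \<star> t) \<bowtie> v) = g \<star> (t \<bowtie> v)"
proof -
  have o: "fst M \<in> obj K" "fst N \<in> obj K" using RMN_simps by simp_all
  note s = o tpi_simps tensor_quot_simps(1-5)
  have 1: "tsec \<star> tensor_quot K R M N \<star> t = tpi R M N \<star> t"
    using arg_cong[OF tsec_quot, of "\<lambda>f. f \<star> t"] s t(3,4) by simp
  have "(g \<cdot> (tsec \<otimes> one w)) \<star> ((tensor_quot K R M N \<star> t) \<bowtie> v) = g \<star> ((tsec \<star> tensor_quot K R M N \<star> t) \<bowtie> v)"
    using s g t w by simp
  also have "\<dots> = (g \<cdot> (tpi R M N \<otimes> one w)) \<star> (t \<bowtie> v)"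
    unfolding 1 using s g t w by simp
  also have "\<dots> = g \<star> (t \<bowtie> v)"
    unfolding tpi_lift_r[OF w g e b] ..
  finally show ?thesis .
qed

end

lemma factor_through_eq:
  assumes "split_epi e" "h \<in> arr K" "src K h = tgt K e" "h \<cdot> e = f"
  shows "factor_through K e f = h"
  unfolding factor_through_def
proof (rule the_equality)
  have e: "e \<in> arr K" using assms by (simp add: split_epi_def)
  show "h \<in> hom K (tgt K e) (tgt K f) \<and> h \<cdot> e = f"
    using assms(2,3) e by (simp add: hom_def assms(4)[symmetric])
  fix k assume k: "k \<in> hom K (tgt K e) (tgt K f) \<and> k \<cdot> e = f"
  note kd = homD[OF conjunct1[OF k]]
  show "k = h"
  proof (rule split_epi_cancel[OF assms(1)])
    show "k \<cdot> e = h \<cdot> e" using k assms(4) by (simp only:)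
  qed (use kd assms(2,3) in simp_all)
qed

text \<open>The \<open>B\<close>-module \<open>M \<otimes>\<^sub>R N\<close> for a \<open>B\<close>-module \<open>M\<close>, an \<open>R\<close>-module \<open>N\<close> and \<open>f\<close> from \<open>R\<close> to \<open>B\<close>.\<close>

definition tens_over :: "('o, 'm) ring_ob \<Rightarrow> ('o, 'm) ring_ob \<Rightarrow> 'm \<Rightarrow> 'o \<times> 'm \<Rightarrow> 'o \<times> 'm \<Rightarrow> 'o \<times> 'm" where
  "tens_over R B f M N = (tgt K (tensor_quot K R (restr f M) N),
    factor_through K (one (car B) \<otimes> tensor_quot K R (restr f M) N)
       (tensor_quot K R (restr f M) N \<cdot> (snd M \<otimes> one (fst N))
          \<cdot> inv (\<alpha> (car B) (fst M) (fst N))))"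

lemma extend_scalars_tens_over: "extend_scalars K R B f N = tens_over R B f (car B, mul B) N"
  by (simp add: extend_scalars_def tens_over_def restricted_module_restr Let_def)

lemma module_tensor_tens_over:
  "\<lbrakk>M \<in> modules K A; ring_object K A\<rbrakk> \<Longrightarrow> module_tensor K A M N = tens_over A A (one (car A)) M N"
  by (simp add: module_tensor_def tens_over_def restr_idn)

abbreviation tq :: "('o, 'm) ring_ob \<Rightarrow> 'm \<Rightarrow> 'o \<times> 'm \<Rightarrow> 'o \<times> 'm \<Rightarrow> 'm" where
  "tq R f M N \<equiv> tensor_quot K R (restr f M) N"

abbreviation ts :: "('o, 'm) ring_ob \<Rightarrow> 'm \<Rightarrow> 'o \<times> 'm \<Rightarrow> 'o \<times> 'm \<Rightarrow> 'm" where
  "ts R f M N \<equiv> tsec R (restr f M) N"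

context
  fixes R B f M N
  assumes R: "tt_ring K R" and B: "tt_ring K B" and f: "f \<in> ring_homs K R B"
    and M: "M \<in> modules K B" and N: "N \<in> modules K R"
begin

lemmas RBMN_simps = tt_ringD[OF R] tt_ringD[OF B] modules_simps[OF M] modules_simps[OF N] ring_homs_simps[OF f]

lemma restr_M: "restr f M \<in> modules K R"
  using restr_module[OF f M] R B by (simp add: tt_ringD)

lemma tq_simps:
  "tq R f M N \<in> arr K" "src K (tq R f M N) = fst M \<odot> fst N" "tgt K (tq R f M N) = fst (tens_over R B f M N)"
  "ts R f M N \<in> arr K" "src K (ts R f M N) = fst (tens_over R B f M N)" "tgt K (ts R f M N) = fst M \<odot> fst N"
  "tq R f M N \<cdot> ts R f M N = one (fst (tens_over R B f M N))"
  "split_epi (tq R f M N)" "fst (tens_over R B f M N) \<in> obj K"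
  using tensor_quot_simps[OF R restr_M N] by (auto simp: tens_over_def)

lemma tq_balanced:
  "\<lbrakk>el a; el m; el n; ty a = car R; ty m = fst M; ty n = fst N; lab a \<inter> lab m = {}\<rbrakk> \<Longrightarrow>
        tq R f M N \<star> (m \<bowtie> (snd N \<star> (a \<bowtie> n))) = tq R f M N \<star> ((snd M \<star> ((f \<star> a) \<bowtie> m)) \<bowtie> n)"
  using tensor_quot_balanced[OF R restr_M N, of a m n] RBMN_simps by (simp add: restr_act[OF f M])

lemma tq_lift:
  assumes g: "g \<in> arr K" "src K g = fst M \<odot> fst N"
    and e: "gen m" "gen n" "ty m = fst M" "ty n = fst N" "0 \<notin> lab m"
    and b: "g \<star> ((snd M \<star> ((f \<star> V 0 (car R)) \<bowtie> m)) \<bowtie> n) = g \<star> (m \<bowtie> (snd N \<star> (V 0 (car R) \<bowtie> n)))"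
    and t: "el t" "ty t = fst M \<odot> fst N"
  shows "(g \<cdot> ts R f M N) \<star> tq R f M N \<star> t = g \<star> t"
  by (rule lift_el[OF R restr_M N, where m=m and n=n]) (use g e b t RBMN_simps gen_el[OF e(1)] in \<open>simp_all add: restr_act[OF f M]\<close>)

lemma tq_lift_l:
  assumes w: "w \<in> obj K" and g: "g \<in> arr K" "src K g = w \<odot> (fst M \<odot> fst N)"
    and e: "gen u" "gen m" "gen n" "ty u = w" "ty m = fst M" "ty n = fst N" "0 \<notin> lab m"
    and b: "g \<star> (u \<bowtie> ((snd M \<star> ((f \<star> V 0 (car R)) \<bowtie> m)) \<bowtie> n)) = g \<star> (u \<bowtie> (m \<bowtie> (snd N \<star> (V 0 (car R) \<bowtie> n))))"
    and t: "el v" "ty v = w" "el t" "ty t = fst M \<odot> fst N"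
  shows "(g \<cdot> (one w \<otimes> ts R f M N)) \<star> (v \<bowtie> (tq R f M N \<star> t)) = g \<star> (v \<bowtie> t)"
  by (rule lift_el_l[OF R restr_M N w, where u=u and m=m and n=n]) (use g e b t RBMN_simps gen_el[OF e(2)] in \<open>simp_all add: restr_act[OF f M]\<close>)

lemma tq_lift_r:
  assumes w: "w \<in> obj K" and g: "g \<in> arr K" "src K g = (fst M \<odot> fst N) \<odot> w"
    and e: "gen u" "gen m" "gen n" "ty u = w" "ty m = fst M" "ty n = fst N" "0 \<notin> lab m"
    and b: "g \<star> (((snd M \<star> ((f \<star> V 0 (car R)) \<bowtie> m)) \<bowtie> n) \<bowtie> u) = g \<star> ((m \<bowtie> (snd N \<star> (V 0 (car R) \<bowtie> n))) \<bowtie> u)"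
    and t: "el v" "ty v = w" "el t" "ty t = fst M \<odot> fst N"
  shows "(g \<cdot> (ts R f M N \<otimes> one w)) \<star> ((tq R f M N \<star> t) \<bowtie> v) = g \<star> (t \<bowtie> v)"
  by (rule lift_el_r[OF R restr_M N w, where u=u and m=m and n=n]) (use g e b t RBMN_simps gen_el[OF e(2)] in \<open>simp_all add: restr_act[OF f M]\<close>)

text \<open>Acting by b on the first factor respects the relations over R because B is commutative.
  This gives the factorization to which the \<open>factor_through\<close> in the definition must be
  equal.\<close>

lemma tens_over_act_arr:
  "snd (tens_over R B f M N) \<in> arr K \<and> src K (snd (tens_over R B f M N)) = car B \<odot> fst (tens_over R B f M N) \<and>
   tgt K (snd (tens_over R B f M N)) = fst (tens_over R B f M N) \<and>
   snd (tens_over R B f M N) \<cdot> (one (car B) \<otimes> tq R f M N) =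
     tq R f M N \<cdot> (snd M \<otimes> one (fst N)) \<cdot> inv (\<alpha> (car B) (fst M) (fst N))"
proof -
  note s = RBMN_simps tq_simps
  let ?b = "car B" and ?m = "fst M" and ?n = "fst N"
  define g where "g = tq R f M N \<cdot> (snd M \<otimes> one ?n) \<cdot> inv (\<alpha> ?b ?m ?n)"
  have g: "g \<in> arr K" "src K g = ?b \<odot> (?m \<odot> ?n)" "tgt K g = fst (tens_over R B f M N)"
    using s by (simp_all add: g_def)
  have ge: "g \<star> (b \<bowtie> (m \<bowtie> n)) = tq R f M N \<star> ((snd M \<star> (b \<bowtie> m)) \<bowtie> n)"
    if "el b" "el m" "el n" "ty b = ?b" "ty m = ?m" "ty n = ?n" for b m n
    using s that by (simp add: g_def ap_simps)
  define h where "h = g \<cdot> (one ?b \<otimes> ts R f M N)"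
  have h: "h \<in> arr K" "src K h = ?b \<odot> fst (tens_over R B f M N)" "tgt K h = fst (tens_over R B f M N)"
    using s g by (simp_all add: h_def)
  have "h \<cdot> (one ?b \<otimes> tq R f M N) = g"
  proof (rule gen_eqI[of "V 1 ?b \<bowtie> (V 2 ?m \<bowtie> V 3 ?n)"])
    show "(h \<cdot> (one ?b \<otimes> tq R f M N)) \<star> (V 1 ?b \<bowtie> (V 2 ?m \<bowtie> V 3 ?n)) = g \<star> (V 1 ?b \<bowtie> (V 2 ?m \<bowtie> V 3 ?n))"
      using s g h tq_lift_l[of ?b g "V 1 ?b" "V 2 ?m" "V 3 ?n" "V 1 ?b" "V 2 ?m \<bowtie> V 3 ?n", folded h_def]
      by (simp add: ge tq_balanced act_act[OF M] mul_comm)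
  qed (use s g h in simp_all)
  moreover have "split_epi (one ?b \<otimes> tq R f M N)" using s by simp
  ultimately have "snd (tens_over R B f M N) = h"
    unfolding tens_over_def snd_conv
    using h s by (intro factor_through_eq) (simp_all add: g_def)
  with h \<open>h \<cdot> (one ?b \<otimes> tq R f M N) = g\<close> show ?thesis by (simp add: g_def)
qed

lemma tens_over_simps:
  "snd (tens_over R B f M N) \<in> arr K" "src K (snd (tens_over R B f M N)) = car B \<odot> fst (tens_over R B f M N)"
   "tgt K (snd (tens_over R B f M N)) = fst (tens_over R B f M N)"
  using tens_over_act_arr by blast+

lemma tens_over_act:
  assumes "el b" "el m" "el n" "ty b = car B" "ty m = fst M" "ty n = fst N"
  shows "snd (tens_over R B f M N) \<star> (b \<bowtie> (tq R f M N \<star> (m \<bowtie> n))) = tq R f M N \<star> ((snd M \<star> (b \<bowtie> m)) \<bowtie> n)"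
proof -
  have "snd (tens_over R B f M N) \<cdot> (one (car B) \<otimes> tq R f M N) =
     tq R f M N \<cdot> (snd M \<otimes> one (fst N)) \<cdot> inv (\<alpha> (car B) (fst M) (fst N))"
    using tens_over_act_arr by blast
  from arg_cong[OF this, of "\<lambda>f. f \<star> (b \<bowtie> (m \<bowtie> n))"] show ?thesis
    using RBMN_simps tq_simps tens_over_simps assms by (simp add: ap_simps)
qed

lemma tens_over_module: "tens_over R B f M N \<in> modules K B"
proof -
  note s = RBMN_simps tq_simps tens_over_simps
  have "(fst (tens_over R B f M N), snd (tens_over R B f M N)) \<in> modules K B"
    by (rule modulesI[of _ _ _ "tq R f M N \<star> (V 2 (fst M) \<bowtie> V 3 (fst N))"])
      (use s in \<open>simp_all add: tens_over_act act_act[OF M] act_uni[OF M]\<close>)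
  then show ?thesis by simp
qed

end

end

section \<open>Functoriality, unit, symmetry and associativity of the relative tensor
  product\<close>

section \<open>Functoriality of the tensor product\<close>

context tt_category
begin

text \<open>Only the existence of maps is recorded, since thick ideals see no more than
  that.\<close>

definition retr :: "('o, 'm) ring_ob \<Rightarrow> 'o \<times> 'm \<Rightarrow> 'o \<times> 'm \<Rightarrow> bool" where
  "retr A X Y \<longleftrightarrow> X \<in> modules K A \<and> Y \<in> modules K A \<and>
     (\<exists>i \<in> module_homs K A X Y. \<exists>r \<in> module_homs K A Y X. r \<cdot> i = one (fst X))"

definition miso :: "('o, 'm) ring_ob \<Rightarrow> 'o \<times> 'm \<Rightarrow> 'o \<times> 'm \<Rightarrow> bool" where
  "miso A X Y \<longleftrightarrow> X \<in> modules K A \<and> Y \<in> modules K A \<and>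
     (\<exists>i \<in> module_homs K A X Y. \<exists>r \<in> module_homs K A Y X. r \<cdot> i = one (fst X) \<and> i \<cdot> r = one (fst Y))"

lemma miso_retr: "miso A X Y \<Longrightarrow> retr A X Y" "miso A X Y \<Longrightarrow> retr A Y X"
  unfolding miso_def retr_def by blast+

lemma retr_modules: "retr A X Y \<Longrightarrow> X \<in> modules K A" "retr A X Y \<Longrightarrow> Y \<in> modules K A"
  unfolding retr_def by blast+

lemma module_homs_cmp:
  assumes f: "f \<in> module_homs K A X Y" and g: "g \<in> module_homs K A Y Z"
    and m: "X \<in> modules K A" "Y \<in> modules K A" "Z \<in> modules K A" "ring_object K A"
  shows "g \<cdot> f \<in> module_homs K A X Z"
  by (rule module_homsI[of _ _ _ _ "V 1 (fst X)"])
    (use m module_homs_simps[OF f] module_homs_simps[OF g] modules_simps[OF m(1)]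
     in \<open>simp_all add: linear_el[OF f] linear_el[OF g]\<close>)

lemma module_homs_idn:
  assumes "X \<in> modules K A" "ring_object K A"
  shows "one (fst X) \<in> module_homs K A X X"
  by (rule module_homsI[of _ _ _ _ "V 1 (fst X)"]) (use assms modules_simps[OF assms(1)] in simp_all)

lemma retr_refl: "X \<in> modules K A \<Longrightarrow> ring_object K A \<Longrightarrow> retr A X X"
  unfolding retr_def using module_homs_idn[of X A] modules_simps[of X A]
  by (metis arr_idn cmp_idn_r src_idn)

lemma retr_trans:
  assumes "retr A X Y" "retr A Y Z" "ring_object K A"
  shows "retr A X Z"
proof -
  obtain i r where 1: "X \<in> modules K A" "Y \<in> modules K A" "i \<in> module_homs K A X Y"
    "r \<in> module_homs K A Y X" "r \<cdot> i = one (fst X)"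
    using assms(1) unfolding retr_def by blast
  obtain j s where 2: "Z \<in> modules K A" "j \<in> module_homs K A Y Z"
    "s \<in> module_homs K A Z Y" "s \<cdot> j = one (fst Y)"
    using assms(2) unfolding retr_def by blast
  note s = module_homs_simps[OF 1(3)] module_homs_simps[OF 1(4)] module_homs_simps[OF 2(2)] module_homs_simps[OF 2(3)]
  have "(r \<cdot> s) \<cdot> (j \<cdot> i) = r \<cdot> ((s \<cdot> j) \<cdot> i)"
    using s by (simp add: cmp_ass)
  also have "\<dots> = one (fst X)" unfolding 2(4) using s 1(5) by simp
  finally show ?thesis
    unfolding retr_def using 1 2 assms(3)
    by (blast intro: module_homs_cmp)
qed

lemma retr_restr:
  assumes "retr B X Y" "f \<in> ring_homs K R B" "ring_object K R" "ring_object K B"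
  shows "retr R (restr f X) (restr f Y)"
  using assms unfolding retr_def
  by (metis fst_restr restr_homs restr_module)

context
  fixes R B f M N M' N' h g
  assumes R: "tt_ring K R" and B: "tt_ring K B" and f: "f \<in> ring_homs K R B"
    and M: "M \<in> modules K B" and N: "N \<in> modules K R"
    and M': "M' \<in> modules K B" and N': "N' \<in> modules K R"
    and h: "h \<in> module_homs K B M M'" and g: "g \<in> module_homs K R N N'"
begin

definition tmap :: "'m" where
  "tmap = (tq R f M' N' \<cdot> (h \<otimes> g)) \<cdot> ts R f M N"

lemmas tmap_facts = RBMN_simps[OF R B f M N] tq_simps[OF R B f M N] tens_over_simps[OF R B f M N]
  RBMN_simps[OF R B f M' N'] tq_simps[OF R B f M' N'] tens_over_simps[OF R B f M' N']
  module_homs_simps[OF h] module_homs_simps[OF g]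

lemma tmap_simps: "tmap \<in> arr K" "src K tmap = fst (tens_over R B f M N)"
    "tgt K tmap = fst (tens_over R B f M' N')"
  using tmap_facts by (simp_all add: tmap_def)

lemma tmap_quot:
  assumes "el t" "ty t = fst M \<odot> fst N"
  shows "tmap \<star> tq R f M N \<star> t = tq R f M' N' \<star> (h \<otimes> g) \<star> t"
proof -
  note s = tmap_facts
  have "tmap \<star> tq R f M N \<star> t = (tq R f M' N' \<cdot> (h \<otimes> g)) \<star> t"
    unfolding tmap_def
    by (rule tq_lift[OF R B f M N _ _, of _ "V 1 (fst M)" "V 2 (fst N)"])
      (use assms s in \<open>simp_all add: tq_balanced[OF R B f M' N'] linear_el[OF h M M'] linear_el[OF g N N']\<close>)
  then show ?thesis using assms s by simp
qed

lemma tmap_hom: "tmap \<in> module_homs K B (tens_over R B f M N) (tens_over R B f M' N')"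
  by (rule module_homsI[of _ _ _ _ "tq R f M N \<star> (V 1 (fst M) \<bowtie> V 2 (fst N))"])
    (use tmap_facts tmap_simps tens_over_module[OF R B f M N] tens_over_module[OF R B f M' N'] in
     \<open>simp_all add: tens_over_act[OF R B f M N] tens_over_act[OF R B f M' N'] tmap_quot linear_el[OF h M M']\<close>)

end

context
  fixes R B f
  assumes R: "tt_ring K R" and B: "tt_ring K B" and f: "f \<in> ring_homs K R B"
begin

lemma retr_tens_over:
  assumes r: "retr B M M'" "retr R N N'"
  shows "retr B (tens_over R B f M N) (tens_over R B f M' N')"
proof -
  obtain i r where 1: "M \<in> modules K B" "M' \<in> modules K B" "i \<in> module_homs K B M M'"
    "r \<in> module_homs K B M' M" "r \<cdot> i = one (fst M)"
    using r(1) unfolding retr_def by blast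
  obtain j s where 2: "N \<in> modules K R" "N' \<in> modules K R" "j \<in> module_homs K R N N'"
    "s \<in> module_homs K R N' N" "s \<cdot> j = one (fst N)"
    using r(2) unfolding retr_def by blast
  note a = R B f 1(1) 2(1) 1(2) 2(2) 1(3) 2(3) and b = R B f 1(2) 2(2) 1(1) 2(1) 1(4) 2(4)
  let ?i = "tmap R f M N M' N' i j" and ?r = "tmap R f M' N' M N r s"
  note z = tmap_facts[OF a] tmap_simps[OF a] tmap_simps[OF b] module_homs_simps[OF 1(4)] module_homs_simps[OF 2(4)]
  have "(r \<otimes> s) \<cdot> (i \<otimes> j) = one (fst M \<odot> fst N)" using z 1(5) 2(5) by (simp add: tens_cmp)
  from arg_cong[OF this, of "\<lambda>f. f \<star> (V 1 (fst M) \<bowtie> V 2 (fst N))"]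
  have e: "(r \<star> i \<star> V 1 (fst M)) \<bowtie> (s \<star> j \<star> V 2 (fst N)) = V 1 (fst M) \<bowtie> V 2 (fst N)"
    using z by simp
  have "?r \<cdot> ?i = one (fst (tens_over R B f M N))"
    by (rule gen_eqI[of "tq R f M N \<star> (V 1 (fst M) \<bowtie> V 2 (fst N))"])
      (use z e in \<open>simp_all add: tmap_quot[OF a] tmap_quot[OF b]\<close>)
  then show ?thesis
    unfolding retr_def using tmap_hom[OF a] tmap_hom[OF b] tens_over_module[OF R B f 1(1) 2(1)]
      tens_over_module[OF R B f 1(2) 2(2)] by blast
qed

text \<open>The counit from the extension of the restriction of c back to c is the action of B.
  Separability of B provides its linear section, the coaction followed by the quotient map.\<close>

lemma retr_extend:
  assumes c: "c \<in> modules K B"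
  shows "retr B c (tens_over R B f (car B, mul B) (restr f c))"
proof -
  let ?S = "(car B, mul B)" and ?c = "restr f c"
  let ?T = "tens_over R B f ?S ?c"
  have S: "?S \<in> modules K B" using self_module tt_ringD(1)[OF B] .
  have N: "?c \<in> modules K R" using restr_module[OF f c] R B by (simp add: tt_ringD)
  note s = RBMN_simps[OF R B f S N] tq_simps[OF R B f S N] tens_over_simps[OF R B f S N] coact_simps[OF B c]
    modules_simps[OF c]
  define r where "r = snd c \<cdot> ts R f ?S ?c"
  define i where "i = tq R f ?S ?c \<cdot> coact B c"
  have ri: "r \<in> arr K" "src K r = fst ?T" "tgt K r = fst c" "i \<in> arr K" "src K i = fst c" "tgt K i = fst ?T"
    using s by (simp_all add: r_def i_def)
  have re: "r \<star> tq R f ?S ?c \<star> t = snd c \<star> t" if "el t" "ty t = car B \<odot> fst c" for t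
    unfolding r_def
    by (rule tq_lift[OF R B f S N, of _ "V 1 (car B)" "V 2 (fst c)"])
      (use that s R B in \<open>simp_all add: restr_act[OF f c] act_act[OF c] mul_comm tt_ringD\<close>)
  have rh: "r \<in> module_homs K B ?T c"
    by (rule module_homsI[of _ _ _ _ "tq R f ?S ?c \<star> (V 1 (car B) \<bowtie> V 2 (fst c))"])
      (use s ri tens_over_module[OF R B f S N] c B in \<open>simp_all add: tens_over_act[OF R B f S N] re act_act[OF c]\<close>)
  have ih: "i \<in> module_homs K B c ?T"
  proof (rule module_homsI[of _ _ _ _ "V 1 (fst c)"])
    fix b assume b: "gen b" "el b" "ty b = car B" "lab b = {0}"
    \<comment> \<open>A value of the coaction is not a pure tensor, so \<open>tens_over_act\<close>
      does not reach it; the equation of arrows behind that rule is evaluated instead.\<close>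
    have q: "snd ?T \<cdot> (one (car B) \<otimes> tq R f ?S ?c) = tq R f ?S ?c \<cdot> (mul B \<otimes> one (fst c)) \<cdot> inv (\<alpha> (car B) (car B) (fst c))"
      using tens_over_act_arr[OF R B f S N] by simp
    from arg_cong[OF q, of "\<lambda>f. f \<star> (b \<bowtie> (coact B c \<star> V 1 (fst c)))"]
    show "i \<star> snd c \<star> (b \<bowtie> V 1 (fst c)) = snd ?T \<star> (b \<bowtie> (i \<star> V 1 (fst c)))"
      using s b by (simp add: i_def coact_act[OF B c])
  qed (use s ri tens_over_module[OF R B f S N] c B in simp_all)
  have "r \<cdot> i = one (fst c)"
  proof (rule gen_eqI[of "V 1 (fst c)"])
    have "(snd c \<cdot> coact B c) \<star> V 1 (fst c) = V 1 (fst c)"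
      unfolding act_coact[OF B c] using s by simp
    then show "(r \<cdot> i) \<star> V 1 (fst c) = one (fst c) \<star> V 1 (fst c)"
      using s ri by (simp add: re i_def)
  qed (use s ri in simp_all)
  then show ?thesis
    unfolding retr_def using rh ih c tens_over_module[OF R B f S N] by blast
qed

text \<open>The mutually inverse maps are m \<otimes> a -> f(a) m and m -> m \<otimes> 1.\<close>

lemma tens_over_unit:
  assumes M: "M \<in> modules K B"
  shows "miso B (tens_over R B f M (car R, mul R)) M"
proof -
  let ?S = "(car R, mul R)"
  let ?T = "tens_over R B f M ?S"
  have S: "?S \<in> modules K R" using self_module tt_ringD(1)[OF R] .
  note s = RBMN_simps[OF R B f M S] tq_simps[OF R B f M S] tens_over_simps[OF R B f M S]
  define g where "g = snd M \<cdot> ((f \<otimes> one (fst M)) \<cdot> \<beta> (fst M) (car R))"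
  have g: "g \<in> arr K" "src K g = fst M \<odot> car R" "tgt K g = fst M"
    using s by (simp_all add: g_def)
  have ge: "g \<star> (m \<bowtie> a) = snd M \<star> ((f \<star> a) \<bowtie> m)"
    if "el m" "el a" "ty m = fst M" "ty a = car R" "lab a \<inter> lab m = {}" for m a
    using that s by (simp add: g_def ap_simps Int_commute)
  define i where "i = g \<cdot> ts R f M ?S"
  define r where "r = tq R f M ?S \<cdot> ((one (fst M) \<otimes> uni R) \<cdot> inv (ru (fst M)))"
  have ir: "i \<in> arr K" "src K i = fst ?T" "tgt K i = fst M" "r \<in> arr K" "src K r = fst M" "tgt K r = fst ?T"
    using s g by (simp_all add: r_def i_def)
  have re: "r \<star> m = tq R f M ?S \<star> (m \<bowtie> (uni R \<star> u1))" if "el m" "ty m = fst M" for m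
    using that s by (simp add: r_def ap_simps)
  have ie: "i \<star> tq R f M ?S \<star> t = g \<star> t" if "el t" "ty t = fst M \<odot> car R" for t
    unfolding i_def
    by (rule tq_lift[OF R B f M S, of _ "V 1 (fst M)" "V 2 (car R)"])
      (use that s g R B in \<open>simp_all add: ge ring_hom_mul[OF f] act_act[OF M] mul_comm\<close>)
  have ih: "i \<in> module_homs K B ?T M"
    by (rule module_homsI[of _ _ _ _ "tq R f M ?S \<star> (V 1 (fst M) \<bowtie> V 2 (car R))"])
      (use s ir tens_over_module[OF R B f M S] M B in \<open>simp_all add: tens_over_act[OF R B f M S] ie ge act_act[OF M] mul_comm\<close>)
  have rh: "r \<in> module_homs K B M ?T"
    by (rule module_homsI[of _ _ _ _ "V 1 (fst M)"])
      (use s ir tens_over_module[OF R B f M S] M B in \<open>simp_all add: tens_over_act[OF R B f M S] re\<close>)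
  have 1: "i \<cdot> r = one (fst M)"
    by (rule gen_eqI[of "V 1 (fst M)"])
      (use s ir in \<open>simp_all add: ie re ge ring_hom_uni[OF f] act_uni[OF M]\<close>)
  have 2: "r \<cdot> i = one (fst ?T)"
  proof (rule gen_eqI[of "tq R f M ?S \<star> (V 1 (fst M) \<bowtie> V 2 (car R))"])
    have "tq R f M ?S \<star> ((snd M \<star> ((f \<star> V 2 (car R)) \<bowtie> V 1 (fst M))) \<bowtie> (uni R \<star> u1)) =
      tq R f M ?S \<star> (V 1 (fst M) \<bowtie> (mul R \<star> (V 2 (car R) \<bowtie> (uni R \<star> u1))))"
      using tq_balanced[OF R B f M S, of "V 2 (car R)" "V 1 (fst M)" "uni R \<star> u1"] s by simp
    then show "(r \<cdot> i) \<star> tq R f M ?S \<star> (V 1 (fst M) \<bowtie> V 2 (car R)) =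
      one (fst ?T) \<star> tq R f M ?S \<star> (V 1 (fst M) \<bowtie> V 2 (car R))"
      using s ir by (simp add: ie re ge mul_uni_r)
  qed (use s ir in simp_all)
  show ?thesis
    unfolding miso_def using rh ih 1 2 M tens_over_module[OF R B f M S] by blast
qed

text \<open>Strictness: both sides are formed from the same chosen coequalizer.\<close>

lemma restr_tens_over:
  assumes C: "tt_ring K C" and u: "u \<in> ring_homs K B C" and M: "M \<in> modules K C" and N: "N \<in> modules K R"
  shows "restr u (tens_over R C (u \<cdot> f) M N) = tens_over R B f (restr u M) N"
proof -
  have uf: "u \<cdot> f \<in> ring_homs K R C" using ring_homs_cmp[OF f u] R B C by (simp add: tt_ringD)
  have M': "restr u M \<in> modules K B" using restr_module[OF u M] B C by (simp add: tt_ringD)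
  have e: "restr f (restr u M) = restr (u \<cdot> f) M" by (rule restr_restr[OF f u M])
  have q: "tq R f (restr u M) N = tq R (u \<cdot> f) M N" by (simp add: e)
  let ?T = "tens_over R C (u \<cdot> f) M N" and ?S = "tens_over R B f (restr u M) N"
  have fe: "fst ?S = fst ?T" by (simp add: tens_over_def e)
  have T: "?T \<in> modules K C" by (rule tens_over_module[OF R C uf M N])
  note s = RBMN_simps[OF R C uf M N] tq_simps[OF R C uf M N] tens_over_simps[OF R C uf M N]
    tens_over_simps[OF R B f M' N] B ring_homs_simps[OF u] tt_ringD[OF B] modules_simps[OF restr_module[OF u T]]
  have "snd (restr u ?T) = snd ?S"
  proof (rule gen_eqI[of "V 0 (car B) \<bowtie> (tq R (u \<cdot> f) M N \<star> (V 1 (fst M) \<bowtie> V 2 (fst N)))"])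
    show "snd (restr u ?T) \<star> (V 0 (car B) \<bowtie> (tq R (u \<cdot> f) M N \<star> (V 1 (fst M) \<bowtie> V 2 (fst N)))) =
      snd ?S \<star> (V 0 (car B) \<bowtie> (tq R (u \<cdot> f) M N \<star> (V 1 (fst M) \<bowtie> V 2 (fst N))))"
      using s tens_over_act[OF R B f M' N, of "V 0 (car B)" "V 1 (fst M)" "V 2 (fst N)", unfolded q]
      by (simp add: restr_act[OF u T] restr_act[OF u M] tens_over_act[OF R C uf M N])
  qed (use s fe in simp_all)
  then show ?thesis using fe by (simp add: prod_eq_iff)
qed

end

lemma tens_over_comm:
  assumes A: "tt_ring K A" and M: "M \<in> modules K A" and N: "N \<in> modules K A"
  shows "miso A (tens_over A A (one (car A)) M N) (tens_over A A (one (car A)) N M)"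
proof -
  let ?o = "one (car A)"
  let ?T = "\<lambda>M N. tens_over A A ?o M N" and ?q = "\<lambda>M N. tq A ?o M N"
  have f: "?o \<in> ring_homs K A A" using ring_homs_idn tt_ringD(1)[OF A] .
  define c where "c M N = (?q N M \<cdot> \<beta> (fst M) (fst N)) \<cdot> ts A ?o M N" for M N
  have main: "c M N \<in> module_homs K A (?T M N) (?T N M) \<and>
      (\<forall>m n. el m \<longrightarrow> el n \<longrightarrow> ty m = fst M \<longrightarrow> ty n = fst N \<longrightarrow> lab m \<inter> lab n = {} \<longrightarrow>
         c M N \<star> ?q M N \<star> (m \<bowtie> n) = ?q N M \<star> (n \<bowtie> m))"
    if M: "M \<in> modules K A" and N: "N \<in> modules K A" for M N
  proof -
    note s = RBMN_simps[OF A A f M N] tq_simps[OF A A f M N] tens_over_simps[OF A A f M N]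
       tq_simps[OF A A f N M] tens_over_simps[OF A A f N M]
    have c: "c M N \<in> arr K" "src K (c M N) = fst (?T M N)" "tgt K (c M N) = fst (?T N M)"
      using s by (simp_all add: c_def)
    have e: "c M N \<star> ?q M N \<star> (m \<bowtie> n) = ?q N M \<star> (n \<bowtie> m)"
      if "el m" "el n" "ty m = fst M" "ty n = fst N" "lab m \<inter> lab n = {}" for m n
    proof -
      have "c M N \<star> ?q M N \<star> (m \<bowtie> n) = (?q N M \<cdot> \<beta> (fst M) (fst N)) \<star> (m \<bowtie> n)"
        unfolding c_def
        by (rule tq_lift[OF A A f M N, of _ "V 1 (fst M)" "V 2 (fst N)"])
          (use that s in \<open>simp_all add: ap_simps tq_balanced[OF A A f N M]\<close>)
      then show ?thesis using that s by (simp add: ap_simps)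
    qed
    have "c M N \<in> module_homs K A (?T M N) (?T N M)"
    proof (rule module_homsI[of _ _ _ _ "?q M N \<star> (V 1 (fst M) \<bowtie> V 2 (fst N))"])
      fix a assume a: "gen a" "el a" "ty a = car A" "lab a = {0}"
      show "c M N \<star> snd (?T M N) \<star> (a \<bowtie> (?q M N \<star> (V 1 (fst M) \<bowtie> V 2 (fst N)))) =
        snd (?T N M) \<star> (a \<bowtie> (c M N \<star> ?q M N \<star> (V 1 (fst M) \<bowtie> V 2 (fst N))))"
        using s a tq_balanced[OF A A f N M, of a "V 2 (fst N)" "V 1 (fst M)"]
        by (simp add: e tens_over_act[OF A A f M N] tens_over_act[OF A A f N M])
    qed (use s c tens_over_module[OF A A f M N] tens_over_module[OF A A f N M] in simp_all)
    with e show ?thesis by blast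
  qed
  note mn = main[OF M N, THEN conjunct1] main[OF M N, THEN conjunct2, rule_format]
    main[OF N M, THEN conjunct1] main[OF N M, THEN conjunct2, rule_format]
  note s = RBMN_simps[OF A A f M N] tq_simps[OF A A f M N] tens_over_simps[OF A A f M N]
       tq_simps[OF A A f N M] tens_over_simps[OF A A f N M] module_homs_simps[OF mn(1)] module_homs_simps[OF mn(3)]
  have 1: "c N M \<cdot> c M N = one (fst (?T M N))"
    by (rule gen_eqI[of "?q M N \<star> (V 1 (fst M) \<bowtie> V 2 (fst N))"]) (use s in \<open>simp_all add: mn(2,4)\<close>)
  have 2: "c M N \<cdot> c N M = one (fst (?T N M))"
    by (rule gen_eqI[of "?q N M \<star> (V 1 (fst N) \<bowtie> V 2 (fst M))"]) (use s in \<open>simp_all add: mn(2,4)\<close>)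
  show ?thesis
    unfolding miso_def using mn(1,3) 1 2 tens_over_module[OF A A f M N] tens_over_module[OF A A f N M] by blast
qed

text \<open>Three rings are allowed so that one statement covers associativity over one ring,
  compatibility of extension with tensor products, the projection formula and transitivity of
  extension.\<close>

lemma tens_over_assoc:
  assumes R: "tt_ring K R" and B: "tt_ring K B" and C: "tt_ring K C"
    and g: "g \<in> ring_homs K R B" and h: "h \<in> ring_homs K B C"
    and M: "M \<in> modules K C" and L: "L \<in> modules K B" and N: "N \<in> modules K R"
  shows "miso C (tens_over B C h M (tens_over R B g L N)) (tens_over R C (h \<cdot> g) (tens_over B C h M L) N)"
proof -
  let ?T2 = "tens_over R B g L N" and ?T3 = "tens_over B C h M L"
  let ?T1 = "tens_over B C h M ?T2" and ?T4 = "tens_over R C (h \<cdot> g) ?T3 N"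
  have hg: "h \<cdot> g \<in> ring_homs K R C" using ring_homs_cmp[OF g h] R B C by (simp add: tt_ringD)
  have T2: "?T2 \<in> modules K B" by (rule tens_over_module[OF R B g L N])
  have T3: "?T3 \<in> modules K C" by (rule tens_over_module[OF B C h M L])
  note c1 = B C h M T2 and c2 = R B g L N and c3 = B C h M L and c4 = R C hg T3 N
  let ?q1 = "tq B h M ?T2" and ?q2 = "tq R g L N" and ?q3 = "tq B h M L" and ?q4 = "tq R (h \<cdot> g) ?T3 N"
  let ?m = "fst M" and ?l = "fst L" and ?n = "fst N"
  note s = RBMN_simps[OF c3] RBMN_simps[OF c2] tq_simps[OF c1] tq_simps[OF c2] tq_simps[OF c3] tq_simps[OF c4]
    tens_over_simps[OF c1] tens_over_simps[OF c2] tens_over_simps[OF c3] tens_over_simps[OF c4]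
  \<comment> \<open>The rebracketing m \<otimes> (l \<otimes> n) -> (m \<otimes> l) \<otimes> n
    descends in two stages, over R inside the second factor (\<open>k1\<close>) and then over B
    (\<open>\<phi>\<close>).\<close>
  define k0 where "k0 = ?q4 \<cdot> ((?q3 \<otimes> one ?n) \<cdot> inv (\<alpha> ?m ?l ?n))"
  have k0: "k0 \<in> arr K" "src K k0 = ?m \<odot> (?l \<odot> ?n)" "tgt K k0 = fst ?T4"
    by (simp_all add: k0_def s)
  have k0e: "k0 \<star> (m \<bowtie> (l \<bowtie> n)) = ?q4 \<star> ((?q3 \<star> (m \<bowtie> l)) \<bowtie> n)"
    if "el m" "el l" "el n" "ty m = ?m" "ty l = ?l" "ty n = ?n" for m l n
    using that by (simp add: k0_def s ap_simps)
  define k1 where "k1 = k0 \<cdot> (one ?m \<otimes> ts R g L N)"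
  have k1: "k1 \<in> arr K" "src K k1 = ?m \<odot> fst ?T2" "tgt K k1 = fst ?T4"
    by (simp_all add: k1_def k0 s)
  have k1e: "k1 \<star> (v \<bowtie> (?q2 \<star> t)) = k0 \<star> (v \<bowtie> t)" if "el v" "ty v = ?m" "el t" "ty t = ?l \<odot> ?n" for v t
    unfolding k1_def
    by (rule tq_lift_l[OF c2, where u = "V 1 ?m" and m = "V 2 ?l" and n = "V 3 ?n"])
      (simp_all add: s that k0 k0e tq_balanced[OF c3] tq_balanced[OF c4] tens_over_act[OF c3])
  define \<phi> where "\<phi> = k1 \<cdot> ts B h M ?T2"
  have p: "\<phi> \<in> arr K" "src K \<phi> = fst ?T1" "tgt K \<phi> = fst ?T4"
    by (simp_all add: \<phi>_def k1 s)
  have pe: "\<phi> \<star> ?q1 \<star> t = k1 \<star> t" if "el t" "ty t = ?m \<odot> fst ?T2" for t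
    unfolding \<phi>_def
    by (rule tq_lift[OF c1, where m = "V 1 ?m" and n = "?q2 \<star> (V 2 ?l \<bowtie> V 3 ?n)"])
      (simp_all add: s that k1 k1e k0e tens_over_act[OF c2] tq_balanced[OF c3])
  have p1: "\<phi> \<star> ?q1 \<star> (m \<bowtie> (?q2 \<star> (l \<bowtie> n))) = ?q4 \<star> ((?q3 \<star> (m \<bowtie> l)) \<bowtie> n)"
    if "el m" "el l" "el n" "ty m = ?m" "ty l = ?l" "ty n = ?n" for m l n
    using that by (simp add: pe s k1e k0e)
  \<comment> \<open>The inverse rebracketing, descending in the other order: over B inside the first
    factor (\<open>j1\<close>), then over R (\<open>\<psi>\<close>).\<close>
  define j0 where "j0 = ?q1 \<cdot> ((one ?m \<otimes> ?q2) \<cdot> \<alpha> ?m ?l ?n)"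
  have j0: "j0 \<in> arr K" "src K j0 = (?m \<odot> ?l) \<odot> ?n" "tgt K j0 = fst ?T1"
    by (simp_all add: j0_def s)
  have j0e: "j0 \<star> ((m \<bowtie> l) \<bowtie> n) = ?q1 \<star> (m \<bowtie> (?q2 \<star> (l \<bowtie> n)))"
    if "el m" "el l" "el n" "ty m = ?m" "ty l = ?l" "ty n = ?n" for m l n
    using that by (simp add: j0_def s ap_simps)
  define j1 where "j1 = j0 \<cdot> (ts B h M L \<otimes> one ?n)"
  have j1: "j1 \<in> arr K" "src K j1 = fst ?T3 \<odot> ?n" "tgt K j1 = fst ?T1"
    by (simp_all add: j1_def j0 s)
  have bal: "?q1 \<star> (m \<bowtie> (?q2 \<star> ((snd L \<star> (b \<bowtie> l)) \<bowtie> n))) = ?q1 \<star> ((snd M \<star> ((h \<star> b) \<bowtie> m)) \<bowtie> (?q2 \<star> (l \<bowtie> n)))"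
    if "el m" "el l" "el n" "ty m = ?m" "ty l = ?l" "ty n = ?n" "el b" "ty b = car B" "lab b \<inter> lab m = {}" for m l n b
    using tq_balanced[OF c1, of b m "?q2 \<star> (l \<bowtie> n)"] that by (simp add: s tens_over_act[OF c2])
  have j1e: "j1 \<star> ((?q3 \<star> t) \<bowtie> v) = j0 \<star> (t \<bowtie> v)" if "el v" "ty v = ?n" "el t" "ty t = ?m \<odot> ?l" for v t
    unfolding j1_def
    by (rule tq_lift_r[OF c3, where u = "V 3 ?n" and m = "V 1 ?m" and n = "V 2 ?l"])
      (simp_all add: s that j0 j0e bal)
  define \<psi> where "\<psi> = j1 \<cdot> ts R (h \<cdot> g) ?T3 N"
  have r: "\<psi> \<in> arr K" "src K \<psi> = fst ?T4" "tgt K \<psi> = fst ?T1"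
    by (simp_all add: \<psi>_def j1 s)
  have re: "\<psi> \<star> ?q4 \<star> t = j1 \<star> t" if "el t" "ty t = fst ?T3 \<odot> ?n" for t
    unfolding \<psi>_def
    by (rule tq_lift[OF c4, where m = "?q3 \<star> (V 1 ?m \<bowtie> V 2 ?l)" and n = "V 3 ?n"])
      (simp_all add: s that j1 j1e j0e tens_over_act[OF c3] tq_balanced[OF c2] bal)
  have r1: "\<psi> \<star> ?q4 \<star> ((?q3 \<star> (m \<bowtie> l)) \<bowtie> n) = ?q1 \<star> (m \<bowtie> (?q2 \<star> (l \<bowtie> n)))"
    if "el m" "el l" "el n" "ty m = ?m" "ty l = ?l" "ty n = ?n" for m l n
    using that by (simp add: re s j1e j0e)
  let ?t1 = "?q1 \<star> (V 1 ?m \<bowtie> (?q2 \<star> (V 2 ?l \<bowtie> V 3 ?n)))" and ?t4 = "?q4 \<star> ((?q3 \<star> (V 1 ?m \<bowtie> V 2 ?l)) \<bowtie> V 3 ?n)"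
  have m1: "?T1 \<in> modules K C" and m4: "?T4 \<in> modules K C"
    by (rule tens_over_module[OF c1], rule tens_over_module[OF c4])
  have 1: "\<phi> \<in> module_homs K C ?T1 ?T4"
    by (rule module_homsI[OF m1 m4, where m = ?t1])
      (simp_all add: s p p1 tens_over_act[OF c1] tens_over_act[OF c4] tens_over_act[OF c3])
  have 2: "\<psi> \<in> module_homs K C ?T4 ?T1"
    by (rule module_homsI[OF m4 m1, where m = ?t4])
      (simp_all add: s r r1 tens_over_act[OF c1] tens_over_act[OF c4] tens_over_act[OF c3])
  have 3: "\<psi> \<cdot> \<phi> = one (fst ?T1)"
    by (rule gen_eqI[of ?t1]) (simp_all add: s p r p1 r1)
  have 4: "\<phi> \<cdot> \<psi> = one (fst ?T4)"
    by (rule gen_eqI[of ?t4]) (simp_all add: s p r p1 r1)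
  show ?thesis unfolding miso_def using m1 m4 1 2 3 4 by blast
qed

end

section \<open>The tt-ring structure on A \<otimes> B and the two inclusions of A into A \<otimes>
  A\<close>

section \<open>The tensor product of two rings\<close>

context symmetric_monoidal_category
begin

lemma ring_objectI_gen:
  assumes o: "car A \<in> obj K" "mul A \<in> arr K" "src K (mul A) = car A \<odot> car A" "tgt K (mul A) = car A"
     "uni A \<in> arr K" "src K (uni A) = \<one>" "tgt K (uni A) = car A"
    and g: "gen a" "gen b" "gen c" "ty a = car A" "ty b = car A" "ty c = car A"
    and a: "mul A \<star> ((mul A \<star> (a \<bowtie> b)) \<bowtie> c) = mul A \<star> (a \<bowtie> (mul A \<star> (b \<bowtie> c)))"
    and l: "mul A \<star> ((uni A \<star> u1) \<bowtie> a) = a"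
    and r: "mul A \<star> (a \<bowtie> (uni A \<star> u1)) = a"
  shows "ring_object K A"
proof -
  note s = o g g(1-3)[THEN gen_el]
  have "mul A \<cdot> (mul A \<otimes> one (car A)) = mul A \<cdot> (one (car A) \<otimes> mul A) \<cdot> \<alpha> (car A) (car A) (car A)"
    by (rule gen_eqI[of "(a \<bowtie> b) \<bowtie> c"]) (simp_all add: s ap_simps a)
  moreover have "mul A \<cdot> (uni A \<otimes> one (car A)) = lu (car A)"
    by (rule gen_eqI[of "u1 \<bowtie> a"]) (simp_all add: s ap_simps l)
  moreover have "mul A \<cdot> (one (car A) \<otimes> uni A) = ru (car A)"
    by (rule gen_eqI[of "a \<bowtie> u1"]) (simp_all add: s ap_simps r)
  ultimately show ?thesis unfolding ring_object_def hom_def using o by blast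
qed

lemma ring_homsI_gen:
  assumes o: "ring_object K A" "ring_object K B" "f \<in> arr K" "src K f = car A" "tgt K f = car B"
    and g: "gen a" "gen b" "ty a = car A" "ty b = car A"
    and m: "f \<star> mul A \<star> (a \<bowtie> b) = mul B \<star> ((f \<star> a) \<bowtie> (f \<star> b))"
    and u: "f \<star> uni A \<star> u1 = uni B \<star> u1"
  shows "f \<in> ring_homs K A B"
proof -
  note s = o g g(1,2)[THEN gen_el]
  have "f \<cdot> mul A = mul B \<cdot> (f \<otimes> f)"
    by (rule gen_eqI[of "a \<bowtie> b"]) (simp_all add: s ap_simps m)
  moreover have "f \<cdot> uni A = uni B"
    by (rule gen_eqI[of u1]) (simp_all add: s ap_simps u)
  ultimately show ?thesis using o by (simp add: ring_homs_def hom_def)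
qed

context
  fixes A B
  assumes A: "ring_object K A" and B: "ring_object K B"
begin

lemma ring_tensor_simps:
  "car (ring_tensor K A B) = car A \<odot> car B"
  "mul (ring_tensor K A B) \<in> arr K" "src K (mul (ring_tensor K A B)) = (car A \<odot> car B) \<odot> (car A \<odot> car B)"
  "tgt K (mul (ring_tensor K A B)) = car A \<odot> car B"
  "uni (ring_tensor K A B) \<in> arr K" "src K (uni (ring_tensor K A B)) = \<one>" "tgt K (uni (ring_tensor K A B)) = car A \<odot> car B"
  by (simp_all add: ring_tensor_def A B)

lemma ring_tensor_mul:
  assumes "el a" "el b" "el c" "el d" "ty a = car A" "ty b = car B" "ty c = car A" "ty d = car B" "lab b \<inter> lab c = {}"
  shows "mul (ring_tensor K A B) \<star> ((a \<bowtie> b) \<bowtie> (c \<bowtie> d)) = (mul A \<star> (a \<bowtie> c)) \<bowtie> (mul B \<star> (b \<bowtie> d))"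
  by (simp add: ring_tensor_def A B assms ap_interchange)

lemma ring_tensor_uni: "uni (ring_tensor K A B) \<star> u1 = (uni A \<star> u1) \<bowtie> (uni B \<star> u1)"
  by (simp add: ring_tensor_def A B ap_inv_lu)

lemma ring_tensor_ring: "ring_object K (ring_tensor K A B)"
  by (rule ring_objectI_gen[of _ "V 0 (car A) \<bowtie> V 1 (car B)" "V 2 (car A) \<bowtie> V 3 (car B)" "V 4 (car A) \<bowtie> V 5 (car B)"])
    (simp_all add: ring_tensor_simps A B ring_tensor_mul ring_tensor_uni mul_assoc mul_uni_l mul_uni_r)

lemma ring_tensor_commutative:
  assumes "commutative_ring K A" "commutative_ring K B"
  shows "commutative_ring K (ring_tensor K A B)"
proof -
  have "mul (ring_tensor K A B) \<cdot> \<beta> (car A \<odot> car B) (car A \<odot> car B) = mul (ring_tensor K A B)"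
    by (rule gen_eqI[of "(V 0 (car A) \<bowtie> V 1 (car B)) \<bowtie> (V 2 (car A) \<bowtie> V 3 (car B))"])
      (simp_all add: ring_tensor_simps A B ring_tensor_mul ap_simps mul_comm assms)
  then show ?thesis by (simp add: commutative_ring_def ring_tensor_simps)
qed

lemma ring_tensor_separable:
  assumes sA: "separable_ring K A" and sB: "separable_ring K B"
  shows "separable_ring K (ring_tensor K A B)"
proof -
  let ?a = "car A" and ?b = "car B" and ?D = "ring_tensor K A B" and ?d = "car A \<odot> car B"
  note s = sep_simps(1-3)[OF sA] sep_simps(1-3)[OF sB] A B ring_tensor_simps
  let ?I = "interchange K ?a ?a ?b ?b"
  \<comment> \<open>The separability sections of both factors, with the middle two of the four
    factors exchanged.\<close>
  define \<sigma> where "\<sigma> = ?I \<cdot> (sep A \<otimes> sep B)"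
  have sg: "\<sigma> \<in> arr K" "src K \<sigma> = ?d" "tgt K \<sigma> = ?d \<odot> ?d"
    by (simp_all add: \<sigma>_def s)
  have "mul ?D \<cdot> ?I = mul A \<otimes> mul B"
    by (rule gen_eqI[of "(V 0 ?a \<bowtie> V 1 ?a) \<bowtie> (V 2 ?b \<bowtie> V 3 ?b)"])
      (simp_all add: s ring_tensor_mul ap_interchange)
  then have "mul ?D \<cdot> \<sigma> = (mul A \<otimes> mul B) \<cdot> (sep A \<otimes> sep B)"
    by (simp add: \<sigma>_def s cmp_ass[symmetric])
  then have 1: "mul ?D \<cdot> \<sigma> = one ?d"
    by (simp add: s tens_cmp sep_mul[OF sA] sep_mul[OF sB])
  let ?f = "(one ?a \<otimes> mul A) \<cdot> \<alpha> ?a ?a ?a" and ?g = "(one ?b \<otimes> mul B) \<cdot> \<alpha> ?b ?b ?b"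
  \<comment> \<open>Values of \<open>sep A\<close> and \<open>sep B\<close> are not pure tensors.
    The identity needed for them is proved as an equation of arrows on pure tensors of variables and
    evaluated afterwards.\<close>
  have e2: "(one ?d \<otimes> mul ?D) \<cdot> (\<alpha> ?d ?d ?d \<cdot> (?I \<otimes> one ?d)) = ?I \<cdot> ((?f \<otimes> ?g) \<cdot> interchange K (?a \<odot> ?a) (?b \<odot> ?b) ?a ?b)"
    by (rule gen_eqI[of "((V 0 ?a \<bowtie> V 1 ?a) \<bowtie> (V 2 ?b \<bowtie> V 3 ?b)) \<bowtie> (V 4 ?a \<bowtie> V 5 ?b)"])
      (simp_all add: s ring_tensor_mul ap_interchange ap_\<alpha> del: tensa_idn)
  have f2: "?f \<cdot> (sep A \<otimes> one ?a) = sep A \<cdot> mul A" "?g \<cdot> (sep B \<otimes> one ?b) = sep B \<cdot> mul B"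
    using sep_simps(5)[OF sA] sep_simps(5)[OF sB] by simp_all
  have 2: "(one ?d \<otimes> mul ?D) \<cdot> \<alpha> ?d ?d ?d \<cdot> (\<sigma> \<otimes> one ?d) = \<sigma> \<cdot> mul ?D"
  proof (rule gen_eqI[of "(V 0 ?a \<bowtie> V 1 ?b) \<bowtie> (V 2 ?a \<bowtie> V 3 ?b)"])
    let ?t = "((sep A \<star> V 0 ?a) \<bowtie> (sep B \<star> V 1 ?b)) \<bowtie> (V 2 ?a \<bowtie> V 3 ?b)"
    have "((one ?d \<otimes> mul ?D) \<cdot> \<alpha> ?d ?d ?d \<cdot> (\<sigma> \<otimes> one ?d)) \<star> ((V 0 ?a \<bowtie> V 1 ?b) \<bowtie> (V 2 ?a \<bowtie> V 3 ?b)) =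
      ((one ?d \<otimes> mul ?D) \<cdot> (\<alpha> ?d ?d ?d \<cdot> (?I \<otimes> one ?d))) \<star> ?t"
      by (simp add: s sg cmp_ass) (simp add: s \<sigma>_def)
    also have "\<dots> = ?I \<star> ((?f \<star> ((sep A \<star> V 0 ?a) \<bowtie> V 2 ?a)) \<bowtie> (?g \<star> ((sep B \<star> V 1 ?b) \<bowtie> V 3 ?b)))"
      unfolding e2 by (simp add: s ap_interchange del: tensa_idn)
    also have "\<dots> = ?I \<star> (((?f \<cdot> (sep A \<otimes> one ?a)) \<star> (V 0 ?a \<bowtie> V 2 ?a)) \<bowtie> ((?g \<cdot> (sep B \<otimes> one ?b)) \<star> (V 1 ?b \<bowtie> V 3 ?b)))"
      by (simp add: s)
    also have "\<dots> = (\<sigma> \<cdot> mul ?D) \<star> ((V 0 ?a \<bowtie> V 1 ?b) \<bowtie> (V 2 ?a \<bowtie> V 3 ?b))"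
      unfolding f2 by (simp add: s sg ring_tensor_mul) (simp add: s \<sigma>_def)
    finally show "((one ?d \<otimes> mul ?D) \<cdot> \<alpha> ?d ?d ?d \<cdot> (\<sigma> \<otimes> one ?d)) \<star> ((V 0 ?a \<bowtie> V 1 ?b) \<bowtie> (V 2 ?a \<bowtie> V 3 ?b)) =
       (\<sigma> \<cdot> mul ?D) \<star> ((V 0 ?a \<bowtie> V 1 ?b) \<bowtie> (V 2 ?a \<bowtie> V 3 ?b))" .
  qed (simp_all add: s sg)
  let ?f' = "(mul A \<otimes> one ?a) \<cdot> inv (\<alpha> ?a ?a ?a)" and ?g' = "(mul B \<otimes> one ?b) \<cdot> inv (\<alpha> ?b ?b ?b)"
  have e3: "(mul ?D \<otimes> one ?d) \<cdot> (inv (\<alpha> ?d ?d ?d) \<cdot> (one ?d \<otimes> ?I)) = ?I \<cdot> ((?f' \<otimes> ?g') \<cdot> interchange K ?a ?b (?a \<odot> ?a) (?b \<odot> ?b))"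
    by (rule gen_eqI[of "(V 4 ?a \<bowtie> V 5 ?b) \<bowtie> ((V 0 ?a \<bowtie> V 1 ?a) \<bowtie> (V 2 ?b \<bowtie> V 3 ?b))"])
      (simp_all add: s ring_tensor_mul ap_interchange ap_inv_\<alpha> del: tensa_idn)
  have f3: "?f' \<cdot> (one ?a \<otimes> sep A) = sep A \<cdot> mul A" "?g' \<cdot> (one ?b \<otimes> sep B) = sep B \<cdot> mul B"
    using sep_simps(6)[OF sA] sep_simps(6)[OF sB] by simp_all
  have 3: "(mul ?D \<otimes> one ?d) \<cdot> inv (\<alpha> ?d ?d ?d) \<cdot> (one ?d \<otimes> \<sigma>) = \<sigma> \<cdot> mul ?D"
  proof (rule gen_eqI[of "(V 0 ?a \<bowtie> V 1 ?b) \<bowtie> (V 2 ?a \<bowtie> V 3 ?b)"])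
    let ?t = "(V 0 ?a \<bowtie> V 1 ?b) \<bowtie> ((sep A \<star> V 2 ?a) \<bowtie> (sep B \<star> V 3 ?b))"
    have "((mul ?D \<otimes> one ?d) \<cdot> inv (\<alpha> ?d ?d ?d) \<cdot> (one ?d \<otimes> \<sigma>)) \<star> ((V 0 ?a \<bowtie> V 1 ?b) \<bowtie> (V 2 ?a \<bowtie> V 3 ?b)) =
      ((mul ?D \<otimes> one ?d) \<cdot> (inv (\<alpha> ?d ?d ?d) \<cdot> (one ?d \<otimes> ?I))) \<star> ?t"
      by (simp add: s sg cmp_ass) (simp add: s \<sigma>_def)
    also have "\<dots> = ?I \<star> ((?f' \<star> (V 0 ?a \<bowtie> (sep A \<star> V 2 ?a))) \<bowtie> (?g' \<star> (V 1 ?b \<bowtie> (sep B \<star> V 3 ?b))))"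
      unfolding e3 by (simp add: s ap_interchange del: tensa_idn)
    also have "\<dots> = ?I \<star> (((?f' \<cdot> (one ?a \<otimes> sep A)) \<star> (V 0 ?a \<bowtie> V 2 ?a)) \<bowtie> ((?g' \<cdot> (one ?b \<otimes> sep B)) \<star> (V 1 ?b \<bowtie> V 3 ?b)))"
      by (simp add: s)
    also have "\<dots> = (\<sigma> \<cdot> mul ?D) \<star> ((V 0 ?a \<bowtie> V 1 ?b) \<bowtie> (V 2 ?a \<bowtie> V 3 ?b))"
      unfolding f3 by (simp add: s sg ring_tensor_mul) (simp add: s \<sigma>_def)
    finally show "((mul ?D \<otimes> one ?d) \<cdot> inv (\<alpha> ?d ?d ?d) \<cdot> (one ?d \<otimes> \<sigma>)) \<star> ((V 0 ?a \<bowtie> V 1 ?b) \<bowtie> (V 2 ?a \<bowtie> V 3 ?b)) =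
       (\<sigma> \<cdot> mul ?D) \<star> ((V 0 ?a \<bowtie> V 1 ?b) \<bowtie> (V 2 ?a \<bowtie> V 3 ?b))" .
  qed (simp_all add: s sg)
  have "\<sigma> \<in> hom K ?d (?d \<odot> ?d)" using sg by (simp add: hom_def)
  with 1 2 3 show ?thesis unfolding separable_ring_def ring_tensor_simps(1) by blast
qed

end

lemma ring_tensor_tt:
  "\<lbrakk>tt_ring K A; tt_ring K B\<rbrakk> \<Longrightarrow> tt_ring K (ring_tensor K A B)"
  by (simp add: tt_ring_def ring_tensor_ring ring_tensor_commutative ring_tensor_separable)

context
  fixes A
  assumes A: "ring_object K A"
begin

lemma incl_el: "\<lbrakk>el a; ty a = car A\<rbrakk> \<Longrightarrow> left_incl K A \<star> a = a \<bowtie> (uni A \<star> u1)"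
  "\<lbrakk>el a; ty a = car A\<rbrakk> \<Longrightarrow> right_incl K A \<star> a = (uni A \<star> u1) \<bowtie> a"
  by (simp_all add: left_incl_def right_incl_def A ap_simps)

lemma incl_simps: "left_incl K A \<in> arr K" "src K (left_incl K A) = car A" "tgt K (left_incl K A) = car A \<odot> car A"
  "right_incl K A \<in> arr K" "src K (right_incl K A) = car A" "tgt K (right_incl K A) = car A \<odot> car A"
  by (simp_all add: left_incl_def right_incl_def A)

lemma incl_ring_homs: "left_incl K A \<in> ring_homs K A (ring_tensor K A A)"
    "right_incl K A \<in> ring_homs K A (ring_tensor K A A)"
  by (rule ring_homsI_gen[of _ _ _ "V 0 (car A)" "V 1 (car A)"];
      simp add: A ring_tensor_ring ring_tensor_simps ring_tensor_mul ring_tensor_uni incl_el incl_simps mul_uni_l)+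

end

end

section \<open>Additive categories, and exactness properties of distinguished triangles\<close>

section \<open>Triangles\<close>

context additive_category
begin

lemma arr_zero [simp]: "\<lbrakk>x \<in> obj K; y \<in> obj K\<rbrakk> \<Longrightarrow> zero_arr K x y \<in> arr K"
  and src_zero [simp]: "\<lbrakk>x \<in> obj K; y \<in> obj K\<rbrakk> \<Longrightarrow> src K (zero_arr K x y) = x"
  and tgt_zero [simp]: "\<lbrakk>x \<in> obj K; y \<in> obj K\<rbrakk> \<Longrightarrow> tgt K (zero_arr K x y) = y"
  using zero_hom[of x y] by (auto simp: hom_def)

lemma arr_plus [simp]: "\<lbrakk>f \<in> arr K; g \<in> arr K; src K f = src K g; tgt K f = tgt K g\<rbrakk> \<Longrightarrow> f \<oplus> g \<in> arr K"
  and src_plus [simp]: "\<lbrakk>f \<in> arr K; g \<in> arr K; src K f = src K g; tgt K f = tgt K g\<rbrakk> \<Longrightarrow> src K (f \<oplus> g) = src K g"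
  and tgt_plus [simp]: "\<lbrakk>f \<in> arr K; g \<in> arr K; src K f = src K g; tgt K f = tgt K g\<rbrakk> \<Longrightarrow> tgt K (f \<oplus> g) = tgt K g"
  using plus_hom[of f "src K g" "tgt K g" g] by (auto simp: hom_def)

lemma plus_cancel:
  assumes "f \<in> hom K x y" "g \<in> hom K x y" "h \<in> hom K x y" "f \<oplus> g = f \<oplus> h"
  shows "g = h"
proof -
  obtain n where n: "n \<in> hom K x y" "f \<oplus> n = zero_arr K x y" using neg_ex[OF assms(1)] by blast
  have *: "k = n \<oplus> (f \<oplus> k)" if k: "k \<in> hom K x y" for k
  proof -
    have "n \<oplus> (f \<oplus> k) = (f \<oplus> n) \<oplus> k"
      using plus_assoc[OF n(1) assms(1) k] plus_comm[OF n(1) assms(1)] by simp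
    then show ?thesis using n zero_plus[OF k] by simp
  qed
  show ?thesis using *[OF assms(2)] *[OF assms(3)] assms(4) by simp
qed

text \<open>The way in which additive operations, such as composition, suspension and tensoring, are
  seen to preserve zero: the image of a zero arrow is its own double.\<close>

lemma plus_self_zero:
  assumes "f \<in> hom K x y" "f \<oplus> f = f"
  shows "f = zero_arr K x y"
proof -
  have o: "x \<in> obj K" "y \<in> obj K" using assms by (auto simp: hom_def)
  have z: "zero_arr K x y \<in> hom K x y" using zero_hom o .
  have "f \<oplus> zero_arr K x y = f" using plus_comm[OF assms(1) z] zero_plus[OF assms(1)] by simp
  with assms plus_cancel[OF assms(1) assms(1) z] show ?thesis by simp
qed

lemma plus_zero: "f \<in> hom K x y \<Longrightarrow> f \<oplus> zero_arr K x y = f"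
  using plus_comm[of f x y "zero_arr K x y"] zero_plus[of f x y] zero_hom[of x y] hom_obj by metis

lemma cmp_zero [simp]:
  assumes "g \<in> arr K" "src K g = y" "x \<in> obj K"
  shows "g \<cdot> zero_arr K x y = zero_arr K x (tgt K g)"
proof (rule plus_self_zero)
  have z: "zero_arr K x y \<in> hom K x y" "g \<in> hom K y (tgt K g)" using assms by (auto simp: hom_def)
  show "g \<cdot> zero_arr K x y \<in> hom K x (tgt K g)" using cmp_hom[OF z] .
  show "(g \<cdot> zero_arr K x y) \<oplus> (g \<cdot> zero_arr K x y) = g \<cdot> zero_arr K x y"
    using cmp_plus[OF z(1) z(1) z(2)] zero_plus[OF z(1)] by simp
qed

lemma zero_cmp [simp]:
  assumes "f \<in> arr K" "tgt K f = y" "z \<in> obj K"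
  shows "zero_arr K y z \<cdot> f = zero_arr K (src K f) z"
proof (rule plus_self_zero)
  have z: "f \<in> hom K (src K f) y" "zero_arr K y z \<in> hom K y z" using assms by (auto simp: hom_def)
  show "zero_arr K y z \<cdot> f \<in> hom K (src K f) z" using cmp_hom[OF z] .
  show "(zero_arr K y z \<cdot> f) \<oplus> (zero_arr K y z \<cdot> f) = zero_arr K y z \<cdot> f"
    using plus_cmp[OF z(1) z(2) z(2)] zero_plus[OF z(2)] by simp
qed

lemma neg_arr_props:
  assumes "f \<in> hom K x y"
  shows "neg_arr K f \<in> hom K x y" "f \<oplus> neg_arr K f = zero_arr K x y"
proof -
  obtain n where n: "n \<in> hom K x y" "f \<oplus> n = zero_arr K x y" using neg_ex[OF assms] by blast
  have st: "src K f = x" "tgt K f = y" using assms by (auto simp: hom_def)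
  have "neg_arr K f = n"
    unfolding neg_arr_def st
  proof (rule the_equality)
    show "n \<in> hom K x y \<and> f \<oplus> n = zero_arr K x y" using n by simp
    fix m assume "m \<in> hom K x y \<and> f \<oplus> m = zero_arr K x y"
    then show "m = n" using plus_cancel[OF assms, of m n] n by simp
  qed
  with n show "neg_arr K f \<in> hom K x y" "f \<oplus> neg_arr K f = zero_arr K x y" by simp_all
qed

lemma neg_unique:
  assumes "f \<in> hom K x y" "g \<in> hom K x y" "f \<oplus> g = zero_arr K x y"
  shows "g = neg_arr K f"
  using plus_cancel[OF assms(1) assms(2) neg_arr_props(1)[OF assms(1)]] neg_arr_props(2)[OF assms(1)] assms(3) by simp

lemma neg_neg: "f \<in> hom K x y \<Longrightarrow> neg_arr K (neg_arr K f) = f"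
  using neg_unique[of "neg_arr K f" x y f] neg_arr_props[of f x y] plus_comm[of f x y "neg_arr K f"] by simp

lemma arr_neg [simp]: "f \<in> arr K \<Longrightarrow> neg_arr K f \<in> arr K"
  and src_neg [simp]: "f \<in> arr K \<Longrightarrow> src K (neg_arr K f) = src K f"
  and tgt_neg [simp]: "f \<in> arr K \<Longrightarrow> tgt K (neg_arr K f) = tgt K f"
  using neg_arr_props(1)[of f "src K f" "tgt K f"] by (auto simp: hom_def)

lemma cmp_neg:
  assumes "f \<in> hom K x y" "g \<in> hom K y z"
  shows "g \<cdot> neg_arr K f = neg_arr K (g \<cdot> f)"
proof (rule neg_unique[of _ x z])
  note n = neg_arr_props[OF assms(1)]
  show "g \<cdot> f \<in> hom K x z" "g \<cdot> neg_arr K f \<in> hom K x z" using assms n by (blast intro: cmp_hom)+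
  show "(g \<cdot> f) \<oplus> (g \<cdot> neg_arr K f) = zero_arr K x z"
    using cmp_plus[OF assms(1) n(1) assms(2)] n(2) assms by (auto simp: hom_def)
qed

lemma neg_cmp:
  assumes "f \<in> hom K x y" "g \<in> hom K y z"
  shows "neg_arr K g \<cdot> f = neg_arr K (g \<cdot> f)"
proof (rule neg_unique[of _ x z])
  note n = neg_arr_props[OF assms(2)]
  show "g \<cdot> f \<in> hom K x z" "neg_arr K g \<cdot> f \<in> hom K x z" using assms n by (blast intro: cmp_hom)+
  show "(g \<cdot> f) \<oplus> (neg_arr K g \<cdot> f) = zero_arr K x z"
    using plus_cmp[OF assms(1) assms(2) n(1)] n(2) assms by (auto simp: hom_def)
qed

lemma neg_zero: "\<lbrakk>x \<in> obj K; y \<in> obj K\<rbrakk> \<Longrightarrow> neg_arr K (zero_arr K x y) = zero_arr K x y"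
  using neg_unique[of "zero_arr K x y" x y "zero_arr K x y"] zero_hom[of x y] zero_plus by force

lemma neg_eq_zero:
  assumes "f \<in> hom K x y" "neg_arr K f = zero_arr K x y"
  shows "f = zero_arr K x y"
  using neg_neg[OF assms(1)] neg_zero[of x y] assms hom_obj[OF assms(1)] by simp

lemma zero_object_arr: "\<lbrakk>zero_object K z; f \<in> hom K x z; x \<in> obj K\<rbrakk> \<Longrightarrow> f = zero_arr K x z"
   "\<lbrakk>zero_object K z; g \<in> hom K z x; x \<in> obj K\<rbrakk> \<Longrightarrow> g = zero_arr K z x"
  unfolding zero_object_def using zero_hom[of x z] zero_hom[of z x] by blast+

lemma zero_objectI:
  assumes z: "z \<in> obj K" and e: "idn K z = zero_arr K z z"
  shows "zero_object K z"
  unfolding zero_object_def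
proof (intro conjI ballI z ex1I)
  fix x assume x: "x \<in> obj K"
  show "zero_arr K x z \<in> hom K x z" "zero_arr K z x \<in> hom K z x" using x z by (auto intro: zero_hom)
  fix f assume f: "f \<in> hom K x z"
  have "f = idn K z \<cdot> f" using idn_cmp[OF f] by simp
  then show "f = zero_arr K x z" unfolding e using f z by (simp add: hom_def)
next
  fix x f assume x: "x \<in> obj K" and f: "f \<in> hom K z x"
  have "f = f \<cdot> idn K z" using cmp_idn[OF f] by simp
  then show "f = zero_arr K z x" unfolding e using f z by (simp add: hom_def)
qed

lemma zero_object_idn: "zero_object K z \<Longrightarrow> idn K z = zero_arr K z z"
  using zero_object_arr(1)[of z "idn K z" z] idn_hom[of z] by (simp add: zero_object_def)

definition minus :: "'m \<Rightarrow> 'm \<Rightarrow> 'm" where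
  "minus f g = f \<oplus> neg_arr K g"

lemma minus_hom: "\<lbrakk>f \<in> hom K x y; g \<in> hom K x y\<rbrakk> \<Longrightarrow> minus f g \<in> hom K x y"
  unfolding minus_def by (intro plus_hom neg_arr_props(1))

lemma minus_plus: "\<lbrakk>f \<in> hom K x y; g \<in> hom K x y\<rbrakk> \<Longrightarrow> minus f g \<oplus> g = f"
proof -
  assume f: "f \<in> hom K x y" and g: "g \<in> hom K x y"
  note n = neg_arr_props[OF g]
  have "minus f g \<oplus> g = f \<oplus> (g \<oplus> neg_arr K g)"
    unfolding minus_def using plus_assoc[OF f n(1) g] plus_comm[OF n(1) g] by simp
  then show ?thesis using n plus_zero[OF f] by simp
qed

lemma minus_self: "f \<in> hom K x y \<Longrightarrow> minus f f = zero_arr K x y"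
  unfolding minus_def by (rule neg_arr_props(2))

lemma cmp_minus: "\<lbrakk>f \<in> hom K x y; g \<in> hom K x y; h \<in> hom K y z\<rbrakk> \<Longrightarrow> h \<cdot> minus f g = minus (h \<cdot> f) (h \<cdot> g)"
  unfolding minus_def by (simp add: cmp_plus[of _ x y _ _ z] neg_arr_props(1) cmp_neg[of _ x y])

lemma minus_cmp: "\<lbrakk>f \<in> hom K x y; g \<in> hom K y z; h \<in> hom K y z\<rbrakk> \<Longrightarrow> minus g h \<cdot> f = minus (g \<cdot> f) (h \<cdot> f)"
  unfolding minus_def by (simp add: plus_cmp[of _ x y _ z] neg_arr_props(1) neg_cmp[of _ x y _ z])

lemma minus_zero_eq:
  assumes "f \<in> hom K x y" "g \<in> hom K x y" "minus f g = zero_arr K x y"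
  shows "f = g"
  using minus_plus[OF assms(1,2)] zero_plus[OF assms(2)] assms(3) by simp

end

context triangulated_category
begin

lemma susa_hom: "f \<in> hom K x y \<Longrightarrow> susa K f \<in> hom K (sus K x) (sus K y)"
  using susa_bij[of x y] hom_obj[of f x y] by (auto simp: bij_betw_def)

lemma sus_in [simp]: "x \<in> obj K \<Longrightarrow> sus K x \<in> obj K"
  by (rule sus_obj)

lemma arr_susa [simp]: "f \<in> arr K \<Longrightarrow> susa K f \<in> arr K"
  and src_susa [simp]: "f \<in> arr K \<Longrightarrow> src K (susa K f) = sus K (src K f)"
  and tgt_susa [simp]: "f \<in> arr K \<Longrightarrow> tgt K (susa K f) = sus K (tgt K f)"
  using susa_hom[of f "src K f" "tgt K f"] by (auto simp: hom_def)

lemma susa_comp: "\<lbrakk>f \<in> arr K; g \<in> arr K; src K g = tgt K f\<rbrakk> \<Longrightarrow> susa K (g \<cdot> f) = susa K g \<cdot> susa K f"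
  using susa_cmp[of f "src K f" "tgt K f" g "tgt K g"] by (simp add: hom_def)

lemma susa_zero: "\<lbrakk>x \<in> obj K; y \<in> obj K\<rbrakk> \<Longrightarrow> susa K (zero_arr K x y) = zero_arr K (sus K x) (sus K y)"
  by (rule plus_self_zero[OF susa_hom[OF zero_hom]])
    (simp_all add: susa_plus[OF zero_hom zero_hom, symmetric] zero_plus[OF zero_hom])

lemma susa_inj: "\<lbrakk>f \<in> hom K x y; g \<in> hom K x y; susa K f = susa K g\<rbrakk> \<Longrightarrow> f = g"
  using susa_bij[of x y] hom_obj[of f x y] by (auto simp: bij_betw_def dest: inj_onD)

lemma susa_surj: "\<lbrakk>g \<in> hom K (sus K x) (sus K y); x \<in> obj K; y \<in> obj K\<rbrakk> \<Longrightarrow> \<exists>f \<in> hom K x y. susa K f = g"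
  using susa_bij[of x y] unfolding bij_betw_def by (metis imageE)

lemma sus_zero_object: "zero_object K z \<Longrightarrow> zero_object K (sus K z)"
  using zero_object_idn[of z] susa_idn[of z] susa_zero[of z z]
  by (intro zero_objectI) (simp_all add: zero_object_def)

lemma dist_simps:
  assumes "(f, g, h) \<in> dist K"
  shows "f \<in> arr K" "g \<in> arr K" "h \<in> arr K" "src K g = tgt K f" "src K h = tgt K g" "tgt K h = sus K (src K f)"
  using dist_triangle[OF assms] by (auto simp: is_triangle_def)

lemma dist_rot: "(f, g, h) \<in> dist K \<Longrightarrow> (g, h, neg_arr K (susa K f)) \<in> dist K"
  using dist_rotate[of f g h] dist_triangle[of f g h] by simp

lemma dist_cmp_zero:
  assumes "(f, g, h) \<in> dist K"
  shows "g \<cdot> f = zero_arr K (src K f) (tgt K g)"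
proof -
  note s = dist_simps[OF assms]
  obtain z where z: "zero_object K z" using zero_object_ex by blast
  then have zo: "z \<in> obj K" by (simp add: zero_object_def)
  let ?x = "src K f"
  have "(idn K ?x, zero_arr K ?x z, zero_arr K z (sus K ?x)) \<in> dist K"
    using z s by (intro dist_idn) auto
  from dist_morphism[OF this assms, of "idn K ?x" f] s
  obtain c where c: "triangle_morphism K (idn K ?x, zero_arr K ?x z, zero_arr K z (sus K ?x)) (f, g, h) (idn K ?x) f c"
    by (auto simp: hom_def)
  then have "c \<in> hom K z (tgt K g)" "c \<cdot> zero_arr K ?x z = g \<cdot> f"
    using s zo by (auto simp: triangle_morphism_def)
  then show ?thesis using s zo by (simp add: hom_def)
qed

lemma dist_cmp_zero2:
  assumes "(f, g, h) \<in> dist K"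
  shows "h \<cdot> g = zero_arr K (tgt K f) (sus K (src K f))"
  using dist_cmp_zero[OF dist_rot[OF assms]] dist_simps[OF assms] by simp

lemma dist_cmp_zero3:
  assumes "(f, g, h) \<in> dist K"
  shows "susa K f \<cdot> h = zero_arr K (tgt K g) (sus K (tgt K f))"
proof -
  note s = dist_simps[OF assms]
  have h: "h \<in> hom K (tgt K g) (sus K (src K f))" "susa K f \<in> hom K (sus K (src K f)) (sus K (tgt K f))"
    using s by (auto simp: hom_def)
  have "neg_arr K (susa K f) \<cdot> h = zero_arr K (tgt K g) (sus K (tgt K f))"
    using dist_cmp_zero2[OF dist_rot[OF assms]] s by simp
  then have "neg_arr K (susa K f \<cdot> h) = zero_arr K (tgt K g) (sus K (tgt K f))"
    using neg_cmp[OF h] by simp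
  then show ?thesis using neg_eq_zero[OF cmp_hom[OF h]] by simp
qed

text \<open>Maps from an object w are exact along a triangle: the trivial triangle on w, rotated
  once, is mapped to the rotated triangle. The fill-in is an arrow between suspensions, the signs on
  both sides cancel, and the suspension is fully faithful.\<close>

lemma dist_exact:
  assumes d: "(f, g, h) \<in> dist K" and t: "t \<in> arr K" "tgt K t = tgt K f" "g \<cdot> t = zero_arr K (src K t) (tgt K g)"
  shows "\<exists>s \<in> hom K (src K t) (src K f). f \<cdot> s = t"
proof -
  note s = dist_simps[OF d]
  obtain z where z: "zero_object K z" using zero_object_ex by blast
  then have zo: "z \<in> obj K" by (simp add: zero_object_def)
  let ?w = "src K t" and ?x = "src K f"
  have wo: "?w \<in> obj K" using t by simp
  have "(idn K ?w, zero_arr K ?w z, zero_arr K z (sus K ?w)) \<in> dist K"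
    using z wo by (intro dist_idn)
  then have r: "(zero_arr K ?w z, zero_arr K z (sus K ?w), neg_arr K (idn K (sus K ?w))) \<in> dist K"
    using dist_rot susa_idn[OF wo] by metis
  have a: "t \<in> hom K (src K (zero_arr K ?w z)) (src K g)"
    "zero_arr K z (tgt K g) \<in> hom K (tgt K (zero_arr K ?w z)) (tgt K g)"
    "zero_arr K z (tgt K g) \<cdot> zero_arr K ?w z = g \<cdot> t"
    using s t wo zo by (auto simp: hom_def)
  from dist_morphism[OF r dist_rot[OF d] a] obtain c where
    "triangle_morphism K (zero_arr K ?w z, zero_arr K z (sus K ?w), neg_arr K (idn K (sus K ?w)))
       (g, h, neg_arr K (susa K f)) t (zero_arr K z (tgt K g)) c" by blast
  then have c: "c \<in> hom K (sus K ?w) (sus K ?x)"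
    and e: "susa K t \<cdot> neg_arr K (idn K (sus K ?w)) = neg_arr K (susa K f) \<cdot> c"
    using s t wo zo by (auto simp: triangle_morphism_def)
  have F: "susa K f \<in> hom K (sus K ?x) (sus K (tgt K f))" and T: "susa K t \<in> hom K (sus K ?w) (sus K (tgt K f))"
    using s t by (auto simp: hom_def)
  have "neg_arr K (susa K t) = neg_arr K (susa K f \<cdot> c)"
    using e cmp_neg[OF idn_hom[of "sus K ?w"] T] neg_cmp[OF c F] wo cmp_idn[OF T] by simp
  then have "susa K t = susa K f \<cdot> c" by (metis neg_neg[OF T] neg_neg[OF cmp_hom[OF c F]])
  moreover obtain u where u: "u \<in> hom K ?w ?x" "susa K u = c"
    using susa_surj[OF c] wo s by auto
  moreover have fu: "f \<in> hom K ?x (tgt K f)" "t \<in> hom K ?w (tgt K f)" using s t by (auto simp: hom_def)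
  ultimately have "susa K t = susa K (f \<cdot> u)" using susa_cmp[OF u(1) fu(1)] by simp
  then have "f \<cdot> u = t" using susa_inj[OF fu(2) cmp_hom[OF u(1) fu(1)]] by simp
  with u show ?thesis by blast
qed

lemma dist_exact2:
  assumes d: "(f, g, h) \<in> dist K" and t: "t \<in> arr K" "tgt K t = tgt K g" "h \<cdot> t = zero_arr K (src K t) (sus K (src K f))"
  shows "\<exists>s \<in> hom K (src K t) (tgt K f). g \<cdot> s = t"
  using dist_exact[OF dist_rot[OF d], of t] t dist_simps[OF d] by simp

lemma dist_exact3:
  assumes d: "(f, g, h) \<in> dist K" and t: "t \<in> arr K" "tgt K t = sus K (src K f)"
    "susa K f \<cdot> t = zero_arr K (src K t) (sus K (tgt K f))"
  shows "\<exists>s \<in> hom K (src K t) (tgt K g). h \<cdot> s = t"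
proof -
  note s = dist_simps[OF d]
  have h: "t \<in> hom K (src K t) (sus K (src K f))" "susa K f \<in> hom K (sus K (src K f)) (sus K (tgt K f))"
    using s t by (auto simp: hom_def)
  have "neg_arr K (susa K f) \<cdot> t = zero_arr K (src K t) (sus K (tgt K f))"
    using neg_cmp[OF h] t neg_zero s by simp
  then show ?thesis using dist_exact2[OF dist_rot[OF d], of t] t s by simp
qed

lemma dist_coexact:
  assumes d: "(f, g, h) \<in> dist K" and t: "t \<in> arr K" "src K t = tgt K f" "t \<cdot> f = zero_arr K (src K f) (tgt K t)"
  shows "\<exists>s \<in> hom K (tgt K g) (tgt K t). s \<cdot> g = t"
proof -
  note s = dist_simps[OF d]
  obtain z where z: "zero_object K z" using zero_object_ex by blast
  then have zo: "z \<in> obj K" by (simp add: zero_object_def)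
  let ?w = "tgt K t"
  have wo: "?w \<in> obj K" using t by simp
  \<comment> \<open>The zero object is chosen as a suspension, so that this triangle can be rotated
    backwards to one starting at \<open>z\<close>.\<close>
  have "(idn K ?w, zero_arr K ?w (sus K z), zero_arr K (sus K z) (sus K ?w)) \<in> dist K"
    using sus_zero_object[OF z] wo by (intro dist_idn)
  then have "(zero_arr K z ?w, idn K ?w, zero_arr K ?w (sus K z)) \<in> dist K"
    using dist_rotate[of "zero_arr K z ?w" "idn K ?w" "zero_arr K ?w (sus K z)"] wo zo
    by (simp add: is_triangle_def susa_zero neg_zero)
  from dist_morphism[OF d this, of "zero_arr K (src K f) z" t] obtain c where
    "triangle_morphism K (f, g, h) (zero_arr K z ?w, idn K ?w, zero_arr K ?w (sus K z)) (zero_arr K (src K f) z) t c"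
    using s t wo zo by (auto simp: hom_def)
  then have "c \<in> hom K (tgt K g) ?w" "c \<cdot> g = idn K ?w \<cdot> t"
    using s wo zo by (auto simp: triangle_morphism_def)
  then show ?thesis using t by auto
qed

text \<open>The five lemma at the third vertex, for maps from arbitrary objects: exactness of both
  triangles makes composition with \<theta> onto and injective, so \<theta> is an isomorphism of
  triangles.\<close>

lemma dist_of_exact:
  assumes d: "(f, g, h) \<in> dist K" and t: "is_triangle K f g' h'"
    and th: "\<theta> \<in> hom K (tgt K g) (tgt K g')" "\<theta> \<cdot> g = g'" "h' \<cdot> \<theta> = h"
    and z: "susa K f \<cdot> h' = zero_arr K (tgt K g') (sus K (tgt K f))"
    and e1: "\<And>t. \<lbrakk>t \<in> arr K; tgt K t = tgt K f; g' \<cdot> t = zero_arr K (src K t) (tgt K g')\<rbrakk>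
      \<Longrightarrow> \<exists>s \<in> hom K (src K t) (src K f). f \<cdot> s = t"
    and e2: "\<And>t. \<lbrakk>t \<in> arr K; tgt K t = tgt K g'; h' \<cdot> t = zero_arr K (src K t) (sus K (src K f))\<rbrakk>
      \<Longrightarrow> \<exists>s \<in> hom K (src K t) (tgt K f). g' \<cdot> s = t"
  shows "(f, g', h') \<in> dist K"
proof -
  note s = dist_simps[OF d]
  have s': "g' \<in> arr K" "h' \<in> arr K" "src K g' = tgt K f" "src K h' = tgt K g'" "tgt K h' = sus K (src K f)"
    using t by (auto simp: is_triangle_def)
  note ths = homD[OF th(1)]
  let ?z = "tgt K g" and ?z' = "tgt K g'"
  have zo: "?z' \<in> obj K" "?z \<in> obj K" using s s' by auto
  \<comment> \<open>The composite \<open>h' \<cdot> t\<close> lifts through \<open>h\<close>; the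
    error between \<open>t\<close> and the image of the lift dies under \<open>h'\<close> and is
    corrected through \<open>g'\<close>.\<close>
  have surj: "\<exists>u \<in> hom K (src K t) ?z. \<theta> \<cdot> u = t" if t: "t \<in> arr K" "tgt K t = ?z'" for t
  proof -
    let ?w = "src K t"
    have "susa K f \<cdot> (h' \<cdot> t) = (susa K f \<cdot> h') \<cdot> t" using s s' t by (simp add: cmp_ass)
    also have "\<dots> = zero_arr K ?w (sus K (tgt K f))" unfolding z using t s by simp
    finally have "\<exists>u \<in> hom K (src K (h' \<cdot> t)) ?z. h \<cdot> u = h' \<cdot> t"
      using s s' t by (intro dist_exact3[OF d]) simp_all
    then obtain u where u: "u \<in> hom K ?w ?z" "h \<cdot> u = h' \<cdot> t" using s s' t by auto
    note us = homD[OF u(1)]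
    have H: "t \<in> hom K ?w ?z'" "\<theta> \<cdot> u \<in> hom K ?w ?z'" "h' \<in> hom K ?z' (sus K (src K f))"
      using t s s' us ths by (auto simp: hom_def)
    have hu: "h' \<cdot> (\<theta> \<cdot> u) = h' \<cdot> t" using u(2) us ths s s' by (simp add: th(3)[symmetric] cmp_ass)
    have hm: "h' \<cdot> minus t (\<theta> \<cdot> u) = zero_arr K ?w (sus K (src K f))"
      unfolding cmp_minus[OF H] hu by (rule minus_self[OF cmp_hom[OF H(1,3)]])
    note ms = homD[OF minus_hom[OF H(1,2)]]
    from e2[OF ms(1) ms(3)] hm obtain v where v: "v \<in> hom K ?w (tgt K f)" "g' \<cdot> v = minus t (\<theta> \<cdot> u)"
      unfolding ms(2) by blast
    note vs = homD[OF v(1)]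
    have gv: "g \<cdot> v \<in> hom K ?w ?z" using s vs by (auto simp: hom_def)
    have "\<theta> \<cdot> ((g \<cdot> v) \<oplus> u) = (\<theta> \<cdot> (g \<cdot> v)) \<oplus> (\<theta> \<cdot> u)" by (rule cmp_plus[OF gv u(1) th(1)])
    also have "\<theta> \<cdot> (g \<cdot> v) = minus t (\<theta> \<cdot> u)"
      using s vs ths by (simp add: cmp_ass[symmetric] th(2) v(2))
    also have "minus t (\<theta> \<cdot> u) \<oplus> (\<theta> \<cdot> u) = t" by (rule minus_plus[OF H(1,2)])
    finally show ?thesis using plus_hom[OF gv u(1)] by blast
  qed
  have inj: "u = zero_arr K (src K u) ?z" if u: "u \<in> arr K" "tgt K u = ?z" "\<theta> \<cdot> u = zero_arr K (src K u) ?z'" for u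
  proof -
    let ?w = "src K u"
    have "h \<cdot> u = h' \<cdot> (\<theta> \<cdot> u)" using u ths s s' by (simp add: th(3)[symmetric] cmp_ass)
    also have "\<dots> = zero_arr K ?w (sus K (src K f))" unfolding u(3) using s' u by simp
    finally obtain v where v: "v \<in> hom K ?w (tgt K f)" "g \<cdot> v = u"
      using dist_exact2[OF d u(1,2)] by blast
    note vs = homD[OF v(1)]
    have "g' \<cdot> v = \<theta> \<cdot> (g \<cdot> v)" using s vs ths by (simp add: cmp_ass[symmetric] th(2))
    also have "\<dots> = zero_arr K ?w ?z'" unfolding v(2) by (rule u(3))
    finally obtain x where x: "x \<in> hom K ?w (src K f)" "f \<cdot> x = v"
      using e1[of v] vs by auto
    note xs = homD[OF x(1)]
    have "u = (g \<cdot> f) \<cdot> x" using v(2) x(2) xs s by (simp add: cmp_ass)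
    also have "\<dots> = zero_arr K ?w ?z" unfolding dist_cmp_zero[OF d] using xs s by simp
    finally show ?thesis .
  qed
  \<comment> \<open>A preimage of the identity. It is also a left inverse, since \<theta>
    annihilates the difference of \<open>k \<cdot> \<theta>\<close> and the identity.\<close>
  obtain k where k: "k \<in> hom K ?z' ?z" "\<theta> \<cdot> k = idn K ?z'" using surj[of "idn K ?z'"] zo by auto
  note ks = homD[OF k(1)]
  have K1: "k \<cdot> \<theta> \<in> hom K ?z ?z" "idn K ?z \<in> hom K ?z ?z" using ks ths zo by (auto simp: hom_def)
  have "\<theta> \<cdot> (k \<cdot> \<theta>) = (\<theta> \<cdot> k) \<cdot> \<theta>" using ks ths by (simp add: cmp_ass)
  also have "\<dots> = \<theta> \<cdot> idn K ?z" unfolding k(2) using ths by simp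
  finally have "\<theta> \<cdot> minus (k \<cdot> \<theta>) (idn K ?z) = zero_arr K ?z ?z'"
    unfolding cmp_minus[OF K1 th(1)] using minus_self[OF th(1)] ths by simp
  with inj[of "minus (k \<cdot> \<theta>) (idn K ?z)"] homD[OF minus_hom[OF K1]]
  have "minus (k \<cdot> \<theta>) (idn K ?z) = zero_arr K ?z ?z" by simp
  then have k\<theta>: "k \<cdot> \<theta> = idn K ?z" by (rule minus_zero_eq[OF K1])
  show ?thesis
  proof (rule dist_iso[OF d t, of "idn K (src K f)" "idn K (tgt K f)" \<theta>])
    show "\<theta> \<in> isos K (tgt K g) (tgt K g')" using isosI[OF th(1) k(1) k\<theta> k(2)] .
    show "idn K (src K f) \<in> isos K (src K f) (src K f)" "idn K (tgt K f) \<in> isos K (tgt K f) (tgt K f)"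
      using s by (auto intro!: isosI idn_hom)
    show "triangle_morphism K (f, g, h) (f, g', h') (idn K (src K f)) (idn K (tgt K f)) \<theta>"
      using s s' th by (simp add: triangle_morphism_def susa_idn hom_def)
  qed
qed

text \<open>A distinguished triangle on \<open>f'\<close> is compared with the retract through
  \<open>c' \<cdot> e\<close>; exactness passes to retracts, so \<open>dist_of_exact\<close>
  applies. Relative tensor products are retracts of tensor products in \<open>K\<close>, and this
  makes them exact.\<close>

lemma dist_retract:
  assumes d: "(f, g, h) \<in> dist K" and t: "is_triangle K f' g' h'"
    and i: "triangle_morphism K (f', g', h') (f, g, h) a b c"
    and r: "triangle_morphism K (f, g, h) (f', g', h') a' b' c'"
    and ri: "a' \<cdot> a = idn K (src K f')" "b' \<cdot> b = idn K (tgt K f')" "c' \<cdot> c = idn K (tgt K g')"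
  shows "(f', g', h') \<in> dist K"
proof -
  note s = dist_simps[OF d]
  have s': "f' \<in> arr K" "g' \<in> arr K" "h' \<in> arr K" "src K g' = tgt K f'" "src K h' = tgt K g'" "tgt K h' = sus K (src K f')"
    using t by (auto simp: is_triangle_def)
  have i': "a \<in> hom K (src K f') (src K f)" "b \<in> hom K (tgt K f') (tgt K f)" "c \<in> hom K (tgt K g') (tgt K g)"
    "b \<cdot> f' = f \<cdot> a" "c \<cdot> g' = g \<cdot> b" "susa K a \<cdot> h' = h \<cdot> c"
    using i by (auto simp: triangle_morphism_def)
  have r': "a' \<in> hom K (src K f) (src K f')" "b' \<in> hom K (tgt K f) (tgt K f')" "c' \<in> hom K (tgt K g) (tgt K g')"
    "b' \<cdot> f = f' \<cdot> a'" "c' \<cdot> g = g' \<cdot> b'" "susa K a' \<cdot> h = h' \<cdot> c'"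
    using r by (auto simp: triangle_morphism_def)
  note z = s s' homD[OF i'(1)] homD[OF i'(2)] homD[OF i'(3)] homD[OF r'(1)] homD[OF r'(2)] homD[OF r'(3)]
  obtain g2 h2 where d2: "(f', g2, h2) \<in> dist K" using dist_cone[OF s'(1)] by blast
  note s2 = dist_simps[OF d2]
  from dist_morphism[OF d2 d i'(1,2,4)] obtain e where "triangle_morphism K (f', g2, h2) (f, g, h) a b e" by blast
  then have e: "e \<in> hom K (tgt K g2) (tgt K g)" "e \<cdot> g2 = g \<cdot> b" "susa K a \<cdot> h2 = h \<cdot> e"
    by (auto simp: triangle_morphism_def)
  note es = homD[OF e(1)]
  have sa: "susa K a' \<cdot> susa K a = idn K (sus K (src K f'))"
    using ri(1) z by (simp add: susa_comp[symmetric] susa_idn)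
  show ?thesis
  proof (rule dist_of_exact[OF d2 t, of "c' \<cdot> e"])
    show "c' \<cdot> e \<in> hom K (tgt K g2) (tgt K g')" using z es by (simp add: hom_def)
    have "(c' \<cdot> e) \<cdot> g2 = (c' \<cdot> g) \<cdot> b" using z es s2 e(2) by (simp add: cmp_ass)
    also have "\<dots> = g' \<cdot> (b' \<cdot> b)" unfolding r'(5) using z by (simp add: cmp_ass)
    finally show "(c' \<cdot> e) \<cdot> g2 = g'" unfolding ri(2) using z by simp
    have "h' \<cdot> (c' \<cdot> e) = (susa K a' \<cdot> h) \<cdot> e" unfolding r'(6) using z es by (simp add: cmp_ass)
    also have "\<dots> = susa K a' \<cdot> (susa K a \<cdot> h2)" unfolding e(3) using z es by (simp add: cmp_ass)
    also have "\<dots> = (susa K a' \<cdot> susa K a) \<cdot> h2" using z s2 by (simp add: cmp_ass)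
    finally show "h' \<cdot> (c' \<cdot> e) = h2" unfolding sa using z s2 by simp
    have "h' = h' \<cdot> (c' \<cdot> c)" unfolding ri(3) using z by simp
    also have "\<dots> = (susa K a' \<cdot> h) \<cdot> c" unfolding r'(6) using z by (simp add: cmp_ass)
    finally have h': "h' = susa K a' \<cdot> (h \<cdot> c)" using z by (simp add: cmp_ass)
    have "susa K f' \<cdot> h' = (susa K f' \<cdot> susa K a') \<cdot> (h \<cdot> c)" by (subst h') (use z in \<open>simp add: cmp_ass\<close>)
    also have "susa K f' \<cdot> susa K a' = susa K b' \<cdot> susa K f"
      using z r'(4) by (simp add: susa_comp[symmetric])
    also have "(susa K b' \<cdot> susa K f) \<cdot> (h \<cdot> c) = susa K b' \<cdot> ((susa K f \<cdot> h) \<cdot> c)" using z by (simp add: cmp_ass)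
    also have "\<dots> = zero_arr K (tgt K g') (sus K (tgt K f'))" unfolding dist_cmp_zero3[OF d] using z by simp
    finally show "susa K f' \<cdot> h' = zero_arr K (tgt K g') (sus K (tgt K f'))" .
  next
    fix t assume t: "t \<in> arr K" "tgt K t = tgt K f'" "g' \<cdot> t = zero_arr K (src K t) (tgt K g')"
    have "g \<cdot> (b \<cdot> t) = (c \<cdot> g') \<cdot> t" unfolding i'(5) using z t by (simp add: cmp_ass)
    also have "\<dots> = c \<cdot> (g' \<cdot> t)" using z t(1,2) by (simp add: cmp_ass)
    also have "\<dots> = zero_arr K (src K t) (tgt K g)" unfolding t(3) using z t(1) by simp
    finally obtain u where u: "u \<in> hom K (src K t) (src K f)" "f \<cdot> u = b \<cdot> t"
      using dist_exact[OF d, of "b \<cdot> t"] z t by auto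
    note us = homD[OF u(1)]
    have "f' \<cdot> (a' \<cdot> u) = (b' \<cdot> f) \<cdot> u" unfolding r'(4) using z us by (simp add: cmp_ass)
    also have "\<dots> = b' \<cdot> (f \<cdot> u)" using z us by (simp add: cmp_ass)
    also have "\<dots> = (b' \<cdot> b) \<cdot> t" unfolding u(2) using z t by (simp add: cmp_ass)
    also have "\<dots> = t" unfolding ri(2) using t by simp
    finally show "\<exists>s \<in> hom K (src K t) (src K f'). f' \<cdot> s = t"
      using z us by (intro bexI[of _ "a' \<cdot> u"]) (auto simp: hom_def)
  next
    fix t assume t: "t \<in> arr K" "tgt K t = tgt K g'" "h' \<cdot> t = zero_arr K (src K t) (sus K (src K f'))"
    have "h \<cdot> (c \<cdot> t) = (susa K a \<cdot> h') \<cdot> t" unfolding i'(6) using z t by (simp add: cmp_ass)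
    also have "\<dots> = susa K a \<cdot> (h' \<cdot> t)" using z t(1,2) by (simp add: cmp_ass)
    also have "\<dots> = zero_arr K (src K t) (sus K (src K f))" unfolding t(3) using z t(1) by simp
    finally obtain u where u: "u \<in> hom K (src K t) (tgt K f)" "g \<cdot> u = c \<cdot> t"
      using dist_exact2[OF d, of "c \<cdot> t"] z t by auto
    note us = homD[OF u(1)]
    have "g' \<cdot> (b' \<cdot> u) = (c' \<cdot> g) \<cdot> u" unfolding r'(5) using z us by (simp add: cmp_ass)
    also have "\<dots> = c' \<cdot> (g \<cdot> u)" using z us by (simp add: cmp_ass)
    also have "\<dots> = (c' \<cdot> c) \<cdot> t" unfolding u(2) using z t by (simp add: cmp_ass)
    also have "\<dots> = t" unfolding ri(3) using t by simp
    finally show "\<exists>s \<in> hom K (src K t) (tgt K f'). g' \<cdot> s = t"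
      using z us by (intro bexI[of _ "b' \<cdot> u"]) (auto simp: hom_def)
  qed
qed

text \<open>The third map of a triangle on \<open>i\<close> is zero because the suspension of
  \<open>i\<close> is a split monomorphism. The triangle serves to show that ideals contain the sums
  of their members.\<close>

lemma dist_biproduct:
  assumes h: "i \<in> hom K x s" "j \<in> hom K y s" "p \<in> hom K s x" "q \<in> hom K s y"
    and e: "p \<cdot> i = idn K x" "q \<cdot> j = idn K y" "q \<cdot> i = zero_arr K x y" "(i \<cdot> p) \<oplus> (j \<cdot> q) = idn K s"
  shows "(i, q, zero_arr K y (sus K x)) \<in> dist K"
proof -
  note z = homD[OF h(1)] homD[OF h(2)] homD[OF h(3)] homD[OF h(4)]
  have o: "x \<in> obj K" "y \<in> obj K" "s \<in> obj K" using hom_obj[OF h(1)] hom_obj[OF h(2)] by auto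
  obtain g2 h2 where d: "(i, g2, h2) \<in> dist K" using dist_cone z by blast
  note s = dist_simps[OF d]
  have "susa K p \<cdot> (susa K i \<cdot> h2) = (susa K p \<cdot> susa K i) \<cdot> h2" using z s by (simp add: cmp_ass)
  also have "susa K p \<cdot> susa K i = idn K (sus K x)" using z e(1) o by (simp add: susa_comp[symmetric] susa_idn)
  finally have h2: "h2 = zero_arr K (tgt K g2) (sus K x)"
    unfolding dist_cmp_zero3[OF d] using z s by simp
  obtain \<theta> where t: "\<theta> \<in> hom K (tgt K g2) y" "\<theta> \<cdot> g2 = q"
    using dist_coexact[OF d, of q] z e(3) by auto
  note ts = homD[OF t(1)]
  show ?thesis
  proof (rule dist_of_exact[OF d])
    show "is_triangle K i q (zero_arr K y (sus K x))" using z o by (simp add: is_triangle_def)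
    show "\<theta> \<in> hom K (tgt K g2) (tgt K q)" "\<theta> \<cdot> g2 = q" using t z by simp_all
    show "zero_arr K y (sus K x) \<cdot> \<theta> = h2" using h2 ts o by simp
    show "susa K i \<cdot> zero_arr K y (sus K x) = zero_arr K (tgt K q) (sus K (tgt K i))" using z o by simp
    fix t assume t: "t \<in> arr K"
    {
      assume t2: "tgt K t = tgt K i" "q \<cdot> t = zero_arr K (src K t) (tgt K q)"
      have T: "t \<in> hom K (src K t) s" using t t2 z by (simp add: hom_def)
      have ip: "i \<cdot> p \<in> hom K s s" "j \<cdot> q \<in> hom K s s" using z by (simp_all add: hom_def)
      have "t = idn K s \<cdot> t" using idn_cmp[OF T] by simp
      also have "\<dots> = ((i \<cdot> p) \<cdot> t) \<oplus> ((j \<cdot> q) \<cdot> t)" unfolding e(4)[symmetric] by (rule plus_cmp[OF T ip])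
      also have "(j \<cdot> q) \<cdot> t = j \<cdot> (q \<cdot> t)" using z t t2(1) by (simp add: cmp_ass)
      also have "\<dots> = zero_arr K (src K t) s" unfolding t2(2) using z t by simp
      also have "((i \<cdot> p) \<cdot> t) \<oplus> zero_arr K (src K t) s = (i \<cdot> p) \<cdot> t"
        by (rule plus_zero[OF cmp_hom[OF T ip(1)]])
      finally have "i \<cdot> (p \<cdot> t) = t" using z t t2(1) by (simp add: cmp_ass)
      then show "\<exists>u \<in> hom K (src K t) (src K i). i \<cdot> u = t"
        using z t t2 by (intro bexI[of _ "p \<cdot> t"]) (auto simp: hom_def)
    next
      assume t2: "tgt K t = tgt K q"
      have "q \<cdot> (j \<cdot> t) = (q \<cdot> j) \<cdot> t" using z t t2 by (simp add: cmp_ass)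
      then show "\<exists>u \<in> hom K (src K t) (tgt K i). q \<cdot> u = t"
        unfolding e(2) using z t t2 by (intro bexI[of _ "j \<cdot> t"]) (auto simp: hom_def)
    }
  qed
qed

end

section \<open>Additive structure of modules: sums, linear idempotents and complements\<close>

section \<open>Triangles of modules\<close>

context tt_category
begin

lemma tens_plus_r: "\<lbrakk>f \<in> hom K x x'; g \<in> hom K y y'; h \<in> hom K y y'\<rbrakk> \<Longrightarrow> f \<otimes> (g \<oplus> h) = (f \<otimes> g) \<oplus> (f \<otimes> h)"
proof -
  assume f: "f \<in> hom K x x'" and g: "g \<in> hom K y y'" and h: "h \<in> hom K y y'"
  note z = homD[OF f] homD[OF g] homD[OF h] hom_obj[OF f] hom_obj[OF g]
  have "f \<otimes> (g \<oplus> h) = (f \<otimes> one y') \<cdot> (one x \<otimes> (g \<oplus> h))" by (simp add: z tens_cmp)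
  also have "\<dots> = (f \<otimes> one y') \<cdot> ((one x \<otimes> g) \<oplus> (one x \<otimes> h))" using tens_plus[OF _ g h] z by simp
  also have "\<dots> = (f \<otimes> g) \<oplus> (f \<otimes> h)"
    by (subst cmp_plus[of _ "x \<odot> y" "x \<odot> y'"]) (simp_all add: z hom_def tens_cmp)
  finally show ?thesis .
qed

lemma tens_plus_l: "\<lbrakk>f \<in> hom K x x'; g \<in> hom K y y'; h \<in> hom K y y'\<rbrakk> \<Longrightarrow> (g \<oplus> h) \<otimes> f = (g \<otimes> f) \<oplus> (h \<otimes> f)"
proof -
  assume f: "f \<in> hom K x x'" and g: "g \<in> hom K y y'" and h: "h \<in> hom K y y'"
  note z = homD[OF f] homD[OF g] homD[OF h] hom_obj[OF f] hom_obj[OF g]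
  have e: "k \<otimes> f = \<beta> x' y' \<cdot> ((f \<otimes> k) \<cdot> \<beta> y x)" if "k \<in> hom K y y'" for k
  proof -
    have "\<beta> x' y' \<cdot> ((f \<otimes> k) \<cdot> \<beta> y x) = (\<beta> x' y' \<cdot> (f \<otimes> k)) \<cdot> \<beta> y x"
      using that z by (simp add: cmp_ass hom_def)
    also have "\<dots> = k \<otimes> f" using that z by (simp add: \<beta>_nat \<beta>_\<beta> cmp_ass hom_def)
    finally show ?thesis by simp
  qed
  have "(g \<oplus> h) \<otimes> f = \<beta> x' y' \<cdot> (((f \<otimes> g) \<oplus> (f \<otimes> h)) \<cdot> \<beta> y x)"
    using e[OF plus_hom[OF g h]] tens_plus_r[OF f g h] by simp
  also have "\<dots> = \<beta> x' y' \<cdot> (((f \<otimes> g) \<cdot> \<beta> y x) \<oplus> ((f \<otimes> h) \<cdot> \<beta> y x))"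
    by (subst plus_cmp[of _ "y \<odot> x" "x \<odot> y" _ "x' \<odot> y'"]) (simp_all add: z hom_def)
  also have "\<dots> = (g \<otimes> f) \<oplus> (h \<otimes> f)"
    by (subst cmp_plus[of _ "y \<odot> x" "x' \<odot> y'"]) (simp_all add: z hom_def e[OF g] e[OF h])
  finally show ?thesis .
qed

lemma tens_zero_r [simp]:
  assumes "f \<in> arr K" "y \<in> obj K" "y' \<in> obj K"
  shows "f \<otimes> zero_arr K y y' = zero_arr K (src K f \<odot> y) (tgt K f \<odot> y')"
proof (rule plus_self_zero)
  have f: "f \<in> hom K (src K f) (tgt K f)" using assms by (simp add: hom_def)
  note z = zero_hom[OF assms(2,3)]
  show "f \<otimes> zero_arr K y y' \<in> hom K (src K f \<odot> y) (tgt K f \<odot> y')" by (rule tensa_hom[OF f z])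
  show "(f \<otimes> zero_arr K y y') \<oplus> (f \<otimes> zero_arr K y y') = f \<otimes> zero_arr K y y'"
    unfolding tens_plus_r[OF f z z, symmetric] zero_plus[OF z] ..
qed

lemma tens_zero_l [simp]:
  assumes "f \<in> arr K" "y \<in> obj K" "y' \<in> obj K"
  shows "zero_arr K y y' \<otimes> f = zero_arr K (y \<odot> src K f) (y' \<odot> tgt K f)"
proof (rule plus_self_zero)
  have f: "f \<in> hom K (src K f) (tgt K f)" using assms by (simp add: hom_def)
  note z = zero_hom[OF assms(2,3)]
  show "zero_arr K y y' \<otimes> f \<in> hom K (y \<odot> src K f) (y' \<odot> tgt K f)" by (rule tensa_hom[OF z f])
  show "(zero_arr K y y' \<otimes> f) \<oplus> (zero_arr K y y' \<otimes> f) = zero_arr K y y' \<otimes> f"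
    unfolding tens_plus_l[OF f z z, symmetric] zero_plus[OF z] ..
qed

context
  fixes A
  assumes A: "ring_object K A"
begin

lemma module_homs_plus:
  assumes M: "M \<in> modules K A" and N: "N \<in> modules K A"
    and f: "f \<in> module_homs K A M N" and g: "g \<in> module_homs K A M N"
  shows "f \<oplus> g \<in> module_homs K A M N"
proof -
  have fg: "f \<in> hom K (fst M) (fst N)" "g \<in> hom K (fst M) (fst N)" "f \<cdot> snd M = snd N \<cdot> (one (car A) \<otimes> f)"
    "g \<cdot> snd M = snd N \<cdot> (one (car A) \<otimes> g)" using f g by (auto simp: module_homs_def)
  note s = modules_simps[OF M] modules_simps[OF N] ring_simps[OF A]
  have m: "snd M \<in> hom K (car A \<odot> fst M) (fst M)" "snd N \<in> hom K (car A \<odot> fst N) (fst N)"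
    "one (car A) \<in> hom K (car A) (car A)"
    using s by (simp_all add: hom_def)
  have "(f \<oplus> g) \<cdot> snd M = (snd N \<cdot> (one (car A) \<otimes> f)) \<oplus> (snd N \<cdot> (one (car A) \<otimes> g))"
    using plus_cmp[OF m(1) fg(1,2)] fg(3,4) by simp
  also have "\<dots> = snd N \<cdot> (one (car A) \<otimes> (f \<oplus> g))"
    unfolding tens_plus_r[OF m(3) fg(1,2)]
    by (rule cmp_plus[symmetric, OF tensa_hom[OF m(3) fg(1)] tensa_hom[OF m(3) fg(2)] m(2)])
  finally show ?thesis using plus_hom[OF fg(1,2)] by (simp add: module_homs_def)
qed

lemma module_homs_zero:
  assumes M: "M \<in> modules K A" and N: "N \<in> modules K A"
  shows "zero_arr K (fst M) (fst N) \<in> module_homs K A M N"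
  using modules_simps[OF M] modules_simps[OF N] ring_simps[OF A] by (simp add: module_homs_def zero_hom)

lemma module_homs_neg:
  assumes M: "M \<in> modules K A" and N: "N \<in> modules K A" and f: "f \<in> module_homs K A M N"
  shows "neg_arr K f \<in> module_homs K A M N"
proof -
  have fg: "f \<in> hom K (fst M) (fst N)" "f \<cdot> snd M = snd N \<cdot> (one (car A) \<otimes> f)"
    using f by (auto simp: module_homs_def)
  note s = modules_simps[OF M] modules_simps[OF N] ring_simps[OF A]
  have m: "snd M \<in> hom K (car A \<odot> fst M) (fst M)" "snd N \<in> hom K (car A \<odot> fst N) (fst N)"
    "one (car A) \<in> hom K (car A) (car A)"
    using s by (simp_all add: hom_def)
  note n = neg_arr_props[OF fg(1)]
  have F: "one (car A) \<otimes> f \<in> hom K (car A \<odot> fst M) (car A \<odot> fst N)" by (rule tensa_hom[OF m(3) fg(1)])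
  have "one (car A) \<otimes> neg_arr K f = neg_arr K (one (car A) \<otimes> f)"
  proof (rule neg_unique[OF F])
    show "one (car A) \<otimes> neg_arr K f \<in> hom K (car A \<odot> fst M) (car A \<odot> fst N)" by (rule tensa_hom[OF m(3) n(1)])
    show "(one (car A) \<otimes> f) \<oplus> (one (car A) \<otimes> neg_arr K f) = zero_arr K (car A \<odot> fst M) (car A \<odot> fst N)"
      unfolding tens_plus_r[OF m(3) fg(1) n(1), symmetric] n(2) using s by simp
  qed
  then have "neg_arr K f \<cdot> snd M = snd N \<cdot> (one (car A) \<otimes> neg_arr K f)"
    using neg_cmp[OF m(1) fg(1)] cmp_neg[OF F m(2)] fg(2) by simp
  then show ?thesis using n(1) by (simp add: module_homs_def)
qed

definition mbip :: "'o \<times> 'm \<Rightarrow> 'o \<times> 'm \<Rightarrow> 'o \<times> 'm \<Rightarrow> bool" where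
  "mbip S X Y \<longleftrightarrow> S \<in> modules K A \<and> X \<in> modules K A \<and> Y \<in> modules K A \<and>
     (\<exists>i \<in> module_homs K A X S. \<exists>j \<in> module_homs K A Y S. \<exists>p \<in> module_homs K A S X. \<exists>q \<in> module_homs K A S Y.
        p \<cdot> i = one (fst X) \<and> q \<cdot> j = one (fst Y) \<and> q \<cdot> i = zero_arr K (fst X) (fst Y) \<and>
        p \<cdot> j = zero_arr K (fst Y) (fst X) \<and> (i \<cdot> p) \<oplus> (j \<cdot> q) = one (fst S))"

lemma mbip_retr: "mbip S X Y \<Longrightarrow> retr A X S" "mbip S X Y \<Longrightarrow> retr A Y S"
  unfolding mbip_def retr_def by blast+

text \<open>The action is transported along the splitting. Linearity of the idempotent
  \<open>i \<cdot> r\<close> is what makes \<open>i\<close> and \<open>r\<close> linear for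
  it.\<close>

lemma module_of_idempotent:
  assumes Y: "Y \<in> modules K A" and z: "z \<in> obj K" and i: "i \<in> hom K z (fst Y)" and r: "r \<in> hom K (fst Y) z"
    and ri: "r \<cdot> i = one z" and e: "i \<cdot> r \<in> module_homs K A Y Y"
  shows "\<exists>\<rho>. (z, \<rho>) \<in> modules K A \<and> i \<in> module_homs K A (z, \<rho>) Y \<and> r \<in> module_homs K A Y (z, \<rho>)"
proof -
  define \<rho> where "\<rho> = r \<cdot> (snd Y \<cdot> (one (car A) \<otimes> i))"
  note s = ring_simps[OF A] modules_simps[OF Y] z homD[OF i] homD[OF r]
  have \<rho>: "\<rho> \<in> arr K" "src K \<rho> = car A \<odot> z" "tgt K \<rho> = z" by (simp_all add: \<rho>_def s)
  have ir: "i \<star> r \<star> snd Y \<star> (a \<bowtie> y) = snd Y \<star> (a \<bowtie> (i \<star> r \<star> y))" if "el a" "el y" "ty a = car A" "ty y = fst Y" for a y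
    using linear_el[OF e Y Y A that] that by (simp add: s)
  have riz: "r \<star> i \<star> v = v" if "el v" "ty v = z" for v
    using arg_cong[OF ri, of "\<lambda>f. f \<star> v"] that by (simp add: s)
  have i\<rho>: "i \<star> \<rho> \<star> (a \<bowtie> v) = snd Y \<star> (a \<bowtie> (i \<star> v))" if "el a" "el v" "ty a = car A" "ty v = z" for a v
    using that by (simp add: \<rho>_def s ir riz)
  have r\<rho>: "\<rho> \<star> (a \<bowtie> (r \<star> y)) = r \<star> snd Y \<star> (a \<bowtie> y)" if "el a" "el y" "ty a = car A" "ty y = fst Y" for a y
  proof -
    have "\<rho> \<star> (a \<bowtie> (r \<star> y)) = r \<star> (i \<star> r \<star> snd Y \<star> (a \<bowtie> y))"
      using that by (simp add: \<rho>_def s ir)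
    then show ?thesis using that by (simp add: s riz)
  qed
  have \<rho>e: "\<rho> \<star> (a \<bowtie> v) = r \<star> snd Y \<star> (a \<bowtie> (i \<star> v))" if "el a" "el v" "ty a = car A" "ty v = z" for a v
    using that by (simp add: \<rho>_def s)
  have m: "(z, \<rho>) \<in> modules K A"
    by (rule modulesI[OF A z \<rho>, of "V 2 z"]) (simp_all add: A s \<rho> r\<rho> \<rho>e[of _ "V 2 z"] \<rho>e[of _ "\<rho> \<star> _"] i\<rho> act_act[OF Y A] act_uni[OF Y A] riz)
  moreover have "i \<in> module_homs K A (z, \<rho>) Y"
    by (rule module_homsI[OF m Y A, of _ "V 1 z"]) (simp_all add: s i\<rho>)
  moreover have "r \<in> module_homs K A Y (z, \<rho>)"
    by (rule module_homsI[OF Y m A, of _ "V 1 (fst Y)"]) (simp_all add: s r\<rho>)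
  ultimately show ?thesis by blast
qed

text \<open>The complement is the image of the linear idempotent that subtracts
  \<open>i \<cdot> r\<close> from the identity. Hence closure under direct summands, the condition
  in the definition of thick ideals, is closure under retracts.\<close>

lemma retr_complement:
  assumes "retr A X Y"
  shows "\<exists>Z. mbip Y X Z"
proof -
  obtain i r where X: "X \<in> modules K A" and Y: "Y \<in> modules K A" and i: "i \<in> module_homs K A X Y"
    and r: "r \<in> module_homs K A Y X" and ri: "r \<cdot> i = one (fst X)"
    using assms unfolding retr_def by blast
  note s = modules_simps[OF X] modules_simps[OF Y] module_homs_simps[OF i] module_homs_simps[OF r]
  let ?x = "fst X" and ?y = "fst Y"
  have ih: "i \<in> hom K ?x ?y" "r \<in> hom K ?y ?x" using s by (simp_all add: hom_def)
  have ir: "i \<cdot> r \<in> module_homs K A Y Y" by (rule module_homs_cmp[OF r i Y X Y A])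
  define e where "e = minus (one ?y) (i \<cdot> r)"
  have e: "e \<in> module_homs K A Y Y"
    unfolding e_def minus_def by (rule module_homs_plus[OF Y Y module_homs_idn[OF Y A] module_homs_neg[OF Y Y ir]])
  have h: "one ?y \<in> hom K ?y ?y" "i \<cdot> r \<in> hom K ?y ?y" using s by (simp_all add: hom_def)
  have re: "r \<cdot> e = zero_arr K ?y ?x"
  proof -
    have "r \<cdot> (i \<cdot> r) = (r \<cdot> i) \<cdot> r" using s by (simp add: cmp_ass)
    then have "r \<cdot> (i \<cdot> r) = r" unfolding ri using s by simp
    then show ?thesis unfolding e_def cmp_minus[OF h ih(2)] using minus_self[OF ih(2)] s by simp
  qed
  have ei: "e \<cdot> i = zero_arr K ?x ?y"
    unfolding e_def minus_cmp[OF ih(1) h] using minus_self[OF ih(1)] s ri by (simp add: cmp_ass)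
  note es = module_homs_simps[OF e]
  have ee: "e \<cdot> e = e"
  proof -
    have "(i \<cdot> r) \<cdot> e = i \<cdot> (r \<cdot> e)" using s es by (simp add: cmp_ass)
    also have "\<dots> = zero_arr K ?y ?y" unfolding re using s by simp
    finally have 1: "(i \<cdot> r) \<cdot> e = zero_arr K ?y ?y" .
    have eh: "e \<in> hom K ?y ?y" using es by (simp add: hom_def)
    have "e \<cdot> e = minus (one ?y \<cdot> e) ((i \<cdot> r) \<cdot> e)"
      by (subst (1) e_def) (rule minus_cmp[OF eh h])
    also have "\<dots> = e" unfolding 1 using es s neg_zero plus_zero[OF eh] by (simp add: minus_def)
    finally show ?thesis .
  qed
  have "e \<in> hom K ?y ?y" using es by (simp add: hom_def)
  with ee s obtain z i' r' where z: "z \<in> obj K" "i' \<in> hom K z ?y" "r' \<in> hom K ?y z" "r' \<cdot> i' = one z" "i' \<cdot> r' = e"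
    using idempotents_split unfolding idempotent_complete_def by metis
  obtain \<rho> where \<rho>: "(z, \<rho>) \<in> modules K A" "i' \<in> module_homs K A (z, \<rho>) Y" "r' \<in> module_homs K A Y (z, \<rho>)"
    using module_of_idempotent[OF Y z(1-4)] e z(5) by metis
  note zs = z(1) homD[OF z(2)] homD[OF z(3)]
  have "r' \<cdot> i = (r' \<cdot> i') \<cdot> (r' \<cdot> i)" unfolding z(4) using s zs by simp
  also have "\<dots> = r' \<cdot> (e \<cdot> i)" unfolding z(5)[symmetric] using s zs by (simp add: cmp_ass)
  also have "\<dots> = zero_arr K ?x z" unfolding ei using s zs by simp
  finally have 1: "r' \<cdot> i = zero_arr K ?x z" .
  have "r \<cdot> i' = (r \<cdot> i') \<cdot> (r' \<cdot> i')" unfolding z(4) using s zs by simp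
  also have "\<dots> = (r \<cdot> e) \<cdot> i'" unfolding z(5)[symmetric] using s zs by (simp add: cmp_ass)
  also have "\<dots> = zero_arr K z ?x" unfolding re using s zs by simp
  finally have 2: "r \<cdot> i' = zero_arr K z ?x" .
  have eh: "e \<in> hom K ?y ?y" using es by (simp add: hom_def)
  have 3: "(i \<cdot> r) \<oplus> (i' \<cdot> r') = one ?y"
    unfolding z(5) using minus_plus[OF h] plus_comm[OF h(2) eh] by (simp add: e_def)
  show ?thesis
    unfolding mbip_def using X Y \<rho> i r ri z(4) 1 2 3 by (intro exI[of _ "(z, \<rho>)"]) auto
qed

text \<open>The action is assembled from its two components and verified after the two projections,
  which are jointly monic. Direct sums of modules are what makes the defining open sets of the
  spectrum closed under intersection.\<close>

lemma mbip_ex: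
  assumes M: "M \<in> modules K A" and N: "N \<in> modules K A"
  shows "\<exists>S. mbip S M N"
proof -
  note s = ring_simps[OF A] modules_simps[OF M] modules_simps[OF N]
  let ?m = "fst M" and ?n = "fst N" and ?a = "car A"
  obtain w where "is_biproduct K w ?m ?n" using biproduct_ex s by blast
  then obtain i j p q where w: "w \<in> obj K" and h: "i \<in> hom K ?m w" "j \<in> hom K ?n w" "p \<in> hom K w ?m" "q \<in> hom K w ?n"
    and e: "p \<cdot> i = one ?m" "q \<cdot> j = one ?n" "q \<cdot> i = zero_arr K ?m ?n" "p \<cdot> j = zero_arr K ?n ?m"
      "(i \<cdot> p) \<oplus> (j \<cdot> q) = one w"
    unfolding is_biproduct_def by blast
  note hs = w homD[OF h(1)] homD[OF h(2)] homD[OF h(3)] homD[OF h(4)]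
  have jm: "f = g" if f: "f \<in> hom K v w" and g: "g \<in> hom K v w" and pf: "p \<cdot> f = p \<cdot> g" and qf: "q \<cdot> f = q \<cdot> g" for f g v
  proof -
    have *: "k = (i \<cdot> (p \<cdot> k)) \<oplus> (j \<cdot> (q \<cdot> k))" if k: "k \<in> hom K v w" for k
    proof -
      have "k = one w \<cdot> k" using idn_cmp[OF k] by simp
      also have "\<dots> = ((i \<cdot> p) \<cdot> k) \<oplus> ((j \<cdot> q) \<cdot> k)"
        unfolding e(5)[symmetric] by (rule plus_cmp[OF k]) (use hs in \<open>simp_all add: hom_def\<close>)
      finally show ?thesis using homD[OF k] hs by (simp add: cmp_ass)
    qed
    show ?thesis using *[OF f] *[OF g] pf qf by simp
  qed
  have jme: "t = t'" if t: "el t" "el t'" "ty t = w" "ty t' = w" "fst t = fst t'" "p \<star> t = p \<star> t'" "q \<star> t = q \<star> t'" for t t'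
  proof -
    have "snd t = snd t'"
      by (rule jm[of _ "tl_obj (fst t)"]) (use t in \<open>auto simp: hom_def el_def ty_def ap_def\<close>)
    with t(5) show ?thesis by (simp add: prod_eq_iff)
  qed
  define \<rho>1 where "\<rho>1 = i \<cdot> (snd M \<cdot> (one ?a \<otimes> p))"
  define \<rho>2 where "\<rho>2 = j \<cdot> (snd N \<cdot> (one ?a \<otimes> q))"
  have r12: "\<rho>1 \<in> hom K (?a \<odot> w) w" "\<rho>2 \<in> hom K (?a \<odot> w) w" by (simp_all add: \<rho>1_def \<rho>2_def hom_def s hs)
  define \<rho> where "\<rho> = \<rho>1 \<oplus> \<rho>2"
  have \<rho>: "\<rho> \<in> arr K" "src K \<rho> = ?a \<odot> w" "tgt K \<rho> = w"
    unfolding \<rho>_def by (rule homD[OF plus_hom[OF r12]])+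
  have M1: "snd M \<cdot> (one ?a \<otimes> p) \<in> hom K (?a \<odot> w) ?m" "snd N \<cdot> (one ?a \<otimes> q) \<in> hom K (?a \<odot> w) ?n"
    by (simp_all add: s hs hom_def)
  note Ms = homD[OF M1(1)] homD[OF M1(2)]
  have p: "p \<cdot> \<rho> = snd M \<cdot> (one ?a \<otimes> p)"
  proof -
    have "p \<cdot> \<rho> = ((p \<cdot> i) \<cdot> (snd M \<cdot> (one ?a \<otimes> p))) \<oplus> ((p \<cdot> j) \<cdot> (snd N \<cdot> (one ?a \<otimes> q)))"
      unfolding \<rho>_def cmp_plus[OF r12 h(3)] using Ms hs by (simp add: \<rho>1_def \<rho>2_def cmp_ass)
    also have "\<dots> = snd M \<cdot> (one ?a \<otimes> p)" unfolding e(1,4) using Ms s plus_zero[OF M1(1)] by simp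
    finally show ?thesis .
  qed
  have q: "q \<cdot> \<rho> = snd N \<cdot> (one ?a \<otimes> q)"
  proof -
    have "q \<cdot> \<rho> = ((q \<cdot> i) \<cdot> (snd M \<cdot> (one ?a \<otimes> p))) \<oplus> ((q \<cdot> j) \<cdot> (snd N \<cdot> (one ?a \<otimes> q)))"
      unfolding \<rho>_def cmp_plus[OF r12 h(4)] using Ms hs by (simp add: \<rho>1_def \<rho>2_def cmp_ass)
    also have "\<dots> = snd N \<cdot> (one ?a \<otimes> q)" unfolding e(2,3) using Ms s zero_plus[OF M1(2)] by simp
    finally show ?thesis .
  qed
  have pe: "p \<star> \<rho> \<star> (a \<bowtie> v) = snd M \<star> (a \<bowtie> (p \<star> v))" if "el a" "el v" "ty a = ?a" "ty v = w" for a v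
    using arg_cong[OF p, of "\<lambda>f. f \<star> (a \<bowtie> v)"] that by (simp add: s hs \<rho>)
  have qe: "q \<star> \<rho> \<star> (a \<bowtie> v) = snd N \<star> (a \<bowtie> (q \<star> v))" if "el a" "el v" "ty a = ?a" "ty v = w" for a v
    using arg_cong[OF q, of "\<lambda>f. f \<star> (a \<bowtie> v)"] that by (simp add: s hs \<rho>)
  \<comment> \<open>The side condition of \<open>jme\<close> on stages: on both sides the labels are
    merged to the same list.\<close>
  have ass: "fst (\<rho> \<star> (a \<bowtie> (\<rho> \<star> (b \<bowtie> v)))) = fst (\<rho> \<star> ((mul A \<star> (a \<bowtie> b)) \<bowtie> v))" for a b v
    by (simp add: ap_def tn_def merge_assoc)
  have uni: "fst (\<rho> \<star> ((uni A \<star> u1) \<bowtie> v)) = fst v" for v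
    by (simp add: ap_def tn_def u1_def)
  have S: "(w, \<rho>) \<in> modules K A"
  proof (rule modulesI[OF A w \<rho>, of "V 2 w"])
    fix a b assume ab: "el a" "el b" "ty a = ?a" "ty b = ?a"
    show "\<rho> \<star> (a \<bowtie> (\<rho> \<star> (b \<bowtie> V 2 w))) = \<rho> \<star> ((mul A \<star> (a \<bowtie> b)) \<bowtie> V 2 w)"
      by (rule jme) (simp_all add: ab s hs \<rho> pe qe ass act_act[OF M A] act_act[OF N A])
  next
    show "\<rho> \<star> ((uni A \<star> u1) \<bowtie> V 2 w) = V 2 w"
      by (rule jme) (simp_all add: s hs \<rho> pe qe uni act_uni[OF M A] act_uni[OF N A])
  qed (simp_all add: hs)
  have pq: "p \<in> module_homs K A (w, \<rho>) M" "q \<in> module_homs K A (w, \<rho>) N"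
    by (simp_all add: module_homs_def h p q)
  have i: "i \<in> module_homs K A M (w, \<rho>)"
  proof -
    have "i \<cdot> snd M = \<rho> \<cdot> (one ?a \<otimes> i)"
    proof (rule jm)
      show "i \<cdot> snd M \<in> hom K (?a \<odot> ?m) w" "\<rho> \<cdot> (one ?a \<otimes> i) \<in> hom K (?a \<odot> ?m) w" using s hs \<rho> by (simp_all add: hom_def)
      have "p \<cdot> (\<rho> \<cdot> (one ?a \<otimes> i)) = snd M \<cdot> (one ?a \<otimes> (p \<cdot> i))"
        using s hs \<rho> p by (simp add: cmp_ass[symmetric]) (simp add: cmp_ass tens_cmp)
      then show "p \<cdot> (i \<cdot> snd M) = p \<cdot> (\<rho> \<cdot> (one ?a \<otimes> i))"
        unfolding e(1) using s hs e(1) by (simp add: cmp_ass[symmetric])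
      have "q \<cdot> (\<rho> \<cdot> (one ?a \<otimes> i)) = snd N \<cdot> (one ?a \<otimes> (q \<cdot> i))"
        using s hs \<rho> q by (simp add: cmp_ass[symmetric]) (simp add: cmp_ass tens_cmp)
      then show "q \<cdot> (i \<cdot> snd M) = q \<cdot> (\<rho> \<cdot> (one ?a \<otimes> i))"
        unfolding e(3) using s hs e(3) by (simp add: cmp_ass[symmetric])
    qed
    then show ?thesis using h by (simp add: module_homs_def)
  qed
  have j: "j \<in> module_homs K A N (w, \<rho>)"
  proof -
    have "j \<cdot> snd N = \<rho> \<cdot> (one ?a \<otimes> j)"
    proof (rule jm)
      show "j \<cdot> snd N \<in> hom K (?a \<odot> ?n) w" "\<rho> \<cdot> (one ?a \<otimes> j) \<in> hom K (?a \<odot> ?n) w" using s hs \<rho> by (simp_all add: hom_def)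
      have "p \<cdot> (\<rho> \<cdot> (one ?a \<otimes> j)) = snd M \<cdot> (one ?a \<otimes> (p \<cdot> j))"
        using s hs \<rho> p by (simp add: cmp_ass[symmetric]) (simp add: cmp_ass tens_cmp)
      then show "p \<cdot> (j \<cdot> snd N) = p \<cdot> (\<rho> \<cdot> (one ?a \<otimes> j))"
        unfolding e(4) using s hs e(4) by (simp add: cmp_ass[symmetric])
      have "q \<cdot> (\<rho> \<cdot> (one ?a \<otimes> j)) = snd N \<cdot> (one ?a \<otimes> (q \<cdot> j))"
        using s hs \<rho> q by (simp add: cmp_ass[symmetric]) (simp add: cmp_ass tens_cmp)
      then show "q \<cdot> (j \<cdot> snd N) = q \<cdot> (\<rho> \<cdot> (one ?a \<otimes> j))"
        unfolding e(2) using s hs e(2) by (simp add: cmp_ass[symmetric])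
    qed
    then show ?thesis using h by (simp add: module_homs_def)
  qed
  show ?thesis
    unfolding mbip_def using S M N i j pq e by (intro exI[of _ "(w, \<rho>)"]) auto
qed

end

section \<open>Suspension of modules and exactness of the relative tensor product\<close>

lemma tsus_simps [simp]:
  assumes "x \<in> obj K" "y \<in> obj K"
  shows "iso (tsus K x y)" "tsus K x y \<in> arr K" "src K (tsus K x y) = x \<odot> sus K y" "tgt K (tsus K x y) = sus K (x \<odot> y)"
  using isos_iso[OF tsus_iso[OF assms]] homD[OF isos_hom[OF tsus_iso[OF assms]]] by simp_all

lemma tsus_nat: "\<lbrakk>f \<in> arr K; g \<in> arr K; tgt K f = x'; tgt K g = y'\<rbrakk> \<Longrightarrow>
   tsus K x' y' \<cdot> (f \<otimes> susa K g) = susa K (f \<otimes> g) \<cdot> tsus K (src K f) (src K g)"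
  using tsus_natural[of f "src K f" x' g "src K g" y'] by (simp add: hom_def)

lemma tsus_nat1: "\<lbrakk>f \<in> arr K; y \<in> obj K; tgt K f = x'\<rbrakk> \<Longrightarrow>
   tsus K x' y \<cdot> (f \<otimes> one (sus K y)) = susa K (f \<otimes> one y) \<cdot> tsus K (src K f) y"
  using tsus_nat[of f "one y" x' y] by (simp add: susa_idn)

lemma tsus_ass: "\<lbrakk>x \<in> obj K; y \<in> obj K; z \<in> obj K\<rbrakk>
      \<Longrightarrow> tsus K x (y \<odot> z) \<cdot> ((one x \<otimes> tsus K y z) \<cdot> \<alpha> x y (sus K z)) = susa K (\<alpha> x y z) \<cdot> tsus K (x \<odot> y) z"
  using tsus_assoc[of x y z] by (simp add: cmp_ass)

lemma susa_inv: "iso f \<Longrightarrow> susa K f \<cdot> susa K (inv f) = one (sus K (tgt K f))"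
   "iso f \<Longrightarrow> susa K (inv f) \<cdot> susa K f = one (sus K (src K f))"
  by (simp_all add: susa_comp[symmetric] susa_idn)

lemma tsus_inv_ass: "\<lbrakk>x \<in> obj K; y \<in> obj K; z \<in> obj K\<rbrakk>
      \<Longrightarrow> tsus K (x \<odot> y) z \<cdot> inv (\<alpha> x y (sus K z)) = susa K (inv (\<alpha> x y z)) \<cdot> (tsus K x (y \<odot> z) \<cdot> (one x \<otimes> tsus K y z))"
proof -
  assume o: "x \<in> obj K" "y \<in> obj K" "z \<in> obj K"
  let ?t = "tsus K (x \<odot> y) z"
  have "(susa K (inv (\<alpha> x y z)) \<cdot> (tsus K x (y \<odot> z) \<cdot> (one x \<otimes> tsus K y z))) \<cdot> \<alpha> x y (sus K z)
      = susa K (inv (\<alpha> x y z)) \<cdot> (susa K (\<alpha> x y z) \<cdot> ?t)"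
    using o by (simp add: cmp_ass tsus_ass)
  also have "\<dots> = (susa K (inv (\<alpha> x y z)) \<cdot> susa K (\<alpha> x y z)) \<cdot> ?t" using o by (simp add: cmp_ass)
  also have "\<dots> = (?t \<cdot> inv (\<alpha> x y (sus K z))) \<cdot> \<alpha> x y (sus K z)" using o by (simp add: susa_inv cmp_ass)
  finally show ?thesis by (rule iso_cancel_r[rotated -1, symmetric]) (use o in simp_all)
qed

lemma module_sus_simps:
  "fst (module_sus K A M) = sus K (fst M)" "snd (module_sus K A M) = susa K (snd M) \<cdot> tsus K (car A) (fst M)"
  by (simp_all add: module_sus_def)

lemma module_sus_module:
  assumes A: "ring_object K A" and M: "M \<in> modules K A"
  shows "module_sus K A M \<in> modules K A"
proof -
  let ?a = "car A" and ?x = "fst M" and ?\<rho> = "snd M"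
  note s = A modules_simps[OF M]
  have m: "?\<rho> \<cdot> (mul A \<otimes> one ?x) = ?\<rho> \<cdot> ((one ?a \<otimes> ?\<rho>) \<cdot> \<alpha> ?a ?a ?x)" "?\<rho> \<cdot> (uni A \<otimes> one ?x) = lu ?x"
    using M s by (auto simp: modules_def cmp_ass)
  let ?r = "susa K ?\<rho> \<cdot> tsus K ?a ?x"
  have "?r \<cdot> (mul A \<otimes> one (sus K ?x)) = susa K (?\<rho> \<cdot> (mul A \<otimes> one ?x)) \<cdot> tsus K (?a \<odot> ?a) ?x"
    by (simp add: s cmp_ass tsus_nat1 susa_comp)
  also have "\<dots> = susa K (?\<rho> \<cdot> (one ?a \<otimes> ?\<rho>)) \<cdot> (susa K (\<alpha> ?a ?a ?x) \<cdot> tsus K (?a \<odot> ?a) ?x)"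
    unfolding m by (simp add: s cmp_ass susa_comp)
  also have "\<dots> = susa K ?\<rho> \<cdot> ((susa K (one ?a \<otimes> ?\<rho>) \<cdot> tsus K ?a (?a \<odot> ?x)) \<cdot> ((one ?a \<otimes> tsus K ?a ?x) \<cdot> \<alpha> ?a ?a (sus K ?x)))"
    by (simp add: s cmp_ass susa_comp tsus_ass[symmetric])
  also have "susa K (one ?a \<otimes> ?\<rho>) \<cdot> tsus K ?a (?a \<odot> ?x) = tsus K ?a ?x \<cdot> (one ?a \<otimes> susa K ?\<rho>)"
    using tsus_nat[of "one ?a" ?\<rho> ?a ?x] by (simp add: s)
  also have "susa K ?\<rho> \<cdot> ((tsus K ?a ?x \<cdot> (one ?a \<otimes> susa K ?\<rho>)) \<cdot> ((one ?a \<otimes> tsus K ?a ?x) \<cdot> \<alpha> ?a ?a (sus K ?x)))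
     = ?r \<cdot> (one ?a \<otimes> ?r) \<cdot> \<alpha> ?a ?a (sus K ?x)"
    by (simp add: s cmp_ass tens_cmp')
  finally have 1: "?r \<cdot> (mul A \<otimes> one (sus K ?x)) = ?r \<cdot> (one ?a \<otimes> ?r) \<cdot> \<alpha> ?a ?a (sus K ?x)" .
  have "?r \<cdot> (uni A \<otimes> one (sus K ?x)) = susa K (?\<rho> \<cdot> (uni A \<otimes> one ?x)) \<cdot> tsus K \<one> ?x"
    by (simp add: s cmp_ass tsus_nat1 susa_comp)
  also have "\<dots> = lu (sus K ?x)" unfolding m using s by (simp add: tsus_unit)
  finally have 2: "?r \<cdot> (uni A \<otimes> one (sus K ?x)) = lu (sus K ?x)" .
  show ?thesis unfolding module_sus_def modules_def using 1 2 by (simp add: s hom_def)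
qed

lemma module_homs_sus:
  assumes A: "ring_object K A" and M: "M \<in> modules K A" and N: "N \<in> modules K A" and f: "f \<in> module_homs K A M N"
  shows "susa K f \<in> module_homs K A (module_sus K A M) (module_sus K A N)"
proof -
  note s = A modules_simps[OF M] modules_simps[OF N] module_homs_simps[OF f]
  let ?a = "car A"
  have "susa K f \<cdot> (susa K (snd M) \<cdot> tsus K ?a (fst M)) = susa K (f \<cdot> snd M) \<cdot> tsus K ?a (fst M)"
    by (simp add: s susa_comp cmp_ass)
  also have "f \<cdot> snd M = snd N \<cdot> (one ?a \<otimes> f)" using f by (simp add: module_homs_def)
  also have "susa K (snd N \<cdot> (one ?a \<otimes> f)) \<cdot> tsus K ?a (fst M) = susa K (snd N) \<cdot> (susa K (one ?a \<otimes> f) \<cdot> tsus K ?a (fst M))"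
    by (simp add: s susa_comp cmp_ass)
  also have "susa K (one ?a \<otimes> f) \<cdot> tsus K ?a (fst M) = tsus K ?a (fst N) \<cdot> (one ?a \<otimes> susa K f)"
    using tsus_nat[of "one ?a" f ?a "fst N"] by (simp add: s)
  finally show ?thesis by (simp add: module_homs_def module_sus_simps s hom_def cmp_ass)
qed

lemma restr_sus:
  assumes f: "f \<in> ring_homs K R B" and M: "M \<in> modules K B"
  shows "restr f (module_sus K B M) = module_sus K R (restr f M)"
  using tsus_nat1[of f "fst M" "car B"] modules_simps[OF M] ring_homs_simps[OF f] hom_obj[of f "car R" "car B"]
  by (simp add: restr_def module_sus_def susa_comp cmp_ass hom_def)

lemma coact_sus:
  assumes R: "tt_ring K R" and N: "N \<in> modules K R"
  shows "tsus K (car R) (fst N) \<cdot> coact R (module_sus K R N) = susa K (coact R N)"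
proof -
  let ?r = "car R" and ?n = "fst N" and ?\<rho> = "snd N"
  note s = tt_ringD(1)[OF R] modules_simps[OF N] sep_simps(1-3)[OF tt_ringD(3)[OF R]]
  let ?e = "sep R \<cdot> uni R"
  have "tsus K ?r ?n \<cdot> coact R (module_sus K R N) =
    (tsus K ?r ?n \<cdot> (one ?r \<otimes> susa K ?\<rho>)) \<cdot> ((one ?r \<otimes> tsus K ?r ?n) \<cdot> (\<alpha> ?r ?r (sus K ?n) \<cdot> ((?e \<otimes> one (sus K ?n)) \<cdot> inv (lu (sus K ?n)))))"
    by (simp add: coact_def module_sus_simps s cmp_ass tens_cmp')
  also have "tsus K ?r ?n \<cdot> (one ?r \<otimes> susa K ?\<rho>) = susa K (one ?r \<otimes> ?\<rho>) \<cdot> tsus K ?r (?r \<odot> ?n)"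
    by (simp add: s tsus_nat)
  also have "(susa K (one ?r \<otimes> ?\<rho>) \<cdot> tsus K ?r (?r \<odot> ?n)) \<cdot> ((one ?r \<otimes> tsus K ?r ?n) \<cdot> (\<alpha> ?r ?r (sus K ?n) \<cdot> ((?e \<otimes> one (sus K ?n)) \<cdot> inv (lu (sus K ?n)))))
    = susa K (one ?r \<otimes> ?\<rho>) \<cdot> ((tsus K ?r (?r \<odot> ?n) \<cdot> ((one ?r \<otimes> tsus K ?r ?n) \<cdot> \<alpha> ?r ?r (sus K ?n))) \<cdot> ((?e \<otimes> one (sus K ?n)) \<cdot> inv (lu (sus K ?n))))"
    by (simp add: s cmp_ass)
  also have "\<dots> = susa K (one ?r \<otimes> ?\<rho>) \<cdot> (susa K (\<alpha> ?r ?r ?n) \<cdot> ((tsus K (?r \<odot> ?r) ?n \<cdot> (?e \<otimes> one (sus K ?n))) \<cdot> inv (lu (sus K ?n))))"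
    using s by (simp only: tsus_ass ring_simps) (simp add: s cmp_ass)
  also have "tsus K (?r \<odot> ?r) ?n \<cdot> (?e \<otimes> one (sus K ?n)) = susa K (?e \<otimes> one ?n) \<cdot> tsus K \<one> ?n"
    by (simp add: s tsus_nat1)
  also have "(susa K (?e \<otimes> one ?n) \<cdot> tsus K \<one> ?n) \<cdot> inv (lu (sus K ?n)) = susa K (?e \<otimes> one ?n) \<cdot> susa K (inv (lu ?n))"
  proof -
    have "tsus K \<one> ?n \<cdot> inv (lu (sus K ?n)) = susa K (inv (lu ?n))"
    proof (rule iso_cancel_r[of "lu (sus K ?n)"])
      have "(tsus K \<one> ?n \<cdot> inv (lu (sus K ?n))) \<cdot> lu (sus K ?n) = (susa K (inv (lu ?n)) \<cdot> susa K (lu ?n)) \<cdot> tsus K \<one> ?n"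
        by (simp add: s cmp_ass susa_inv)
      also have "\<dots> = susa K (inv (lu ?n)) \<cdot> (susa K (lu ?n) \<cdot> tsus K \<one> ?n)" by (simp add: s cmp_ass)
      also have "\<dots> = susa K (inv (lu ?n)) \<cdot> lu (sus K ?n)" using s by (simp only: tsus_unit)
      finally show "(tsus K \<one> ?n \<cdot> inv (lu (sus K ?n))) \<cdot> lu (sus K ?n) = susa K (inv (lu ?n)) \<cdot> lu (sus K ?n)" .
    qed (simp_all add: s)
    then show ?thesis by (simp add: s cmp_ass)
  qed
  also have "susa K (one ?r \<otimes> ?\<rho>) \<cdot> (susa K (\<alpha> ?r ?r ?n) \<cdot> (susa K (?e \<otimes> one ?n) \<cdot> susa K (inv (lu ?n)))) = susa K (coact R N)"
    by (simp add: coact_def s susa_comp)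
  finally show ?thesis .
qed

context
  fixes R M N
  assumes R: "tt_ring K R" and M: "M \<in> modules K R" and N: "N \<in> modules K R"
begin

lemma SN: "module_sus K R N \<in> modules K R"
  by (rule module_sus_module[OF tt_ringD(1)[OF R] N])

text \<open>Scalars pass through \<open>tsus\<close> by its naturality and associativity, the
  coaction by \<open>coact_sus\<close>. So the idempotents for \<open>N\<close> and for its
  suspension correspond, and \<open>tsus\<close> descends to the relative tensor products.\<close>

lemma tpi_sus: "tsus K (fst M) (fst N) \<cdot> tpi R M (module_sus K R N) = susa K (tpi R M N) \<cdot> tsus K (fst M) (fst N)"
proof -
  let ?m = "fst M" and ?r = "car R" and ?n = "fst N"
  note s = RMN_simps[OF R M N] coact_simps[OF R SN] module_sus_simps
  let ?b = "snd M \<cdot> \<beta> ?m ?r"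
  have b: "?b \<in> arr K" "src K ?b = ?m \<odot> ?r" "tgt K ?b = ?m" by (simp_all add: s)
  have "tsus K ?m ?n \<cdot> tpi R M (module_sus K R N) =
      (tsus K ?m ?n \<cdot> (?b \<otimes> one (sus K ?n))) \<cdot> (inv (\<alpha> ?m ?r (sus K ?n)) \<cdot> (one ?m \<otimes> coact R (module_sus K R N)))"
    by (simp add: tpi_def pre_pi_def s cmp_ass)
  also have "tsus K ?m ?n \<cdot> (?b \<otimes> one (sus K ?n)) = susa K (?b \<otimes> one ?n) \<cdot> tsus K (?m \<odot> ?r) ?n"
    using b by (simp add: s tsus_nat1)
  also have "(susa K (?b \<otimes> one ?n) \<cdot> tsus K (?m \<odot> ?r) ?n) \<cdot> (inv (\<alpha> ?m ?r (sus K ?n)) \<cdot> (one ?m \<otimes> coact R (module_sus K R N)))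
     = susa K (?b \<otimes> one ?n) \<cdot> ((tsus K (?m \<odot> ?r) ?n \<cdot> inv (\<alpha> ?m ?r (sus K ?n))) \<cdot> (one ?m \<otimes> coact R (module_sus K R N)))"
    by (simp add: s cmp_ass)
  also have "\<dots> = susa K (?b \<otimes> one ?n) \<cdot> (susa K (inv (\<alpha> ?m ?r ?n)) \<cdot> (tsus K ?m (?r \<odot> ?n) \<cdot> (one ?m \<otimes> (tsus K ?r ?n \<cdot> coact R (module_sus K R N)))))"
    using s(1) s(4,8) by (simp only: tsus_inv_ass ring_simps) (simp add: s cmp_ass tens_cmp)
  also have "\<dots> = susa K (?b \<otimes> one ?n) \<cdot> (susa K (inv (\<alpha> ?m ?r ?n)) \<cdot> (susa K (one ?m \<otimes> coact R N) \<cdot> tsus K ?m ?n))"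
    unfolding coact_sus[OF R N] by (simp add: s tsus_nat)
  also have "\<dots> = susa K (tpi R M N) \<cdot> tsus K ?m ?n"
    by (simp add: tpi_def pre_pi_def s susa_comp cmp_ass)
  finally show ?thesis .
qed

lemma tpi_natural:
  assumes N': "N' \<in> modules K R" and g: "g \<in> module_homs K R N N'"
  shows "tpi R M N' \<cdot> (one (fst M) \<otimes> g) = (one (fst M) \<otimes> g) \<cdot> tpi R M N"
proof -
  note s = RMN_simps[OF R M N] RMN_simps[OF R M N'] module_homs_simps[OF g] pre_pi_simps[OF R M N] pre_pi_simps[OF R M N']
  have 1: "pre_pi R M N' \<cdot> (one (fst M) \<otimes> (one (car R) \<otimes> g)) = (one (fst M) \<otimes> g) \<cdot> pre_pi R M N"
    by (rule gen_eqI[of "V 0 (fst M) \<bowtie> (V 1 (car R) \<bowtie> V 2 (fst N))"])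
      (simp_all add: s pre_pi_el[OF R M N] pre_pi_el[OF R M N'])
  have "tpi R M N' \<cdot> (one (fst M) \<otimes> g) = pre_pi R M N' \<cdot> (one (fst M) \<otimes> (coact R N' \<cdot> g))"
    by (simp add: s tpi_def cmp_ass tens_cmp)
  also have "\<dots> = (pre_pi R M N' \<cdot> (one (fst M) \<otimes> (one (car R) \<otimes> g))) \<cdot> (one (fst M) \<otimes> coact R N)"
    unfolding coact_natural[OF R N N' g] by (simp add: s cmp_ass tens_cmp)
  also have "\<dots> = (one (fst M) \<otimes> g) \<cdot> tpi R M N"
    unfolding 1 by (simp add: s tpi_def cmp_ass)
  finally show ?thesis .
qed

end

context
  fixes R B f M N
  assumes R: "tt_ring K R" and B: "tt_ring K B" and f: "f \<in> ring_homs K R B"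
    and M: "M \<in> modules K B" and N: "N \<in> modules K R"
begin

lemma N_sus: "module_sus K R N \<in> modules K R"
  by (rule module_sus_module[OF tt_ringD(1)[OF R] N])

definition sus_map :: "'m" where
  "sus_map = susa K (tq R f M N) \<cdot> (tsus K (fst M) (fst N) \<cdot> ts R f M (module_sus K R N))"

definition sus_inv :: "'m" where
  "sus_inv = tq R f M (module_sus K R N) \<cdot> (inv (tsus K (fst M) (fst N)) \<cdot> susa K (ts R f M N))"

lemmas sus_facts = RBMN_simps[OF R B f M N] tq_simps[OF R B f M N] tens_over_simps[OF R B f M N]
  tq_simps[OF R B f M N_sus] tens_over_simps[OF R B f M N_sus] module_sus_simps
  tpi_simps[OF R restr_M[OF R B f M N] N] tpi_simps[OF R restr_M[OF R B f M N] N_sus]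

lemma quot_tpi: "tq R f M N \<cdot> tpi R (restr f M) N = tq R f M N"
  using tsec_quot[OF R restr_M[OF R B f M N] N] by (simp add: sus_facts cmp_ass[symmetric] flip: tsec_quot[OF R restr_M[OF R B f M N] N])

lemma sus_map_simps: "sus_map \<in> arr K" "src K sus_map = fst (tens_over R B f M (module_sus K R N))"
   "tgt K sus_map = sus K (fst (tens_over R B f M N))"
  "sus_inv \<in> arr K" "tgt K sus_inv = fst (tens_over R B f M (module_sus K R N))"
   "src K sus_inv = sus K (fst (tens_over R B f M N))"
  by (simp_all add: sus_map_def sus_inv_def sus_facts)

lemma sus_map_quot: "sus_map \<cdot> tq R f M (module_sus K R N) = susa K (tq R f M N) \<cdot> tsus K (fst M) (fst N)"
proof -
  let ?t = "tsus K (fst M) (fst N)"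
  have "sus_map \<cdot> tq R f M (module_sus K R N) = susa K (tq R f M N) \<cdot> (?t \<cdot> (ts R f M (module_sus K R N) \<cdot> tq R f M (module_sus K R N)))"
    by (simp add: sus_map_def sus_facts cmp_ass)
  also have "\<dots> = susa K (tq R f M N) \<cdot> (susa K (tpi R (restr f M) N) \<cdot> ?t)"
    unfolding tsec_quot[OF R restr_M[OF R B f M N] N_sus] using tpi_sus[OF R restr_M[OF R B f M N] N] by simp
  also have "\<dots> = susa K (tq R f M N \<cdot> tpi R (restr f M) N) \<cdot> ?t"
    by (simp add: sus_facts susa_comp cmp_ass)
  finally show ?thesis unfolding quot_tpi .
qed

lemma sus_map_inv: "sus_inv \<cdot> sus_map = one (fst (tens_over R B f M (module_sus K R N)))"
proof (rule split_epi_cancel[of "tq R f M (module_sus K R N)"])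
  let ?t = "tsus K (fst M) (fst N)" and ?q = "tq R f M (module_sus K R N)"
  have "(sus_inv \<cdot> sus_map) \<cdot> ?q = sus_inv \<cdot> (sus_map \<cdot> ?q)" by (simp add: sus_map_simps sus_facts cmp_ass)
  also have "\<dots> = ?q \<cdot> (inv ?t \<cdot> (susa K (ts R f M N \<cdot> tq R f M N) \<cdot> ?t))"
    unfolding sus_map_quot by (simp add: sus_inv_def sus_facts susa_comp cmp_ass)
  also have "susa K (ts R f M N \<cdot> tq R f M N) \<cdot> ?t = ?t \<cdot> tpi R (restr f M) (module_sus K R N)"
    unfolding tsec_quot[OF R restr_M[OF R B f M N] N] using tpi_sus[OF R restr_M[OF R B f M N] N] by simp
  also have "?q \<cdot> (inv ?t \<cdot> (?t \<cdot> tpi R (restr f M) (module_sus K R N))) = ?q \<cdot> (ts R f M (module_sus K R N) \<cdot> ?q)"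
    unfolding tsec_quot[OF R restr_M[OF R B f M N] N_sus] by (simp add: sus_facts)
  also have "\<dots> = (?q \<cdot> ts R f M (module_sus K R N)) \<cdot> ?q" by (rule cmp_ass[symmetric]) (simp_all add: sus_facts)
  also have "\<dots> = one (fst (tens_over R B f M (module_sus K R N))) \<cdot> ?q"
    by (simp add: sus_facts)
  finally show "(sus_inv \<cdot> sus_map) \<cdot> ?q = one (fst (tens_over R B f M (module_sus K R N))) \<cdot> ?q" .
qed (simp_all add: sus_map_simps sus_facts)

lemma sus_map_inv2: "sus_map \<cdot> sus_inv = one (sus K (fst (tens_over R B f M N)))"
proof -
  let ?t = "tsus K (fst M) (fst N)" and ?q = "tq R f M (module_sus K R N)"
  have "sus_map \<cdot> sus_inv = (sus_map \<cdot> ?q) \<cdot> (inv ?t \<cdot> susa K (ts R f M N))"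
    by (simp add: sus_map_simps sus_inv_def sus_facts cmp_ass)
  also have "\<dots> = susa K (tq R f M N \<cdot> ts R f M N)"
    unfolding sus_map_quot by (subst susa_comp) (simp_all add: sus_facts cmp_ass)
  also have "\<dots> = one (sus K (fst (tens_over R B f M N)))"
    using sus_facts by (simp add: susa_idn)
  finally show ?thesis .
qed

lemma sus_map_hom: "sus_map \<in> module_homs K B (tens_over R B f M (module_sus K R N)) (module_sus K B (tens_over R B f M N))"
proof -
  let ?T = "tens_over R B f M N" and ?T' = "tens_over R B f M (module_sus K R N)"
  let ?q = "tq R f M N" and ?q' = "tq R f M (module_sus K R N)"
  let ?b = "car B" and ?m = "fst M" and ?n = "fst N"
  let ?t = "tsus K (fst M) (fst N)"
  note s = sus_facts sus_map_simps
  have a: "snd ?T \<cdot> (one ?b \<otimes> ?q) = ?q \<cdot> ((snd M \<otimes> one ?n) \<cdot> inv (\<alpha> ?b ?m ?n))"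
    using tens_over_act_arr[OF R B f M N] by (simp add: s cmp_ass)
  have a': "snd ?T' \<cdot> (one ?b \<otimes> ?q') = ?q' \<cdot> ((snd M \<otimes> one (sus K ?n)) \<cdot> inv (\<alpha> ?b ?m (sus K ?n)))"
    using tens_over_act_arr[OF R B f M N_sus] by (simp add: s cmp_ass)
  have "sus_map \<cdot> snd ?T' = snd (module_sus K B ?T) \<cdot> (one ?b \<otimes> sus_map)"
  proof (rule split_epi_cancel[of "one ?b \<otimes> ?q'"])
    have "(sus_map \<cdot> snd ?T') \<cdot> (one ?b \<otimes> ?q') = (sus_map \<cdot> ?q') \<cdot> ((snd M \<otimes> one (sus K ?n)) \<cdot> inv (\<alpha> ?b ?m (sus K ?n)))"
      using a' by (simp add: s cmp_ass)
    also have "\<dots> = susa K ?q \<cdot> ((?t \<cdot> (snd M \<otimes> one (sus K ?n))) \<cdot> inv (\<alpha> ?b ?m (sus K ?n)))"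
      unfolding sus_map_quot by (simp add: s cmp_ass)
    also have "?t \<cdot> (snd M \<otimes> one (sus K ?n)) = susa K (snd M \<otimes> one ?n) \<cdot> tsus K (?b \<odot> ?m) ?n"
      by (simp add: s tsus_nat1)
    also have "susa K ?q \<cdot> ((susa K (snd M \<otimes> one ?n) \<cdot> tsus K (?b \<odot> ?m) ?n) \<cdot> inv (\<alpha> ?b ?m (sus K ?n)))
      = susa K ?q \<cdot> (susa K (snd M \<otimes> one ?n) \<cdot> (tsus K (?b \<odot> ?m) ?n \<cdot> inv (\<alpha> ?b ?m (sus K ?n))))"
      by (simp add: s cmp_ass)
    also have "tsus K (?b \<odot> ?m) ?n \<cdot> inv (\<alpha> ?b ?m (sus K ?n)) = susa K (inv (\<alpha> ?b ?m ?n)) \<cdot> (tsus K ?b (?m \<odot> ?n) \<cdot> (one ?b \<otimes> ?t))"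
      by (simp add: s tsus_inv_ass)
    also have "susa K ?q \<cdot> (susa K (snd M \<otimes> one ?n) \<cdot> (susa K (inv (\<alpha> ?b ?m ?n)) \<cdot> (tsus K ?b (?m \<odot> ?n) \<cdot> (one ?b \<otimes> ?t))))
      = susa K (?q \<cdot> ((snd M \<otimes> one ?n) \<cdot> inv (\<alpha> ?b ?m ?n))) \<cdot> (tsus K ?b (?m \<odot> ?n) \<cdot> (one ?b \<otimes> ?t))"
      by (simp add: s susa_comp cmp_ass)
    also have "\<dots> = susa K (snd ?T) \<cdot> ((susa K (one ?b \<otimes> ?q) \<cdot> tsus K ?b (?m \<odot> ?n)) \<cdot> (one ?b \<otimes> ?t))"
      unfolding a[symmetric] by (simp add: s susa_comp cmp_ass)
    also have "susa K (one ?b \<otimes> ?q) \<cdot> tsus K ?b (?m \<odot> ?n) = tsus K ?b (fst ?T) \<cdot> (one ?b \<otimes> susa K ?q)"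
      using tsus_nat[of "one ?b" ?q ?b "fst ?T"] by (simp add: s)
    also have "susa K (snd ?T) \<cdot> ((tsus K ?b (fst ?T) \<cdot> (one ?b \<otimes> susa K ?q)) \<cdot> (one ?b \<otimes> ?t))
       = snd (module_sus K B ?T) \<cdot> (one ?b \<otimes> (susa K ?q \<cdot> ?t))"
      by (simp add: s cmp_ass tens_cmp)
    also have "\<dots> = (snd (module_sus K B ?T) \<cdot> (one ?b \<otimes> sus_map)) \<cdot> (one ?b \<otimes> ?q')"
      unfolding sus_map_quot[symmetric] by (simp add: s cmp_ass tens_cmp)
    finally show "(sus_map \<cdot> snd ?T') \<cdot> (one ?b \<otimes> ?q') = (snd (module_sus K B ?T) \<cdot> (one ?b \<otimes> sus_map)) \<cdot> (one ?b \<otimes> ?q')" .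
  qed (simp_all add: s)
  then show ?thesis by (simp add: module_homs_def s hom_def)
qed

end

lemma misoI:
  assumes A: "ring_object K A" and X: "X \<in> modules K A" and Y: "Y \<in> modules K A"
    and i: "i \<in> module_homs K A X Y" and r: "r \<in> arr K" "src K r = fst Y" "tgt K r = fst X"
    and 1: "r \<cdot> i = one (fst X)" and 2: "i \<cdot> r = one (fst Y)"
  shows "miso A X Y"
proof -
  note s = A modules_simps[OF X] modules_simps[OF Y] module_homs_simps[OF i] r
  have i': "i \<cdot> snd X = snd Y \<cdot> (one (car A) \<otimes> i)" using i by (simp add: module_homs_def)
  have "r \<cdot> snd Y = r \<cdot> (snd Y \<cdot> (one (car A) \<otimes> (i \<cdot> r)))" unfolding 2 by (simp add: s)
  also have "\<dots> = r \<cdot> ((snd Y \<cdot> (one (car A) \<otimes> i)) \<cdot> (one (car A) \<otimes> r))" by (simp add: s cmp_ass tens_cmp)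
  also have "\<dots> = (r \<cdot> i) \<cdot> (snd X \<cdot> (one (car A) \<otimes> r))" unfolding i'[symmetric] by (simp add: s cmp_ass)
  also have "\<dots> = snd X \<cdot> (one (car A) \<otimes> r)" unfolding 1 by (simp add: s)
  finally have "r \<in> module_homs K A Y X" using r by (simp add: module_homs_def hom_def)
  with assms show ?thesis unfolding miso_def by blast
qed

context
  fixes R B f
  assumes R: "tt_ring K R" and B: "tt_ring K B" and f: "f \<in> ring_homs K R B"
begin

lemma tens_over_sus:
  assumes M: "M \<in> modules K B" and N: "N \<in> modules K R"
  shows "miso B (tens_over R B f M (module_sus K R N)) (module_sus K B (tens_over R B f M N))"
proof (rule misoI[of _ _ _ "sus_map R f M N" "sus_inv R f M N"])
  note z = R B f M N
  show "sus_map R f M N \<cdot> sus_inv R f M N = one (fst (module_sus K B (tens_over R B f M N)))"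
    using sus_map_inv2[OF z] by (simp add: module_sus_simps)
qed (simp_all add: sus_map_simps[OF R B f M N] module_sus_simps sus_map_hom[OF R B f M N] sus_map_inv[OF R B f M N]
   module_sus_module tens_over_module[OF R B f M] N tt_ringD[OF R] tt_ringD[OF B])

lemma tens_over_zero:
  assumes M: "M \<in> modules K B" and N: "N \<in> modules K R" and z: "one (fst N) = zero_arr K (fst N) (fst N)"
  shows "one (fst (tens_over R B f M N)) = zero_arr K (fst (tens_over R B f M N)) (fst (tens_over R B f M N))"
proof -
  note s = RBMN_simps[OF R B f M N] tq_simps[OF R B f M N]
  have "one (fst (tens_over R B f M N)) = tq R f M N \<cdot> ((one (fst M) \<otimes> one (fst N)) \<cdot> ts R f M N)" by (simp add: s)
  also have "\<dots> = zero_arr K (fst (tens_over R B f M N)) (fst (tens_over R B f M N))"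
    unfolding z by (simp add: s)
  finally show ?thesis .
qed

text \<open>On underlying objects the relative tensor product with M is a retract of the tensor
  product with M in \<open>K\<close>, with inclusion \<open>ts\<close> and projection
  \<open>tq\<close>. Naturality of the idempotents makes both into morphisms of triangles, and
  \<open>dist_retract\<close> concludes.\<close>

lemma tens_over_dist:
  assumes M: "M \<in> modules K B" and N: "N1 \<in> modules K R" "N2 \<in> modules K R" "N3 \<in> modules K R"
    and a: "a \<in> module_homs K R N1 N2" and b: "b \<in> module_homs K R N2 N3" and c: "c \<in> module_homs K R N3 (module_sus K R N1)"
    and d: "(a, b, c) \<in> dist K"
  shows "\<exists>a' b' c'. a' \<in> module_homs K B (tens_over R B f M N1) (tens_over R B f M N2) \<and>
     b' \<in> module_homs K B (tens_over R B f M N2) (tens_over R B f M N3) \<and>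
     c' \<in> module_homs K B (tens_over R B f M N3) (module_sus K B (tens_over R B f M N1)) \<and> (a', b', c') \<in> dist K"
proof -
  let ?m = "fst M"
  have im: "one ?m \<in> module_homs K B M M" using module_homs_idn M tt_ringD(1)[OF B] .
  have S1: "module_sus K R N1 \<in> modules K R" by (rule module_sus_module[OF tt_ringD(1)[OF R] N(1)])
  have rM: "restr f M \<in> modules K R" by (rule restr_M[OF R B f M N(1)])
  let ?T = "\<lambda>N. tens_over R B f M N" and ?q = "\<lambda>N. tq R f M N" and ?s = "\<lambda>N. ts R f M N" and ?p = "\<lambda>N. tpi R (restr f M) N"
  let ?S = "module_sus K R N1" and ?n1 = "fst N1"
  note s = RBMN_simps[OF R B f M N(1)] RBMN_simps[OF R B f M N(2)] RBMN_simps[OF R B f M N(3)]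
     tq_simps[OF R B f M N(1)] tq_simps[OF R B f M N(2)] tq_simps[OF R B f M N(3)] tq_simps[OF R B f M S1]
     module_homs_simps[OF a] module_homs_simps[OF b] module_homs_simps[OF c] module_sus_simps
     tpi_simps[OF R rM N(1)] tpi_simps[OF R rM N(2)] tpi_simps[OF R rM N(3)] tpi_simps[OF R rM S1]
     sus_map_simps[OF R B f M N(1)]
  have sq: "?s N \<cdot> ?q N = ?p N" if "N \<in> modules K R" for N using tsec_quot[OF R rM that] .
  have qp: "?q N \<cdot> ?p N = ?q N" if "N \<in> modules K R" for N using quot_tpi[OF R B f M that] .
  have ps: "?p N \<cdot> ?s N = ?s N" if N: "N \<in> modules K R" for N
    using tq_simps[OF R B f M N] by (simp add: sq[OF N, symmetric] cmp_ass)
  have nat: "?p N' \<cdot> (one ?m \<otimes> g) = (one ?m \<otimes> g) \<cdot> ?p N" if "N \<in> modules K R" "N' \<in> modules K R" "g \<in> module_homs K R N N'" for N N' g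
    using tpi_natural[OF R rM that] by simp
  define a' where "a' = tmap R f M N1 M N2 (one ?m) a"
  define b' where "b' = tmap R f M N2 M N3 (one ?m) b"
  define c0 where "c0 = tmap R f M N3 M ?S (one ?m) c"
  \<comment> \<open>The map induced by \<open>c\<close> ends in the tensor product with the
    suspension; a triangle has to end in the suspension of the tensor product.\<close>
  define c' where "c' = sus_map R f M N1 \<cdot> c0"
  have ah: "a' \<in> module_homs K B (?T N1) (?T N2)" unfolding a'_def by (rule tmap_hom[OF R B f M N(1) M N(2) im a])
  have bh: "b' \<in> module_homs K B (?T N2) (?T N3)" unfolding b'_def by (rule tmap_hom[OF R B f M N(2) M N(3) im b])
  have c0h: "c0 \<in> module_homs K B (?T N3) (?T ?S)" unfolding c0_def by (rule tmap_hom[OF R B f M N(3) M S1 im c])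
  have ch: "c' \<in> module_homs K B (?T N3) (module_sus K B (?T N1))"
    unfolding c'_def
    by (rule module_homs_cmp[OF c0h sus_map_hom[OF R B f M N(1)]])
      (simp_all add: tens_over_module[OF R B f M] N S1 module_sus_module tt_ringD[OF B])
  note hs = module_homs_simps[OF ah] module_homs_simps[OF bh] module_homs_simps[OF ch] module_homs_simps[OF c0h]
  let ?a = "one ?m \<otimes> a" and ?b = "one ?m \<otimes> b" and ?c = "tsus K ?m ?n1 \<cdot> (one ?m \<otimes> c)"
  have D: "(?a, ?b, ?c) \<in> dist K" using tens_exact[OF _ d, of ?m] s by simp
  have a1: "a' = ?q N2 \<cdot> (?a \<cdot> ?s N1)" and b1: "b' = ?q N3 \<cdot> (?b \<cdot> ?s N2)"
    by (simp_all add: a'_def b'_def tmap_def[OF R B f M N(1) M N(2) im a] tmap_def[OF R B f M N(2) M N(3) im b] s cmp_ass)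
  have c1: "c' = susa K (?q N1) \<cdot> (?c \<cdot> ?s N3)"
  proof -
    have "c' = (sus_map R f M N1 \<cdot> ?q ?S) \<cdot> ((one ?m \<otimes> c) \<cdot> ?s N3)"
      by (simp add: c'_def c0_def tmap_def[OF R B f M N(3) M S1 im c] s cmp_ass)
    then show ?thesis unfolding sus_map_quot[OF R B f M N(1)] by (simp add: s cmp_ass)
  qed
  have cp: "?c \<cdot> ?p N3 = susa K (?p N1) \<cdot> ?c"
  proof -
    have "?c \<cdot> ?p N3 = tsus K ?m ?n1 \<cdot> (?p ?S \<cdot> (one ?m \<otimes> c))" by (simp add: s cmp_ass nat[OF N(3) S1 c])
    also have "\<dots> = (tsus K ?m ?n1 \<cdot> ?p ?S) \<cdot> (one ?m \<otimes> c)" by (simp add: s cmp_ass)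
    also have "tsus K ?m ?n1 \<cdot> ?p ?S = susa K (?p N1) \<cdot> tsus K ?m ?n1" using tpi_sus[OF R rM N(1)] by simp
    finally show ?thesis by (simp add: s cmp_ass)
  qed
  have "(a', b', c') \<in> dist K"
  proof (rule dist_retract[OF D])
    show "is_triangle K a' b' c'" using hs by (simp add: is_triangle_def module_sus_simps)
    have 1: "?s N2 \<cdot> a' = ?a \<cdot> ?s N1"
    proof -
      have "?s N2 \<cdot> a' = (?s N2 \<cdot> ?q N2) \<cdot> (?a \<cdot> ?s N1)" by (simp add: a1 s cmp_ass)
      also have "\<dots> = (?p N2 \<cdot> ?a) \<cdot> ?s N1" unfolding sq[OF N(2)] by (simp add: s cmp_ass)
      also have "\<dots> = ?a \<cdot> (?p N1 \<cdot> ?s N1)" unfolding nat[OF N(1,2) a] by (simp add: s cmp_ass)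
      finally show ?thesis unfolding ps[OF N(1)] .
    qed
    have 2: "?s N3 \<cdot> b' = ?b \<cdot> ?s N2"
    proof -
      have "?s N3 \<cdot> b' = (?s N3 \<cdot> ?q N3) \<cdot> (?b \<cdot> ?s N2)" by (simp add: b1 s cmp_ass)
      also have "\<dots> = (?p N3 \<cdot> ?b) \<cdot> ?s N2" unfolding sq[OF N(3)] by (simp add: s cmp_ass)
      also have "\<dots> = ?b \<cdot> (?p N2 \<cdot> ?s N2)" unfolding nat[OF N(2,3) b] by (simp add: s cmp_ass)
      finally show ?thesis unfolding ps[OF N(2)] .
    qed
    have 3: "susa K (?s N1) \<cdot> c' = ?c \<cdot> ?s N3"
    proof -
      have "susa K (?s N1) \<cdot> c' = susa K (?s N1 \<cdot> ?q N1) \<cdot> (?c \<cdot> ?s N3)" by (simp add: c1 s cmp_ass susa_comp)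
      also have "\<dots> = (susa K (?p N1) \<cdot> ?c) \<cdot> ?s N3" unfolding sq[OF N(1)] by (simp add: s cmp_ass)
      also have "\<dots> = ?c \<cdot> (?p N3 \<cdot> ?s N3)" unfolding cp[symmetric] by (simp add: s cmp_ass)
      finally show ?thesis unfolding ps[OF N(3)] .
    qed
    show "triangle_morphism K (a', b', c') (?a, ?b, ?c) (?s N1) (?s N2) (?s N3)"
      using 1 2 3 by (simp add: triangle_morphism_def hs s hom_def)
    have 4: "?q N2 \<cdot> ?a = a' \<cdot> ?q N1"
    proof -
      have "a' \<cdot> ?q N1 = ?q N2 \<cdot> (?a \<cdot> (?s N1 \<cdot> ?q N1))" by (simp add: a1 s cmp_ass)
      also have "\<dots> = (?q N2 \<cdot> ?p N2) \<cdot> ?a" unfolding sq[OF N(1)] nat[OF N(1,2) a, symmetric] by (simp add: s cmp_ass)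
      finally show ?thesis unfolding qp[OF N(2)] ..
    qed
    have 5: "?q N3 \<cdot> ?b = b' \<cdot> ?q N2"
    proof -
      have "b' \<cdot> ?q N2 = ?q N3 \<cdot> (?b \<cdot> (?s N2 \<cdot> ?q N2))" by (simp add: b1 s cmp_ass)
      also have "\<dots> = (?q N3 \<cdot> ?p N3) \<cdot> ?b" unfolding sq[OF N(2)] nat[OF N(2,3) b, symmetric] by (simp add: s cmp_ass)
      finally show ?thesis unfolding qp[OF N(3)] ..
    qed
    have 6: "susa K (?q N1) \<cdot> ?c = c' \<cdot> ?q N3"
    proof -
      have "c' \<cdot> ?q N3 = susa K (?q N1) \<cdot> (?c \<cdot> (?s N3 \<cdot> ?q N3))" by (simp add: c1 s cmp_ass)
      also have "\<dots> = susa K (?q N1 \<cdot> ?p N1) \<cdot> ?c" unfolding sq[OF N(3)] cp by (simp add: s cmp_ass susa_comp)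
      finally show ?thesis unfolding qp[OF N(1)] ..
    qed
    show "triangle_morphism K (?a, ?b, ?c) (a', b', c') (?q N1) (?q N2) (?q N3)"
      using 4 5 6 by (simp add: triangle_morphism_def hs s hom_def)
  qed (simp_all add: hs s)
  with ah bh ch show ?thesis by blast
qed

end

end

section \<open>Zorn's lemma, lifting, going down and incomparability for abstract thick
  ideals\<close>

section \<open>Primes in an abstract ideal theory\<close>

text \<open>
  \<open>Th\<close> stands for the thick tensor ideals. All tensor identities are only required to hold up to
  membership in such ideals, which is what natural isomorphisms and retracts provide.
\<close>

locale tt_ideals =
  fixes Ob :: "'a set" and Th :: "'a set \<Rightarrow> bool" and T :: "'a \<Rightarrow> 'a \<Rightarrow> 'a" (infixl "\<squnion>\<^sub>t" 70) and I :: 'a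
  assumes Th_sub: "Th J \<Longrightarrow> J \<subseteq> Ob"
    and T_ob: "\<lbrakk>a \<in> Ob; b \<in> Ob\<rbrakk> \<Longrightarrow> a \<squnion>\<^sub>t b \<in> Ob"
    and I_ob: "I \<in> Ob"
    and Th_chain: "\<lbrakk>C \<noteq> {}; \<And>J. J \<in> C \<Longrightarrow> Th J; \<And>J J'. \<lbrakk>J \<in> C; J' \<in> C\<rbrakk> \<Longrightarrow> J \<subseteq> J' \<or> J' \<subseteq> J\<rbrakk> \<Longrightarrow> Th (\<Union> C)"
    and Th_Inter: "\<lbrakk>C \<noteq> {}; \<And>J. J \<in> C \<Longrightarrow> Th J\<rbrakk> \<Longrightarrow> Th (\<Inter> C)"
    and Th_quot: "\<lbrakk>Th J; a \<in> Ob\<rbrakk> \<Longrightarrow> Th {c \<in> Ob. a \<squnion>\<^sub>t c \<in> J}"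
    and Th_ideal: "\<lbrakk>Th J; a \<in> Ob; c \<in> J\<rbrakk> \<Longrightarrow> a \<squnion>\<^sub>t c \<in> J"
    and Th_comm: "\<lbrakk>Th J; a \<in> Ob; b \<in> Ob; a \<squnion>\<^sub>t b \<in> J\<rbrakk> \<Longrightarrow> b \<squnion>\<^sub>t a \<in> J"
    and Th_assoc: "\<lbrakk>Th J; a \<in> Ob; b \<in> Ob; c \<in> Ob\<rbrakk> \<Longrightarrow> (a \<squnion>\<^sub>t b) \<squnion>\<^sub>t c \<in> J \<longleftrightarrow> a \<squnion>\<^sub>t (b \<squnion>\<^sub>t c) \<in> J"
    and Th_unit: "\<lbrakk>Th J; a \<in> Ob\<rbrakk> \<Longrightarrow> a \<squnion>\<^sub>t I \<in> J \<longleftrightarrow> a \<in> J"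
begin

definition prime :: "'a set \<Rightarrow> bool" where
  "prime P \<longleftrightarrow> Th P \<and> P \<noteq> Ob \<and> (\<forall>a \<in> Ob. \<forall>b \<in> Ob. a \<squnion>\<^sub>t b \<in> P \<longrightarrow> a \<in> P \<or> b \<in> P)"

lemma prime_Th: "prime P \<Longrightarrow> Th P"
  by (simp add: prime_def)

lemma primeD: "\<lbrakk>prime P; a \<in> Ob; b \<in> Ob; a \<squnion>\<^sub>t b \<in> P\<rbrakk> \<Longrightarrow> a \<in> P \<or> b \<in> P"
  by (simp add: prime_def)

lemma Th_ideal_r: "\<lbrakk>Th J; a \<in> Ob; c \<in> J\<rbrakk> \<Longrightarrow> c \<squnion>\<^sub>t a \<in> J"
  using Th_ideal[of J a c] Th_comm[of J a c] Th_sub[of J] by blast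

lemma unit_notin_prime:
  assumes "prime P"
  shows "I \<notin> P"
proof
  assume "I \<in> P"
  then have "a \<in> P" if "a \<in> Ob" for a
    using Th_ideal[of P a I] Th_unit[of P a] that prime_Th[OF assms] by blast
  with assms Th_sub[of P] show False by (auto simp: prime_def)
qed

text \<open>The quotient of an ideal by \<open>c\<close> is an ideal again, so an implication that
  is valid in all ideals may be applied under a tensor factor.\<close>

lemma Th_replace:
  assumes "Th J" "a \<in> Ob" "b \<in> Ob" "c \<in> Ob" and r: "\<And>J'. Th J' \<Longrightarrow> a \<in> J' \<Longrightarrow> b \<in> J'" and "c \<squnion>\<^sub>t a \<in> J"
  shows "c \<squnion>\<^sub>t b \<in> J"
  using r[OF Th_quot[OF assms(1,4)]] assms by blast

lemma Th_replace_l: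
  assumes "Th J" "a \<in> Ob" "b \<in> Ob" "c \<in> Ob" and r: "\<And>J'. Th J' \<Longrightarrow> a \<in> J' \<Longrightarrow> b \<in> J'" and "a \<squnion>\<^sub>t c \<in> J"
  shows "b \<squnion>\<^sub>t c \<in> J"
  using Th_replace[OF assms(1-4) r] Th_comm[OF assms(1)] assms by blast

text \<open>The exchange needed to multiply two elements of the form F(a) \<otimes> m within an
  ideal.\<close>

lemma Th_perm:
  assumes J: "Th J" and o: "a \<in> Ob" "m \<in> Ob" "b \<in> Ob" "n \<in> Ob" and h: "(a \<squnion>\<^sub>t m) \<squnion>\<^sub>t (b \<squnion>\<^sub>t n) \<in> J"
  shows "(a \<squnion>\<^sub>t b) \<squnion>\<^sub>t (m \<squnion>\<^sub>t n) \<in> J"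
proof -
  have swap: "b \<squnion>\<^sub>t (m \<squnion>\<^sub>t n) \<in> J'" if J': "Th J'" and "m \<squnion>\<^sub>t (b \<squnion>\<^sub>t n) \<in> J'" for J'
  proof -
    have h: "(m \<squnion>\<^sub>t b) \<squnion>\<^sub>t n \<in> J'" using that o by (simp add: Th_assoc)
    have "(b \<squnion>\<^sub>t m) \<squnion>\<^sub>t n \<in> J'"
      by (rule Th_replace_l[OF J' T_ob[OF o(2,3)] T_ob[OF o(3,2)] o(4) Th_comm[OF _ o(2,3)] h])
    then show ?thesis using J' o by (simp add: Th_assoc)
  qed
  have h': "a \<squnion>\<^sub>t (m \<squnion>\<^sub>t (b \<squnion>\<^sub>t n)) \<in> J" using J o h by (simp add: Th_assoc T_ob)
  have "a \<squnion>\<^sub>t (b \<squnion>\<^sub>t (m \<squnion>\<^sub>t n)) \<in> J"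
    by (rule Th_replace[OF J T_ob[OF o(2) T_ob[OF o(3,4)]] T_ob[OF o(3) T_ob[OF o(2,4)]] o(1) swap h'])
  then show ?thesis using J o by (simp add: Th_assoc T_ob)
qed

text \<open>Multiplicativity only up to ideals: products are known up to isomorphism, and F(a)
  \<otimes> F(b) is not literally of the form F(c).\<close>

definition mult_set :: "'a set \<Rightarrow> bool" where
  "mult_set S \<longleftrightarrow> S \<subseteq> Ob \<and> S \<noteq> {} \<and> (\<forall>s \<in> S. \<forall>t \<in> S. \<exists>u \<in> S. \<forall>J. Th J \<longrightarrow> s \<squnion>\<^sub>t t \<in> J \<longrightarrow> u \<in> J)"

text \<open>An ideal Q that is maximal among those avoiding S is prime. If a \<otimes> b lies in Q
  but b does not, the quotient of Q by a is larger than Q and contains some s in S; if a is not in Q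
  either, the quotient of Q by s is larger too and contains some t in S. Quotients of ideals take
  the place of generated ideals.\<close>

lemma prime_ex:
  assumes J: "Th J" and S: "mult_set S" and JS: "J \<inter> S = {}"
  shows "\<exists>P. prime P \<and> J \<subseteq> P \<and> P \<inter> S = {}"
proof -
  let ?C = "{J'. Th J' \<and> J \<subseteq> J' \<and> J' \<inter> S = {}}"
  have "\<exists>M \<in> ?C. \<forall>X \<in> ?C. M \<subseteq> X \<longrightarrow> X = M"
  proof (rule subset_Zorn_nonempty)
    show "?C \<noteq> {}" using J JS by blast
    fix C assume C: "C \<noteq> {}" "subset.chain ?C C"
    then have "\<And>X. X \<in> C \<Longrightarrow> X \<in> ?C" "\<And>X Y. X \<in> C \<Longrightarrow> Y \<in> C \<Longrightarrow> X \<subseteq> Y \<or> Y \<subseteq> X"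
      by (auto simp: subset_chain_def)
    with C(1) Th_chain[of C] show "\<Union> C \<in> ?C" by blast
  qed
  then obtain Q where QC: "Q \<in> ?C" and QM: "\<forall>X \<in> ?C. Q \<subseteq> X \<longrightarrow> X = Q" by (rule bexE)
  have Q: "Th Q" "J \<subseteq> Q" "Q \<inter> S = {}" using QC by simp_all
  have max: "X = Q" if "Th X" "Q \<subseteq> X" "X \<inter> S = {}" for X
    using QM that Q(2) by simp
  have big: "\<exists>s \<in> S. a \<squnion>\<^sub>t s \<in> Q" if a: "a \<in> Ob" and b: "b \<in> Ob" "b \<notin> Q" "a \<squnion>\<^sub>t b \<in> Q" for a b
  proof (rule ccontr)
    assume n: "\<not> ?thesis"
    let ?X = "{c \<in> Ob. a \<squnion>\<^sub>t c \<in> Q}"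
    have "?X = Q"
    proof (rule max)
      show "Th ?X" by (rule Th_quot[OF Q(1) a])
      show "Q \<subseteq> ?X" using Th_ideal[OF Q(1) a] Th_sub[OF Q(1)] by blast
      show "?X \<inter> S = {}" using n by blast
    qed
    with b show False by blast
  qed
  have "a \<in> Q \<or> b \<in> Q" if ab: "a \<in> Ob" "b \<in> Ob" "a \<squnion>\<^sub>t b \<in> Q" for a b
  proof (rule ccontr)
    assume n: "\<not> ?thesis"
    obtain s where s: "s \<in> S" "a \<squnion>\<^sub>t s \<in> Q" using big[of a b] ab n by blast
    have so: "s \<in> Ob" using S s by (auto simp: mult_set_def)
    obtain t where t: "t \<in> S" "s \<squnion>\<^sub>t t \<in> Q" using big[of s a] Th_comm[OF Q(1)] so s ab n by blast
    then obtain u where "u \<in> S" "u \<in> Q" using S s Q(1) unfolding mult_set_def by meson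
    with Q(3) show False by blast
  qed
  moreover have "Q \<noteq> Ob" using Q(3) S by (auto simp: mult_set_def)
  ultimately show ?thesis using Q unfolding prime_def by blast
qed

text \<open>If one member of the chain misses a and another misses b, the smaller of the two misses
  both. The purpose is the existence of minimal primes in a fibre.\<close>

lemma prime_Inter_chain:
  assumes C: "C \<noteq> {}" "\<And>P. P \<in> C \<Longrightarrow> prime P" "\<And>P P'. \<lbrakk>P \<in> C; P' \<in> C\<rbrakk> \<Longrightarrow> P \<subseteq> P' \<or> P' \<subseteq> P"
  shows "prime (\<Inter> C)"
  unfolding prime_def
proof (intro conjI ballI impI)
  show "Th (\<Inter> C)" by (rule Th_Inter[OF C(1) prime_Th[OF C(2)]])
  obtain P where "P \<in> C" using C(1) by blast
  then show "\<Inter> C \<noteq> Ob" using C(2) unit_notin_prime I_ob by blast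
  fix a b assume ab: "a \<in> Ob" "b \<in> Ob" "a \<squnion>\<^sub>t b \<in> \<Inter> C"
  show "a \<in> \<Inter> C \<or> b \<in> \<Inter> C"
  proof (rule ccontr)
    assume "\<not> ?thesis"
    then obtain P P' where "P \<in> C" "a \<notin> P" "P' \<in> C" "b \<notin> P'" by blast
    then show False using C(3)[of P P'] primeD[OF C(2)[of P] ab(1,2)] primeD[OF C(2)[of P'] ab(1,2)] ab(3) by blast
  qed
qed

end

text \<open>\<open>F\<close> is a tensor functor and \<open>U\<close> its right adjoint, satisfying the projection formula.\<close>

locale tt_pair =
  X: tt_ideals ObX ThX TX IX + Y: tt_ideals ObY ThY TY IY
  for ObX :: "'a set" and ThX TX IX and ObY :: "'b set" and ThY TY IY +
  fixes F :: "'a \<Rightarrow> 'b" and U :: "'b \<Rightarrow> 'a"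
  assumes F_ob: "a \<in> ObX \<Longrightarrow> F a \<in> ObY"
    and U_ob: "c \<in> ObY \<Longrightarrow> U c \<in> ObX"
    and F_pull: "ThY J \<Longrightarrow> ThX {a \<in> ObX. F a \<in> J}"
    and U_pull: "ThX H \<Longrightarrow> ThY {c \<in> ObY. U c \<in> H}"
    and F_tens: "\<lbrakk>ThY J; a \<in> ObX; b \<in> ObX\<rbrakk> \<Longrightarrow> F (TX a b) \<in> J \<longleftrightarrow> TY (F a) (F b) \<in> J"
    and F_unit: "ThY J \<Longrightarrow> F IX \<in> J \<longleftrightarrow> IY \<in> J"
    and proj: "\<lbrakk>ThX H; a \<in> ObX; c \<in> ObY\<rbrakk> \<Longrightarrow> U (TY (F a) c) \<in> H \<longleftrightarrow> TX a (U c) \<in> H"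
    and counit: "\<lbrakk>ThY J; c \<in> ObY; F (U c) \<in> J\<rbrakk> \<Longrightarrow> c \<in> J"
begin

text \<open>Contraction of ideals, the map on spectra induced by \<open>F\<close>.\<close>

definition con :: "'b set \<Rightarrow> 'a set" where
  "con Q = {a \<in> ObX. F a \<in> Q}"

lemma con_prime:
  assumes Q: "Y.prime Q"
  shows "X.prime (con Q)"
  unfolding X.prime_def
proof (intro conjI ballI impI)
  note t = Y.prime_Th[OF Q]
  show "ThX (con Q)" unfolding con_def by (rule F_pull[OF t])
  show "con Q \<noteq> ObX" using F_unit[OF t] Y.unit_notin_prime[OF Q] X.I_ob by (auto simp: con_def)
  fix a b assume "a \<in> ObX" "b \<in> ObX" "TX a b \<in> con Q"
  then show "a \<in> con Q \<or> b \<in> con Q"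
    using F_tens[OF t] Y.primeD[OF Q F_ob F_ob] by (auto simp: con_def)
qed

lemma con_mono: "Q \<subseteq> Q' \<Longrightarrow> con Q \<subseteq> con Q'"
  by (auto simp: con_def)

lemma U_mem_con:
  assumes "Y.prime Q" "c \<in> ObY" "U c \<in> con Q"
  shows "c \<in> Q"
  using assms counit[OF Y.prime_Th] by (auto simp: con_def)

text \<open>The lifted prime contains \<open>U\<inverse>(P)\<close> and avoids the products \<open>F(a) \<otimes> m\<close> with \<open>a \<notin> P\<close>, \<open>m \<in> M\<close>.\<close>

lemma lift:
  assumes P: "X.prime P" and M: "Y.mult_set M" and n: "\<And>m. m \<in> M \<Longrightarrow> U m \<notin> P"
  shows "\<exists>Q. Y.prime Q \<and> con Q = P \<and> Q \<inter> M = {}"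
proof -
  note tP = X.prime_Th[OF P]
  let ?J = "{c \<in> ObY. U c \<in> P}"
  have J: "ThY ?J" by (rule U_pull[OF tP])
  let ?S = "{TY (F a) m | a m. a \<in> ObX \<and> a \<notin> P \<and> m \<in> M}"
  have Mo: "M \<subseteq> ObY" using M by (simp add: Y.mult_set_def)
  obtain m0 where m0: "m0 \<in> M" using M by (auto simp: Y.mult_set_def)
  have IP: "IX \<in> ObX" "IX \<notin> P" using X.I_ob X.unit_notin_prime[OF P] by auto
  have S: "Y.mult_set ?S"
    unfolding Y.mult_set_def
  proof (intro conjI ballI)
    show "?S \<subseteq> ObY" using Mo F_ob Y.T_ob by blast
    show "?S \<noteq> {}" using m0 IP by blast
    fix s t assume "s \<in> ?S" "t \<in> ?S"
    then obtain a m b k where s: "s = TY (F a) m" "a \<in> ObX" "a \<notin> P" "m \<in> M"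
      and t: "t = TY (F b) k" "b \<in> ObX" "b \<notin> P" "k \<in> M" by blast
    obtain u where u: "u \<in> M" "\<And>J'. ThY J' \<Longrightarrow> TY m k \<in> J' \<Longrightarrow> u \<in> J'"
      using M s(4) t(4) unfolding Y.mult_set_def by meson
    have o: "m \<in> ObY" "k \<in> ObY" "u \<in> ObY" "F a \<in> ObY" "F b \<in> ObY" "TX a b \<in> ObX"
      using s t u Mo F_ob X.T_ob by auto
    have "TX a b \<notin> P" using X.primeD[OF P] s t by blast
    then have "TY (F (TX a b)) u \<in> ?S" using u o by blast
    moreover have "TY (F (TX a b)) u \<in> J'" if J': "ThY J'" "TY s t \<in> J'" for J'
    proof -
      have "TY (TY (F a) (F b)) (TY m k) \<in> J'"
        using Y.Th_perm[OF J'(1)] J'(2) s t o by blast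
      then have "TY (TY (F a) (F b)) u \<in> J'"
        by (rule Y.Th_replace[OF J'(1), rotated -1]) (use o u Y.T_ob in auto)
      then show ?thesis
        by (rule Y.Th_replace_l[OF J'(1), rotated -1]) (use o s t Y.T_ob F_ob F_tens in auto)
    qed
    ultimately show "\<exists>u \<in> ?S. \<forall>J. ThY J \<longrightarrow> TY s t \<in> J \<longrightarrow> u \<in> J" by blast
  qed
  \<comment> \<open>By the projection formula U(F(a) \<otimes> m) is as good as a \<otimes> U(m),
    which the prime \<open>P\<close> contains only if it contains a or U(m).\<close>
  have JS: "?J \<inter> ?S = {}"
    using proj[OF tP] X.primeD[OF P] n U_ob Mo by blast
  from Y.prime_ex[OF J S JS] obtain Q where Q': "Y.prime Q \<and> ?J \<subseteq> Q \<and> Q \<inter> ?S = {}" by (rule exE)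
  then have Q: "Y.prime Q" "?J \<subseteq> Q" "Q \<inter> ?S = {}" by simp_all
  note tQ = Y.prime_Th[OF Q(1)]
  have "a \<in> con Q" if a: "a \<in> P" for a
  proof -
    have ao: "a \<in> ObX" using a X.Th_sub[OF tP] by blast
    have "TX a (U IY) \<in> P" using X.Th_ideal_r[OF tP U_ob[OF Y.I_ob] a] .
    then have "TY (F a) IY \<in> ?J" using proj[OF tP ao Y.I_ob] Y.T_ob[OF F_ob[OF ao] Y.I_ob] by blast
    then have "F a \<in> ?J" using Y.Th_unit[OF J F_ob[OF ao]] by blast
    then show ?thesis using Q(2) ao by (auto simp: con_def)
  qed
  moreover have "a \<in> P" if a: "a \<in> con Q" for a
  proof (rule ccontr)
    assume aP: "a \<notin> P"
    have ao: "a \<in> ObX" "F a \<in> Q" using a by (auto simp: con_def)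
    then have "TY (F a) m0 \<in> Q" using Y.Th_ideal_r[OF tQ] m0 Mo by blast
    then show False using Q(3) ao aP m0 by blast
  qed
  moreover have "m \<notin> Q" if m: "m \<in> M" for m
  proof
    assume "m \<in> Q"
    then have "TY (F IX) m \<in> Q" using Y.Th_ideal[OF tQ] F_ob[OF IP(1)] by blast
    then show False using Q(3) IP m by blast
  qed
  ultimately show ?thesis using Q(1) by blast
qed

text \<open>Lifting with the complement of \<open>T\<close> as the multiplicative set. If m is
  outside \<open>T\<close>, the counit keeps U(m) outside the contraction of \<open>T\<close>, and
  therefore outside \<open>R\<close>.\<close>

lemma going_down:
  assumes T: "Y.prime T" and R: "X.prime R" and le: "R \<subseteq> con T"
  shows "\<exists>T'. Y.prime T' \<and> con T' = R \<and> T' \<subseteq> T"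
proof -
  have M: "Y.mult_set (ObY - T)"
    unfolding Y.mult_set_def
  proof (intro conjI ballI)
    show "ObY - T \<noteq> {}" using Y.unit_notin_prime[OF T] Y.I_ob by blast
    fix s u assume "s \<in> ObY - T" "u \<in> ObY - T"
    then have "TY s u \<in> ObY - T" using Y.primeD[OF T] Y.T_ob by blast
    then show "\<exists>w \<in> ObY - T. \<forall>J. ThY J \<longrightarrow> TY s u \<in> J \<longrightarrow> w \<in> J" by blast
  qed blast
  have n: "U m \<notin> R" if "m \<in> ObY - T" for m using U_mem_con[OF T, of m] le that by blast
  from lift[OF R M n] obtain Q where Q: "Y.prime Q \<and> con Q = R \<and> Q \<inter> (ObY - T) = {}" by (rule exE)
  then have "Q \<subseteq> T" using Y.Th_sub[OF Y.prime_Th, of Q] by blast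
  with Q show ?thesis by blast
qed

definition incomparable :: bool where
  "incomparable \<longleftrightarrow> (\<forall>R Q. Y.prime R \<longrightarrow> Y.prime Q \<longrightarrow> R \<subseteq> Q \<longrightarrow> con R = con Q \<longrightarrow> R = Q)"

lemma minimal_ex:
  assumes R: "Y.prime R"
  shows "\<exists>N. Y.prime N \<and> N \<subseteq> R \<and> con N = con R \<and> (\<forall>N'. Y.prime N' \<longrightarrow> N' \<subseteq> N \<longrightarrow> con N' = con R \<longrightarrow> N' = N)"
proof -
  \<comment> \<open>Complements, so that Zorn's lemma for maximal sets delivers a minimal prime of
    the fibre.\<close>
  let ?A = "{ObY - N | N. Y.prime N \<and> N \<subseteq> R \<and> con N = con R}"
  have "\<exists>M \<in> ?A. \<forall>X \<in> ?A. M \<subseteq> X \<longrightarrow> X = M"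
  proof (rule subset_Zorn_nonempty)
    show "?A \<noteq> {}" using R by blast
    fix C assume C: "C \<noteq> {}" "subset.chain ?A C"
    define D where "D = (\<lambda>c. ObY - c) ` C"
    have CA: "\<And>c. c \<in> C \<Longrightarrow> c \<in> ?A" and ch: "\<And>X Y. X \<in> C \<Longrightarrow> Y \<in> C \<Longrightarrow> X \<subseteq> Y \<or> Y \<subseteq> X"
      using C(2) by (auto simp: subset_chain_def)
    have DP: "Y.prime P \<and> P \<subseteq> R \<and> con P = con R" if PD: "P \<in> D" for P
    proof -
      obtain c where c: "c \<in> C" "P = ObY - c" using PD by (auto simp: D_def)
      then obtain N where N: "c = ObY - N" "Y.prime N" "N \<subseteq> R" "con N = con R" using CA by blast
      have "P = N" using c N Y.Th_sub[OF Y.prime_Th[OF N(2)]] by blast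
      with N show ?thesis by simp
    qed
    have 1: "Y.prime (\<Inter> D)"
    proof (rule Y.prime_Inter_chain)
      show "D \<noteq> {}" using C(1) by (simp add: D_def)
      show "Y.prime P" if "P \<in> D" for P using DP[OF that] by simp
      fix P P' assume "P \<in> D" "P' \<in> D"
      then obtain c c' where "c \<in> C" "c' \<in> C" "P = ObY - c" "P' = ObY - c'" by (auto simp: D_def)
      with ch[of c c'] show "P \<subseteq> P' \<or> P' \<subseteq> P" by auto
    qed
    obtain c0 where "c0 \<in> C" using C(1) by (meson ex_in_conv)
    then have P0: "ObY - c0 \<in> D" by (simp add: D_def)
    have 2: "\<Inter> D \<subseteq> R" by (rule subset_trans[OF Inter_lower[OF P0] DP[OF P0, THEN conjunct2, THEN conjunct1]])
    have 3: "con (\<Inter> D) = con R"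
    proof
      show "con (\<Inter> D) \<subseteq> con R" by (rule con_mono[OF 2])
      show "con R \<subseteq> con (\<Inter> D)"
      proof
        fix a assume a: "a \<in> con R"
        have "F a \<in> P" if "P \<in> D" for P
        proof -
          have "a \<in> con P" using DP[OF that] a by simp
          then show ?thesis by (simp add: con_def)
        qed
        then show "a \<in> con (\<Inter> D)" using a by (simp add: con_def)
      qed
    qed
    have "c \<subseteq> ObY" if "c \<in> C" for c using CA[OF that] by auto
    then have "\<Union> C = ObY - \<Inter> D" using C(1) unfolding D_def by auto
    with 1 2 3 show "\<Union> C \<in> ?A" by auto
  qed
  then obtain M where MA: "M \<in> ?A" and MM: "\<forall>X \<in> ?A. M \<subseteq> X \<longrightarrow> X = M" by (rule bexE)
  from MA obtain N where N: "Y.prime N" "N \<subseteq> R" "con N = con R" and MN: "M = ObY - N" by blast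
  have max: "ObY - N' = ObY - N" if "Y.prime N'" "N' \<subseteq> R" "con N' = con R" "ObY - N \<subseteq> ObY - N'" for N'
    using MM[rule_format, of "ObY - N'"] that unfolding MN by blast
  have "N' = N" if "Y.prime N'" "N' \<subseteq> N" "con N' = con R" for N'
  proof -
    have "ObY - N' = ObY - N" by (rule max) (use that N in auto)
    then show ?thesis using Y.Th_sub[OF Y.prime_Th[OF that(1)]] Y.Th_sub[OF Y.prime_Th[OF N(1)]] by blast
  qed
  with N show ?thesis by blast
qed

end

text \<open>
  One step of the splitting tower: \<open>(F, U)\<close> is extension along \<open>R \<rightarrow> B\<close>, and \<open>(F1, U1)\<close>, \<open>(F2, U2)\<close>
  are extension along the two homomorphisms \<open>B \<rightarrow> E\<close>, where \<open>B \<otimes>\<^sub>R B \<cong> B \<times> E\<close>.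
\<close>

lemma incomparable_step:
  fixes F :: "'a \<Rightarrow> 'b" and F1 F2 :: "'b \<Rightarrow> 'c"
  assumes "tt_pair ObX ThX TX IX ObY ThY TY IY F U"
    and "tt_pair ObY ThY TY IY ObZ ThZ TZ IZ F1 U1"
    and "tt_pair ObY ThY TY IY ObZ ThZ TZ IZ F2 U2"
    and split: "\<And>J a. \<lbrakk>ThY J; a \<in> J; U2 (F1 a) \<in> J\<rbrakk> \<Longrightarrow> F (U a) \<in> J"
    and eq: "\<And>J x. \<lbrakk>ThZ J; x \<in> ObX\<rbrakk> \<Longrightarrow> F1 (F x) \<in> J \<longleftrightarrow> F2 (F x) \<in> J"
    and inc: "tt_pair.incomparable ObY ObZ ThZ TZ F1"
  shows "tt_pair.incomparable ObX ObY ThY TY F"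
proof -
  interpret f: tt_pair ObX ThX TX IX ObY ThY TY IY F U by fact
  interpret u: tt_pair ObY ThY TY IY ObZ ThZ TZ IZ F1 U1 by fact
  interpret v: tt_pair ObY ThY TY IY ObZ ThZ TZ IZ F2 U2 by fact
  have over: "f.con (u.con T) = f.con (v.con T)" if "u.Y.prime T" for T
    using eq[OF u.Y.prime_Th[OF that]] f.F_ob by (auto simp: f.con_def u.con_def v.con_def)
  show ?thesis
    unfolding f.incomparable_def
  proof (intro allI impI, rule ccontr)
    fix R0 Q assume R0: "f.Y.prime R0" and Q: "f.Y.prime Q" and le: "R0 \<subseteq> Q" and eqc: "f.con R0 = f.con Q" and ne: "R0 \<noteq> Q"
    \<comment> \<open>A minimal prime of the fibre is chosen below the smaller one: the primes
      constructed next are only known to contract into \<open>R\<close>, and minimality turns this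
      into equality.\<close>
    obtain R where R: "f.Y.prime R" "R \<subseteq> R0" "f.con R = f.con Q"
      and min: "\<And>N. f.Y.prime N \<Longrightarrow> N \<subseteq> R \<Longrightarrow> f.con N = f.con Q \<Longrightarrow> N = R"
      using f.minimal_ex[OF R0] eqc by auto
    note tQ = f.Y.prime_Th[OF Q]
    obtain c where c: "c \<in> Q" "c \<notin> R" using R le ne by blast
    have co: "c \<in> ObY" using c f.Y.Th_sub[OF tQ] by blast
    let ?M = "F1 ` (ObY - R)"
    have M: "u.Y.mult_set ?M"
      unfolding u.Y.mult_set_def
    proof (intro conjI ballI)
      show "?M \<subseteq> ObZ" using u.F_ob by blast
      show "?M \<noteq> {}" using co c by blast
      fix s t assume "s \<in> ?M" "t \<in> ?M"
      then obtain a b where ab: "s = F1 a" "t = F1 b" "a \<in> ObY" "b \<in> ObY" "a \<notin> R" "b \<notin> R" by blast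
      then have "TY a b \<in> ObY - R" using f.Y.T_ob f.Y.primeD[OF R(1)] by blast
      then show "\<exists>w \<in> ?M. \<forall>J. ThZ J \<longrightarrow> TZ s t \<in> J \<longrightarrow> w \<in> J"
        using u.F_tens ab by (intro bexI[of _ "F1 (TY a b)"]) auto
    qed
    have n: "U2 m \<notin> Q" if mM: "m \<in> ?M" for m
    proof
      assume m: "U2 m \<in> Q"
      obtain a where a: "m = F1 a" "a \<in> ObY" "a \<notin> R" using mM by blast
      \<comment> \<open>The hypothesis \<open>split\<close> asks for an element of \<open>Q\<close>,
        which \<open>a\<close> need not be. Its product with \<open>c\<close> lies in
        \<open>Q\<close> and, \<open>R\<close> being prime, still not in \<open>R\<close>.\<close>
      let ?a = "TY a c"
      have ao: "?a \<in> ObY" "?a \<notin> R" "?a \<in> Q"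
        using a c co f.Y.T_ob f.Y.primeD[OF R(1)] f.Y.Th_ideal[OF tQ] by blast+
      let ?J = "{z \<in> ObZ. U2 z \<in> Q}"
      have J: "ThZ ?J" by (rule v.U_pull[OF tQ])
      have "F1 a \<in> ?J" using m a u.F_ob by simp
      then have "TZ (F1 a) (F1 c) \<in> ?J" by (rule u.Y.Th_ideal_r[OF J u.F_ob[OF co]])
      then have "F1 ?a \<in> ?J" using u.F_tens[OF J a(2) co] by blast
      then have "F (U ?a) \<in> Q" using split[OF tQ ao(3)] by blast
      then have "U ?a \<in> f.con R" unfolding R(3) using f.U_ob[OF ao(1)] by (simp add: f.con_def)
      then have "?a \<in> R" by (rule f.U_mem_con[OF R(1) ao(1)])
      with ao show False by blast
    qed
    from v.lift[OF Q M n] obtain T where "u.Y.prime T \<and> v.con T = Q \<and> T \<inter> ?M = {}" by (rule exE)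
    then have T: "u.Y.prime T" "v.con T = Q" "T \<inter> ?M = {}" by simp_all
    have "u.con T \<subseteq> R" using T(3) by (auto simp: u.con_def)
    moreover have "f.con (u.con T) = f.con Q" using over[OF T(1)] T(2) by simp
    ultimately have uT: "u.con T = R" using min[OF u.con_prime[OF T(1)]] by blast
    \<comment> \<open>\<open>T\<close> lies over the pair (R, Q). Going down along the second map
      gives \<open>T'\<close> below it over (R, R); both have the same contraction along the first
      map, so they coincide and R = Q.\<close>
    have "R \<subseteq> v.con T" using T(2) R(2) le by blast
    then obtain T' where T': "u.Y.prime T'" "v.con T' = R" "T' \<subseteq> T" using v.going_down[OF T(1) R(1)] by blast
    have "u.con T' \<subseteq> R" using u.con_mono[OF T'(3)] uT by simp
    moreover have "f.con (u.con T') = f.con Q" using over[OF T'(1)] T'(2) R(3) by simp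
    ultimately have "u.con T' = R" using min[OF u.con_prime[OF T'(1)]] by blast
    then have "T' = T" using inc T' T(1) uT unfolding u.incomparable_def by blast
    then show False using T(2) T'(2) R(2) le ne by blast
  qed
qed

text \<open>\<open>Q2\<close> is lifted along \<open>F2\<close> so as to avoid the image under
  \<open>F1\<close> of the complement of \<open>Q1\<close>; the hypothesis \<open>base\<close> shows
  that this is possible. The lift contracts along \<open>F1\<close> into \<open>Q1\<close> and to
  the same prime below, and incomparability upgrades the inclusion to an equality.\<close>

lemma glue_primes:
  fixes F :: "'a \<Rightarrow> 'b" and F1 F2 :: "'b \<Rightarrow> 'c"
  assumes "tt_pair ObX ThX TX IX ObY ThY TY IY F U"
    and "tt_pair ObY ThY TY IY ObZ ThZ TZ IZ F1 U1"
    and "tt_pair ObY ThY TY IY ObZ ThZ TZ IZ F2 U2"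
    and base: "\<And>J a. \<lbrakk>ThY J; a \<in> ObY; U2 (F1 a) \<in> J\<rbrakk> \<Longrightarrow> F (U a) \<in> J"
    and eq: "\<And>J x. \<lbrakk>ThZ J; x \<in> ObX\<rbrakk> \<Longrightarrow> F1 (F x) \<in> J \<longleftrightarrow> F2 (F x) \<in> J"
    and inc: "tt_pair.incomparable ObX ObY ThY TY F"
    and Q1: "tt_ideals.prime ObY ThY TY Q1" and Q2: "tt_ideals.prime ObY ThY TY Q2"
    and Q12: "tt_pair.con ObX F Q1 = tt_pair.con ObX F Q2"
  shows "\<exists>T. tt_ideals.prime ObZ ThZ TZ T \<and> tt_pair.con ObY F1 T = Q1 \<and> tt_pair.con ObY F2 T = Q2"
proof -
  interpret f: tt_pair ObX ThX TX IX ObY ThY TY IY F U by fact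
  interpret u: tt_pair ObY ThY TY IY ObZ ThZ TZ IZ F1 U1 by fact
  interpret v: tt_pair ObY ThY TY IY ObZ ThZ TZ IZ F2 U2 by fact
  have over: "f.con (u.con T) = f.con (v.con T)" if "u.Y.prime T" for T
    using eq[OF u.Y.prime_Th[OF that]] f.F_ob by (auto simp: f.con_def u.con_def v.con_def)
  let ?M = "F1 ` (ObY - Q1)"
  have M: "u.Y.mult_set ?M"
    unfolding u.Y.mult_set_def
  proof (intro conjI ballI)
    show "?M \<subseteq> ObZ" using u.F_ob by blast
    show "?M \<noteq> {}" using f.Y.I_ob f.Y.unit_notin_prime[OF Q1] by blast
    fix s t assume "s \<in> ?M" "t \<in> ?M"
    then obtain a b where ab: "s = F1 a" "t = F1 b" "a \<in> ObY" "b \<in> ObY" "a \<notin> Q1" "b \<notin> Q1" by blast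
    then have "TY a b \<in> ObY - Q1" using f.Y.T_ob f.Y.primeD[OF Q1] by blast
    then show "\<exists>w \<in> ?M. \<forall>J. ThZ J \<longrightarrow> TZ s t \<in> J \<longrightarrow> w \<in> J"
      using u.F_tens ab by (intro bexI[of _ "F1 (TY a b)"]) auto
  qed
  have n: "U2 m \<notin> Q2" if mM: "m \<in> ?M" for m
  proof
    assume m: "U2 m \<in> Q2"
    obtain a where a: "m = F1 a" "a \<in> ObY" "a \<notin> Q1" using mM by blast
    have "F (U a) \<in> Q2" using base[OF f.Y.prime_Th[OF Q2] a(2)] m a(1) by blast
    then have "U a \<in> f.con Q1" unfolding Q12 using f.U_ob[OF a(2)] by (simp add: f.con_def)
    then have "a \<in> Q1" by (rule f.U_mem_con[OF Q1 a(2)])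
    with a show False by blast
  qed
  from v.lift[OF Q2 M n] obtain T where "u.Y.prime T \<and> v.con T = Q2 \<and> T \<inter> ?M = {}" by (rule exE)
  then have T: "u.Y.prime T" "v.con T = Q2" "T \<inter> ?M = {}" by simp_all
  have "u.con T \<subseteq> Q1" using T(3) by (auto simp: u.con_def)
  moreover have "f.con (u.con T) = f.con Q1" using over[OF T(1)] T(2) Q12 by simp
  ultimately have "u.con T = Q1" using inc u.con_prime[OF T(1)] Q1 unfolding f.incomparable_def by blast
  with T show ?thesis by blast
qed

section \<open>Thick ideals of module categories in terms of \<open>K\<close>, and the abstract
  axioms for them\<close>

section \<open>Ideals of the module categories\<close>

context tt_category
begin

lemma Mod_simps [simp]:
  "obj (Mod K A) = modules K A" "src (Mod K A) (M, f, N) = M" "tgt (Mod K A) (M, f, N) = N"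
  "idn (Mod K A) M = (M, one (fst M), M)" "cmp (Mod K A) (N', g, P) (M, f, N) = (M, g \<cdot> f, P)"
  "plus_arr (Mod K A) (M, f, N) (M', f', N') = (M, f \<oplus> f', N)"
  "zero_arr (Mod K A) M N = (M, zero_arr K (fst M) (fst N), N)" "sus (Mod K A) = module_sus K A"
  "tens (Mod K A) = module_tensor K A"
  "(M, f, N) \<in> arr (Mod K A) \<longleftrightarrow> M \<in> modules K A \<and> N \<in> modules K A \<and> f \<in> module_homs K A M N"
  by (simp_all add: Mod_def Mod_without_octahedra_def Let_def)

lemma Mod_dist: "dist (Mod K A) = {((M, f, N), (N, g, P), (P, h, module_sus K A M)) | M f N g P h.
    M \<in> modules K A \<and> N \<in> modules K A \<and> P \<in> modules K A \<and> module_sus K A M \<in> modules K A \<and>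
    f \<in> module_homs K A M N \<and> g \<in> module_homs K A N P \<and> h \<in> module_homs K A P (module_sus K A M) \<and> (f, g, h) \<in> dist K}"
  unfolding Mod_def Mod_without_octahedra_def Let_def by auto

lemma hom_Mod: "hom (Mod K A) M N = {(M, f, N) | f. M \<in> modules K A \<and> N \<in> modules K A \<and> f \<in> module_homs K A M N}"
  unfolding hom_def by (auto simp del: Mod_simps(10)) (auto simp: Mod_simps(10))

lemma bex_hom_Mod: "\<lbrakk>M \<in> modules K A; N \<in> modules K A\<rbrakk> \<Longrightarrow>
    (\<exists>i \<in> hom (Mod K A) M N. P i) \<longleftrightarrow> (\<exists>f \<in> module_homs K A M N. P (M, f, N))"
  unfolding hom_Mod by blast

definition nul :: "('o, 'm) ring_ob \<Rightarrow> 'o \<times> 'm \<Rightarrow> bool" where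
  "nul A Z \<longleftrightarrow> Z \<in> modules K A \<and> one (fst Z) = zero_arr K (fst Z) (fst Z)"

lemma zero_object_Mod:
  assumes A: "ring_object K A"
  shows "zero_object (Mod K A) Z \<longleftrightarrow> nul A Z"
proof
  assume z: "zero_object (Mod K A) Z"
  then have Z: "Z \<in> modules K A" by (simp add: zero_object_def)
  then have "\<exists>!f. f \<in> hom (Mod K A) Z Z" using z by (simp add: zero_object_def)
  moreover have "(Z, one (fst Z), Z) \<in> hom (Mod K A) Z Z" "(Z, zero_arr K (fst Z) (fst Z), Z) \<in> hom (Mod K A) Z Z"
    using Z A module_homs_idn module_homs_zero by (auto simp: hom_Mod)
  ultimately show "nul A Z" using Z unfolding nul_def by blast
next
  assume z: "nul A Z"
  then have Z: "Z \<in> modules K A" and e: "one (fst Z) = zero_arr K (fst Z) (fst Z)" by (auto simp: nul_def)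
  have zo: "zero_object K (fst Z)" by (rule zero_objectI[OF modules_simps(1)[OF Z] e])
  show "zero_object (Mod K A) Z"
    unfolding zero_object_def
  proof (intro conjI ballI)
    fix x assume "x \<in> obj (Mod K A)"
    then have x: "x \<in> modules K A" by simp
    note xo = modules_simps(1)[OF x]
    show "\<exists>!f. f \<in> hom (Mod K A) x Z"
    proof (rule ex1I)
      show "(x, zero_arr K (fst x) (fst Z), Z) \<in> hom (Mod K A) x Z"
        using x Z module_homs_zero[OF A x Z] by (simp add: hom_Mod)
      fix f assume "f \<in> hom (Mod K A) x Z"
      then show "f = (x, zero_arr K (fst x) (fst Z), Z)"
        using zero_object_arr(1)[OF zo _ xo] by (auto simp: hom_Mod module_homs_def)
    qed
    show "\<exists>!f. f \<in> hom (Mod K A) Z x"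
    proof (rule ex1I)
      show "(Z, zero_arr K (fst Z) (fst x), x) \<in> hom (Mod K A) Z x"
        using x Z module_homs_zero[OF A Z x] by (simp add: hom_Mod)
      fix f assume "f \<in> hom (Mod K A) Z x"
      then show "f = (Z, zero_arr K (fst Z) (fst x), x)"
        using zero_object_arr(2)[OF zo _ xo] by (auto simp: hom_Mod module_homs_def)
    qed
  qed (simp add: Z)
qed

lemma is_biproduct_Mod: "ring_object K A \<Longrightarrow> is_biproduct (Mod K A) S X Y \<longleftrightarrow> mbip A S X Y"
  unfolding is_biproduct_def mbip_def
  by (simp add: bex_hom_Mod cong: conj_cong)

text \<open>The part of thickness that does not mention the tensor product, with arrows of modules
  replaced by arrows of \<open>K\<close> and direct summands by retracts. Exact functors pull it
  back even if they are not monoidal, as restriction of scalars.\<close>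

definition pthick :: "('o, 'm) ring_ob \<Rightarrow> ('o \<times> 'm) set \<Rightarrow> bool" where
  "pthick A J \<longleftrightarrow> J \<subseteq> modules K A \<and> (\<forall>Z. nul A Z \<longrightarrow> Z \<in> J) \<and>
     (\<forall>X \<in> modules K A. X \<in> J \<longleftrightarrow> module_sus K A X \<in> J) \<and>
     (\<forall>X Y Z f g h. X \<in> J \<longrightarrow> Y \<in> J \<longrightarrow> Z \<in> modules K A \<longrightarrow> f \<in> module_homs K A X Y \<longrightarrow> g \<in> module_homs K A Y Z \<longrightarrow>
         h \<in> module_homs K A Z (module_sus K A X) \<longrightarrow> (f, g, h) \<in> dist K \<longrightarrow> Z \<in> J) \<and>
     (\<forall>X Y. retr A X Y \<longrightarrow> Y \<in> J \<longrightarrow> X \<in> J)"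

abbreviation thM :: "('o, 'm) ring_ob \<Rightarrow> ('o \<times> 'm) set \<Rightarrow> bool" where
  "thM A \<equiv> thick_ideal (Mod K A)"

lemma thick_Mod:
  assumes A: "ring_object K A"
  shows "thM A J \<longleftrightarrow> pthick A J \<and> (\<forall>X \<in> modules K A. \<forall>Y \<in> J. module_tensor K A X Y \<in> J)"
proof -
  have d: "(\<forall>f g h. (f, g, h) \<in> dist (Mod K A) \<longrightarrow> src (Mod K A) f \<in> J \<longrightarrow> tgt (Mod K A) f \<in> J \<longrightarrow> tgt (Mod K A) g \<in> J)
    \<longleftrightarrow> (\<forall>X Y Z f g h. X \<in> J \<longrightarrow> Y \<in> J \<longrightarrow> Z \<in> modules K A \<longrightarrow> f \<in> module_homs K A X Y \<longrightarrow> g \<in> module_homs K A Y Z \<longrightarrow>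
         h \<in> module_homs K A Z (module_sus K A X) \<longrightarrow> (f, g, h) \<in> dist K \<longrightarrow> Z \<in> J)" if J: "J \<subseteq> modules K A"
  proof (intro iffI allI impI)
    fix X Y Z f g h
    assume h: "\<forall>f g h. (f, g, h) \<in> dist (Mod K A) \<longrightarrow> src (Mod K A) f \<in> J \<longrightarrow> tgt (Mod K A) f \<in> J \<longrightarrow> tgt (Mod K A) g \<in> J"
      and a: "X \<in> J" "Y \<in> J" "Z \<in> modules K A" "f \<in> module_homs K A X Y" "g \<in> module_homs K A Y Z"
       "h \<in> module_homs K A Z (module_sus K A X)" "(f, g, h) \<in> dist K"
    have "((X, f, Y), (Y, g, Z), (Z, h, module_sus K A X)) \<in> dist (Mod K A)"
      unfolding Mod_dist using a J module_sus_module[OF A] by blast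
    with h a(1,2) show "Z \<in> J" by fastforce
  next
    fix f g h
    assume a: "\<forall>X Y Z f g h. X \<in> J \<longrightarrow> Y \<in> J \<longrightarrow> Z \<in> modules K A \<longrightarrow> f \<in> module_homs K A X Y \<longrightarrow> g \<in> module_homs K A Y Z \<longrightarrow>
         h \<in> module_homs K A Z (module_sus K A X) \<longrightarrow> (f, g, h) \<in> dist K \<longrightarrow> Z \<in> J"
     and d: "(f, g, h) \<in> dist (Mod K A)" "src (Mod K A) f \<in> J" "tgt (Mod K A) f \<in> J"
    from d(1) obtain X f' Y g' Z h' where e: "f = (X, f', Y)" "g = (Y, g', Z)" "h = (Z, h', module_sus K A X)"
      "Z \<in> modules K A" "f' \<in> module_homs K A X Y" "g' \<in> module_homs K A Y Z"
       "h' \<in> module_homs K A Z (module_sus K A X)" "(f', g', h') \<in> dist K" unfolding Mod_dist by blast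
    from d(2,3) have "X \<in> J" "Y \<in> J" by (simp_all add: e(1))
    with a e(4-8) have "Z \<in> J" by blast
    then show "tgt (Mod K A) g \<in> J" by (simp add: e(2))
  qed
  have b: "(\<forall>s x y. is_biproduct (Mod K A) s x y \<longrightarrow> s \<in> J \<longrightarrow> x \<in> J) \<longleftrightarrow> (\<forall>X Y. retr A X Y \<longrightarrow> Y \<in> J \<longrightarrow> X \<in> J)"
    unfolding is_biproduct_Mod[OF A] using mbip_retr(1)[OF A] retr_complement[OF A] by blast
  show ?thesis
  proof (cases "J \<subseteq> modules K A")
    case True
    show ?thesis
      unfolding thick_ideal_def pthick_def zero_object_Mod[OF A] b d[OF True] Mod_simps by (simp only: conj_assoc)
  qed (simp add: thick_ideal_def pthick_def)
qed

text \<open>An exact functor as thick ideals see it: a map on objects for which the image triangles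
  merely exist, so that no action on arrows has to be carried along.\<close>

definition exf :: "('o, 'm) ring_ob \<Rightarrow> ('o, 'm) ring_ob \<Rightarrow> ('o \<times> 'm \<Rightarrow> 'o \<times> 'm) \<Rightarrow> bool" where
  "exf R B F \<longleftrightarrow> (\<forall>N \<in> modules K R. F N \<in> modules K B) \<and> (\<forall>N N'. retr R N N' \<longrightarrow> retr B (F N) (F N')) \<and>
     (\<forall>N. nul R N \<longrightarrow> nul B (F N)) \<and>
     (\<forall>N \<in> modules K R. retr B (F (module_sus K R N)) (module_sus K B (F N)) \<and> retr B (module_sus K B (F N)) (F (module_sus K R N))) \<and>
     (\<forall>X Y Z f g h. X \<in> modules K R \<longrightarrow> Y \<in> modules K R \<longrightarrow> Z \<in> modules K R \<longrightarrow> f \<in> module_homs K R X Y \<longrightarrow>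
        g \<in> module_homs K R Y Z \<longrightarrow> h \<in> module_homs K R Z (module_sus K R X) \<longrightarrow> (f, g, h) \<in> dist K \<longrightarrow>
        (\<exists>f' g' h'. f' \<in> module_homs K B (F X) (F Y) \<and> g' \<in> module_homs K B (F Y) (F Z) \<and>
          h' \<in> module_homs K B (F Z) (module_sus K B (F X)) \<and> (f', g', h') \<in> dist K))"

lemma pthick_pull:
  assumes F: "exf R B F" and R: "ring_object K R" and J: "pthick B J"
  shows "pthick R {N \<in> modules K R. F N \<in> J}"
proof -
  have F1: "F N \<in> modules K B" if "N \<in> modules K R" for N using F that unfolding exf_def by blast
  have F2: "retr B (F N) (F N')" if "retr R N N'" for N N' using F that unfolding exf_def by blast
  have F3: "nul B (F N)" if "nul R N" for N using F that unfolding exf_def by blast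
  have F4: "retr B (F (module_sus K R N)) (module_sus K B (F N))" "retr B (module_sus K B (F N)) (F (module_sus K R N))"
    if "N \<in> modules K R" for N using F that unfolding exf_def by blast+
  have J2: "Z \<in> J" if "nul B Z" for Z using J that unfolding pthick_def by blast
  have J3: "X \<in> J \<longleftrightarrow> module_sus K B X \<in> J" if "X \<in> modules K B" for X using J that unfolding pthick_def by blast
  have J5: "X \<in> J" if "retr B X Y" "Y \<in> J" for X Y using J that unfolding pthick_def by blast
  show ?thesis
    unfolding pthick_def
  proof (intro conjI allI impI ballI)
    show "Z \<in> {N \<in> modules K R. F N \<in> J}" if "nul R Z" for Z using J2[OF F3[OF that]] that by (simp add: nul_def)
    fix X assume X: "X \<in> modules K R"
    have "F X \<in> J \<longleftrightarrow> F (module_sus K R X) \<in> J"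
      using J3[OF F1[OF X]] J5 F4[OF X] by blast
    then show "(X \<in> {N \<in> modules K R. F N \<in> J}) = (module_sus K R X \<in> {N \<in> modules K R. F N \<in> J})"
      using X module_sus_module[OF R X] by simp
  next
    fix X Y Z f g h
    assume a: "X \<in> {N \<in> modules K R. F N \<in> J}" "Y \<in> {N \<in> modules K R. F N \<in> J}" "Z \<in> modules K R"
      "f \<in> module_homs K R X Y" "g \<in> module_homs K R Y Z" "h \<in> module_homs K R Z (module_sus K R X)" "(f, g, h) \<in> dist K"
    then have "\<exists>f' g' h'. f' \<in> module_homs K B (F X) (F Y) \<and> g' \<in> module_homs K B (F Y) (F Z) \<and>
          h' \<in> module_homs K B (F Z) (module_sus K B (F X)) \<and> (f', g', h') \<in> dist K"
      using F unfolding exf_def by blast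
    then have "F Z \<in> J" using a(1-3) F1[OF a(3)] J unfolding pthick_def by blast
    with a(3) show "Z \<in> {N \<in> modules K R. F N \<in> J}" by blast
  next
    fix X Y assume "retr R X Y" "Y \<in> {N \<in> modules K R. F N \<in> J}"
    then show "X \<in> {N \<in> modules K R. F N \<in> J}" using J5[OF F2] retr_modules(1) by blast
  qed blast
qed

lemma exf_tens_over:
  assumes R: "tt_ring K R" and B: "tt_ring K B" and f: "f \<in> ring_homs K R B" and M: "M \<in> modules K B"
  shows "exf R B (tens_over R B f M)"
  unfolding exf_def
proof (intro conjI ballI allI impI)
  show "tens_over R B f M N \<in> modules K B" if "N \<in> modules K R" for N by (rule tens_over_module[OF R B f M that])
  show "retr B (tens_over R B f M N) (tens_over R B f M N')" if "retr R N N'" for N N'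
    using retr_tens_over[OF R B f retr_refl[OF M tt_ringD(1)[OF B]] that] .
  show "nul B (tens_over R B f M N)" if "nul R N" for N
    using that tens_over_module[OF R B f M] tens_over_zero[OF R B f M] by (simp add: nul_def)
  show "retr B (tens_over R B f M (module_sus K R N)) (module_sus K B (tens_over R B f M N))"
    "retr B (module_sus K B (tens_over R B f M N)) (tens_over R B f M (module_sus K R N))" if "N \<in> modules K R" for N
    using miso_retr[OF tens_over_sus[OF R B f M that]] by auto
qed (rule tens_over_dist[OF R B f M])

lemma exf_restr:
  assumes R: "tt_ring K R" and B: "tt_ring K B" and f: "f \<in> ring_homs K R B"
  shows "exf B R (restr f)"
  unfolding exf_def
proof (intro conjI ballI allI impI)
  note rb = tt_ringD(1)[OF R] tt_ringD(1)[OF B]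
  show m: "restr f N \<in> modules K R" if "N \<in> modules K B" for N by (rule restr_module[OF f that rb])
  show "retr R (restr f N) (restr f N')" if "retr B N N'" for N N' by (rule retr_restr[OF that f rb])
  show "nul R (restr f N)" if "nul B N" for N using that m by (simp add: nul_def)
  show "retr R (restr f (module_sus K B N)) (module_sus K R (restr f N))"
    "retr R (module_sus K R (restr f N)) (restr f (module_sus K B N))" if "N \<in> modules K B" for N
    unfolding restr_sus[OF f that] by (rule retr_refl[OF module_sus_module[OF rb(1) m[OF that]] rb(1)])+
  fix X Y Z a b c
  assume z: "X \<in> modules K B" "Y \<in> modules K B" "Z \<in> modules K B" "a \<in> module_homs K B X Y" "b \<in> module_homs K B Y Z"
    "c \<in> module_homs K B Z (module_sus K B X)" "(a, b, c) \<in> dist K"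
  have "c \<in> module_homs K R (restr f Z) (module_sus K R (restr f X))"
    using restr_homs[OF f z(3) module_sus_module[OF rb(2) z(1)] z(6) rb] by (simp add: restr_sus[OF f z(1)])
  then show "\<exists>f' g' h'. f' \<in> module_homs K R (restr f X) (restr f Y) \<and> g' \<in> module_homs K R (restr f Y) (restr f Z) \<and>
     h' \<in> module_homs K R (restr f Z) (module_sus K R (restr f X)) \<and> (f', g', h') \<in> dist K"
    using restr_homs[OF f z(1,2,4) rb] restr_homs[OF f z(2,3,5) rb] z(7) by blast
qed

text \<open>Ideals are closed under third vertices only. Two rotations of the split triangle X -> S
  -> Y put the suspension of S there, after Y and the suspension of X.\<close>

lemma pthick_sum:
  assumes A: "ring_object K A" and J: "pthick A J" and S: "mbip A S X Y" and XY: "X \<in> J" "Y \<in> J"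
  shows "S \<in> J"
proof -
  obtain i j p q where m: "S \<in> modules K A" "X \<in> modules K A" "Y \<in> modules K A"
    and h: "i \<in> module_homs K A X S" "j \<in> module_homs K A Y S" "p \<in> module_homs K A S X" "q \<in> module_homs K A S Y"
    and e: "p \<cdot> i = one (fst X)" "q \<cdot> j = one (fst Y)" "q \<cdot> i = zero_arr K (fst X) (fst Y)" "(i \<cdot> p) \<oplus> (j \<cdot> q) = one (fst S)"
    using S unfolding mbip_def[OF A] by blast
  have h': "i \<in> hom K (fst X) (fst S)" "j \<in> hom K (fst Y) (fst S)" "p \<in> hom K (fst S) (fst X)" "q \<in> hom K (fst S) (fst Y)"
    using h by (simp_all add: module_homs_def)
  let ?z = "zero_arr K (fst Y) (sus K (fst X))"
  have "(i, q, ?z) \<in> dist K" by (rule dist_biproduct[OF h' e])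
  then have "(?z, neg_arr K (susa K i), neg_arr K (susa K q)) \<in> dist K" using dist_rot by blast
  moreover have sm: "module_sus K A S \<in> modules K A" "module_sus K A X \<in> modules K A" "module_sus K A Y \<in> modules K A"
    using m module_sus_module[OF A] by blast+
  moreover have "?z \<in> module_homs K A Y (module_sus K A X)"
    using module_homs_zero[OF A m(3) sm(2)] by (simp add: module_sus_simps)
  moreover have "neg_arr K (susa K i) \<in> module_homs K A (module_sus K A X) (module_sus K A S)"
    "neg_arr K (susa K q) \<in> module_homs K A (module_sus K A S) (module_sus K A Y)"
    using module_homs_neg[OF A] module_homs_sus[OF A] m sm h by blast+
  moreover have "module_sus K A X \<in> J" using J m XY unfolding pthick_def by blast
  ultimately have "module_sus K A S \<in> J" using J XY unfolding pthick_def by blast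
  then show ?thesis using J m unfolding pthick_def by blast
qed

lemma thM_retr: "\<lbrakk>thM A J; ring_object K A; retr A X Y; Y \<in> J\<rbrakk> \<Longrightarrow> X \<in> J"
  unfolding thick_Mod pthick_def by blast

lemma thM_miso: "\<lbrakk>thM A J; ring_object K A; miso A X Y\<rbrakk> \<Longrightarrow> X \<in> J \<longleftrightarrow> Y \<in> J"
  using thM_retr miso_retr by blast

context
  fixes A
  assumes A: "tt_ring K A"
begin

lemma A_ring: "ring_object K A" and A_idn: "one (car A) \<in> ring_homs K A A" and A_self: "(car A, mul A) \<in> modules K A"
  using tt_ringD(1)[OF A] ring_homs_idn self_module by auto

lemma module_tensor_eq: "M \<in> modules K A \<Longrightarrow> module_tensor K A M N = tens_over A A (one (car A)) M N"
  by (rule module_tensor_tens_over[OF _ A_ring])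

lemma one_one: "one (car A) \<cdot> one (car A) = one (car A)"
  using ring_simps[OF A_ring] by simp

lemma module_tensor_module: "\<lbrakk>M \<in> modules K A; N \<in> modules K A\<rbrakk> \<Longrightarrow> module_tensor K A M N \<in> modules K A"
  by (simp add: module_tensor_eq tens_over_module[OF A A A_idn])

lemma module_tensor_comm: "\<lbrakk>M \<in> modules K A; N \<in> modules K A\<rbrakk> \<Longrightarrow> miso A (module_tensor K A M N) (module_tensor K A N M)"
  using tens_over_comm[OF A] by (simp add: module_tensor_eq)

lemma module_tensor_assoc: "\<lbrakk>M \<in> modules K A; N \<in> modules K A; P \<in> modules K A\<rbrakk> \<Longrightarrow>
   miso A (module_tensor K A M (module_tensor K A N P)) (module_tensor K A (module_tensor K A M N) P)"
  using tens_over_assoc[OF A A A A_idn A_idn, of M N P] tens_over_module[OF A A A_idn]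
  by (simp add: module_tensor_eq one_one del: cmp_idn_r cmp_idn_l)

lemma module_tensor_unit: "M \<in> modules K A \<Longrightarrow> miso A (module_tensor K A M (car A, mul A)) M"
  using tens_over_unit[OF A A A_idn] by (simp add: module_tensor_eq)

lemma tt_ideals_Mod: "tt_ideals (modules K A) (thM A) (module_tensor K A) (car A, mul A)"
proof
  note th = thick_Mod[OF A_ring]
  show "J \<subseteq> modules K A" if "thM A J" for J using that unfolding th pthick_def by blast
  show "(car A, mul A) \<in> modules K A" by (rule A_self)
  show "module_tensor K A a b \<in> modules K A" if "a \<in> modules K A" "b \<in> modules K A" for a b
    by (rule module_tensor_module[OF that])
  show "module_tensor K A a c \<in> J" if "thM A J" "a \<in> modules K A" "c \<in> J" for J a c
    using that unfolding th by blast
  show "module_tensor K A b a \<in> J" if "thM A J" "a \<in> modules K A" "b \<in> modules K A" "module_tensor K A a b \<in> J" for J a b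
    using thM_miso[OF that(1) A_ring module_tensor_comm[OF that(2,3)]] that(4) by blast
  show "module_tensor K A (module_tensor K A a b) c \<in> J \<longleftrightarrow> module_tensor K A a (module_tensor K A b c) \<in> J"
    if "thM A J" "a \<in> modules K A" "b \<in> modules K A" "c \<in> modules K A" for J a b c
    using thM_miso[OF that(1) A_ring module_tensor_assoc[OF that(2-4)]] by blast
  show "module_tensor K A a (car A, mul A) \<in> J \<longleftrightarrow> a \<in> J" if "thM A J" "a \<in> modules K A" for J a
    using thM_miso[OF that(1) A_ring module_tensor_unit[OF that(2)]] by blast
  \<comment> \<open>The thick part is exactness of the tensor product with \<open>a\<close>; the
    ideal part commutes \<open>X\<close> past \<open>a\<close> by symmetry and
    associativity.\<close>
  show "thM A {c \<in> modules K A. module_tensor K A a c \<in> J}" if J: "thM A J" and a: "a \<in> modules K A" for J a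
    unfolding th
  proof (intro conjI ballI)
    have "exf A A (module_tensor K A a)"
      using exf_tens_over[OF A A A_idn a] unfolding module_tensor_eq[OF a, abs_def] .
    then show "pthick A {c \<in> modules K A. module_tensor K A a c \<in> J}"
      using pthick_pull A_ring J unfolding th by blast
    fix X Y assume X: "X \<in> modules K A" and Y: "Y \<in> {c \<in> modules K A. module_tensor K A a c \<in> J}"
    then have Y': "Y \<in> modules K A" "module_tensor K A a Y \<in> J" by auto
    let ?t = "module_tensor K A"
    have 1: "?t X (?t a Y) \<in> J" using J X Y' unfolding th by blast
    then have 2: "?t (?t X a) Y \<in> J" using thM_miso[OF J A_ring module_tensor_assoc[OF X a Y'(1)]] by blast
    have "retr A (?t (?t a X) Y) (?t (?t X a) Y)"
      using retr_tens_over[OF A A A_idn miso_retr(1)[OF module_tensor_comm[OF a X]] retr_refl[OF Y'(1) A_ring]]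
        module_tensor_module a X by (simp add: module_tensor_eq)
    with 2 have "?t (?t a X) Y \<in> J" using thM_retr[OF J A_ring] by blast
    then have "?t a (?t X Y) \<in> J" using thM_miso[OF J A_ring module_tensor_assoc[OF a X Y'(1)]] by blast
    then show "?t X Y \<in> {c \<in> modules K A. ?t a c \<in> J}" using module_tensor_module[OF X Y'(1)] by blast
  qed
  show "thM A (\<Union> C)" if C: "C \<noteq> {}" "\<And>J. J \<in> C \<Longrightarrow> thM A J"
    "\<And>J J'. \<lbrakk>J \<in> C; J' \<in> C\<rbrakk> \<Longrightarrow> J \<subseteq> J' \<or> J' \<subseteq> J" for C
  proof -
    have t: "pthick A J" "\<And>X Y. X \<in> modules K A \<Longrightarrow> Y \<in> J \<Longrightarrow> module_tensor K A X Y \<in> J" if "J \<in> C" for J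
      using C(2)[OF that] unfolding th by blast+
    have "pthick A (\<Union> C)"
      unfolding pthick_def
    proof (intro conjI allI impI ballI)
      show "\<Union> C \<subseteq> modules K A" using t(1) unfolding pthick_def by blast
      show "Z \<in> \<Union> C" if "nul A Z" for Z using t(1) C(1) that unfolding pthick_def by blast
      show "(X \<in> \<Union> C) = (module_sus K A X \<in> \<Union> C)" if "X \<in> modules K A" for X
        using t(1) that unfolding pthick_def by blast
      show "X \<in> \<Union> C" if "retr A X Y" "Y \<in> \<Union> C" for X Y using t(1) that unfolding pthick_def by blast
      fix X Y Z f g h
      assume a: "X \<in> \<Union> C" "Y \<in> \<Union> C" "Z \<in> modules K A" "f \<in> module_homs K A X Y" "g \<in> module_homs K A Y Z"
        "h \<in> module_homs K A Z (module_sus K A X)" "(f, g, h) \<in> dist K"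
      obtain J where "J \<in> C" "X \<in> J" "Y \<in> J" using a(1,2) C(3) by blast
      then show "Z \<in> \<Union> C" using t(1) a(3-7) unfolding pthick_def by blast
    qed
    then show ?thesis unfolding th using t(2) by blast
  qed
  show "thM A (\<Inter> C)" if C: "C \<noteq> {}" "\<And>J. J \<in> C \<Longrightarrow> thM A J" for C
  proof -
    have t: "pthick A J" "\<And>X Y. X \<in> modules K A \<Longrightarrow> Y \<in> J \<Longrightarrow> module_tensor K A X Y \<in> J" if "J \<in> C" for J
      using C(2)[OF that] unfolding th by blast+
    have "pthick A (\<Inter> C)"
      unfolding pthick_def
    proof (intro conjI allI impI ballI)
      show "\<Inter> C \<subseteq> modules K A" using t(1) C(1) unfolding pthick_def by blast
      show "Z \<in> \<Inter> C" if "nul A Z" for Z using t(1) that unfolding pthick_def by blast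
      show "(X \<in> \<Inter> C) = (module_sus K A X \<in> \<Inter> C)" if "X \<in> modules K A" for X
        using t(1) that unfolding pthick_def by blast
      show "X \<in> \<Inter> C" if "retr A X Y" "Y \<in> \<Inter> C" for X Y using t(1) that unfolding pthick_def by blast
      show "Z \<in> \<Inter> C" if "X \<in> \<Inter> C" "Y \<in> \<Inter> C" "Z \<in> modules K A" "f \<in> module_homs K A X Y" "g \<in> module_homs K A Y Z"
        "h \<in> module_homs K A Z (module_sus K A X)" "(f, g, h) \<in> dist K" for X Y Z f g h
        using t(1) that unfolding pthick_def by blast
    qed
    then show ?thesis unfolding th using t(2) by blast
  qed
qed

lemma prime_Mod: "prime_ideal (Mod K A) P \<longleftrightarrow> tt_ideals.prime (modules K A) (thM A) (module_tensor K A) P"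
  unfolding prime_ideal_def tt_ideals.prime_def[OF tt_ideals_Mod] by simp

end

section \<open>Extension and restriction of scalars as an adjoint pair with projection
  formula\<close>

context
  fixes R B f
  assumes R: "tt_ring K R" and B: "tt_ring K B" and f: "f \<in> ring_homs K R B"
begin

abbreviation (input) ext where "ext \<equiv> extend_scalars K R B f"

lemma extend_eq: "ext = tens_over R B f (car B, mul B)"
  by (rule ext) (rule extend_scalars_tens_over)

text \<open>Associativity along R -> B = B, followed by the unit law for B.\<close>

lemma extend_tensor_r:
  assumes M: "M \<in> modules K B" and N: "N \<in> modules K R"
  shows "retr B (module_tensor K B M (ext N)) (tens_over R B f M N)"
    "retr B (tens_over R B f M N) (module_tensor K B M (ext N))"
proof -
  note S = A_self[OF B]
  have 1: "miso B (module_tensor K B M (ext N)) (tens_over R B f (module_tensor K B M (car B, mul B)) N)"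
    using tens_over_assoc[OF R B B f A_idn[OF B] M S N] M S ring_homs_simps[OF f]
    by (simp add: module_tensor_eq[OF B] extend_eq)
  note u = miso_retr[OF module_tensor_unit[OF B M]]
  have "retr B (tens_over R B f (module_tensor K B M (car B, mul B)) N) (tens_over R B f M N)"
    "retr B (tens_over R B f M N) (tens_over R B f (module_tensor K B M (car B, mul B)) N)"
    using retr_tens_over[OF R B f _ retr_refl[OF N]] u tt_ringD(1)[OF R] by blast+
  with miso_retr[OF 1] show "retr B (module_tensor K B M (ext N)) (tens_over R B f M N)"
    "retr B (tens_over R B f M N) (module_tensor K B M (ext N))"
    using retr_trans tt_ringD(1)[OF B] by blast+
qed

text \<open>Every homomorphism of tt-rings enters the abstract theory here. The counit condition is
  \<open>retr_extend\<close>, thus separability of B; the projection formula combines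
  \<open>extend_tensor_r\<close> with the strict equality \<open>restr_tens_over\<close>.\<close>

lemma tt_pair_Mod: "tt_pair (modules K R) (thM R) (module_tensor K R) (car R, mul R)
    (modules K B) (thM B) (module_tensor K B) (car B, mul B) (extend_scalars K R B f) (restr f)"
proof -
  interpret X: tt_ideals "modules K R" "thM R" "module_tensor K R" "(car R, mul R)" by (rule tt_ideals_Mod[OF R])
  interpret Y: tt_ideals "modules K B" "thM B" "module_tensor K B" "(car B, mul B)" by (rule tt_ideals_Mod[OF B])
  note S = A_self[OF B] and rb = tt_ringD(1)[OF R] tt_ringD(1)[OF B]
  have Fm: "ext N \<in> modules K B" if "N \<in> modules K R" for N
    unfolding extend_eq by (rule tens_over_module[OF R B f S that])
  have Um: "restr f M \<in> modules K R" if "M \<in> modules K B" for M by (rule restr_module[OF f that rb])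
  have Ft: "module_tensor K B (ext a) (ext b) \<in> J \<longleftrightarrow> ext (module_tensor K R a b) \<in> J"
    if J: "thM B J" and a: "a \<in> modules K R" and b: "b \<in> modules K R" for J a b
  proof -
    have "miso B (ext (module_tensor K R a b)) (tens_over R B f (ext a) b)"
      using tens_over_assoc[OF R R B A_idn[OF R] f S a b] a ring_homs_simps[OF f]
      by (simp add: module_tensor_eq[OF R] extend_eq)
    then show ?thesis using extend_tensor_r[OF Fm[OF a] b] thM_retr[OF J rb(2)] thM_miso[OF J rb(2)] by blast
  qed
  have pr: "retr R (restr f (module_tensor K B (ext a) c)) (module_tensor K R a (restr f c))"
    "retr R (module_tensor K R a (restr f c)) (restr f (module_tensor K B (ext a) c))"
    if a: "a \<in> modules K R" and c: "c \<in> modules K B" for a c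
  proof -
    \<comment> \<open>Both sides use the same coequalizer in \<open>K\<close>, with the action of B
      remembered or restricted to R.\<close>
    have "restr f (tens_over R B f c a) = module_tensor K R (restr f c) a"
      using restr_tens_over[OF R R A_idn[OF R] B f c a] ring_homs_simps[OF f] module_tensor_eq[OF R Um[OF c]]
        ring_simps(1)[OF rb(1)] by simp
    moreover note retr_restr[OF extend_tensor_r(1)[OF c a] f rb] retr_restr[OF extend_tensor_r(2)[OF c a] f rb]
    moreover note c1 = miso_retr[OF module_tensor_comm[OF B Fm[OF a] c]]
    note retr_restr[OF c1(1) f rb] retr_restr[OF c1(2) f rb]
    moreover note miso_retr[OF module_tensor_comm[OF R a Um[OF c]]]
    ultimately show "retr R (restr f (module_tensor K B (ext a) c)) (module_tensor K R a (restr f c))"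
      "retr R (module_tensor K R a (restr f c)) (restr f (module_tensor K B (ext a) c))"
      using retr_trans rb(1) by metis+
  qed
  show ?thesis
  proof
    show "ext a \<in> modules K B" if "a \<in> modules K R" for a by (rule Fm[OF that])
    show "restr f c \<in> modules K R" if "c \<in> modules K B" for c by (rule Um[OF that])
    show "ext (module_tensor K R a b) \<in> J \<longleftrightarrow> module_tensor K B (ext a) (ext b) \<in> J"
      if "thM B J" "a \<in> modules K R" "b \<in> modules K R" for J a b using Ft[OF that] by blast
    show "ext (car R, mul R) \<in> J \<longleftrightarrow> (car B, mul B) \<in> J" if "thM B J" for J
      using thM_miso[OF that rb(2) tens_over_unit[OF R B f S]] unfolding extend_eq .
    show "c \<in> J" if "thM B J" "c \<in> modules K B" "ext (restr f c) \<in> J" for J c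
      using thM_retr[OF that(1) rb(2) retr_extend[OF R B f that(2)]] that(3) unfolding extend_eq .
    show "restr f (module_tensor K B (ext a) c) \<in> J \<longleftrightarrow> module_tensor K R a (restr f c) \<in> J"
      if "thM R J" "a \<in> modules K R" "c \<in> modules K B" for J a c
      using thM_retr[OF that(1) rb(1)] pr[OF that(2,3)] by blast
    show "thM R {a \<in> modules K R. ext a \<in> J}" if J: "thM B J" for J
      unfolding thick_Mod[OF rb(1)]
    proof (intro conjI ballI)
      show "pthick R {a \<in> modules K R. ext a \<in> J}"
        using pthick_pull[OF exf_tens_over[OF R B f S] rb(1)] J unfolding thick_Mod[OF rb(2)] extend_eq by blast
      fix X Y assume "X \<in> modules K R" "Y \<in> {a \<in> modules K R. ext a \<in> J}"
      then show "module_tensor K R X Y \<in> {a \<in> modules K R. ext a \<in> J}"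
        using Ft[OF J] Y.Th_ideal[OF J Fm] X.T_ob by blast
    qed
    show "thM B {c \<in> modules K B. restr f c \<in> J}" if J: "thM R J" for J
      unfolding thick_Mod[OF rb(2)]
    proof (intro conjI ballI)
      show "pthick B {c \<in> modules K B. restr f c \<in> J}"
        using pthick_pull[OF exf_restr[OF R B f] rb(2)] J unfolding thick_Mod[OF rb(1)] by blast
      fix X Y assume X: "X \<in> modules K B" and Y: "Y \<in> {c \<in> modules K B. restr f c \<in> J}"
      then have Y': "Y \<in> modules K B" "restr f Y \<in> J" by auto
      \<comment> \<open>Restriction is not monoidal, but \<open>X\<close> is a retract of the
        extension of its restriction. So the restriction of X \<otimes> Y is a retract of something
        to which the projection formula applies.\<close>
      have "retr B (module_tensor K B X Y) (module_tensor K B (ext (restr f X)) Y)"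
        using retr_tens_over[OF B B A_idn[OF B] retr_extend[OF R B f X] retr_refl[OF Y'(1) rb(2)]]
         module_tensor_eq[OF B X] module_tensor_eq[OF B Fm[OF Um[OF X]]] by (simp add: extend_eq)
      then have "retr R (restr f (module_tensor K B X Y)) (restr f (module_tensor K B (ext (restr f X)) Y))"
        using retr_restr[OF _ f rb] by blast
      then have "retr R (restr f (module_tensor K B X Y)) (module_tensor K R (restr f X) (restr f Y))"
        using pr(1)[OF Um[OF X] Y'(1)] retr_trans rb(1) by blast
      then have "restr f (module_tensor K B X Y) \<in> J"
        using thM_retr[OF J rb(1)] X.Th_ideal[OF J Um[OF X] Y'(2)] by blast
      then show "module_tensor K B X Y \<in> {c \<in> modules K B. restr f c \<in> J}" using Y.T_ob[OF X Y'(1)] by blast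
    qed
  qed
qed

end

end

section \<open>Incomparability of the primes in a fibre, along the splitting tower\<close>

section \<open>The splitting tower\<close>

context tt_category
begin

text \<open>
  \<open>B \<otimes>\<^sub>R a\<close> as a retract of \<open>P \<otimes>\<^sub>B a\<close>, where \<open>P\<close> is \<open>B \<otimes>\<^sub>R B\<close> up to isomorphism, presented as a split
  quotient \<open>k\<close> of \<open>B \<otimes> B\<close>. The \<open>B\<close>-module structure of \<open>P \<otimes>\<^sub>B a\<close> comes from the right factor of \<open>P\<close>.
\<close>

lemma retr_base_change:
  assumes R: "tt_ring K R" and B: "tt_ring K B" and f: "f \<in> ring_homs K R B" and P: "ring_object K P"
    and k: "k \<in> ring_homs K (ring_tensor K B B) P" and a: "a \<in> modules K B"
    and kb: "\<And>b1 b2 x. \<lbrakk>el b1; el b2; el x; ty b1 = car B; ty b2 = car B; ty x = car R; lab x \<inter> lab b1 = {}\<rbrakk> \<Longrightarrow>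
       k \<star> (b1 \<bowtie> (mul B \<star> ((f \<star> x) \<bowtie> b2))) = k \<star> ((mul B \<star> ((f \<star> x) \<bowtie> b1)) \<bowtie> b2)"
    and sct: "sct \<in> arr K" "src K sct = car P" "tgt K sct = car B \<odot> car B" "k \<cdot> sct = one (car P)"
    and kp: "\<And>w g. \<lbrakk>w \<in> obj K; g \<in> arr K; src K g = (car B \<odot> car B) \<odot> w;
       g \<star> (((mul B \<star> ((f \<star> V 0 (car R)) \<bowtie> V 1 (car B))) \<bowtie> V 2 (car B)) \<bowtie> V 3 w) =
       g \<star> ((V 1 (car B) \<bowtie> (mul B \<star> ((f \<star> V 0 (car R)) \<bowtie> V 2 (car B)))) \<bowtie> V 3 w)\<rbrakk> \<Longrightarrow> g \<cdot> ((sct \<cdot> k) \<otimes> one w) = g"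
  shows "retr B (tens_over R B f (car B, mul B) (restr f a))
     (restr (right_incl K B) (tens_over B (ring_tensor K B B) (left_incl K B) (restr k (car P, mul P)) a))"
proof -
  let ?D = "ring_tensor K B B" and ?l = "left_incl K B" and ?r = "right_incl K B" and ?b = "car B"
  note rb = tt_ringD(1)[OF R] tt_ringD(1)[OF B]
  have D: "tt_ring K ?D" by (rule ring_tensor_tt[OF B B])
  note Dr = tt_ringD(1)[OF D] and l = incl_ring_homs(1)[OF rb(2)] and r = incl_ring_homs(2)[OF rb(2)]
  let ?S = "(?b, mul B)" and ?Q = "(car P, mul P)"
  have S: "?S \<in> modules K B" and Q: "?Q \<in> modules K P" by (rule self_module[OF rb(2)], rule self_module[OF P])
  let ?M = "restr k ?Q" and ?N = "restr f a"
  have M: "?M \<in> modules K ?D" by (rule restr_module[OF k Q Dr P])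
  have N: "?N \<in> modules K R" by (rule restr_module[OF f a rb])
  note cX = R B f S N and cY = B D l M a
  let ?X = "tens_over R B f ?S ?N" and ?Y = "tens_over B ?D ?l ?M a"
  let ?qX = "tq R f ?S ?N" and ?qY = "tq B ?l ?M a"
  have mX: "?X \<in> modules K B" and mY: "?Y \<in> modules K ?D" by (rule tens_over_module[OF cX], rule tens_over_module[OF cY])
  have mY': "restr ?r ?Y \<in> modules K B" by (rule restr_module[OF r mY rb(2) Dr])
  note s = rb tt_ringD(2)[OF B] P Dr ring_tensor_simps[OF rb(2) rb(2)] incl_simps[OF rb(2)] ring_homs_simps[OF f] ring_homs_simps[OF k, unfolded ring_tensor_simps(1)[OF rb(2) rb(2)]]
    tq_simps[OF cX] tens_over_simps[OF cX] tq_simps[OF cY] tens_over_simps[OF cY] modules_simps[OF a] sct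
    modules_simps[OF M, unfolded ring_tensor_simps(1)[OF rb(2) rb(2)]] modules_simps[OF N]
  let ?u = "uni B \<star> u1" and ?a = "fst a"
  have Mact: "snd ?M \<star> (d \<bowtie> (k \<star> t)) = k \<star> mul ?D \<star> (d \<bowtie> t)" if "el d" "el t" "ty d = ?b \<odot> ?b" "ty t = ?b \<odot> ?b" for d t
    using that restr_act[OF k Q Dr P, of d "k \<star> t"] ring_hom_mul[OF k Dr P, of d t] by (simp add: s)
  have kl: "snd ?M \<star> ((?l \<star> b) \<bowtie> (k \<star> (b1 \<bowtie> b2))) = k \<star> ((mul B \<star> (b \<bowtie> b1)) \<bowtie> b2)"
    if "el b" "el b1" "el b2" "ty b = ?b" "ty b1 = ?b" "ty b2 = ?b" for b b1 b2
    using that by (simp add: s Mact incl_el ring_tensor_mul mul_uni_l)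
  have kr: "snd ?M \<star> ((?r \<star> b) \<bowtie> (k \<star> (b1 \<bowtie> b2))) = k \<star> (b1 \<bowtie> (mul B \<star> (b \<bowtie> b2)))"
    if "el b" "el b1" "el b2" "ty b = ?b" "ty b1 = ?b" "ty b2 = ?b" "lab b \<inter> lab b1 = {}" for b b1 b2
    using that by (simp add: s Mact incl_el ring_tensor_mul mul_uni_l)
  \<comment> \<open>The inclusion \<open>\<phi>\<close> is b \<otimes> m -> k(1 \<otimes> b)
    \<otimes> m; the retraction \<open>\<psi>\<close> below is k(b1 \<otimes> b2) \<otimes> m -> b2
    \<otimes> b1 m.\<close>
  define g0 where "g0 = ?qY \<cdot> ((k \<cdot> ?r) \<otimes> one ?a)"
  have g0: "g0 \<in> arr K" "src K g0 = ?b \<odot> ?a" "tgt K g0 = fst ?Y" by (simp_all add: g0_def s)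
  have g0e: "g0 \<star> (b \<bowtie> m) = ?qY \<star> ((k \<star> (?u \<bowtie> b)) \<bowtie> m)" if "el b" "el m" "ty b = ?b" "ty m = ?a" for b m
    using that by (simp add: g0_def s incl_el)
  define \<phi> where "\<phi> = g0 \<cdot> ts R f ?S ?N"
  have ph: "\<phi> \<in> arr K" "src K \<phi> = fst ?X" "tgt K \<phi> = fst ?Y" by (simp_all add: \<phi>_def s g0)
  have phe: "\<phi> \<star> ?qX \<star> t = g0 \<star> t" if "el t" "ty t = ?b \<odot> ?a" for t
    unfolding \<phi>_def
    by (rule tq_lift[OF cX, of _ "V 1 ?b" "V 2 ?a"])
      (simp_all add: s that g0 g0e restr_act[OF f a] tq_balanced[OF cY] kl mul_uni_r kb)
  have Yact: "snd (restr ?r ?Y) \<star> (b \<bowtie> (?qY \<star> ((k \<star> (b1 \<bowtie> b2)) \<bowtie> m))) = ?qY \<star> ((k \<star> (b1 \<bowtie> (mul B \<star> (b \<bowtie> b2)))) \<bowtie> m)"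
    if "el b" "el b1" "el b2" "el m" "ty b = ?b" "ty b1 = ?b" "ty b2 = ?b" "ty m = ?a" "lab b \<inter> lab b1 = {}" for b b1 b2 m
    using that by (simp add: s restr_act[OF r mY] tens_over_act[OF cY] kr)
  have ph_hom: "\<phi> \<in> module_homs K B ?X (restr ?r ?Y)"
    by (rule module_homsI[OF mX mY' rb(2), of _ "?qX \<star> (V 1 ?b \<bowtie> V 2 ?a)"])
      (simp_all add: s ph phe g0e tens_over_act[OF cX] Yact)
  define e0 where "e0 = ?qX \<cdot> ((one ?b \<otimes> snd a) \<cdot> (\<alpha> ?b ?b ?a \<cdot> (\<beta> ?b ?b \<otimes> one ?a)))"
  have e0: "e0 \<in> arr K" "src K e0 = (?b \<odot> ?b) \<odot> ?a" "tgt K e0 = fst ?X" by (simp_all add: e0_def s)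
  have e0e: "e0 \<star> ((b1 \<bowtie> b2) \<bowtie> m) = ?qX \<star> (b2 \<bowtie> (snd a \<star> (b1 \<bowtie> m)))"
    if "el b1" "el b2" "el m" "ty b1 = ?b" "ty b2 = ?b" "ty m = ?a" "lab b1 \<inter> lab b2 = {}" for b1 b2 m
    using that by (simp add: e0_def s ap_simps)
  have Xbal: "?qX \<star> (b \<bowtie> (snd a \<star> ((f \<star> x) \<bowtie> m))) = ?qX \<star> ((mul B \<star> ((f \<star> x) \<bowtie> b)) \<bowtie> m)"
    if "el b" "el x" "el m" "ty b = ?b" "ty x = car R" "ty m = ?a" "lab x \<inter> lab b = {}" for b x m
    using tq_balanced[OF cX, of x b m] that by (simp add: s restr_act[OF f a])
  define e1 where "e1 = e0 \<cdot> (sct \<otimes> one ?a)"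
  have e1: "e1 \<in> arr K" "src K e1 = car P \<odot> ?a" "tgt K e1 = fst ?X" by (simp_all add: e1_def s e0)
  \<comment> \<open>\<open>e0\<close> is balanced over R in b1 and b2, which by the hypothesis
    \<open>kp\<close> is what it takes to descend along \<open>k\<close>.\<close>
  have e1k: "e0 \<cdot> ((sct \<cdot> k) \<otimes> one ?a) = e0"
  proof (rule kp)
    have "e0 \<star> (((mul B \<star> ((f \<star> V 0 (car R)) \<bowtie> V 1 ?b)) \<bowtie> V 2 ?b) \<bowtie> V 3 ?a) =
      ?qX \<star> (V 2 ?b \<bowtie> (snd a \<star> ((f \<star> V 0 (car R)) \<bowtie> (snd a \<star> (V 1 ?b \<bowtie> V 3 ?a)))))"
      by (simp add: s e0e act_act[OF a])
    also have "\<dots> = e0 \<star> ((V 1 ?b \<bowtie> (mul B \<star> ((f \<star> V 0 (car R)) \<bowtie> V 2 ?b))) \<bowtie> V 3 ?a)"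
      by (simp add: s e0e Xbal)
    finally show "e0 \<star> (((mul B \<star> ((f \<star> V 0 (car R)) \<bowtie> V 1 ?b)) \<bowtie> V 2 ?b) \<bowtie> V 3 ?a) =
       e0 \<star> ((V 1 ?b \<bowtie> (mul B \<star> ((f \<star> V 0 (car R)) \<bowtie> V 2 ?b))) \<bowtie> V 3 ?a)" .
  qed (simp_all add: s e0)
  have e1e: "e1 \<star> ((k \<star> t) \<bowtie> m) = e0 \<star> (t \<bowtie> m)" if "el t" "el m" "ty t = ?b \<odot> ?b" "ty m = ?a" for t m
    using arg_cong[OF e1k, of "\<lambda>f. f \<star> (t \<bowtie> m)"] that by (simp add: s e0 e1_def)
  have spk: "split_epi k" by (rule split_epiI[of k sct]) (simp_all add: s)
  define \<psi> where "\<psi> = e1 \<cdot> ts B ?l ?M a"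
  have ps: "\<psi> \<in> arr K" "src K \<psi> = fst ?Y" "tgt K \<psi> = fst ?X" by (simp_all add: \<psi>_def s e1)
  have pse: "\<psi> \<star> ?qY \<star> t = e1 \<star> t" if "el t" "ty t = car P \<odot> ?a" for t
    unfolding \<psi>_def
    by (rule tq_lift[OF cY, of _ "k \<star> (V 1 ?b \<bowtie> V 2 ?b)" "V 3 ?a"])
      (simp_all add: s that spk e1 e1e kl e0e act_act[OF a] mul_comm)
  have ps_hom: "\<psi> \<in> module_homs K B (restr ?r ?Y) ?X"
    by (rule module_homsI[OF mY' mX rb(2), of _ "?qY \<star> ((k \<star> (V 1 ?b \<bowtie> V 2 ?b)) \<bowtie> V 3 ?a)"])
      (simp_all add: s spk ps pse Yact e1e e0e tens_over_act[OF cX])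
  have "\<psi> \<cdot> \<phi> = one (fst ?X)"
    by (rule gen_eqI[of "?qX \<star> (V 1 ?b \<bowtie> V 2 ?a)"])
      (simp_all add: s ph ps phe pse g0e e1e e0e act_uni[OF a])
  with ph_hom ps_hom mX mY' show ?thesis unfolding retr_def by blast
qed

text \<open>Balance at b1 = b2 = 1. Consequently the two extensions of an object that comes from R
  agree, as the gluing arguments require.\<close>

lemma incl_eq_on_base:
  assumes R: "ring_object K R" and B: "ring_object K B" and f: "f \<in> ring_homs K R B" and k: "k \<in> arr K" "src K k = car B \<odot> car B"
    and kb: "\<And>b1 b2 x. \<lbrakk>el b1; el b2; el x; ty b1 = car B; ty b2 = car B; ty x = car R; lab x \<inter> lab b1 = {}\<rbrakk> \<Longrightarrow>
       k \<star> (b1 \<bowtie> (mul B \<star> ((f \<star> x) \<bowtie> b2))) = k \<star> ((mul B \<star> ((f \<star> x) \<bowtie> b1)) \<bowtie> b2)"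
  shows "(k \<cdot> left_incl K B) \<cdot> f = (k \<cdot> right_incl K B) \<cdot> f"
proof (rule gen_eqI[of "V 0 (car R)"])
  note s = R B k ring_homs_simps[OF f] incl_simps[OF B]
  have "k \<star> ((uni B \<star> u1) \<bowtie> (f \<star> V 0 (car R))) = k \<star> ((f \<star> V 0 (car R)) \<bowtie> (uni B \<star> u1))"
    using kb[of "uni B \<star> u1" "uni B \<star> u1" "V 0 (car R)"] by (simp add: s mul_uni_r)
  then show "((k \<cdot> left_incl K B) \<cdot> f) \<star> V 0 (car R) = ((k \<cdot> right_incl K B) \<cdot> f) \<star> V 0 (car R)"
    by (simp add: s incl_el)
qed (use assms ring_homs_simps[OF f] incl_simps[OF B] in simp_all)

lemma extend_extend:
  assumes R: "tt_ring K R" and B: "tt_ring K B" and E: "tt_ring K E" and f: "f \<in> ring_homs K R B" and u: "u \<in> ring_homs K B E"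
    and J: "thM E J" and x: "x \<in> modules K R"
  shows "extend_scalars K B E u (extend_scalars K R B f x) \<in> J \<longleftrightarrow> extend_scalars K R E (u \<cdot> f) x \<in> J"
proof -
  note rr = tt_ringD(1)[OF R] tt_ringD(1)[OF B] tt_ringD(1)[OF E]
  have uf: "u \<cdot> f \<in> ring_homs K R E" by (rule ring_homs_cmp[OF f u rr])
  let ?SE = "(car E, mul E)"
  have 1: "miso E (extend_scalars K B E u (extend_scalars K R B f x)) (tens_over R E (u \<cdot> f) (tens_over B E u ?SE (car B, mul B)) x)"
    unfolding extend_scalars_tens_over by (rule tens_over_assoc[OF R B E f u A_self[OF E] A_self[OF B] x])
  note m = miso_retr[OF tens_over_unit[OF B E u A_self[OF E]]]
  show ?thesis
    using thM_miso[OF J rr(3) 1] thM_retr[OF J rr(3)] retr_tens_over[OF R E uf m(1) retr_refl[OF x rr(1)]]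
      retr_tens_over[OF R E uf m(2) retr_refl[OF x rr(1)]]
    unfolding extend_scalars_tens_over by blast
qed

lemma mbip_restr:
  assumes B: "ring_object K B" and R: "ring_object K R" and f: "f \<in> ring_homs K R B" and S: "mbip B S X Y"
  shows "mbip R (restr f S) (restr f X) (restr f Y)"
proof -
  have m: "S \<in> modules K B" "X \<in> modules K B" "Y \<in> modules K B" using S unfolding mbip_def[OF B] by blast+
  note h = restr_homs[OF f _ _ _ R B] and n = restr_module[OF f _ R B]
  obtain i j p q where
    h': "i \<in> module_homs K B X S" "j \<in> module_homs K B Y S" "p \<in> module_homs K B S X" "q \<in> module_homs K B S Y"
    and e: "p \<cdot> i = one (fst X)" "q \<cdot> j = one (fst Y)" "q \<cdot> i = zero_arr K (fst X) (fst Y)"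
      "p \<cdot> j = zero_arr K (fst Y) (fst X)" "(i \<cdot> p) \<oplus> (j \<cdot> q) = one (fst S)"
    using S unfolding mbip_def[OF B] by blast
  show ?thesis
    unfolding mbip_def[OF R] fst_restr
    using n[OF m(1)] n[OF m(2)] n[OF m(3)] h[OF m(2,1) h'(1)] h[OF m(3,1) h'(2)] h[OF m(1,2) h'(3)] h[OF m(1,3) h'(4)] e
    by (intro conjI bexI) auto
qed

lemma mbip_tens_over:
  assumes R: "tt_ring K R" and B: "tt_ring K B" and f: "f \<in> ring_homs K R B" and S: "mbip B S X Y" and N: "N \<in> modules K R"
  shows "mbip B (tens_over R B f S N) (tens_over R B f X N) (tens_over R B f Y N)"
proof -
  note rb = tt_ringD(1)[OF R] tt_ringD(1)[OF B]
  obtain i j p q where m: "S \<in> modules K B" "X \<in> modules K B" "Y \<in> modules K B" and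
    h: "i \<in> module_homs K B X S" "j \<in> module_homs K B Y S" "p \<in> module_homs K B S X" "q \<in> module_homs K B S Y"
    and e: "p \<cdot> i = one (fst X)" "q \<cdot> j = one (fst Y)" "q \<cdot> i = zero_arr K (fst X) (fst Y)"
      "p \<cdot> j = zero_arr K (fst Y) (fst X)" "(i \<cdot> p) \<oplus> (j \<cdot> q) = one (fst S)"
    using S unfolding mbip_def[OF rb(2)] by blast
  have i1: "one (fst N) \<in> module_homs K R N N" by (rule module_homs_idn[OF N rb(1)])
  let ?T = "\<lambda>M. tens_over R B f M N" and ?n = "fst N"
  \<comment> \<open>The map induced on relative tensor products by \<open>g\<close> and the identity
    of \<open>N\<close>. It is additive and functorial in \<open>g\<close>, so the equations of the
    biproduct carry over.\<close>
  define t where "t M M' g = (tq R f M' N \<cdot> (g \<otimes> one ?n)) \<cdot> ts R f M N" for M M' g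
  have hom: "t M M' g \<in> module_homs K B (?T M) (?T M')"
    if "M \<in> modules K B" "M' \<in> modules K B" "g \<in> module_homs K B M M'" for M M' g
    using tmap_hom[OF R B f that(1) N that(2) N that(3) i1] tmap_def[OF R B f that(1) N that(2) N that(3) i1] by (simp add: t_def)
  have comp: "t M' M'' g' \<cdot> t M M' g = t M M'' (g' \<cdot> g)"
    if M: "M \<in> modules K B" "M' \<in> modules K B" "M'' \<in> modules K B" and g: "g \<in> module_homs K B M M'" "g' \<in> module_homs K B M' M''" for M M' M'' g g'
  proof (rule gen_eqI[of "tq R f M N \<star> (V 1 (fst M) \<bowtie> V 2 ?n)"])
    note gg = module_homs_cmp[OF g M rb(2)]
    note td = tmap_quot[OF R B f M(1) N M(2) N g(1) i1, unfolded tmap_def[OF R B f M(1) N M(2) N g(1) i1], folded t_def]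
      tmap_quot[OF R B f M(2) N M(3) N g(2) i1, unfolded tmap_def[OF R B f M(2) N M(3) N g(2) i1], folded t_def]
      tmap_quot[OF R B f M(1) N M(3) N gg i1, unfolded tmap_def[OF R B f M(1) N M(3) N gg i1], folded t_def]
    note s = tq_simps[OF R B f M(1) N] tq_simps[OF R B f M(2) N] tq_simps[OF R B f M(3) N] modules_simps[OF M(1)] modules_simps[OF N]
      module_homs_simps[OF g(1)] module_homs_simps[OF g(2)] module_homs_simps[OF hom[OF M(1,2) g(1)]] module_homs_simps[OF hom[OF M(2,3) g(2)]]
      module_homs_simps[OF hom[OF M(1,3) gg]]
    show "(t M' M'' g' \<cdot> t M M' g) \<star> tq R f M N \<star> (V 1 (fst M) \<bowtie> V 2 ?n) = t M M'' (g' \<cdot> g) \<star> tq R f M N \<star> (V 1 (fst M) \<bowtie> V 2 ?n)"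
      by (simp add: s td)
    show "gen (tq R f M N \<star> (V 1 (fst M) \<bowtie> V 2 ?n))" "t M' M'' g' \<cdot> t M M' g \<in> arr K" "t M M'' (g' \<cdot> g) \<in> arr K"
      "src K (t M' M'' g' \<cdot> t M M' g) = ty (tq R f M N \<star> (V 1 (fst M) \<bowtie> V 2 ?n))"
      "src K (t M M'' (g' \<cdot> g)) = ty (tq R f M N \<star> (V 1 (fst M) \<bowtie> V 2 ?n))"
      by (simp_all add: s)
  qed
  have to: "t M M (one (fst M)) = one (fst (?T M))" if M: "M \<in> modules K B" for M
    using tq_simps[OF R B f M N] modules_simps[OF M] modules_simps[OF N] by (simp add: t_def)
  have tz: "t M M' (zero_arr K (fst M) (fst M')) = zero_arr K (fst (?T M)) (fst (?T M'))"
    if M: "M \<in> modules K B" "M' \<in> modules K B" for M M'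
    using tq_simps[OF R B f M(1) N] tq_simps[OF R B f M(2) N] modules_simps[OF M(1)] modules_simps[OF M(2)] modules_simps[OF N] by (simp add: t_def)
  have tp: "t S S (g \<oplus> g') = t S S g \<oplus> t S S g'" if g: "g \<in> hom K (fst S) (fst S)" "g' \<in> hom K (fst S) (fst S)" for g g'
  proof -
    note s = tq_simps[OF R B f m(1) N] modules_simps[OF m(1)] modules_simps[OF N] homD[OF g(1)] homD[OF g(2)]
    have n1: "one ?n \<in> hom K ?n ?n" using s by (simp add: hom_def)
    have qh: "tq R f S N \<in> hom K (fst S \<odot> ?n) (fst (?T S))" "ts R f S N \<in> hom K (fst (?T S)) (fst S \<odot> ?n)" using s by (simp_all add: hom_def)
    have gh: "g \<otimes> one ?n \<in> hom K (fst S \<odot> ?n) (fst S \<odot> ?n)" "g' \<otimes> one ?n \<in> hom K (fst S \<odot> ?n) (fst S \<odot> ?n)"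
      using tensa_hom g n1 by blast+
    show ?thesis
      unfolding t_def tens_plus_l[OF n1 g] cmp_plus[OF gh qh(1)]
      by (rule plus_cmp[OF qh(2) cmp_hom[OF gh(1) qh(1)] cmp_hom[OF gh(2) qh(1)]])
  qed
  have hh: "i \<cdot> p \<in> hom K (fst S) (fst S)" "j \<cdot> q \<in> hom K (fst S) (fst S)"
    using h by (auto simp: module_homs_def intro: cmp_hom)
  show ?thesis
    unfolding mbip_def[OF rb(2)]
  proof (intro conjI bexI)
    show "t S X p \<cdot> t X S i = one (fst (?T X))" using comp[OF m(2,1,2) h(1,3)] e(1) to[OF m(2)] by simp
    show "t S Y q \<cdot> t Y S j = one (fst (?T Y))" using comp[OF m(3,1,3) h(2,4)] e(2) to[OF m(3)] by simp
    show "t S Y q \<cdot> t X S i = zero_arr K (fst (?T X)) (fst (?T Y))" using comp[OF m(2,1,3) h(1,4)] e(3) tz[OF m(2,3)] by simp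
    show "t S X p \<cdot> t Y S j = zero_arr K (fst (?T Y)) (fst (?T X))" using comp[OF m(3,1,2) h(2,3)] e(4) tz[OF m(3,2)] by simp
    show "(t X S i \<cdot> t S X p) \<oplus> (t Y S j \<cdot> t S Y q) = one (fst (?T S))"
      using comp[OF m(1,2,1) h(3,1)] comp[OF m(1,3,1) h(4,2)] tp[OF hh] e(5) to[OF m(1)] by simp
  qed (use m h N hom tens_over_module[OF R B f] in auto)
qed

text \<open>An additive category: a product is a biproduct, and the sections are linear.\<close>

lemma ring_product_mbip:
  assumes D: "ring_object K D" and P: "ring_object K P" and B: "ring_object K B" and E: "ring_object K E"
    and k: "k \<in> ring_homs K D P" and pr: "ring_product K B E P p p'"
  shows "mbip D (restr k (car P, mul P)) (restr (p \<cdot> k) (car B, mul B)) (restr (p' \<cdot> k) (car E, mul E))"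
proof -
  have p: "p \<in> ring_homs K P B" and p': "p' \<in> ring_homs K P E" and ip: "is_product K (car P) (car B) (car E) p p'"
    using pr by (auto simp: ring_product_def)
  note s = D P B E ring_homs_simps[OF p] ring_homs_simps[OF p'] ring_homs_simps[OF k]
  have uni: "\<exists>!h. h \<in> hom K w (car P) \<and> p \<cdot> h = f \<and> p' \<cdot> h = g" if "f \<in> hom K w (car B)" "g \<in> hom K w (car E)" for w f g
    using ip that hom_obj(1)[OF that(1)] unfolding is_product_def by blast
  have z: "zero_arr K (car B) (car E) \<in> hom K (car B) (car E)" "zero_arr K (car E) (car B) \<in> hom K (car E) (car B)"
    "one (car B) \<in> hom K (car B) (car B)" "one (car E) \<in> hom K (car E) (car E)"
    by (simp_all add: s hom_def)
  obtain i where i: "i \<in> hom K (car B) (car P)" "p \<cdot> i = one (car B)" "p' \<cdot> i = zero_arr K (car B) (car E)"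
    using uni[OF z(3,1)] by blast
  obtain j where j: "j \<in> hom K (car E) (car P)" "p \<cdot> j = zero_arr K (car E) (car B)" "p' \<cdot> j = one (car E)"
    using uni[OF z(2,4)] by blast
  note ijs = homD[OF i(1)] homD[OF j(1)]
  have jm: "f = g" if "f \<in> hom K w (car P)" "g \<in> hom K w (car P)" "p \<cdot> f = p \<cdot> g" "p' \<cdot> f = p' \<cdot> g" for f g w
  proof -
    have "p \<cdot> g \<in> hom K w (car B)" "p' \<cdot> g \<in> hom K w (car E)" using that s by (simp_all add: hom_def)
    from uni[OF this] show ?thesis using that by blast
  qed
  have sum: "(i \<cdot> p) \<oplus> (j \<cdot> p') = one (car P)"
  proof (rule jm)
    have h: "i \<cdot> p \<in> hom K (car P) (car P)" "j \<cdot> p' \<in> hom K (car P) (car P)" "p \<in> hom K (car P) (car B)" "p' \<in> hom K (car P) (car E)"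
      by (simp_all add: s ijs hom_def)
    show "(i \<cdot> p) \<oplus> (j \<cdot> p') \<in> hom K (car P) (car P)" by (rule plus_hom[OF h(1,2)])
    show "one (car P) \<in> hom K (car P) (car P)" by (simp add: s hom_def)
    have "p \<cdot> ((i \<cdot> p) \<oplus> (j \<cdot> p')) = ((p \<cdot> i) \<cdot> p) \<oplus> ((p \<cdot> j) \<cdot> p')"
      unfolding cmp_plus[OF h(1,2,3)] by (simp add: s ijs cmp_ass)
    then show "p \<cdot> ((i \<cdot> p) \<oplus> (j \<cdot> p')) = p \<cdot> one (car P)"
      unfolding i(2) j(2) using plus_zero[OF h(3)] by (simp add: s)
    have "p' \<cdot> ((i \<cdot> p) \<oplus> (j \<cdot> p')) = ((p' \<cdot> i) \<cdot> p) \<oplus> ((p' \<cdot> j) \<cdot> p')"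
      unfolding cmp_plus[OF h(1,2,4)] by (simp add: s ijs cmp_ass)
    then show "p' \<cdot> ((i \<cdot> p) \<oplus> (j \<cdot> p')) = p' \<cdot> one (car P)"
      unfolding i(3) j(3) using zero_plus[OF h(4)] by (simp add: s)
  qed
  let ?P = "(car P, mul P)" and ?B = "(car B, mul B)" and ?E = "(car E, mul E)"
  have m: "?P \<in> modules K P" "restr p ?B \<in> modules K P" "restr p' ?E \<in> modules K P"
    using self_module[OF P] restr_module[OF p self_module[OF B] P B] restr_module[OF p' self_module[OF E] P E] by auto
  have pm: "p \<cdot> mul P = mul B \<cdot> (p \<otimes> p)" "p' \<cdot> mul P = mul E \<cdot> (p' \<otimes> p')" using p p' by (auto simp: ring_homs_def)
  have "p \<in> module_homs K P ?P (restr p ?B)" "p' \<in> module_homs K P ?P (restr p' ?E)"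
    by (simp_all add: module_homs_def restr_def pm s hom_def cmp_ass tens_cmp)
  moreover have "i \<cdot> (mul B \<cdot> (p \<otimes> one (car B))) = mul P \<cdot> (one (car P) \<otimes> i)"
  proof (rule jm)
    show "i \<cdot> (mul B \<cdot> (p \<otimes> one (car B))) \<in> hom K (car P \<odot> car B) (car P)" "mul P \<cdot> (one (car P) \<otimes> i) \<in> hom K (car P \<odot> car B) (car P)"
      by (simp_all add: s ijs hom_def)
    have "p \<cdot> (mul P \<cdot> (one (car P) \<otimes> i)) = (p \<cdot> mul P) \<cdot> (one (car P) \<otimes> i)" by (simp add: s ijs cmp_ass)
    also have "\<dots> = mul B \<cdot> (p \<otimes> (p \<cdot> i))" unfolding pm by (simp add: s ijs cmp_ass tens_cmp)
    also have "\<dots> = (p \<cdot> i) \<cdot> (mul B \<cdot> (p \<otimes> one (car B)))" unfolding i(2) by (simp add: s)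
    finally show "p \<cdot> (i \<cdot> (mul B \<cdot> (p \<otimes> one (car B)))) = p \<cdot> (mul P \<cdot> (one (car P) \<otimes> i))" by (simp add: s ijs cmp_ass)
    have "p' \<cdot> (mul P \<cdot> (one (car P) \<otimes> i)) = (p' \<cdot> mul P) \<cdot> (one (car P) \<otimes> i)" by (simp add: s ijs cmp_ass)
    also have "\<dots> = mul E \<cdot> (p' \<otimes> (p' \<cdot> i))" unfolding pm by (simp add: s ijs cmp_ass tens_cmp)
    also have "\<dots> = (p' \<cdot> i) \<cdot> (mul B \<cdot> (p \<otimes> one (car B)))" unfolding i(3) by (simp add: s)
    finally show "p' \<cdot> (i \<cdot> (mul B \<cdot> (p \<otimes> one (car B)))) = p' \<cdot> (mul P \<cdot> (one (car P) \<otimes> i))" by (simp add: s ijs cmp_ass)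
  qed
  then have "i \<in> module_homs K P (restr p ?B) ?P" using i(1) by (simp add: module_homs_def restr_def)
  moreover have "j \<cdot> (mul E \<cdot> (p' \<otimes> one (car E))) = mul P \<cdot> (one (car P) \<otimes> j)"
  proof (rule jm)
    show "j \<cdot> (mul E \<cdot> (p' \<otimes> one (car E))) \<in> hom K (car P \<odot> car E) (car P)" "mul P \<cdot> (one (car P) \<otimes> j) \<in> hom K (car P \<odot> car E) (car P)"
      by (simp_all add: s ijs hom_def)
    have "p \<cdot> (mul P \<cdot> (one (car P) \<otimes> j)) = (p \<cdot> mul P) \<cdot> (one (car P) \<otimes> j)" by (simp add: s ijs cmp_ass)
    also have "\<dots> = mul B \<cdot> (p \<otimes> (p \<cdot> j))" unfolding pm by (simp add: s ijs cmp_ass tens_cmp)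
    also have "\<dots> = (p \<cdot> j) \<cdot> (mul E \<cdot> (p' \<otimes> one (car E)))" unfolding j(2) by (simp add: s)
    finally show "p \<cdot> (j \<cdot> (mul E \<cdot> (p' \<otimes> one (car E)))) = p \<cdot> (mul P \<cdot> (one (car P) \<otimes> j))" by (simp add: s ijs cmp_ass)
    have "p' \<cdot> (mul P \<cdot> (one (car P) \<otimes> j)) = (p' \<cdot> mul P) \<cdot> (one (car P) \<otimes> j)" by (simp add: s ijs cmp_ass)
    also have "\<dots> = mul E \<cdot> (p' \<otimes> (p' \<cdot> j))" unfolding pm by (simp add: s ijs cmp_ass tens_cmp)
    also have "\<dots> = (p' \<cdot> j) \<cdot> (mul E \<cdot> (p' \<otimes> one (car E)))" unfolding j(3) by (simp add: s)
    finally show "p' \<cdot> (j \<cdot> (mul E \<cdot> (p' \<otimes> one (car E)))) = p' \<cdot> (mul P \<cdot> (one (car P) \<otimes> j))" by (simp add: s ijs cmp_ass)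
  qed
  then have "j \<in> module_homs K P (restr p' ?E) ?P" using j(1) by (simp add: module_homs_def restr_def)
  ultimately have "mbip P ?P (restr p ?B) (restr p' ?E)"
    unfolding mbip_def[OF P] using m i(2,3) j(2,3) sum by auto
  from mbip_restr[OF P D k this] show ?thesis
    using restr_restr[OF k p self_module[OF B]] restr_restr[OF k p' self_module[OF E]] by simp
qed

abbreviation incomp :: "('o, 'm) ring_ob \<Rightarrow> ('o, 'm) ring_ob \<Rightarrow> 'm \<Rightarrow> bool" where
  "incomp R B f \<equiv> tt_pair.incomparable (modules K R) (modules K B) (thM B) (module_tensor K B) (extend_scalars K R B f)"

text \<open>Over the zero ring the unit module is a zero object; it lies in every thick ideal, and
  there are no primes.\<close>

lemma incomp_zero:
  assumes R: "tt_ring K R" and B: "tt_ring K B" and f: "f \<in> ring_homs K R B" and z: "zero_object K (car B)"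
  shows "incomp R B f"
proof -
  interpret p: tt_pair "modules K R" "thM R" "module_tensor K R" "(car R, mul R)"
    "modules K B" "thM B" "module_tensor K B" "(car B, mul B)" "extend_scalars K R B f" "restr f" by (rule tt_pair_Mod[OF R B f])
  have "nul B (car B, mul B)" using A_self[OF B] zero_object_idn[OF z] by (simp add: nul_def)
  then have "(car B, mul B) \<in> J" if "thM B J" for J
    using that unfolding thick_Mod[OF tt_ringD(1)[OF B]] pthick_def by blast
  then have "\<not> p.Y.prime Q" for Q using p.Y.unit_notin_prime[of Q] p.Y.prime_Th[of Q] by blast
  then show ?thesis unfolding p.incomparable_def by blast
qed

context
  fixes R B E P :: "('o, 'm) ring_ob" and f p p' h :: 'm
  assumes R: "tt_ring K R" and B: "tt_ring K B" and E: "tt_ring K E" and f: "f \<in> ring_homs K R B"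
    and pr: "ring_product K B E P p p'" and h: "h \<in> ring_isos K (algebra_square K R B f) P"
    and ph: "p \<cdot> h \<cdot> algebra_quot K R B f = mul B"
begin

lemmas step_rings = tt_ringD(1)[OF R] tt_ringD(1)[OF B] tt_ringD(1)[OF E]

lemma step_module: "restr f (car B, mul B) \<in> modules K R"
  by (rule restr_module[OF f A_self[OF B] step_rings(1,2)])

lemma step_quot: "algebra_quot K R B f = tensor_quot K R (restr f (car B, mul B)) (restr f (car B, mul B))"
  by (simp add: algebra_quot_def restricted_module_restr)

text \<open>The composite B \<otimes> B -> B \<otimes>_R B -> P. Its source keeps pure tensors
  available, while its target carries the product decomposition.\<close>

definition step_k :: 'm where
  "step_k = h \<cdot> algebra_quot K R B f"

definition step_s :: 'm where
  "step_s = tsec R (restr f (car B, mul B)) (restr f (car B, mul B)) \<cdot> inv h"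

lemma step_facts:
  shows "ring_object K P" "step_k \<in> arr K" "src K step_k = car B \<odot> car B" "tgt K step_k = car P"
    "step_s \<in> arr K" "src K step_s = car P" "tgt K step_s = car B \<odot> car B" "step_k \<cdot> step_s = one (car P)"
    and step_sk: "step_s \<cdot> step_k = tpi R (restr f (car B, mul B)) (restr f (car B, mul B))"
    and step_hom: "step_k \<in> ring_homs K (ring_tensor K B B) P"
    and step_p: "p \<cdot> step_k = mul B"
proof -
  let ?S = "restr f (car B, mul B)" and ?D = "ring_tensor K B B" and ?b = "car B"
  let ?q = "algebra_quot K R B f" and ?s = "tsec R ?S ?S" and ?C = "algebra_square K R B f"
  have P: "ring_object K P" and p: "p \<in> ring_homs K P B" using pr by (auto simp: ring_product_def)
  note q = tensor_quot_simps[OF R step_module step_module, folded step_quot]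
  note sq = tsec_quot[OF R step_module step_module, folded step_quot]
  have hi: "h \<in> isos K (tgt K ?q) (car P)" and hr: "h \<in> ring_homs K ?C P"
    using h by (auto simp: ring_isos_def algebra_square_def Let_def)
  have hs: "iso h" "src K h = tgt K ?q" "tgt K h = car P" using isos_iso[OF hi] homD[OF isos_hom[OF hi]] by auto
  note s = P step_rings q hs ring_tensor_simps[OF step_rings(2,2)] ring_homs_simps[OF p] tpi_simps[OF R step_module step_module]
    ring_homs_simps[OF f]
  show "ring_object K P" by (rule P)
  show ks: "step_k \<in> arr K" "src K step_k = ?b \<odot> ?b" "tgt K step_k = car P"
    "step_s \<in> arr K" "src K step_s = car P" "tgt K step_s = ?b \<odot> ?b"
    by (simp_all add: step_k_def step_s_def s)
  have "step_k \<cdot> step_s = h \<cdot> ((?q \<cdot> ?s) \<cdot> inv h)"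
    by (simp add: step_k_def step_s_def s cmp_ass del: q(6))
  then show "step_k \<cdot> step_s = one (car P)" by (simp add: s)
  have "step_s \<cdot> step_k = ?s \<cdot> ?q" by (simp add: step_k_def step_s_def s cmp_ass)
  then show "step_s \<cdot> step_k = tpi R ?S ?S" unfolding sq .
  have "p \<cdot> step_k = p \<cdot> h \<cdot> ?q" by (simp add: step_k_def s cmp_ass)
  then show "p \<cdot> step_k = mul B" unfolding ph .
  let ?g = "?q \<cdot> mul ?D"
  have g: "?g \<in> arr K" "src K ?g = (?b \<odot> ?b) \<odot> (?b \<odot> ?b)" "tgt K ?g = tgt K ?q" by (simp_all add: s)
  have act: "snd ?S \<star> (x \<bowtie> b) = mul B \<star> ((f \<star> x) \<bowtie> b)" if "el x" "el b" "ty x = car R" "ty b = ?b" for x b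
    using restr_act[OF f A_self[OF B] step_rings(1,2), of x b] that by simp
  have bal: "?q \<star> (b1 \<bowtie> (mul B \<star> ((f \<star> x) \<bowtie> b2))) = ?q \<star> ((mul B \<star> ((f \<star> x) \<bowtie> b1)) \<bowtie> b2)"
    if "el x" "el b1" "el b2" "ty x = car R" "ty b1 = ?b" "ty b2 = ?b" "lab x \<inter> lab b1 = {}" for x b1 b2
    using tensor_quot_balanced[OF R step_module step_module, of x b1 b2, folded step_quot] that by (simp add: act)
  have lc: "mul B \<star> (b1 \<bowtie> (mul B \<star> ((f \<star> x) \<bowtie> b2))) = mul B \<star> ((f \<star> x) \<bowtie> (mul B \<star> (b1 \<bowtie> b2)))"
    if "el x" "el b1" "el b2" "ty x = car R" "ty b1 = ?b" "ty b2 = ?b" "lab x \<inter> lab b1 = {}" for x b1 b2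
    using mul_lcomm[of B b1 "f \<star> x" b2] that by (simp add: s tt_ringD[OF B] Int_commute)
  \<comment> \<open>Multiplication of pure tensors is balanced over R in either argument, so it
    descends to B \<otimes>_R B; this evaluates the \<open>factor_through\<close> in
    \<open>algebra_square\<close>.\<close>
  have 1: "?g \<cdot> (one (?b \<odot> ?b) \<otimes> tpi R ?S ?S) = ?g"
    by (rule tpi_lift_l[OF R step_module step_module, of _ _ "V 1 ?b \<bowtie> V 2 ?b" "V 3 ?b" "V 4 ?b"])
      (simp_all add: s act ring_tensor_mul bal lc)
  have 2: "?g \<cdot> (tpi R ?S ?S \<otimes> one (?b \<odot> ?b)) = ?g"
    by (rule tpi_lift_r[OF R step_module step_module, of _ _ "V 1 ?b \<bowtie> V 2 ?b" "V 3 ?b" "V 4 ?b"])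
      (simp_all add: s act ring_tensor_mul bal mul_assoc)
  have "(?g \<cdot> (?s \<otimes> ?s)) \<cdot> (?q \<otimes> ?q) = ?g \<cdot> ((?s \<cdot> ?q) \<otimes> (?s \<cdot> ?q))" by (simp add: s g cmp_ass tens_cmp)
  also have "\<dots> = (?g \<cdot> (tpi R ?S ?S \<otimes> one (?b \<odot> ?b))) \<cdot> (one (?b \<odot> ?b) \<otimes> tpi R ?S ?S)"
    unfolding sq by (simp add: s g cmp_ass tens_cmp)
  also have "\<dots> = ?g" unfolding 2 by (rule 1)
  finally have e: "(?g \<cdot> (?s \<otimes> ?s)) \<cdot> (?q \<otimes> ?q) = ?g" .
  have mC: "mul ?C = ?g \<cdot> (?s \<otimes> ?s)"
    unfolding algebra_square_def Let_def ring_ob.simps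
    by (rule factor_through_eq[OF _ _ _ e]) (simp_all add: s)
  have m: "mul ?C \<cdot> (?q \<otimes> ?q) = ?g" unfolding mC by (rule e)
  have C: "mul ?C \<in> arr K" "src K (mul ?C) = tgt K ?q \<odot> tgt K ?q" "tgt K (mul ?C) = tgt K ?q"
    unfolding mC by (simp_all add: s)
  have hm: "h \<cdot> mul ?C = mul P \<cdot> (h \<otimes> h)" "h \<cdot> uni ?C = uni P" using hr by (auto simp: ring_homs_def)
  have "step_k \<cdot> mul ?D = h \<cdot> (mul ?C \<cdot> (?q \<otimes> ?q))" unfolding m by (simp add: step_k_def s cmp_ass)
  also have "\<dots> = (h \<cdot> mul ?C) \<cdot> (?q \<otimes> ?q)" by (simp add: s C cmp_ass)
  also have "\<dots> = mul P \<cdot> (step_k \<otimes> step_k)" unfolding hm by (simp add: step_k_def s cmp_ass tens_cmp)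
  finally have km: "step_k \<cdot> mul ?D = mul P \<cdot> (step_k \<otimes> step_k)" .
  have "step_k \<cdot> uni ?D = h \<cdot> uni ?C" by (simp add: step_k_def s cmp_ass algebra_square_def Let_def)
  then have ku: "step_k \<cdot> uni ?D = uni P" unfolding hm .
  show "step_k \<in> ring_homs K ?D P" using km ku ks by (simp add: ring_homs_def hom_def s)
qed

lemma step_balanced:
  assumes "el b1" "el b2" "el x" "ty b1 = car B" "ty b2 = car B" "ty x = car R" "lab x \<inter> lab b1 = {}"
  shows "step_k \<star> (b1 \<bowtie> (mul B \<star> ((f \<star> x) \<bowtie> b2))) = step_k \<star> ((mul B \<star> ((f \<star> x) \<bowtie> b1)) \<bowtie> b2)"
proof -
  let ?S = "restr f (car B, mul B)" and ?q = "algebra_quot K R B f"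
  note q = tensor_quot_simps[OF R step_module step_module, folded step_quot]
  have hi: "h \<in> isos K (tgt K ?q) (car P)" using h by (auto simp: ring_isos_def algebra_square_def Let_def)
  note s = step_rings q iso_arr[OF isos_iso[OF hi]] homD[OF isos_hom[OF hi]] ring_homs_simps[OF f] assms
  have act: "snd ?S \<star> (x \<bowtie> b) = mul B \<star> ((f \<star> x) \<bowtie> b)" if "el b" "ty b = car B" for b
    using restr_act[OF f A_self[OF B] step_rings(1,2), of x b] that s by simp
  have "?q \<star> (b1 \<bowtie> (mul B \<star> ((f \<star> x) \<bowtie> b2))) = ?q \<star> ((mul B \<star> ((f \<star> x) \<bowtie> b1)) \<bowtie> b2)"
    using tensor_quot_balanced[OF R step_module step_module, of x b1 b2, folded step_quot] s by (simp add: act)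
  then show ?thesis by (simp add: step_k_def s)
qed

lemma step_param:
  assumes "w \<in> obj K" "g \<in> arr K" "src K g = (car B \<odot> car B) \<odot> w"
    "g \<star> (((mul B \<star> ((f \<star> V 0 (car R)) \<bowtie> V 1 (car B))) \<bowtie> V 2 (car B)) \<bowtie> V 3 w) =
       g \<star> ((V 1 (car B) \<bowtie> (mul B \<star> ((f \<star> V 0 (car R)) \<bowtie> V 2 (car B)))) \<bowtie> V 3 w)"
  shows "g \<cdot> ((step_s \<cdot> step_k) \<otimes> one w) = g"
  unfolding step_sk
  by (rule tpi_lift_r[OF R step_module step_module, of _ _ "V 3 w" "V 1 (car B)" "V 2 (car B)"])
    (use assms in \<open>simp_all add: step_rings restr_act[OF f A_self[OF B] step_rings(1,2)]\<close>)

text \<open>\<open>u1'\<close> and \<open>u2\<close> are the homomorphisms B -> P -> E from the left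
  and the right factor. They agree on R, and P = B x E yields the hypothesis \<open>split\<close> of
  \<open>incomparable_step\<close>.\<close>

lemma step_incomp:
  assumes u1: "u1' = p' \<cdot> h \<cdot> algebra_quot K R B f \<cdot> left_incl K B" and inc: "incomp B E u1'"
  shows "incomp R B f"
proof -
  let ?D = "ring_tensor K B B" and ?l = "left_incl K B" and ?r = "right_incl K B"
  note P = step_facts(1) and kf = step_facts(2-8)
  have D: "tt_ring K ?D" by (rule ring_tensor_tt[OF B B])
  note Dr = tt_ringD(1)[OF D] and l = incl_ring_homs(1)[OF step_rings(2)] and r = incl_ring_homs(2)[OF step_rings(2)]
  have p: "p \<in> ring_homs K P B" and p': "p' \<in> ring_homs K P E" using pr by (auto simp: ring_product_def)
  have pk: "p \<cdot> step_k \<in> ring_homs K ?D B" by (rule ring_homs_cmp[OF step_hom p Dr P step_rings(2)])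
  have pk': "p' \<cdot> step_k \<in> ring_homs K ?D E" by (rule ring_homs_cmp[OF step_hom p' Dr P step_rings(3)])
  define u2 where "u2 = (p' \<cdot> step_k) \<cdot> ?r"
  note q = tensor_quot_simps[OF R step_module step_module, folded step_quot]
  have hi: "h \<in> isos K (tgt K (algebra_quot K R B f)) (car P)" using h by (auto simp: ring_isos_def algebra_square_def Let_def)
  note s = step_rings P q iso_arr[OF isos_iso[OF hi]] homD[OF isos_hom[OF hi]] ring_homs_simps[OF p'] ring_homs_simps[OF p]
    incl_simps[OF step_rings(2)] kf ring_homs_simps[OF f]
  have u1: "u1' = (p' \<cdot> step_k) \<cdot> ?l" unfolding u1 step_k_def by (simp add: s cmp_ass)
  have U1: "u1' \<in> ring_homs K B E" unfolding u1 by (rule ring_homs_cmp[OF l pk' step_rings(2) Dr step_rings(3)])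
  have U2: "u2 \<in> ring_homs K B E" unfolding u2_def by (rule ring_homs_cmp[OF r pk' step_rings(2) Dr step_rings(3)])
  \<comment> \<open>The component P -> B is the multiplication, of which both inclusions are
    sections. So the summand of P \<otimes>_B a belonging to B is a copy of a, with its own
    action.\<close>
  have pl: "(p \<cdot> step_k) \<cdot> ?l = one (car B)" "(p \<cdot> step_k) \<cdot> ?r = one (car B)"
    unfolding step_p by (rule gen_eqI[of "V 0 (car B)"]; simp add: s incl_el mul_uni_l mul_uni_r)+
  have uf: "u1' \<cdot> f = u2 \<cdot> f"
  proof -
    have "(step_k \<cdot> ?l) \<cdot> f = (step_k \<cdot> ?r) \<cdot> f"
      by (rule incl_eq_on_base[OF step_rings(1,2) f kf(1,2) step_balanced])
    then have "p' \<cdot> ((step_k \<cdot> ?l) \<cdot> f) = p' \<cdot> ((step_k \<cdot> ?r) \<cdot> f)" by simp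
    then show ?thesis unfolding u1 u2_def by (simp add: s cmp_ass)
  qed
  show ?thesis
  proof (rule incomparable_step[OF tt_pair_Mod[OF R B f] tt_pair_Mod[OF B E U1] tt_pair_Mod[OF B E U2] _ _ inc])
    fix J a assume J: "thM B J" and a: "a \<in> J" and b: "restr u2 (extend_scalars K B E u1' a) \<in> J"
    have am: "a \<in> modules K B" using J a unfolding thick_Mod[OF step_rings(2)] pthick_def by blast
    let ?P = "restr step_k (car P, mul P)" and ?B = "restr (p \<cdot> step_k) (car B, mul B)" and ?E = "restr (p' \<cdot> step_k) (car E, mul E)"
    let ?T = "\<lambda>M. restr ?r (tens_over B ?D ?l M a)"
    \<comment> \<open>P tensored over the left B with a, regarded as a module over the right B,
      splits into a copy of a and the restriction along \<open>u2\<close> of the extension of a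
      along \<open>u1'\<close>. Both lie in J by assumption.\<close>
    have "mbip ?D ?P ?B ?E" by (rule ring_product_mbip[OF Dr P step_rings(2,3) step_hom pr])
    then have sum: "mbip B (?T ?P) (?T ?B) (?T ?E)"
      using mbip_restr[OF Dr step_rings(2) r mbip_tens_over[OF B D l _ am]] by blast
    have "?T ?B = restr ((p \<cdot> step_k) \<cdot> ?r) (tens_over B B ((p \<cdot> step_k) \<cdot> ?l) (car B, mul B) a)"
      unfolding restr_tens_over[OF B D l B pk A_self[OF B] am, symmetric]
      by (rule restr_restr[OF r pk tens_over_module[OF B B _ A_self[OF B] am]]) (simp add: pl A_idn[OF B])
    also have "\<dots> = tens_over B B (one (car B)) (car B, mul B) a"
      unfolding pl by (rule restr_idn[OF tens_over_module[OF B B A_idn[OF B] A_self[OF B] am] step_rings(2)])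
    also have "\<dots> = module_tensor K B (car B, mul B) a" by (rule module_tensor_eq[OF B A_self[OF B], symmetric])
    finally have "?T ?B \<in> J"
      using thM_miso[OF J step_rings(2) module_tensor_comm[OF B A_self[OF B] am]]
        thM_miso[OF J step_rings(2) module_tensor_unit[OF B am]] a by simp
    moreover have "?T ?E = restr u2 (tens_over B E u1' (car E, mul E) a)"
      unfolding restr_tens_over[OF B D l E pk' A_self[OF E] am, symmetric] u2_def u1
      by (rule restr_restr[OF r pk' tens_over_module[OF B E U1[unfolded u1] A_self[OF E] am]])
    then have "?T ?E \<in> J" using b by (simp add: extend_scalars_tens_over)
    ultimately have "?T ?P \<in> J" using pthick_sum[OF step_rings(2) _ sum] J unfolding thick_Mod[OF step_rings(2)] by blast
    moreover have "retr B (tens_over R B f (car B, mul B) (restr f a)) (?T ?P)"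
      by (rule retr_base_change[OF R B f P step_hom am step_balanced kf(4-7) step_param])
    ultimately show "extend_scalars K R B f (restr f a) \<in> J"
      using thM_retr[OF J step_rings(2)] by (simp add: extend_scalars_tens_over)
  next
    fix J x assume J: "thM E J" and x: "x \<in> modules K R"
    show "extend_scalars K B E u1' (extend_scalars K R B f x) \<in> J \<longleftrightarrow> extend_scalars K B E u2 (extend_scalars K R B f x) \<in> J"
      unfolding extend_extend[OF R B E f U1 J x] extend_extend[OF R B E f U2 J x] uf ..
  qed
qed

end

lemma tower_incomp:
  assumes t: "splitting_tower K A Bn t" and z: "zero_object K (car (Bn (Suc d)))" and n: "n \<le> d"
  shows "incomp (Bn n) (Bn (Suc n)) (t n)"
  using n
proof (induction n rule: inc_induct)
  have tt: "tt_ring K (Bn n)" "t n \<in> ring_homs K (Bn n) (Bn (Suc n))" for n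
    using t by (auto simp: splitting_tower_def)
  \<comment> \<open>Here \<open>n = d\<close>, and the target \<open>Bn (Suc d)\<close> is the zero
    ring.\<close>
  case base
  show ?case by (rule incomp_zero[OF tt(1) tt(1) tt(2) z])
next
  have tt: "tt_ring K (Bn n)" "t n \<in> ring_homs K (Bn n) (Bn (Suc n))" for n
    using t by (auto simp: splitting_tower_def)
  case (step n)
  have "\<exists>P p p' h. ring_product K (Bn (n + 1)) (Bn (n + 2)) P p p' \<and>
          h \<in> ring_isos K (algebra_square K (Bn n) (Bn (n + 1)) (t n)) P \<and>
          p \<cdot> h \<cdot> algebra_quot K (Bn n) (Bn (n + 1)) (t n) = mul (Bn (n + 1)) \<and>
          t (n + 1) = p' \<cdot> h \<cdot> algebra_quot K (Bn n) (Bn (n + 1)) (t n) \<cdot> left_incl K (Bn (n + 1))"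
    using t unfolding splitting_tower_def Let_def by blast
  then obtain P p p' h where "ring_product K (Bn (Suc n)) (Bn (Suc (Suc n))) P p p'"
      "h \<in> ring_isos K (algebra_square K (Bn n) (Bn (Suc n)) (t n)) P"
      "p \<cdot> h \<cdot> algebra_quot K (Bn n) (Bn (Suc n)) (t n) = mul (Bn (Suc n))"
      "t (Suc n) = p' \<cdot> h \<cdot> algebra_quot K (Bn n) (Bn (Suc n)) (t n) \<cdot> left_incl K (Bn (Suc n))"
    by (auto simp: numeral_2_eq_2)
  then show ?case using step_incomp[OF tt(1) tt(1) tt(1) tt(2)] step.IH by blast
qed

end

section \<open>The category \<open>K\<close> as the category of modules over the unit ring\<close>

section \<open>Modules over the unit ring\<close>

context tt_category
begin

text \<open>The only action of the unit ring that an object carries, by \<open>modules_Un\<close>.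
  It turns free A-modules into extensions of scalars along \<open>uni A\<close>.\<close>

definition iota :: "'o \<Rightarrow> 'o \<times> 'm" where
  "iota x = (x, lu x)"

lemma fst_iota [simp]: "fst (iota x) = x" and snd_iota: "snd (iota x) = lu x"
  by (simp_all add: iota_def)

lemma free_module_module:
  assumes A: "ring_object K A" and x: "x \<in> obj K"
  shows "free_module K A x \<in> modules K A"
  unfolding free_module_def
  by (rule modulesI[OF A, of _ _ "V 2 (car A) \<bowtie> V 3 x"]) (simp_all add: A x ap_simps mul_assoc mul_uni_l)

text \<open>The unit triangle and \<open>ru_\<beta>\<close>. Scalars from the unit ring pass freely
  between tensor factors, so over it every map is balanced and the idempotent \<open>tpi\<close> is
  the identity.\<close>

lemma unit_swap:
  assumes "el m" "el a" "el n" "ty a = \<one>" "lab a \<inter> lab m = {}"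
  shows "(lu (ty m) \<star> (a \<bowtie> m)) \<bowtie> n = m \<bowtie> (lu (ty n) \<star> (a \<bowtie> n))"
proof -
  have o: "ty m \<in> obj K" "ty n \<in> obj K" using assms by auto
  have "((one (ty m) \<otimes> lu (ty n)) \<cdot> \<alpha> (ty m) \<one> (ty n)) \<star> ((m \<bowtie> a) \<bowtie> n) = (ru (ty m) \<otimes> one (ty n)) \<star> ((m \<bowtie> a) \<bowtie> n)"
    using o by (simp add: unit_triangle)
  then have "m \<bowtie> (lu (ty n) \<star> (a \<bowtie> n)) = (ru (ty m) \<star> (m \<bowtie> a)) \<bowtie> n" using assms o by (simp add: ap_simps)
  moreover have "(ru (ty m) \<cdot> \<beta> \<one> (ty m)) \<star> (a \<bowtie> m) = lu (ty m) \<star> (a \<bowtie> m)" using o by (simp add: ru_\<beta>)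
  then have "ru (ty m) \<star> (m \<bowtie> a) = lu (ty m) \<star> (a \<bowtie> m)" using assms o by (simp add: ap_simps)
  ultimately show ?thesis by simp
qed

context
  assumes U: "tt_ring K (unit_ring K)"
begin

abbreviation Ur :: "('o, 'm) ring_ob" where "Ur \<equiv> unit_ring K"

lemma Un_simps: "car Ur = \<one>" "mul Ur = lu \<one>" "uni Ur = one \<one>"
  by (simp_all add: unit_ring_def)

lemma Un_ring: "ring_object K Ur" by (rule tt_ringD(1)[OF U])

lemma modules_Un: "modules K Ur = iota ` obj K"
proof (intro equalityI subsetI)
  fix M assume M: "M \<in> modules K Ur"
  note s = modules_simps[OF M]
  have "snd M \<cdot> (uni Ur \<otimes> one (fst M)) = lu (fst M)" using M by (auto simp: modules_def)
  then have "snd M = lu (fst M)" using s by (simp add: Un_simps)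
  with s(1) show "M \<in> iota ` obj K" by (auto simp: iota_def image_iff prod_eq_iff)
next
  fix M assume "M \<in> iota ` obj K"
  then obtain x where x: "x \<in> obj K" "M = iota x" by blast
  have "lu x \<cdot> (lu \<one> \<otimes> one x) = lu x \<cdot> ((one \<one> \<otimes> lu x) \<cdot> \<alpha> \<one> \<one> x)"
    using x(1) lu_one unit_triangle[of \<one> x] by simp
  then show "M \<in> modules K Ur" using x by (simp add: modules_def iota_def Un_simps hom_def cmp_ass)
qed

lemma iota_module: "x \<in> obj K \<Longrightarrow> iota x \<in> modules K Ur"
  by (simp add: modules_Un)

lemma module_homs_Un: "\<lbrakk>x \<in> obj K; y \<in> obj K\<rbrakk> \<Longrightarrow> module_homs K Ur (iota x) (iota y) = hom K x y"
  by (auto simp: module_homs_def Un_simps snd_iota hom_def lu_nat)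

lemma module_sus_Un: "x \<in> obj K \<Longrightarrow> module_sus K Ur (iota x) = iota (sus K x)"
  by (simp add: module_sus_def iota_def Un_simps tsus_unit)

lemma tpi_Un:
  assumes x: "x \<in> obj K" and y: "y \<in> obj K"
  shows "tpi Ur (iota x) (iota y) = one (x \<odot> y)"
proof -
  note s = tpi_simps[OF U iota_module[OF x] iota_module[OF y]]
  have "one (x \<odot> y) \<cdot> tpi Ur (iota x) (iota y) = one (x \<odot> y)"
    by (rule tpi_lift[OF U iota_module[OF x] iota_module[OF y], of _ "V 1 x" "V 2 y"])
      (use x y unit_swap[of "V 1 x" "V 0 \<one>" "V 2 y"] in \<open>simp_all add: snd_iota Un_simps\<close>)
  then show ?thesis using s by simp
qed

lemma quot_Un:
  assumes x: "x \<in> obj K" and y: "y \<in> obj K"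
  shows "tsec Ur (iota x) (iota y) \<cdot> tensor_quot K Ur (iota x) (iota y) = one (x \<odot> y)"
  unfolding tsec_quot[OF U iota_module[OF x] iota_module[OF y]] by (rule tpi_Un[OF x y])

lemma tensor_Un:
  assumes x: "x \<in> obj K" and y: "y \<in> obj K"
  shows "miso Ur (module_tensor K Ur (iota x) (iota y)) (iota (x \<odot> y))"
proof -
  note X = iota_module[OF x] and Y = iota_module[OF y]
  note q = tensor_quot_simps[OF U X Y]
  have xy: "x \<odot> y \<in> obj K" using x y by simp
  have T: "module_tensor K Ur (iota x) (iota y) \<in> modules K Ur" by (rule module_tensor_module[OF U X Y])
  have f: "fst (module_tensor K Ur (iota x) (iota y)) = tgt K (tensor_quot K Ur (iota x) (iota y))"
    by (simp add: module_tensor_def)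
  obtain z where z: "z \<in> obj K" "module_tensor K Ur (iota x) (iota y) = iota z" using T by (auto simp: modules_Un)
  have zq: "tgt K (tensor_quot K Ur (iota x) (iota y)) = z" using f z by simp
  show ?thesis
    unfolding z(2)
  proof (rule misoI[OF Un_ring iota_module[OF z(1)] iota_module[OF xy], of "tsec Ur (iota x) (iota y)" "tensor_quot K Ur (iota x) (iota y)"])
    show "tsec Ur (iota x) (iota y) \<in> module_homs K Ur (iota z) (iota (x \<odot> y))"
      using q zq by (simp add: module_homs_Un z xy hom_def)
  qed (use q zq quot_Un[OF x y] in simp_all)
qed

lemma mbip_Un: "\<lbrakk>s \<in> obj K; x \<in> obj K; y \<in> obj K\<rbrakk> \<Longrightarrow> mbip Ur (iota s) (iota x) (iota y) \<longleftrightarrow> is_biproduct K s x y"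
  unfolding mbip_def[OF Un_ring] is_biproduct_def by (simp add: module_homs_Un iota_module)

lemma inj_iota: "iota x \<in> iota ` P \<longleftrightarrow> x \<in> P"
  by (auto simp: iota_def)

lemma thick_Un:
  assumes P: "P \<subseteq> obj K"
  shows "thick_ideal K P \<longleftrightarrow> thM Ur (iota ` P)"
proof -
  have nul: "nul Ur Z \<longleftrightarrow> (\<exists>z. zero_object K z \<and> Z = iota z)" for Z
  proof
    assume "nul Ur Z"
    then show "\<exists>z. zero_object K z \<and> Z = iota z"
      unfolding nul_def modules_Un using zero_objectI by fastforce
  next
    assume "\<exists>z. zero_object K z \<and> Z = iota z"
    then show "nul Ur Z" unfolding nul_def
      by (auto simp: zero_object_idn iota_module zero_object_def)
  qed
  have 1: "(\<forall>z. zero_object K z \<longrightarrow> z \<in> P) \<longleftrightarrow> (\<forall>Z. nul Ur Z \<longrightarrow> Z \<in> iota ` P)"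
    unfolding nul using inj_iota by blast
  have 2: "(\<forall>x \<in> obj K. x \<in> P \<longleftrightarrow> sus K x \<in> P) \<longleftrightarrow> (\<forall>X \<in> modules K Ur. X \<in> iota ` P \<longleftrightarrow> module_sus K Ur X \<in> iota ` P)"
    unfolding modules_Un by (simp add: module_sus_Un inj_iota)
  have 3: "(\<forall>f g h. (f, g, h) \<in> dist K \<longrightarrow> src K f \<in> P \<longrightarrow> tgt K f \<in> P \<longrightarrow> tgt K g \<in> P) \<longleftrightarrow>
     (\<forall>X Y Z f g h. X \<in> iota ` P \<longrightarrow> Y \<in> iota ` P \<longrightarrow> Z \<in> modules K Ur \<longrightarrow> f \<in> module_homs K Ur X Y \<longrightarrow> g \<in> module_homs K Ur Y Z \<longrightarrow>
         h \<in> module_homs K Ur Z (module_sus K Ur X) \<longrightarrow> (f, g, h) \<in> dist K \<longrightarrow> Z \<in> iota ` P)" (is "?L \<longleftrightarrow> ?R")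
  proof
    assume L: ?L
    show ?R
    proof (intro allI impI)
      fix X Y Z f g h
      assume a: "X \<in> iota ` P" "Y \<in> iota ` P" "Z \<in> modules K Ur" "f \<in> module_homs K Ur X Y" "g \<in> module_homs K Ur Y Z" "(f, g, h) \<in> dist K"
      obtain x y z where xyz: "X = iota x" "Y = iota y" "Z = iota z" "x \<in> P" "y \<in> P" "z \<in> obj K" using a(1-3) by (auto simp: modules_Un)
      have "src K f = x" "tgt K f = y" "tgt K g = z" using module_homs_simps[OF a(4)] module_homs_simps[OF a(5)] xyz by simp_all
      with L a(6) xyz show "Z \<in> iota ` P" by (metis imageI)
    qed
  next
    assume R: ?R
    show ?L
    proof (intro allI impI)
      fix f g h assume d: "(f, g, h) \<in> dist K" "src K f \<in> P" "tgt K f \<in> P"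
      note s = dist_simps[OF d(1)]
      have "f \<in> module_homs K Ur (iota (src K f)) (iota (tgt K f))" "g \<in> module_homs K Ur (iota (tgt K f)) (iota (tgt K g))"
        "h \<in> module_homs K Ur (iota (tgt K g)) (module_sus K Ur (iota (src K f)))"
        using s by (simp_all add: module_homs_Un module_sus_Un hom_def)
      then have "iota (tgt K g) \<in> iota ` P" using R d s iota_module by (meson imageI tgt_in)
      then show "tgt K g \<in> P" by (simp add: inj_iota)
    qed
  qed
  have 4: "(\<forall>s x y. is_biproduct K s x y \<longrightarrow> s \<in> P \<longrightarrow> x \<in> P) \<longleftrightarrow> (\<forall>X Y. retr Ur X Y \<longrightarrow> Y \<in> iota ` P \<longrightarrow> X \<in> iota ` P)" (is "?L \<longleftrightarrow> ?R")
  proof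
    assume L: ?L
    show ?R
    proof (intro allI impI)
      fix X Y assume r: "retr Ur X Y" "Y \<in> iota ` P"
      obtain Z where Z: "mbip Ur Y X Z" using retr_complement[OF Un_ring r(1)] by blast
      then have "Y \<in> modules K Ur" "X \<in> modules K Ur" "Z \<in> modules K Ur" unfolding mbip_def[OF Un_ring] by blast+
      then obtain x y z where e: "X = iota x" "Y = iota y" "Z = iota z" "x \<in> obj K" "y \<in> obj K" "z \<in> obj K" by (auto simp: modules_Un)
      then have "is_biproduct K y x z" using Z mbip_Un by simp
      then show "X \<in> iota ` P" using L r(2) e by (auto simp: inj_iota)
    qed
  next
    assume R: ?R
    show ?L
    proof (intro allI impI)
      fix s x y assume b: "is_biproduct K s x y" "s \<in> P"
      then have "s \<in> obj K" "x \<in> obj K" "y \<in> obj K" by (auto simp: is_biproduct_def)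
      then have "mbip Ur (iota s) (iota x) (iota y)" using b(1) mbip_Un by simp
      then have "retr Ur (iota x) (iota s)" by (rule mbip_retr(1)[OF Un_ring])
      with R b(2) have "iota x \<in> iota ` P" by blast
      then show "x \<in> P" by (simp add: inj_iota)
    qed
  qed
  have p: "pthick Ur (iota ` P) \<longleftrightarrow> (\<forall>z. zero_object K z \<longrightarrow> z \<in> P) \<and> (\<forall>x \<in> obj K. x \<in> P \<longleftrightarrow> sus K x \<in> P) \<and>
     (\<forall>f g h. (f, g, h) \<in> dist K \<longrightarrow> src K f \<in> P \<longrightarrow> tgt K f \<in> P \<longrightarrow> tgt K g \<in> P) \<and>
     (\<forall>s x y. is_biproduct K s x y \<longrightarrow> s \<in> P \<longrightarrow> x \<in> P)"
    unfolding pthick_def 1 2 3 4 using P by (auto simp: modules_Un)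
  \<comment> \<open>The two tensor products agree only up to isomorphism, so the ideal conditions
    are compared under the assumption that the set is closed under retracts.\<close>
  have i: "(\<forall>x \<in> obj K. \<forall>y \<in> P. x \<odot> y \<in> P) \<longleftrightarrow> (\<forall>X \<in> modules K Ur. \<forall>Y \<in> iota ` P. module_tensor K Ur X Y \<in> iota ` P)"
    if pt: "pthick Ur (iota ` P)"
  proof -
    have "module_tensor K Ur (iota x) (iota y) \<in> iota ` P \<longleftrightarrow> x \<odot> y \<in> P" if x: "x \<in> obj K" and y: "y \<in> P" for x y
    proof -
      have yo: "y \<in> obj K" using y P by blast
      have "module_tensor K Ur (iota x) (iota y) \<in> iota ` P \<longleftrightarrow> iota (x \<odot> y) \<in> iota ` P"
        using miso_retr[OF tensor_Un[OF x yo]] pt unfolding pthick_def by blast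
      then show ?thesis by (simp add: inj_iota)
    qed
    then show ?thesis by (auto simp: modules_Un)
  qed
  have "thick_ideal K P \<longleftrightarrow> pthick Ur (iota ` P) \<and> (\<forall>x \<in> obj K. \<forall>y \<in> P. x \<odot> y \<in> P)"
    unfolding p thick_ideal_def using P by (simp only: simp_thms conj_assoc)
  also have "\<dots> \<longleftrightarrow> thM Ur (iota ` P)" unfolding thick_Mod[OF Un_ring] by (rule conj_cong[OF refl i])
  finally show ?thesis .
qed

lemma prime_Un:
  assumes P: "P \<subseteq> obj K"
  shows "prime_ideal K P \<longleftrightarrow> prime_ideal (Mod K Ur) (iota ` P)"
proof -
  have 1: "P \<noteq> obj K \<longleftrightarrow> iota ` P \<noteq> obj (Mod K Ur)" 
    using inj_image_eq_iff[of iota P "obj K"] by (simp add: modules_Un inj_def iota_def)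
  have 2: "(\<forall>x \<in> obj K. \<forall>y \<in> obj K. x \<odot> y \<in> P \<longrightarrow> x \<in> P \<or> y \<in> P) \<longleftrightarrow>
    (\<forall>X \<in> obj (Mod K Ur). \<forall>Y \<in> obj (Mod K Ur). tens (Mod K Ur) X Y \<in> iota ` P \<longrightarrow> X \<in> iota ` P \<or> Y \<in> iota ` P)"
    if t: "thM Ur (iota ` P)"
    using thM_miso[OF t Un_ring tensor_Un] by (auto simp: inj_iota modules_Un)
  show ?thesis
    unfolding prime_ideal_def thick_Un[OF P] by (rule conj_cong[OF refl], rule conj_cong[OF 1], rule 2)
qed

lemma retract_thick:
  assumes P: "thick_ideal K P" and i: "i \<in> hom K x y" and r: "r \<in> hom K y x" and ri: "r \<cdot> i = one x" and y: "y \<in> P"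
  shows "x \<in> P"
proof -
  have o: "x \<in> obj K" "y \<in> obj K" using hom_obj[OF i] by auto
  have Po: "P \<subseteq> obj K" using P by (simp add: thick_ideal_def)
  have "retr Ur (iota x) (iota y)"
    unfolding retr_def using o i r ri by (auto simp: iota_module module_homs_Un)
  then have "iota x \<in> iota ` P" using thM_retr[OF _ Un_ring] thick_Un[OF Po] P y by blast
  then show ?thesis by (simp add: inj_iota)
qed

text \<open>Over the unit ring the quotient map is inverted by its section, and as a map from the
  free module it is linear.\<close>

lemma extend_Un:
  assumes A: "tt_ring K A" and f: "uni A \<in> ring_homs K Ur A" and x: "x \<in> obj K"
  shows "miso A (extend_scalars K Ur A (uni A) (iota x)) (free_module K A x)"
proof -
  note Ar = tt_ringD(1)[OF A] and S = A_self[OF A] and X = iota_module[OF x]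
  have e: "restr (uni A) (car A, mul A) = iota (car A)"
    using Ar unfolding ring_object_def by (simp add: restr_def iota_def)
  let ?T = "tens_over Ur A (uni A) (car A, mul A) (iota x)" and ?F = "free_module K A x"
  let ?q = "tq Ur (uni A) (car A, mul A) (iota x)" and ?s = "ts Ur (uni A) (car A, mul A) (iota x)"
  have T: "?T \<in> modules K A" by (rule tens_over_module[OF U A f S X])
  note q = tq_simps[OF U A f S X] tens_over_simps[OF U A f S X]
  have sq: "?s \<cdot> ?q = one (car A \<odot> x)" unfolding e by (rule quot_Un[OF ring_simps(1)[OF Ar] x])
  have F: "fst ?F = car A \<odot> x" "snd ?F = (mul A \<otimes> one x) \<cdot> inv (\<alpha> (car A) (car A) x)" by (simp_all add: free_module_def)
  have "snd ?T \<cdot> (one (car A) \<otimes> ?q) = ?q \<cdot> (mul A \<otimes> one x) \<cdot> inv (\<alpha> (car A) (car A) x)"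
    using tens_over_act_arr[OF U A f S X] by simp
  then have "?q \<in> module_homs K A ?F ?T"
    using q Ar x by (simp add: module_homs_def F hom_def cmp_ass)
  then have "miso A ?F ?T"
    by (rule misoI[OF Ar free_module_module[OF Ar x] T, of _ ?s]) (use q sq F in simp_all)
  then show ?thesis unfolding miso_def extend_scalars_tens_over by blast
qed

end

end

section \<open>Localization at a thick ideal, and nilpotence of the fibre of the unit\<close>

section \<open>Detecting nilpotence\<close>

context tt_category
begin

context
  fixes P
  assumes U: "tt_ring K (unit_ring K)" and P: "thick_ideal K P"
begin

text \<open>The arrows that become invertible in \<open>K/P\<close>.\<close>

definition inverted :: "'m \<Rightarrow> bool" where
  "inverted f \<longleftrightarrow> (\<exists>g h. (f, g, h) \<in> dist K \<and> tgt K g \<in> P)"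

lemma inverted_arr: "inverted f \<Longrightarrow> f \<in> arr K"
  unfolding inverted_def by (auto dest: dist_simps)

lemma thick_sus: "x \<in> obj K \<Longrightarrow> sus K x \<in> P \<longleftrightarrow> x \<in> P"
  using P unfolding thick_ideal_def by blast

lemma thick_tens: "\<lbrakk>x \<in> obj K; y \<in> P\<rbrakk> \<Longrightarrow> x \<odot> y \<in> P"
  using P unfolding thick_ideal_def by blast

text \<open>After two rotations the suspension of the middle object is the third vertex.\<close>

lemma thick_middle:
  assumes d: "(u, v, w) \<in> dist K" and "src K u \<in> P" "tgt K v \<in> P"
  shows "tgt K u \<in> P"
proof -
  note s = dist_simps[OF d]
  have r: "(w, neg_arr K (susa K u), neg_arr K (susa K v)) \<in> dist K" using dist_rot[OF dist_rot[OF d]] .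
  have "sus K (src K u) \<in> P" using thick_sus assms(2) s by simp
  moreover have "tgt K (neg_arr K (susa K u)) = sus K (tgt K u)" using dist_simps[OF r] s by simp
  ultimately have "sus K (tgt K u) \<in> P" using P r assms(3) s(5,6) unfolding thick_ideal_def by metis
  then show ?thesis using thick_sus s by simp
qed

text \<open>Two cones are compared by fill-ins in both directions, and a retraction is enough. The
  endomorphism k = c' c fixes a and b; so n = k - 1 vanishes on a, factors through b, and satisfies
  n k = n. Hence (1 - n) k = 1, and this cone is a retract of the one in \<open>P\<close>.\<close>

lemma inverted_cone:
  assumes f: "inverted f" and d: "(f, a, b) \<in> dist K"
  shows "tgt K a \<in> P"
proof -
  obtain g h where e: "(f, g, h) \<in> dist K" "tgt K g \<in> P" using f by (auto simp: inverted_def)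
  note s = dist_simps[OF d] dist_simps[OF e(1)]
  let ?x = "src K f" and ?y = "tgt K f"
  have i: "one ?x \<in> hom K ?x ?x" "one ?y \<in> hom K ?y ?y" "one ?y \<cdot> f = f \<cdot> one ?x"
    using s by (simp_all add: hom_def)
  obtain c where c: "triangle_morphism K (f, a, b) (f, g, h) (one ?x) (one ?y) c"
    using dist_morphism[OF d e(1) i] by blast
  obtain c' where c': "triangle_morphism K (f, g, h) (f, a, b) (one ?x) (one ?y) c'"
    using dist_morphism[OF e(1) d i] by blast
  define z where "z = tgt K a"
  define k where "k = c' \<cdot> c"
  have h: "c \<in> hom K z (tgt K g)" "c' \<in> hom K (tgt K g) z" "c \<cdot> a = g" "c' \<cdot> g = a" "h \<cdot> c = b" "b \<cdot> c' = h"
    using c c' s unfolding triangle_morphism_def z_def by (auto simp: susa_idn)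
  note t = homD[OF h(1)] homD[OF h(2)]
  have k: "k \<in> hom K z z" "k \<cdot> a = a" "b \<cdot> k = b"
  proof -
    show "k \<in> hom K z z" unfolding k_def by (rule cmp_hom[OF h(1,2)])
    have "k \<cdot> a = c' \<cdot> (c \<cdot> a)" unfolding k_def using s t by (simp add: cmp_ass z_def)
    then show "k \<cdot> a = a" by (simp add: h(3,4))
    have "b \<cdot> k = (b \<cdot> c') \<cdot> c" unfolding k_def using s t by (simp add: cmp_ass z_def)
    then show "b \<cdot> k = b" by (simp add: h(5,6))
  qed
  have zo: "z \<in> obj K" using s by (simp add: z_def)
  have o: "one z \<in> hom K z z" using zo by (simp add: hom_def)
  have az: "a \<in> hom K ?y z" "b \<in> hom K z (sus K ?x)" using s by (simp_all add: hom_def z_def)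
  define n where "n = minus k (one z)"
  have n: "n \<in> hom K z z" unfolding n_def by (rule minus_hom[OF k(1) o])
  have "n \<cdot> a = minus (k \<cdot> a) (one z \<cdot> a)" unfolding n_def by (rule minus_cmp[OF az(1) k(1) o])
  also have "\<dots> = zero_arr K ?y z" using minus_self[OF az(1)] k(2) az(1) by (simp add: hom_def)
  finally have na: "n \<cdot> a = zero_arr K (src K a) (tgt K n)" using n s by (simp add: hom_def)
  have "\<exists>l \<in> hom K (tgt K b) (tgt K n). l \<cdot> b = n"
    by (rule dist_coexact[OF dist_rot[OF d] _ _ na]) (use n in \<open>simp_all add: hom_def z_def\<close>)
  then obtain l where l: "l \<in> hom K (tgt K b) (tgt K n)" "l \<cdot> b = n" by blast
  have nk: "n \<cdot> k = n"
  proof -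
    have "n \<cdot> k = l \<cdot> (b \<cdot> k)" unfolding l(2)[symmetric] using l(1) k(1) az by (simp add: hom_def cmp_ass)
    then show ?thesis by (simp add: k(3) l(2))
  qed
  define r where "r = minus (one z) n"
  have r: "r \<in> hom K z z" unfolding r_def by (rule minus_hom[OF o n])
  have "r \<cdot> k = minus (one z \<cdot> k) (n \<cdot> k)" unfolding r_def by (rule minus_cmp[OF k(1) o n])
  then have rk: "r \<cdot> k = minus k n" using k(1) nk by (simp add: hom_def)
  have "n \<oplus> minus k n = n \<oplus> one z"
    using minus_plus[OF k(1) n] minus_plus[OF k(1) o, folded n_def] plus_comm[OF minus_hom[OF k(1) n] n] by simp
  then have rk1: "r \<cdot> k = one z" unfolding rk using plus_cancel[OF n minus_hom[OF k(1) n] o] by simp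
  have "(r \<cdot> c') \<cdot> c = one z" using rk1 r h(1,2) unfolding k_def by (simp add: hom_def cmp_ass)
  then show ?thesis
    using retract_thick[OF U P h(1) cmp_hom[OF h(2) r] _ e(2)] by (simp add: z_def)
qed

text \<open>In an octahedron the cone of the composite lies between the cones of \<open>f\<close>
  and \<open>g\<close>.\<close>

lemma inverted_comp:
  assumes f: "inverted f" and g: "inverted g" and c: "src K g = tgt K f"
  shows "inverted (g \<cdot> f)"
proof -
  have a: "f \<in> arr K" "g \<in> arr K" using f g by (simp_all add: inverted_arr)
  obtain Q where Q: "Q \<in> octa K" "oct_f Q = f" "oct_g Q = g"
    using octa_base[of f "src K f" "tgt K f" g "tgt K g"] a c by (auto simp: hom_def)
  obtain f1 f2 g1 g2 h1 h2 u v w where q: "Q = Octahedron f g f1 f2 g1 g2 h1 h2 u v w"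
    using Q(2,3) by (cases Q) simp
  have o: "(f, f1, f2) \<in> dist K" "(g, g1, g2) \<in> dist K" "(g \<cdot> f, h1, h2) \<in> dist K" "(u, v, w) \<in> dist K"
    using octa_octahedron[OF Q(1)] unfolding q is_octahedron_def octahedron.case by blast+
  have "\<exists>p r s. octahedron_morphism K Q Q (one (src K f)) (one (tgt K f)) (one (tgt K g)) p r s"
    by (rule octa_morphism[OF Q(1) Q(1)]) (use a c in \<open>simp_all add: Q hom_def\<close>)
  then obtain p r s where m: "octahedron_morphism K Q Q (one (src K f)) (one (tgt K f)) (one (tgt K g)) p r s" by blast
  \<comment> \<open>The equations of an octahedron do not fix the ends of its fourth triangle, but its identity morphism does.\<close>
  have e: "src K u = tgt K f1" "tgt K u = tgt K h1" "tgt K v = tgt K g1"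
    using m unfolding q octahedron_morphism_def triangle_morphism_def by (auto simp: hom_def)
  have "tgt K u \<in> P"
    by (rule thick_middle[OF o(4)]) (simp_all add: e inverted_cone[OF f o(1)] inverted_cone[OF g o(2)])
  then show ?thesis unfolding inverted_def e using o(3) by blast
qed

lemma inverted_iso:
  assumes f: "iso f"
  shows "inverted f"
proof -
  obtain z where z: "zero_object K z" using zero_object_ex by blast
  then have zo: "z \<in> obj K" and zP: "z \<in> P" using P by (auto simp: zero_object_def thick_ideal_def)
  let ?x = "src K f" and ?y = "tgt K f"
  have fa: "f \<in> arr K" using f by simp
  have o: "?x \<in> obj K" "?y \<in> obj K" using fa by simp_all
  have "(f, zero_arr K ?y z, zero_arr K z (sus K ?x)) \<in> dist K"
  proof (rule dist_iso[OF dist_idn[OF o(1) z]])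
    show "is_triangle K f (zero_arr K ?y z) (zero_arr K z (sus K ?x))"
      using fa o zo by (simp add: is_triangle_def)
    show "triangle_morphism K (one ?x, zero_arr K ?x z, zero_arr K z (sus K ?x))
        (f, zero_arr K ?y z, zero_arr K z (sus K ?x)) (one ?x) f (one z)"
      using fa o zo by (simp add: triangle_morphism_def hom_def susa_idn)
  qed (use f o zo isosI[of "one ?x" ?x ?x "one ?x"] isosI[of "one z" z z "one z"] in \<open>simp_all add: iso_def hom_def\<close>)
  then show ?thesis unfolding inverted_def using zP o zo by auto
qed

text \<open>Tensoring on the left tensors the cone, which stays in the ideal; tensoring on the right
  is conjugate to this by the symmetry, and f \<otimes> g is a composite of one of each.\<close>

lemma inverted_tens:
  assumes f: "inverted f" and g: "inverted g"
  shows "inverted (f \<otimes> g)"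
proof -
  have a: "f \<in> arr K" "g \<in> arr K" using f g by (simp_all add: inverted_arr)
  have r: "inverted (one x \<otimes> k)" if k: "inverted k" and x: "x \<in> obj K" for k x
  proof -
    obtain g h where d: "(k, g, h) \<in> dist K" "tgt K g \<in> P" using k by (auto simp: inverted_def)
    have "x \<odot> tgt K g \<in> P" by (rule thick_tens[OF x d(2)])
    then show ?thesis unfolding inverted_def
      using tens_exact[OF x d(1)] dist_simps[OF d(1)] x by (intro exI conjI) auto
  qed
  let ?w = "src K g" and ?y = "tgt K f"
  have "f \<otimes> one ?w = \<beta> ?w ?y \<cdot> ((one ?w \<otimes> f) \<cdot> \<beta> (src K f) ?w)"
    using a \<beta>_nat[of "one ?w" f ?w ?y] by (simp add: cmp_ass[symmetric]) (simp add: cmp_ass \<beta>_\<beta>)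
  moreover have "inverted (\<beta> ?w ?y \<cdot> ((one ?w \<otimes> f) \<cdot> \<beta> (src K f) ?w))"
    by (rule inverted_comp[OF inverted_comp[OF inverted_iso r[OF f]] inverted_iso]) (use a in simp_all)
  ultimately have "inverted (f \<otimes> one ?w)" by simp
  then have "inverted ((one ?y \<otimes> g) \<cdot> (f \<otimes> one ?w))"
    by (rule inverted_comp[OF _ r[OF g]]) (use a in simp_all)
  then show ?thesis using a by (simp add: tens_cmp)
qed

text \<open>The identity of y annihilates the zero arrow, so it factors through the cone and y is a
  retract of it.\<close>

lemma inverted_zero:
  assumes "inverted (zero_arr K x y)" and x: "x \<in> obj K" and y: "y \<in> obj K"
  shows "y \<in> P"
proof -
  obtain g h where d: "(zero_arr K x y, g, h) \<in> dist K" "tgt K g \<in> P" using assms(1) by (auto simp: inverted_def)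
  note s = dist_simps[OF d(1)]
  have "\<exists>s \<in> hom K (tgt K g) (tgt K (one y)). s \<cdot> g = one y"
    by (rule dist_coexact[OF d(1)]) (use x y in simp_all)
  then obtain r where "r \<in> hom K (tgt K g) y" "r \<cdot> g = one y" using y by auto
  then show ?thesis using retract_thick[OF U P _ _ _ d(2), of g y r] s x y by (simp add: hom_def)
qed

end

text \<open>A power of \<xi> that is both zero and invertible modulo \<open>P\<close> would put its
  target, a tensor power of the unit, into \<open>P\<close>.\<close>

theorem nilpotence_prime:
  assumes A: "tt_ring K A" and U: "tt_ring K (unit_ring K)" and N: "detects_nilpotence K A" and P: "prime_ideal K P"
  shows "car A \<notin> P"
proof
  assume AP: "car A \<in> P"
  have T: "thick_ideal K P" and ne: "P \<noteq> obj K" and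
    pr: "\<And>x y. \<lbrakk>x \<in> obj K; y \<in> obj K; x \<odot> y \<in> P\<rbrakk> \<Longrightarrow> x \<in> P \<or> y \<in> P"
    using P by (auto simp: prime_ideal_def)
  have Po: "P \<subseteq> obj K" using T by (simp add: thick_ideal_def)
  note inv = inverted_iso[OF U T] inverted_comp[OF U T] inverted_cone[OF U T] inverted_tens[OF U T]
  have unit: "\<one> \<notin> P"
  proof
    assume 1: "\<one> \<in> P"
    have "x \<in> P" if x: "x \<in> obj K" for x
    proof -
      have "x \<odot> \<one> \<in> P" by (rule thick_tens[OF U T x 1])
      from retract_thick[OF U T _ _ _ this, of "inv (ru x)" x "ru x"] x show ?thesis by (simp add: hom_def)
    qed
    with Po ne show False by blast
  qed
  note s = ring_simps[OF tt_ringD(1)[OF A]]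
  have a: "uni A \<in> arr K" "src K (uni A) = \<one>" "tgt K (uni A) = car A" using s by simp_all
  obtain g h where d: "(uni A, g, h) \<in> dist K" using dist_cone[OF a(1)] by blast
  note ds = dist_simps[OF d]
  \<comment> \<open>Rotating the triangle of the unit twice shows that the suspension of A is a cone
    of \<open>h\<close>.\<close>
  have "tgt K (neg_arr K (susa K (uni A))) \<in> P" using thick_sus[OF U T s(1)] AP a by simp
  then have h: "inverted P h" unfolding inverted_def[OF U T] using dist_rot[OF dist_rot[OF d]] by blast
  \<comment> \<open>The multiplication splits A \<otimes> \<eta>, so its suspension is a
    monomorphism; in the triangle tensored with A it annihilates the arrow coming from
    \<open>h\<close>.\<close>
  have h0: "one (car A) \<otimes> h = zero_arr K (car A \<odot> tgt K g) (car A \<odot> sus K \<one>)"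
  proof -
    let ?k = "tsus K (car A) \<one> \<cdot> (one (car A) \<otimes> h)"
    have "susa K (one (car A) \<otimes> uni A) \<cdot> ?k = zero_arr K (car A \<odot> tgt K g) (sus K (car A \<odot> car A))"
      using dist_cmp_zero3[OF tens_exact[OF s(1) d]] ds a s(1) by simp
    moreover have "mul A \<cdot> (one (car A) \<otimes> uni A) = ru (car A)"
      using tt_ringD(1)[OF A] unfolding ring_object_def by blast
    then have "(inv (ru (car A)) \<cdot> mul A) \<cdot> (one (car A) \<otimes> uni A) = one (car A \<odot> \<one>)"
      using s a by (simp add: cmp_ass)
    then have "susa K (inv (ru (car A)) \<cdot> mul A) \<cdot> susa K (one (car A) \<otimes> uni A) = one (sus K (car A \<odot> \<one>))"
      using s a by (simp add: susa_comp[symmetric] susa_idn)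
    then have "?k = susa K (inv (ru (car A)) \<cdot> mul A) \<cdot> (susa K (one (car A) \<otimes> uni A) \<cdot> ?k)"
      using s a ds by (simp add: cmp_ass[symmetric])
    ultimately have e: "?k = tsus K (car A) \<one> \<cdot> zero_arr K (car A \<odot> tgt K g) (car A \<odot> sus K \<one>)"
      using s a ds by simp
    show ?thesis by (rule iso_cancel_l[OF _ _ _ _ _ e]) (use s a ds in simp_all)
  qed
  obtain w \<phi> where w: "w \<in> obj K" and \<phi>: "\<phi> \<in> isos K (sus K w) (tgt K g)"
    using sus_ess_surj[of "tgt K g"] ds by auto
  have \<phi>s: "iso \<phi>" "\<phi> \<in> arr K" "src K \<phi> = sus K w" "tgt K \<phi> = tgt K g"
    using isos_iso[OF \<phi>] isos_hom[OF \<phi>] by (simp_all add: hom_def)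
  have hp: "h \<cdot> \<phi> \<in> hom K (sus K w) (sus K \<one>)" using ds \<phi>s a by (simp add: hom_def)
  \<comment> \<open>Nilpotence needs an arrow into the unit, so \<open>h\<close> is desuspended. The
    sign makes the triangle of \<xi>, rotated three times, start with
    \<open>h \<cdot> \<phi>\<close>.\<close>
  obtain \<xi> where \<xi>: "\<xi> \<in> hom K w \<one>" "susa K \<xi> = neg_arr K (h \<cdot> \<phi>)"
    using susa_surj[OF neg_arr_props(1)[OF hp] w] by auto
  have inv_\<xi>: "inverted P \<xi>"
  proof -
    obtain a b where e: "(\<xi>, a, b) \<in> dist K" using dist_cone[of \<xi>] \<xi> by (auto simp: hom_def)
    note r = dist_rot[OF dist_rot[OF dist_rot[OF e]]]
    have 1: "neg_arr K (susa K \<xi>) = h \<cdot> \<phi>" using \<xi>(2) neg_neg[OF hp] by simp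
    have "inverted P (h \<cdot> \<phi>)" using h inv(1)[OF \<phi>s(1)] \<phi>s ds by (intro inv(2)) simp_all
    then have "tgt K (neg_arr K (susa K a)) \<in> P" using inv(3)[of "h \<cdot> \<phi>"] r unfolding 1 by blast
    moreover have "tgt K (neg_arr K (susa K a)) = sus K (tgt K a)" using dist_simps[OF e] by simp
    ultimately have "tgt K a \<in> P" using thick_sus[OF U T, of "tgt K a"] dist_simps[OF e] by simp
    then show ?thesis unfolding inverted_def[OF U T] using e by blast
  qed
  have "one (car A) \<otimes> \<xi> = zero_arr K (car A \<odot> w) (car A \<odot> \<one>)"
  proof -
    have aw: "car A \<odot> w \<in> obj K" "car A \<odot> \<one> \<in> obj K" using s(1) w by simp_all
    have "susa K \<xi> = h \<cdot> neg_arr K \<phi>"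
      using cmp_neg[of \<phi> "sus K w" "tgt K g" h "sus K \<one>"] \<xi>(2) \<phi>s ds a by (simp add: hom_def)
    moreover have "neg_arr K \<phi> \<in> hom K (sus K w) (tgt K g)"
      using neg_arr_props(1)[of \<phi>] \<phi>s by (auto simp: hom_def)
    ultimately have "one (car A) \<otimes> susa K \<xi> = (one (car A) \<otimes> h) \<cdot> (one (car A) \<otimes> neg_arr K \<phi>)"
      using s(1) ds by (simp add: tens_cmp hom_def)
    then have "one (car A) \<otimes> susa K \<xi> = zero_arr K (car A \<odot> sus K w) (car A \<odot> sus K \<one>)"
      unfolding h0 using s(1) ds w \<phi>s neg_arr_props(1)[OF isos_hom[OF \<phi>]] by (simp add: hom_def)
    then have "susa K (one (car A) \<otimes> \<xi>) \<cdot> tsus K (car A) w = zero_arr K (sus K (car A \<odot> w)) (sus K (car A \<odot> \<one>)) \<cdot> tsus K (car A) w"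
      using tsus_nat[of "one (car A)" \<xi> "car A" \<one>] \<xi>(1) s(1) w by (simp add: hom_def)
    then have "susa K (one (car A) \<otimes> \<xi>) = susa K (zero_arr K (car A \<odot> w) (car A \<odot> \<one>))"
      unfolding susa_zero[OF aw] by (rule iso_cancel_r[rotated -1]) (use \<xi>(1) s(1) w in \<open>simp_all add: hom_def\<close>)
    then show ?thesis
      by (rule susa_inj[rotated -1]) (use \<xi>(1) s(1) w in \<open>simp_all add: hom_def\<close>)
  qed
  then have "is_zero_arr K (one (car A) \<otimes> \<xi>)" using \<xi> s(1) w by (simp add: is_zero_arr_def hom_def)
  then obtain n where n: "n \<ge> 1" "is_zero_arr K (tensor_power K \<xi> n)"
    using N \<xi> unfolding detects_nilpotence_def by (auto simp: hom_def)
  \<comment> \<open>Exponents start at 1. The target of each power is a tensor power of the unit,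
    and the prime \<open>P\<close> contains none of these.\<close>
  have pw: "inverted P (tensor_power K \<xi> (Suc m)) \<and> tgt K (tensor_power K \<xi> (Suc m)) \<notin> P" for m
  proof (induction m)
    case 0
    then show ?case using inv_\<xi> unit \<xi> by (simp add: hom_def)
  next
    case (Suc m)
    let ?t = "tensor_power K \<xi> (Suc m)"
    have t: "inverted P ?t" "tgt K ?t \<notin> P" using Suc by blast+
    have ta: "?t \<in> arr K" by (rule inverted_arr[OF U T t(1)])
    have e: "tensor_power K \<xi> (Suc (Suc m)) = ?t \<otimes> \<xi>" by simp
    have "tgt K (?t \<otimes> \<xi>) = tgt K ?t \<odot> \<one>" using ta \<xi>(1) by (simp add: hom_def)
    then show ?case unfolding e using inv(4)[OF t(1) inv_\<xi>] pr[OF tgt_in[OF ta] unit_obj] t(2) unit by metis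
  qed
  obtain m where m: "n = Suc m" using n(1) by (cases n) auto
  let ?t = "tensor_power K \<xi> n"
  have t: "inverted P ?t" "tgt K ?t \<notin> P" using pw[of m] m by simp_all
  have "?t \<in> arr K" by (rule inverted_arr[OF U T t(1)])
  then have "tgt K ?t \<in> P" using inverted_zero[OF U T, of "src K ?t" "tgt K ?t"] t(1) n(2) by (simp add: is_zero_arr_def)
  with t(2) show False by simp
qed

end

section \<open>Bases of the spectrum, continuity, and the quotient map onto the spectrum of
  \<open>K\<close>\<close>

section \<open>The spectral topology\<close>

lemma topspace_Spc:
  assumes "\<exists>z. zero_object X z"
  shows "topspace (Spc X) = {P. prime_ideal X P}"
proof -
  obtain z where z: "zero_object X z" using assms by blast
  then have "z \<in> obj X" "\<And>P. prime_ideal X P \<Longrightarrow> z \<in> P"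
    by (auto simp: zero_object_def prime_ideal_def thick_ideal_def)
  then show ?thesis by (auto simp: Spc_def)
qed

lemma openin_Spc: "x \<in> obj X \<Longrightarrow> openin (Spc X) {P. prime_ideal X P \<and> x \<in> P}"
  unfolding Spc_def by (rule topology_generated_by_Basis) blast

lemma continuous_map_Spc_map:
  assumes z: "\<exists>z. zero_object X z" "\<exists>z. zero_object Y z" and F: "\<And>x. x \<in> obj X \<Longrightarrow> F x \<in> obj Y"
    and p: "\<And>Q. prime_ideal Y Q \<Longrightarrow> prime_ideal X (Spc_map X F Q)"
  shows "continuous_map (Spc Y) (Spc X) (Spc_map X F)"
proof -
  let ?B = "{{P. prime_ideal X P \<and> x \<in> P} | x. x \<in> obj X}"
  have "\<Union>?B = {P. prime_ideal X P}"
    using topspace_Spc[OF z(1)] by (simp add: Spc_def)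
  then have "Spc_map X F ` topspace (Spc Y) \<subseteq> \<Union>?B" using p topspace_Spc[OF z(2)] by auto
  moreover have "openin (Spc Y) (Spc_map X F -` {P. prime_ideal X P \<and> x \<in> P} \<inter> topspace (Spc Y))" if x: "x \<in> obj X" for x
  proof -
    have "Spc_map X F -` {P. prime_ideal X P \<and> x \<in> P} \<inter> topspace (Spc Y) = {Q. prime_ideal Y Q \<and> F x \<in> Q}"
      using x p topspace_Spc[OF z(2)] by (auto simp: Spc_map_def)
    then show ?thesis using openin_Spc[OF F[OF x]] by simp
  qed
  ultimately show ?thesis
    unfolding Spc_def[of X] by (intro continuous_on_generated_topo) auto
qed

text \<open>The topology is given by generators; the hypothesis \<open>s\<close>, supplied by direct
  sums, makes them a basis. This is what produces a single module separating a prime from a closed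
  set.\<close>

lemma Spc_basis:
  assumes z: "\<exists>z. zero_object X z"
    and s: "\<And>x y. \<lbrakk>x \<in> obj X; y \<in> obj X\<rbrakk> \<Longrightarrow> \<exists>s \<in> obj X. \<forall>P. prime_ideal X P \<longrightarrow> (s \<in> P \<longleftrightarrow> x \<in> P \<and> y \<in> P)"
    and U: "openin (Spc X) U" and Q: "Q \<in> U"
  shows "\<exists>x \<in> obj X. x \<in> Q \<and> {P. prime_ideal X P \<and> x \<in> P} \<subseteq> U"
proof -
  have "generate_topology_on {{P. prime_ideal X P \<and> x \<in> P} | x. x \<in> obj X} U"
    using U unfolding Spc_def by (rule openin_topology_generated_by)
  then have "\<forall>Q \<in> U. prime_ideal X Q \<and> (\<exists>x \<in> obj X. x \<in> Q \<and> {P. prime_ideal X P \<and> x \<in> P} \<subseteq> U)"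
  proof induction
    case (Int a b)
    show ?case
    proof
      fix Q assume Q: "Q \<in> a \<inter> b"
      have 1: "prime_ideal X Q \<and> (\<exists>x \<in> obj X. x \<in> Q \<and> {P. prime_ideal X P \<and> x \<in> P} \<subseteq> a)"
        using Q by (intro bspec[OF Int.IH(1)]) simp
      have 2: "prime_ideal X Q \<and> (\<exists>y \<in> obj X. y \<in> Q \<and> {P. prime_ideal X P \<and> y \<in> P} \<subseteq> b)"
        using Q by (intro bspec[OF Int.IH(2)]) simp
      from 1 obtain x where x: "x \<in> obj X" "x \<in> Q" "{P. prime_ideal X P \<and> x \<in> P} \<subseteq> a" and p: "prime_ideal X Q" by (elim conjE bexE)
      from 2 obtain y where y: "y \<in> obj X" "y \<in> Q" "{P. prime_ideal X P \<and> y \<in> P} \<subseteq> b" by (elim conjE bexE)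
      obtain s where "s \<in> obj X" "\<forall>P. prime_ideal X P \<longrightarrow> (s \<in> P \<longleftrightarrow> x \<in> P \<and> y \<in> P)"
        using s[OF x(1) y(1)] by (elim bexE)
      with x y p show "prime_ideal X Q \<and> (\<exists>x \<in> obj X. x \<in> Q \<and> {P. prime_ideal X P \<and> x \<in> P} \<subseteq> a \<inter> b)"
        by blast
    qed
  next
    case (UN F)
    then show ?case by (meson Union_iff Union_upper subset_trans)
  qed auto
  with Q show ?thesis by blast
qed

context tt_category
begin

context
  fixes A
  assumes A: "tt_ring K A"
begin

lemma zero_Mod: "\<exists>z. zero_object (Mod K A) z"
proof -
  obtain z where z: "zero_object K z" using zero_object_ex by blast
  then have zo: "z \<in> obj K" by (simp add: zero_object_def)
  note Ar = tt_ringD(1)[OF A]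
  have c: "car A \<in> obj K" using ring_simps(1)[OF Ar] .
  have "one (car A \<odot> z) = zero_arr K (car A \<odot> z) (car A \<odot> z)"
    using tens_zero_r[of "one (car A)" z z] zero_object_idn[OF z] c zo tensa_idn[of "car A" z] by simp
  then have "nul A (free_module K A z)"
    unfolding nul_def using free_module_module[OF Ar zo] by (simp add: free_module_def) 
  then show ?thesis using zero_object_Mod[OF Ar] by blast
qed

lemma sum_Mod:
  assumes "X \<in> modules K A" "Y \<in> modules K A"
  shows "\<exists>S \<in> modules K A. \<forall>P. prime_ideal (Mod K A) P \<longrightarrow> (S \<in> P \<longleftrightarrow> X \<in> P \<and> Y \<in> P)"
proof -
  note Ar = tt_ringD(1)[OF A]
  obtain S where S: "mbip A S X Y" using mbip_ex[OF Ar assms] by blast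
  have "S \<in> P \<longleftrightarrow> X \<in> P \<and> Y \<in> P" if P: "prime_ideal (Mod K A) P" for P
  proof -
    have t: "thM A P" using P by (simp add: prime_ideal_def)
    then have "pthick A P" unfolding thick_Mod[OF Ar] by blast
    then show ?thesis using pthick_sum[OF Ar _ S] thM_retr[OF t Ar] mbip_retr[OF Ar S] by blast
  qed
  moreover have "S \<in> modules K A" using S unfolding mbip_def[OF Ar] by blast
  ultimately show ?thesis by blast
qed

end

lemma continuous_extend:
  assumes R: "tt_ring K R" and B: "tt_ring K B" and f: "f \<in> ring_homs K R B"
  shows "continuous_map (Spc (Mod K B)) (Spc (Mod K R)) (Spc_map (Mod K R) (extend_scalars K R B f))"
proof -
  interpret p: tt_pair "modules K R" "thM R" "module_tensor K R" "(car R, mul R)"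
    "modules K B" "thM B" "module_tensor K B" "(car B, mul B)" "extend_scalars K R B f" "restr f" by (rule tt_pair_Mod[OF R B f])
  show ?thesis
  proof (rule continuous_map_Spc_map[OF zero_Mod[OF R] zero_Mod[OF B]])
    show "prime_ideal (Mod K R) (Spc_map (Mod K R) (extend_scalars K R B f) Q)" if "prime_ideal (Mod K B) Q" for Q
      using p.con_prime[of Q] that by (simp add: prime_Mod[OF R] prime_Mod[OF B] p.con_def Spc_map_def)
  qed (simp add: p.F_ob)
qed

text \<open>The facts from which the coequalizer property is formal. By the last one, each pair of
  primes in a fibre comes from one prime of \<open>D\<close>, so a map equalizing \<phi>1 and
  \<phi>2 is constant on the fibres.\<close>

theorem quotient_map_free_module:
  assumes A: "tt_ring K A" and d: "finite_degree K A" and N: "detects_nilpotence K A"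
  defines "D \<equiv> ring_tensor K A A"
  defines "\<phi> \<equiv> Spc_map K (free_module K A)"
    and "\<phi>1 \<equiv> Spc_map (Mod K A) (extend_scalars K A D (left_incl K A))"
    and "\<phi>2 \<equiv> Spc_map (Mod K A) (extend_scalars K A D (right_incl K A))"
  shows "continuous_map (Spc (Mod K D)) (Spc (Mod K A)) \<phi>1" "continuous_map (Spc (Mod K D)) (Spc (Mod K A)) \<phi>2"
    "quotient_map (Spc (Mod K A)) (Spc K) \<phi>"
    "\<And>T. T \<in> topspace (Spc (Mod K D)) \<Longrightarrow> \<phi> (\<phi>1 T) = \<phi> (\<phi>2 T)"
    "\<And>Q1 Q2. \<lbrakk>Q1 \<in> topspace (Spc (Mod K A)); Q2 \<in> topspace (Spc (Mod K A)); \<phi> Q1 = \<phi> Q2\<rbrakk>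
       \<Longrightarrow> \<exists>T \<in> topspace (Spc (Mod K D)). \<phi>1 T = Q1 \<and> \<phi>2 T = Q2"
proof -
  obtain n Bn t where t: "splitting_tower K A Bn t" and zero: "zero_object K (car (Bn (Suc n)))"
    using d by (auto simp: finite_degree_def has_degree_def)
  have B0: "Bn 0 = unit_ring K" "Bn 1 = A" "t 0 = uni A" and
    Bt: "tt_ring K (Bn 0)" "t 0 \<in> ring_homs K (Bn 0) (Bn (0 + 1))"
    using t unfolding splitting_tower_def by blast+
  define Ur where "Ur = unit_ring K"
  define e where "e = uni A"
  have U: "tt_ring K (unit_ring K)" and U': "tt_ring K Ur" and e: "e \<in> ring_homs K Ur A" and inc: "incomp Ur A e"
    using B0 Bt tower_incomp[OF t zero, of 0] by (simp_all add: Ur_def e_def)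
  have D: "tt_ring K D" unfolding D_def by (rule ring_tensor_tt[OF A A])
  note Ar = tt_ringD(1)[OF A] and Dr = tt_ringD(1)[OF D] and Ud = tt_ringD(1)[OF U']
  have l: "left_incl K A \<in> ring_homs K A D" and r: "right_incl K A \<in> ring_homs K A D"
    using incl_ring_homs[OF Ar] by (simp_all add: D_def)
  show "continuous_map (Spc (Mod K D)) (Spc (Mod K A)) \<phi>1" "continuous_map (Spc (Mod K D)) (Spc (Mod K A)) \<phi>2"
    unfolding \<phi>1_def \<phi>2_def by (rule continuous_extend[OF A D l] continuous_extend[OF A D r])+
  interpret p: tt_pair "modules K Ur" "thM Ur" "module_tensor K Ur" "(car Ur, mul Ur)"
    "modules K A" "thM A" "module_tensor K A" "(car A, mul A)" "extend_scalars K Ur A e" "restr e" by (rule tt_pair_Mod[OF U' A e])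
  interpret p1: tt_pair "modules K A" "thM A" "module_tensor K A" "(car A, mul A)"
    "modules K D" "thM D" "module_tensor K D" "(car D, mul D)" "extend_scalars K A D (left_incl K A)" "restr (left_incl K A)"
    by (rule tt_pair_Mod[OF A D l])
  interpret p2: tt_pair "modules K A" "thM A" "module_tensor K A" "(car A, mul A)"
    "modules K D" "thM D" "module_tensor K D" "(car D, mul D)" "extend_scalars K A D (right_incl K A)" "restr (right_incl K A)"
    by (rule tt_pair_Mod[OF A D r])
  have pA: "prime_ideal (Mod K A) Q \<longleftrightarrow> p.Y.prime Q" for Q by (rule prime_Mod[OF A])
  have pD: "prime_ideal (Mod K D) Q \<longleftrightarrow> p1.Y.prime Q" for Q by (rule prime_Mod[OF D])
  have pK: "prime_ideal K P \<longleftrightarrow> P \<subseteq> obj K \<and> p.X.prime (iota ` P)" for P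
  proof -
    have "prime_ideal K P \<Longrightarrow> P \<subseteq> obj K" unfolding prime_ideal_def thick_ideal_def by (elim conjE)
    moreover have "P \<subseteq> obj K \<Longrightarrow> prime_ideal K P \<longleftrightarrow> p.X.prime (iota ` P)"
      using prime_Un[OF U, of P] prime_Mod[OF U, of "iota ` P"] by (simp add: Ur_def)
    ultimately show ?thesis by (rule_tac iffI) simp_all
  qed
  have tA: "topspace (Spc (Mod K A)) = {Q. p.Y.prime Q}" using topspace_Spc[OF zero_Mod[OF A]] by (simp add: pA)
  have tD: "topspace (Spc (Mod K D)) = {Q. p1.Y.prime Q}" using topspace_Spc[OF zero_Mod[OF D]] by (simp add: pD)
  have tK: "topspace (Spc K) = {P. prime_ideal K P}" using topspace_Spc[OF zero_object_ex] .
  have mU: "modules K Ur = iota ` obj K" unfolding Ur_def by (rule modules_Un[OF U])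
  \<comment> \<open>Through \<open>iota\<close>, \<phi> is contraction along the unit of A, viewed
    as a homomorphism from the unit ring.\<close>
  have con: "p.con Q = iota ` \<phi> Q" if Q: "p.Y.prime Q" for Q
  proof -
    have "extend_scalars K Ur A e (iota x) \<in> Q \<longleftrightarrow> free_module K A x \<in> Q" if x: "x \<in> obj K" for x
      using thM_miso[OF p.Y.prime_Th[OF Q] Ar extend_Un[OF U A _ x]] e by (simp add: Ur_def e_def)
    then show ?thesis unfolding p.con_def by (auto simp: mU \<phi>_def Spc_map_def)
  qed
  have con1: "p1.con T = \<phi>1 T" and con2: "p2.con T = \<phi>2 T" for T
    by (simp_all add: p1.con_def p2.con_def \<phi>1_def \<phi>2_def Spc_map_def)
  have inj: "iota ` P = iota ` P' \<longleftrightarrow> P = P'" for P P' :: "'o set"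
    by (rule inj_image_eq_iff) (simp add: inj_def iota_def)
  have \<phi>_prime: "prime_ideal K (\<phi> Q)" if Q: "p.Y.prime Q" for Q
    unfolding pK using p.con_prime[OF Q] con[OF Q] by (auto simp: \<phi>_def Spc_map_def)
  \<comment> \<open>Scalars from the unit ring act through \<open>lu\<close>, so already the
    identity of A \<otimes> A is balanced.\<close>
  have bal: "one (car A \<odot> car A) \<star> (b1 \<bowtie> (mul A \<star> ((e \<star> x) \<bowtie> b2))) = one (car A \<odot> car A) \<star> ((mul A \<star> ((e \<star> x) \<bowtie> b1)) \<bowtie> b2)"
    if b: "el b1" "el b2" "el x" "ty b1 = car A" "ty b2 = car A" "ty x = car Ur" "lab x \<inter> lab b1 = {}" for b1 b2 x
  proof -
    have x: "ty x = \<one>" using b by (simp add: Ur_def unit_ring_def)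
    have m: "mul A \<star> ((e \<star> x) \<bowtie> y) = lu (car A) \<star> (x \<bowtie> y)" if y: "el y" "ty y = car A" for y
    proof -
      have "(mul A \<cdot> (uni A \<otimes> one (car A))) \<star> (x \<bowtie> y) = lu (car A) \<star> (x \<bowtie> y)"
        using Ar unfolding ring_object_def by metis
      then show ?thesis using ring_simps[OF Ar] b(3) x y by (simp add: e_def ap_simps)
    qed
    have "b1 \<bowtie> (mul A \<star> ((e \<star> x) \<bowtie> b2)) = (mul A \<star> ((e \<star> x) \<bowtie> b1)) \<bowtie> b2"
      using unit_swap[OF b(1,3,2) x b(7)] m[of b1] m[of b2] b by simp
    then show ?thesis by simp
  qed
  have oo: "one (car A \<odot> car A) \<in> arr K" "src K (one (car A \<odot> car A)) = car A \<odot> car A" "tgt K (one (car A \<odot> car A)) = car A \<odot> car A"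
    using ring_simps(1)[OF Ar] by simp_all
  have cD: "car D = car A \<odot> car A" by (simp add: D_def ring_tensor_def)
  have "(one (car A \<odot> car A) \<cdot> left_incl K A) \<cdot> e = (one (car A \<odot> car A) \<cdot> right_incl K A) \<cdot> e"
    by (rule incl_eq_on_base[OF Ud Ar e oo(1,2) bal])
  then have le: "left_incl K A \<cdot> e = right_incl K A \<cdot> e" by (simp add: incl_simps[OF Ar])
  have eq: "extend_scalars K A D (left_incl K A) (extend_scalars K Ur A e x) \<in> J \<longleftrightarrow>
      extend_scalars K A D (right_incl K A) (extend_scalars K Ur A e x) \<in> J" if "thM D J" "x \<in> modules K Ur" for J x
    unfolding extend_extend[OF U' A D e l that] extend_extend[OF U' A D e r that] le ..
  \<comment> \<open>The case of \<open>retr_base_change\<close> in which \<open>k\<close> is the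
    identity: over the unit ring no quotient of A \<otimes> A has to be taken.\<close>
  have base: "extend_scalars K Ur A e (restr e a) \<in> J"
    if J: "thM A J" and a: "a \<in> modules K A" and ra: "restr (right_incl K A) (extend_scalars K A D (left_incl K A) a) \<in> J" for J a
  proof -
    have "retr A (tens_over Ur A e (car A, mul A) (restr e a))
       (restr (right_incl K A) (tens_over A (ring_tensor K A A) (left_incl K A) (restr (one (car A \<odot> car A)) (car D, mul D)) a))"
      by (rule retr_base_change[OF U' A e Dr _ a bal, of "one (car A \<odot> car A)"])
        (use oo A_idn[OF D] in \<open>simp_all add: cD tensa_idn ring_simps(1)[OF Ar] flip: D_def\<close>)
    then have "retr A (extend_scalars K Ur A e (restr e a)) (restr (right_incl K A) (extend_scalars K A D (left_incl K A) a))"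
      using restr_idn[OF A_self[OF D] Dr] by (simp add: cD extend_scalars_tens_over flip: D_def)
    then show ?thesis using thM_retr[OF J Ar] ra by blast
  qed
  show "\<phi> (\<phi>1 T) = \<phi> (\<phi>2 T)" if T: "T \<in> topspace (Spc (Mod K D))" for T
  proof -
    have T': "p1.Y.prime T" using T tD by simp
    have "p.con (p1.con T) = p.con (p2.con T)"
      using eq[OF p1.Y.prime_Th[OF T']] p.F_ob by (auto simp: p.con_def p1.con_def p2.con_def)
    then show ?thesis
      using con[OF p1.con_prime[OF T']] con[OF p2.con_prime[OF T']] inj by (simp add: con1 con2)
  qed
  show "\<exists>T \<in> topspace (Spc (Mod K D)). \<phi>1 T = Q1 \<and> \<phi>2 T = Q2"
    if Q: "Q1 \<in> topspace (Spc (Mod K A))" "Q2 \<in> topspace (Spc (Mod K A))" "\<phi> Q1 = \<phi> Q2" for Q1 Q2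
  proof -
    have q: "p.Y.prime Q1" "p.Y.prime Q2" using Q tA by simp_all
    have "\<exists>T. p1.Y.prime T \<and> p1.con T = Q1 \<and> p2.con T = Q2"
      by (rule glue_primes[OF tt_pair_Mod[OF U' A e] tt_pair_Mod[OF A D l] tt_pair_Mod[OF A D r] base eq inc q])
        (simp_all add: con[OF q(1)] con[OF q(2)] Q(3))
    then show ?thesis by (auto simp: tD con1 con2)
  qed
  have cont: "continuous_map (Spc (Mod K A)) (Spc K) \<phi>"
    unfolding \<phi>_def
  proof (rule continuous_map_Spc_map[OF zero_object_ex zero_Mod[OF A]])
    show "free_module K A x \<in> obj (Mod K A)" if "x \<in> obj K" for x using free_module_module[OF Ar that] by simp
    show "prime_ideal K (Spc_map K (free_module K A) Q)" if "prime_ideal (Mod K A) Q" for Q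
      using \<phi>_prime[of Q] that by (simp add: pA \<phi>_def)
  qed
  have surj: "\<phi> ` topspace (Spc (Mod K A)) = topspace (Spc K)"
  proof (intro equalityI subsetI)
    fix P assume "P \<in> topspace (Spc K)"
    then have P: "prime_ideal K P" using tK by simp
    then have iP: "p.X.prime (iota ` P)" by (simp add: pK)
    have "restr e (car A, mul A) = iota (car A)"
      using Ar unfolding ring_object_def by (simp add: restr_def iota_def e_def)
    then have nP: "restr e (car A, mul A) \<notin> iota ` P"
      using nilpotence_prime[OF A U N P] inj_iota[OF U] by simp
    \<comment> \<open>The unit module is isomorphic to its own square.\<close>
    have M: "p.Y.mult_set {(car A, mul A)}"
      unfolding p.Y.mult_set_def using A_self[OF A] p.Y.Th_unit by blast
    have "\<exists>Q. p.Y.prime Q \<and> p.con Q = iota ` P \<and> Q \<inter> {(car A, mul A)} = {}"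
      by (rule p.lift[OF iP M]) (use nP in simp)
    then obtain Q where "p.Y.prime Q" "p.con Q = iota ` P" by blast
    then show "P \<in> \<phi> ` topspace (Spc (Mod K A))" using con inj tA by auto
  qed (use \<phi>_prime tA tK in auto)
  have clo: "closed_map (Spc (Mod K A)) (Spc K) \<phi>"
    unfolding closed_map_def
  proof (intro allI impI)
    fix Z assume Z: "closedin (Spc (Mod K A)) Z"
    then have Zp: "\<And>Q. Q \<in> Z \<Longrightarrow> p.Y.prime Q" and Zo: "openin (Spc (Mod K A)) (topspace (Spc (Mod K A)) - Z)"
      using tA closedin_subset[OF Z] by (auto simp: closedin_def)
    define M where "M = {m \<in> modules K A. \<forall>Q \<in> Z. m \<notin> Q}"
    have M: "p.Y.mult_set M"
      unfolding p.Y.mult_set_def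
    proof (intro conjI ballI)
      show "M \<noteq> {}" using A_self[OF A] p.Y.unit_notin_prime[OF Zp] unfolding M_def by blast
      show "\<exists>u \<in> M. \<forall>J. thM A J \<longrightarrow> module_tensor K A s t \<in> J \<longrightarrow> u \<in> J" if "s \<in> M" "t \<in> M" for s t
      proof (intro bexI allI impI)
        show "module_tensor K A s t \<in> M"
          using that p.Y.primeD[OF Zp, of _ s t] p.Y.T_ob[of s t] unfolding M_def by blast
      qed
    qed (auto simp: M_def)
    have nbhd: "\<exists>y \<in> obj K. y \<in> P \<and> {P'. prime_ideal K P' \<and> y \<in> P'} \<subseteq> topspace (Spc K) - \<phi> ` Z"
      if P: "prime_ideal K P" "P \<notin> \<phi> ` Z" for P
    proof -
      have iP: "p.X.prime (iota ` P)" using P by (simp add: pK)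
      \<comment> \<open>Otherwise some prime Q over P avoids \<open>M\<close>. As P is not in the
        image of Z, Q is outside the closed set Z; then some m in Q lies in no prime of Z, that is,
        m is in \<open>M\<close>.\<close>
      have "\<exists>m \<in> M. restr e m \<in> iota ` P"
      proof (rule ccontr)
        assume "\<not> ?thesis"
        then have "\<exists>Q. p.Y.prime Q \<and> p.con Q = iota ` P \<and> Q \<inter> M = {}" by (intro p.lift[OF iP M]) blast
        then obtain Q where Q: "p.Y.prime Q" "p.con Q = iota ` P" "Q \<inter> M = {}" by blast
        then have "\<phi> Q = P" using con inj by simp
        then have "Q \<in> topspace (Spc (Mod K A)) - Z" using P(2) Q(1) tA by blast
        then obtain m where "m \<in> modules K A" "m \<in> Q"
          "{Q. prime_ideal (Mod K A) Q \<and> m \<in> Q} \<subseteq> topspace (Spc (Mod K A)) - Z"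
          using Spc_basis[OF zero_Mod[OF A] _ Zo, of Q] sum_Mod[OF A] by auto
        then have "m \<in> M" unfolding M_def using Zp pA by blast
        with Q(3) \<open>m \<in> Q\<close> show False by blast
      qed
      then obtain m where m: "m \<in> M" "restr e m \<in> iota ` P" by blast
      then obtain y where y: "y \<in> P" "restr e m = iota y" by blast
      have "y \<in> obj K" using y(1) P(1) by (auto simp: pK)
      moreover have False if Q: "Q \<in> Z" "y \<in> \<phi> Q" for Q
      proof -
        have "restr e m \<in> p.con Q" using Q(2) con[OF Zp[OF Q(1)]] y(2) by simp
        then have "m \<in> Q" using p.U_mem_con[OF Zp[OF Q(1)]] m(1) by (simp add: M_def)
        then show False using m(1) Q(1) by (simp add: M_def)
      qed
      ultimately show ?thesis using y(1) tK by blast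
    qed
    have "openin (Spc K) (topspace (Spc K) - \<phi> ` Z)"
    proof (rule openin_subopen[THEN iffD2], rule ballI)
      fix P assume "P \<in> topspace (Spc K) - \<phi> ` Z"
      then have P: "prime_ideal K P" "P \<notin> \<phi> ` Z" using tK by simp_all
      from nbhd[OF P] obtain y where "y \<in> obj K" "y \<in> P" "{P'. prime_ideal K P' \<and> y \<in> P'} \<subseteq> topspace (Spc K) - \<phi> ` Z"
        by (elim bexE conjE)
      with P(1) show "\<exists>T. openin (Spc K) T \<and> P \<in> T \<and> T \<subseteq> topspace (Spc K) - \<phi> ` Z"
        using openin_Spc[of y K] by (intro exI[of _ "{P'. prime_ideal K P' \<and> y \<in> P'}"]) simp
    qed
    then show "closedin (Spc K) (\<phi> ` Z)"
      using Zp \<phi>_prime tK by (auto simp: closedin_def)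
  qed
  show "quotient_map (Spc (Mod K A)) (Spc K) \<phi>"
    by (rule continuous_closed_imp_quotient_map[OF cont clo surj])
qed

end

text \<open>By \<open>fib\<close> every two points of a fibre of \<open>q\<close> have the form f x
  and g x, so a map with equal composites is constant on fibres and descends along the quotient
  map.\<close>

lemma top_coequalizer_quotient:
  assumes "continuous_map X Y f" "continuous_map X Y g" and q: "quotient_map Y Z q"
    and "\<And>x. x \<in> topspace X \<Longrightarrow> q (f x) = q (g x)"
    and fib: "\<And>y y'. \<lbrakk>y \<in> topspace Y; y' \<in> topspace Y; q y = q y'\<rbrakk> \<Longrightarrow> \<exists>x \<in> topspace X. f x = y \<and> g x = y'"
  shows "top_coequalizer TYPE('w) X Y Z f g q"
  unfolding top_coequalizer_def
proof (intro conjI ballI allI impI)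
  show "continuous_map Y Z q" using q by (rule quotient_imp_continuous_map)
  have im: "q ` topspace Y = topspace Z" using q by (rule quotient_imp_surjective_map)
  fix W :: "'w topology" and h assume h: "continuous_map Y W h" and eq: "\<forall>x \<in> topspace X. h (f x) = h (g x)"
  have "h y = h y'" if "y \<in> topspace Y" "y' \<in> topspace Y" "q y = q y'" for y y'
    using fib[OF that] eq by blast
  then obtain k where k: "continuous_map Z W k" "\<And>y. y \<in> topspace Y \<Longrightarrow> k (q y) = h y"
    using quotient_map_lift_exists[OF q h] by metis
  show "\<exists>!k. k \<in> extensional (topspace Z) \<and> continuous_map Z W k \<and> (\<forall>y \<in> topspace Y. k (q y) = h y)"
  \<comment> \<open>The values outside the space are normalized, since uniqueness is asserted among
    extensional maps.\<close>
  proof (rule ex1I[of _ "restrict k (topspace Z)"])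
    have "continuous_map Z W (restrict k (topspace Z))"
      using continuous_map_eq[OF k(1), of "restrict k (topspace Z)"] by simp
    then show "restrict k (topspace Z) \<in> extensional (topspace Z) \<and> continuous_map Z W (restrict k (topspace Z)) \<and>
        (\<forall>y \<in> topspace Y. restrict k (topspace Z) (q y) = h y)"
      using k(2) im by auto
    fix k' assume k': "k' \<in> extensional (topspace Z) \<and> continuous_map Z W k' \<and> (\<forall>y \<in> topspace Y. k' (q y) = h y)"
    show "k' = restrict k (topspace Z)"
    proof (rule extensionalityI)
      fix z assume z: "z \<in> topspace Z"
      then obtain y where "y \<in> topspace Y" "z = q y" using im by blast
      then show "k' z = restrict k (topspace Z) z" using k' k(2) z by simp
    qed (use k' in auto)
  qed
qed (use assms in auto)

theorem theorem1p3:
  fixes K :: "('o, 'm) ttcat" and A :: "('o, 'm) ring_ob"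
  assumes "tt_category K"
    and "tt_ring K A"
    and "finite_degree K A"
    and "detects_nilpotence K A"
  shows "top_coequalizer TYPE('w)
    (Spc (Mod K (ring_tensor K A A))) (Spc (Mod K A)) (Spc K)
    (Spc_map (Mod K A) (extend_scalars K A (ring_tensor K A A) (left_incl K A)))
    (Spc_map (Mod K A) (extend_scalars K A (ring_tensor K A A) (right_incl K A)))
    (Spc_map K (free_module K A))"
  by (rule top_coequalizer_quotient) (rule tt_category.quotient_map_free_module[OF assms]; assumption)+

end
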